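(* Let $s_1,s_2,s_3$ be complex numbers and let $N=s_1+s_2+s_3$. Then (I) $\displaystyle\int_0^1 \zeta(1-s_1,\alpha)\zeta(1-s_2,\alpha)\zeta(1-s_3,\alpha)\,d\alpha = 2(2\pi)^{-(s_1+s_2+s_3)}\Gamma(s_1)\Gamma(s_2)\Gamma(s_3)\Big\{\cos\tfrac{\pi}{2}(N-2s_3)\,T(s_1,s_2,s_3)+\cos\tfrac{\pi}{2}(N-2s_1)\,T(s_2,s_3,s_1)+\cos\tfrac{\pi}{2}(N-2s_2)\,T(s_3,s_1,s_2)\Big\}$; (II) $\displaystyle\int_0^1 \zeta(1-s_1,\alpha)\zeta(1-s_2,\alpha)\zeta(1-s_3,1-\alpha)\,d\alpha = 2(2\pi)^{-(s_1+s_2+s_3)}\Gamma(s_1)\Gamma(s_2)\Gamma(s_3)\Big\{\cos\tfrac{\pi}{2}N\,T(s_1,s_2,s_3)+\cos\tfrac{\pi}{2}(N-2s_2)\,T(s_2,s_3,s_1)+\cos\tfrac{\pi}{2}(N-2s_1)\,T(s_3,s_1,s_2)\Big\}$.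
   Context: For complex $\alpha\neq 0,-1,-2,\dots$, $\zeta(s,\alpha)$ denotes the Hurwitz zeta function $\sum_{n\ge0}(n+\alpha)^{-s}$ for $\mathrm{Re}\, s>1$, and its analytic continuation in $s$. $\Gamma$ is Euler's gamma function. The Tornheim double zeta function is $T(s_1,s_2,s_3)=\sum_{n_1\ge1}\sum_{n_2\ge1}n_1^{-s_1}n_2^{-s_2}(n_1+n_2)^{-s_3}$ for $\mathrm{Re}(s_2+s_3)>1$, $\mathrm{Re}(s_3+s_1)>1$, $\mathrm{Re}(s_1+s_2+s_3)>2$, and its meromorphic continuation to $\mathbb{C}^3$.
   Formalization: The identities are claimed only where both sides make sense: no s_j is zero or a negative integer, none of the three T-values is taken on a polar hyperplane of T, and, separately for (I) and (II), the integral over (0,1) converges. *)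

theory Defs
  imports "HOL-Complex_Analysis.Complex_Analysis"
begin

text \<open>
  For fixed \<open>a\<close> the Hurwitz zeta function is the function holomorphic on
  \<open>\<complex> \<setminus> {1}\<close> that extends the Dirichlet series.  It is unique off \<open>s = 1\<close>; its value at the
  pole \<open>s = 1\<close>, and everything for \<open>a = 0, -1, -2, \<dots>\<close>, is meaningless.
\<close>

definition hurwitz_zeta :: "complex \<Rightarrow> complex \<Rightarrow> complex" where
  "hurwitz_zeta s a =
     (SOME f. f holomorphic_on (- {1}) \<and>
              (\<forall>z. Re z > 1 \<longrightarrow> f z = (\<Sum>n. (of_nat n + a) powr (- z)))) s"

text \<open>Complex differentiability in three variables, meant for open \<open>U\<close>.\<close>

definition holomorphic3_on ::
  "(complex \<times> complex \<times> complex \<Rightarrow> complex) \<Rightarrow> (complex \<times> complex \<times> complex) set \<Rightarrow> bool" where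
  "holomorphic3_on F U \<longleftrightarrow>
     (\<forall>p\<in>U. \<exists>a b c. (F has_derivative (\<lambda>(x, y, z). a * x + b * y + c * z)) (at p))"

text \<open>
  \<open>F\<close> is meromorphic on \<open>\<complex>\<^sup>3\<close> with singularities in \<open>P\<close>: locally a quotient of holomorphic
  functions whose denominator vanishes only on \<open>P\<close>.  For \<open>P\<close> closed this makes \<open>F\<close> holomorphic
  off \<open>P\<close>.  The values of \<open>F\<close> on \<open>P\<close> are irrelevant.
\<close>

definition meromorphic3 ::
  "(complex \<times> complex \<times> complex \<Rightarrow> complex) \<Rightarrow> (complex \<times> complex \<times> complex) set \<Rightarrow> bool" where
  "meromorphic3 F P \<longleftrightarrow>
     (\<forall>p. \<exists>U g h. open U \<and> p \<in> U \<and> holomorphic3_on g U \<and> holomorphic3_on h U \<and>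
        (\<forall>q\<in>U. h q = 0 \<longrightarrow> q \<in> P) \<and> (\<forall>q\<in>U - P. F q = g q / h q))"

text \<open>
  The singularities of the Tornheim double zeta function (Matsumoto).  None of these hyperplanes
  is removable: generically on each of them the function has a simple pole.
\<close>

definition tornheim_poles :: "(complex \<times> complex \<times> complex) set" where
  "tornheim_poles =
     {(s1, s2, s3). (\<exists>k::nat. s2 + s3 = 1 - of_nat k) \<or> (\<exists>k::nat. s3 + s1 = 1 - of_nat k) \<or>
                    s1 + s2 + s3 = 2}"

definition tornheim_series :: "complex \<Rightarrow> complex \<Rightarrow> complex \<Rightarrow> complex" where
  "tornheim_series s1 s2 s3 =
     (\<Sum>\<^sub>\<infinity>(m, n) \<in> {1::nat..} \<times> {1::nat..}.
        of_nat m powr (- s1) * of_nat n powr (- s2) * of_nat (m + n) powr (- s3))"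

text \<open>
  The complement of \<open>tornheim_poles\<close> is connected, so the continuation is unique there.
\<close>

definition tornheim_T :: "complex \<Rightarrow> complex \<Rightarrow> complex \<Rightarrow> complex" where
  "tornheim_T s1 s2 s3 =
     (SOME F. meromorphic3 F tornheim_poles \<and>
        (\<forall>z1 z2 z3. Re (z2 + z3) > 1 \<and> Re (z3 + z1) > 1 \<and> Re (z1 + z2 + z3) > 2 \<longrightarrow>
           F (z1, z2, z3) = tornheim_series z1 z2 z3)) (s1, s2, s3)"

end

theory Submission
  imports Defs
begin

text \<open>
  For real parts larger than \<open>1\<close> the identity is Parseval's formula.  Hurwitz's formula
  \<open>\<zeta>(1 - s, \<alpha>) = \<Gamma>(s) \<Sum>\<^sub>n (2 \<pi> i n) powr (-s) exp(2 \<pi> i n \<alpha>)\<close>, over \<open>n \<noteq> 0\<close>, turns the integral into a sum over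
  non-zero integers with \<open>n\<^sub>1 + n\<^sub>2 \<plusminus> n\<^sub>3 = 0\<close>; the six possible sign patterns give the three double series, each
  twice and with conjugate phases, whence the cosines.  The general case follows by analytic continuation along the
  complex line from \<open>(3, 3, 3)\<close> to \<open>(s1, s2, s3)\<close>.

  Right-hand side: the double series with shifts \<open>a\<close> and \<open>b\<close> of the summation variables is the sum of its averages over
  unit intervals in \<open>a\<close> and \<open>b\<close> and of remainders.  Telescoping gives recursions for these with increased
  exponents, whose iteration shows that the series times \<open>(s1 + s2 + s3 - 2) / (\<Gamma>(s1 + s3 - 1) \<Gamma>(s2 + s3 - 1))\<close>
  is entire.

  Left-hand side: near an end point the integrand is a combination of powers \<open>\<alpha> powr e\<close>, \<open>e \<noteq> -1\<close>, plus a bounded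
  function.  The finite part of the integral is holomorphic along the line.  It equals the integral whenever
  the latter exists, since a combination of non-trivial powers can only converge to \<open>0\<close> at the end point.
\<close>

section \<open>Holomorphic dependence on parameters\<close>

text \<open>Both zeta functions are values of choice operators, so each needs a uniqueness argument
  besides existence. In three variables uniqueness is reduced to one on lines through (3, 3, 3), a
  point on no singular hyperplane: such a line loses only countably many parameters and stays
  connected. The integral may fail to exist at points of the line between its two ends, so it is not
  itself continued; its finite part is. The forbidden exponent -1 can occur only at poles of the
  Gamma factors or of the double series, which are excluded. The shifts a and b, set to 1 in the
  end, provide variables in which to differentiate and to average: averages over both carry explicit
  denominators, deviations in both carry none. For Re s > 1 the oscillatory integrals that should
  give the Fourier coefficients of the zeta function diverge when unfolded to the half-line. They
  are computed for -1 < Re s < 0, where a subtraction at 0 makes everything absolutely convergent,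
  and continued from there.\<close>

lemma holomorphic_on_locally:
  fixes f :: "complex \<Rightarrow> complex"
  assumes "\<And>z. z \<in> S \<Longrightarrow> \<exists>r>0. f holomorphic_on ball z r"
  shows "f holomorphic_on S"
  unfolding holomorphic_on_def
proof
  fix z assume "z \<in> S"
  then obtain r where "r > 0" "f holomorphic_on ball z r" using assms by blast
  then have "f field_differentiable at z"
    by (meson centre_in_ball holomorphic_on_imp_differentiable_at open_ball)
  then show "f field_differentiable at z within S"
    using field_differentiable_at_within by blast
qed

lemma continuous_on_locally:
  fixes f :: "'a::t2_space \<Rightarrow> 'b::topological_space"
  assumes "\<And>x. x \<in> S \<Longrightarrow> \<exists>T. open T \<and> x \<in> T \<and> continuous_on (S \<inter> T) f"
  shows "continuous_on S f"
  unfolding continuous_on_eq_continuous_within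
proof (intro ballI)
  fix x assume x: "x \<in> S"
  then obtain T where T: "open T" "x \<in> T" "continuous_on (S \<inter> T) f" using assms by blast
  then have "continuous (at x within S \<inter> T) f"
    using x by (auto simp: continuous_on_eq_continuous_within)
  moreover have "at x within S \<inter> T = at x within S"
    by (rule at_within_nhd[of x T]) (use T in auto)
  ultimately show "continuous (at x within S) f" by simp
qed

text \<open>Cauchy's estimate on discs of radius \<open>d/4\<close> bounds the derivative by
  \<open>4 * B / d\<close> on the half-size disc. A majorant of the function thus already majorises
  its difference quotients.\<close>

lemma holomorphic_quotient_bound:
  fixes f :: "complex \<Rightarrow> complex"
  assumes hol: "f holomorphic_on ball z d" and d: "d > 0"
    and bd: "\<And>w. w \<in> ball z d \<Longrightarrow> norm (f w) \<le> B"
    and w: "w \<in> ball z (d/2)"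
  shows "norm (f w - f z) \<le> (4 * B / d) * norm (w - z)"
proof -
  have deriv_bound: "norm (deriv f u) \<le> 4 * B / d" if u: "u \<in> ball z (d/2)" for u
  proof -
    have sub: "cball u (d/4) \<subseteq> ball z d"
    proof
      fix x assume "x \<in> cball u (d/4)"
      then have "dist u x \<le> d/4" "dist z u < d/2" using u by auto
      then have "dist z x < d" using d dist_triangle[of z x u] by simp
      then show "x \<in> ball z d" by simp
    qed
    have "norm ((deriv ^^ 1) f u) \<le> fact 1 * B / (d/4) ^ 1"
    proof (rule Cauchy_inequality)
      show "f holomorphic_on ball u (d/4)"
        using hol sub ball_subset_cball holomorphic_on_subset by blast
      show "continuous_on (cball u (d/4)) f"
        using hol sub holomorphic_on_imp_continuous_on holomorphic_on_subset by blast
      show "norm (f x) \<le> B" if "norm (u - x) = d/4" for x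
        using sub that by (intro bd) (auto simp: dist_norm)
    qed (use d in auto)
    then show ?thesis by (simp add: mult.commute)
  qed
  show ?thesis
  proof (rule field_differentiable_bound[where S = "ball z (d/2)" and f' = "deriv f"])
    show "(f has_field_derivative deriv f u) (at u within ball z (d/2))" if "u \<in> ball z (d/2)" for u
    proof -
      have "f holomorphic_on ball z (d/2)"
        by (rule holomorphic_on_subset[OF hol]) (use d in auto)
      then have "(f has_field_derivative deriv f u) (at u)"
        using that holomorphic_derivI by blast
      then show ?thesis using has_field_derivative_at_within by blast
    qed
  qed (use w d deriv_bound in auto)
qed

text \<open>Difference quotients inherit an integrable majorant from
  \<open>holomorphic_quotient_bound\<close>, so dominated convergence differentiates under the
  integral once the function itself is dominated.\<close>

lemma holomorphic_on_lebesgue_integral: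
  fixes f :: "complex \<Rightarrow> 'a \<Rightarrow> complex"
  assumes U: "open U"
    and hol: "\<And>x. x \<in> space M \<Longrightarrow> (\<lambda>t. f t x) holomorphic_on U"
    and meas: "\<And>t. t \<in> U \<Longrightarrow> f t \<in> borel_measurable M"
    and dom: "\<And>t0. t0 \<in> U \<Longrightarrow> \<exists>d>0. \<exists>g. integrable M g \<and>
                (\<forall>t\<in>ball t0 d \<inter> U. \<forall>x\<in>space M. norm (f t x) \<le> g x)"
  shows "(\<lambda>t. \<integral>x. f t x \<partial>M) holomorphic_on U"
  unfolding holomorphic_on_def
proof
  fix t0 assume t0: "t0 \<in> U"
  obtain d0 g where d0: "d0 > 0" "integrable M g"
      and bd0: "\<And>t x. t \<in> ball t0 d0 \<inter> U \<Longrightarrow> x \<in> space M \<Longrightarrow> norm (f t x) \<le> g x"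
    using dom[OF t0] by blast
  obtain d1 where d1: "d1 > 0" "ball t0 d1 \<subseteq> U"
    using U t0 open_contains_ball by blast
  define d where "d = min d0 d1"
  have d: "d > 0" "ball t0 d \<subseteq> U" using d0 d1 by (auto simp: d_def)
  have bd: "norm (f t x) \<le> g x" if "t \<in> ball t0 d" "x \<in> space M" for t x
    using that d by (intro bd0) (auto simp: d_def)
  have int: "integrable M (f t)" if "t \<in> ball t0 d" for t
    using that d bd by (intro Bochner_Integration.integrable_bound[OF d0(2)] meas)
      (auto intro!: AE_I2 order.trans[OF bd])
  define D where "D = (\<lambda>x. deriv (\<lambda>t. f t x) t0)"
  have derD: "((\<lambda>t. f t x) has_field_derivative D x) (at t0)" if "x \<in> space M" for x
    unfolding D_def using hol[OF that] U t0 holomorphic_derivI by blast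
  have lim: "((\<lambda>i. (f (X i) x - f t0 x) / (X i - t0)) \<longlonglongrightarrow> D x)"
    if X: "\<And>i. X i \<noteq> t0" "X \<longlonglongrightarrow> t0" and x: "x \<in> space M" for X x
  proof -
    have "((\<lambda>t. (f t x - f t0 x) / (t - t0)) \<longlongrightarrow> D x) (at t0)"
      using derD[OF x] by (simp add: has_field_derivative_iff)
    then show ?thesis
      using X unfolding tendsto_at_iff_sequentially by (auto simp: o_def)
  qed
  have measD: "D \<in> borel_measurable M"
  proof (rule borel_measurable_LIMSEQ_metric)
    define X where "X = (\<lambda>i::nat. t0 + of_real (d / 2 / (real i + 1)))"
    have X1: "X i \<noteq> t0" for i
    proof -
      have "d / 2 / (real i + 1) \<noteq> 0" using d by simp
      then show ?thesis unfolding X_def by (metis add_cancel_left_right of_real_eq_0_iff)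
    qed
    have "(\<lambda>i. d / 2 / (real i + 1)) \<longlonglongrightarrow> 0"
      by real_asymp
    then have "X \<longlonglongrightarrow> t0 + of_real 0" unfolding X_def
      by (intro tendsto_intros)
    then have X2: "X \<longlonglongrightarrow> t0" by simp
    have XU: "X i \<in> U" for i
    proof -
      have "d / 2 / (real i + 1) < d"
        using d by (simp add: field_simps add_pos_nonneg)
      then have "norm (complex_of_real (d / 2 / (real i + 1))) < d" using d by (simp only: norm_of_real) simp
      then have "X i \<in> ball t0 d" by (simp only: X_def mem_ball dist_norm) simp
      then show ?thesis using d by blast
    qed
    show "(\<lambda>x. (f (X i) x - f t0 x) / (X i - t0)) \<in> borel_measurable M" for i
      by (intro borel_measurable_divide borel_measurable_diff meas XU t0) auto
    show "(\<lambda>i. (f (X i) x - f t0 x) / (X i - t0)) \<longlonglongrightarrow> D x" if "x \<in> space M" for x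
      by (rule lim) (use X1 X2 that in auto)
  qed
  have "((\<lambda>t. \<integral>x. f t x \<partial>M) has_field_derivative (\<integral>x. D x \<partial>M)) (at t0)"
    unfolding has_field_derivative_iff tendsto_at_iff_sequentially
  proof (intro allI impI)
    fix X assume X: "\<forall>i. X i \<in> UNIV - {t0}" "X \<longlonglongrightarrow> t0"
    have "eventually (\<lambda>i. X i \<in> ball t0 (d/2)) sequentially"
      using X(2) d by (intro topological_tendstoD) auto
    then obtain N where N: "\<And>i. i \<ge> N \<Longrightarrow> X i \<in> ball t0 (d/2)"
      by (auto simp: eventually_sequentially)
    \<comment> \<open>The first \<open>N\<close> members are dropped because the bound on difference
      quotients holds only in the half-size disc.\<close>
    have hb: "X (i + N) \<in> ball t0 (d/2)" for i using N by simp
    have "(\<lambda>i. \<integral>x. (f (X (i + N)) x - f t0 x) / (X (i + N) - t0) \<partial>M) \<longlonglongrightarrow> (\<integral>x. D x \<partial>M)"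
    proof (rule integral_dominated_convergence[where w = "\<lambda>x. 4 * g x / d"])
      show "AE x in M. (\<lambda>i. (f (X (i + N)) x - f t0 x) / (X (i + N) - t0)) \<longlonglongrightarrow> D x"
        using X by (intro AE_I2 lim) (auto intro!: LIMSEQ_ignore_initial_segment)
      show "(\<lambda>x. (f (X (i + N)) x - f t0 x) / (X (i + N) - t0)) \<in> borel_measurable M" for i
        using hb[of i] d t0 by (intro borel_measurable_divide borel_measurable_diff meas) auto
      show "AE x in M. norm ((f (X (i + N)) x - f t0 x) / (X (i + N) - t0)) \<le> 4 * g x / d" for i
      proof (rule AE_I2)
        fix x assume x: "x \<in> space M"
        have "(\<lambda>t. f t x) holomorphic_on ball t0 d"
          using hol[OF x] d holomorphic_on_subset by blast
        then have "norm (f (X (i + N)) x - f t0 x) \<le> 4 * g x / d * norm (X (i + N) - t0)"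
          using x hb d by (intro holomorphic_quotient_bound) (auto intro: bd)
        moreover have "X (i + N) \<noteq> t0" using X by auto
        ultimately show "norm ((f (X (i + N)) x - f t0 x) / (X (i + N) - t0)) \<le> 4 * g x / d"
          by (simp add: norm_divide divide_le_eq)
      qed
    qed (use d0 measD in auto)
    moreover have "(\<integral>x. (f (X (i + N)) x - f t0 x) / (X (i + N) - t0) \<partial>M) =
        ((\<lambda>t. ((\<integral>x. f t x \<partial>M) - (\<integral>x. f t0 x \<partial>M)) / (t - t0)) \<circ> X) (i + N)" for i
    proof -
      have "X (i + N) \<in> ball t0 d" using hb[of i] d by auto
      then show ?thesis using int d by (simp add: o_def)
    qed
    ultimately show "((\<lambda>t. ((\<integral>x. f t x \<partial>M) - (\<integral>x. f t0 x \<partial>M)) / (t - t0)) \<circ> X) \<longlonglongrightarrow> (\<integral>x. D x \<partial>M)"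
      by (metis (no_types, lifting) LIMSEQ_offset ext)
  qed
  then show "(\<lambda>t. \<integral>x. f t x \<partial>M) field_differentiable at t0 within U"
    using field_differentiable_at_within field_differentiable_def by blast
qed

lemma holomorphic_on_integral_interval:
  fixes f :: "complex \<Rightarrow> real \<Rightarrow> complex"
  assumes U: "open U"
    and hol: "\<And>y. y \<in> {c..d} \<Longrightarrow> (\<lambda>t. f t y) holomorphic_on U"
    and cont: "continuous_on (U \<times> {c..d}) (\<lambda>(t, y). f t y)"
  shows "(\<lambda>t. integral {c..d} (f t)) holomorphic_on U"
proof -
  have conty: "continuous_on {c..d} (f t)" if "t \<in> U" for t
  proof -
    have "continuous_on {c..d} (\<lambda>y. (\<lambda>(t, y). f t y) (t, y))"
      by (rule continuous_on_compose2[OF cont]) (use that in \<open>auto intro!: continuous_intros\<close>)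
    then show ?thesis by simp
  qed
  have "(\<lambda>t. \<integral>x. f t x \<partial>(lebesgue_on {c..d})) holomorphic_on U"
  proof (rule holomorphic_on_lebesgue_integral[OF U])
    show "(\<lambda>t. f t x) holomorphic_on U" if "x \<in> space (lebesgue_on {c..d})" for x
      using that by (intro hol) auto
    show "f t \<in> borel_measurable (lebesgue_on {c..d})" if "t \<in> U" for t
      by (intro continuous_imp_measurable_on_sets_lebesgue conty that) auto
    show "\<exists>e>0. \<exists>g. integrable (lebesgue_on {c..d}) g \<and>
        (\<forall>t\<in>ball t0 e \<inter> U. \<forall>x\<in>space (lebesgue_on {c..d}). norm (f t x) \<le> g x)" if t0: "t0 \<in> U" for t0
    proof -
      obtain e where e: "e > 0" "cball t0 e \<subseteq> U"
        using U t0 open_contains_cball by blast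
      have "compact (cball t0 e \<times> {c..d})" by (intro compact_Times) auto
      moreover have "continuous_on (cball t0 e \<times> {c..d}) (\<lambda>(t, y). f t y)"
        using cont by (rule continuous_on_subset) (use e in auto)
      ultimately have "bounded ((\<lambda>(t, y). f t y) ` (cball t0 e \<times> {c..d}))"
        using compact_continuous_image compact_imp_bounded by blast
      then obtain B where B: "\<And>t y. t \<in> cball t0 e \<Longrightarrow> y \<in> {c..d} \<Longrightarrow> norm (f t y) \<le> B"
        unfolding bounded_iff by force
      have "integrable (lebesgue_on {c..d}) (\<lambda>_. B)"
        by (intro finite_measure.integrable_const finite_measure_lebesgue_on) auto
      then show ?thesis using e B by (intro exI[of _ e] conjI exI[of _ "\<lambda>_. B"]) auto
    qed
  qed
  moreover have "(\<integral>x. f t x \<partial>(lebesgue_on {c..d})) = integral {c..d} (f t)" if "t \<in> U" for t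
    by (rule lebesgue_integral_eq_integral)
       (use conty[OF that] in \<open>auto intro: continuous_imp_integrable_real continuous_imp_integrable\<close>)
  ultimately show ?thesis
    by (metis (no_types, lifting) holomorphic_cong)
qed

section \<open>Functions holomorphic along complex lines\<close>

definition cline :: "complex \<times> complex \<times> complex \<Rightarrow> complex \<times> complex \<times> complex \<Rightarrow> complex
    \<Rightarrow> complex \<times> complex \<times> complex" where
  "cline p v t = (fst p + t * fst v, fst (snd p) + t * fst (snd v), snd (snd p) + t * snd (snd v))"

lemma cline_simp [simp]: "cline (p1, p2, p3) (v1, v2, v3) t = (p1 + t * v1, p2 + t * v2, p3 + t * v3)"
  by (simp add: cline_def)

lemma continuous_on_cline: "continuous_on S (cline p v)"
  unfolding cline_def by (intro continuous_intros)

lemma open_cline_vimage: "open U \<Longrightarrow> open {t. cline p v t \<in> U}"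
  using open_vimage[OF _ continuous_on_cline[of UNIV p v]] by (simp add: vimage_def)

lemma convex_cline_vimage:
  assumes "convex U"
  shows "convex {t. cline p v t \<in> U}"
proof (rule convexI)
  fix x y :: complex and u w :: real
  assume xy: "x \<in> {t. cline p v t \<in> U}" "y \<in> {t. cline p v t \<in> U}" and uw: "0 \<le> u" "0 \<le> w" "u + w = 1"
  have aff: "q + (u *\<^sub>R x + w *\<^sub>R y) * z = u *\<^sub>R (q + x * z) + w *\<^sub>R (q + y * z)" for q z :: complex
  proof -
    have "u *\<^sub>R (q + x * z) + w *\<^sub>R (q + y * z) = (u + w) *\<^sub>R q + (u *\<^sub>R x + w *\<^sub>R y) * z"
      by (simp add: algebra_simps scaleR_conv_of_real)
    then show ?thesis using uw by simp
  qed
  have "cline p v (u *\<^sub>R x + w *\<^sub>R y) = u *\<^sub>R cline p v x + w *\<^sub>R cline p v y"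
    by (cases p; cases v) (simp add: aff)
  then show "u *\<^sub>R x + w *\<^sub>R y \<in> {t. cline p v t \<in> U}"
    using assms xy uw by (simp add: convexD)
qed

text \<open>Holomorphy in the three complex variables is only demanded along complex lines; together with
  continuity this gives joint differentiability (Osgood).\<close>

definition nice :: "(complex \<times> complex \<times> complex \<Rightarrow> real \<Rightarrow> real \<Rightarrow> complex)
    \<Rightarrow> (complex \<times> complex \<times> complex) set \<Rightarrow> bool" where
  "nice f U \<longleftrightarrow> continuous_on (U \<times> {1..} \<times> {1..}) (\<lambda>(s, a, b). f s a b) \<and>
     (\<forall>a\<ge>1. \<forall>b\<ge>1. \<forall>p v. (\<lambda>t. f (cline p v t) a b) holomorphic_on {t. cline p v t \<in> U})"

lemma niceI:
  assumes "continuous_on (U \<times> {1..} \<times> {1..}) (\<lambda>(s, a, b). f s a b)"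
    and "\<And>a b p v. a \<ge> 1 \<Longrightarrow> b \<ge> 1 \<Longrightarrow> (\<lambda>t. f (cline p v t) a b) holomorphic_on {t. cline p v t \<in> U}"
  shows "nice f U"
  using assms by (simp add: nice_def)

lemma nice_continuous: "nice f U \<Longrightarrow> continuous_on (U \<times> {1..} \<times> {1..}) (\<lambda>(s, a, b). f s a b)"
  and nice_holomorphic: "nice f U \<Longrightarrow> a \<ge> 1 \<Longrightarrow> b \<ge> 1 \<Longrightarrow>
    (\<lambda>t. f (cline p v t) a b) holomorphic_on {t. cline p v t \<in> U}"
  unfolding nice_def by blast+

lemma nice_continuous_compose:
  assumes "nice f U" "continuous_on S g1" "continuous_on S g2" "continuous_on S g3"
    "\<And>x. x \<in> S \<Longrightarrow> g1 x \<in> U \<and> g2 x \<ge> 1 \<and> g3 x \<ge> 1"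
  shows "continuous_on S (\<lambda>x. f (g1 x) (g2 x) (g3 x))"
proof -
  have "continuous_on S (\<lambda>x. (\<lambda>(s, a, b). f s a b) (g1 x, g2 x, g3 x))"
    by (rule continuous_on_compose2[OF nice_continuous[OF assms(1)]])
       (use assms in \<open>auto intro!: continuous_intros\<close>)
  then show ?thesis by simp
qed

lemma nice_subset:
  assumes "nice f U" "V \<subseteq> U"
  shows "nice f V"
proof (rule niceI)
  show "continuous_on (V \<times> {1..} \<times> {1..}) (\<lambda>(s, a, b). f s a b)"
    by (rule continuous_on_subset[OF nice_continuous[OF assms(1)]]) (use assms(2) in auto)
  show "(\<lambda>t. f (cline p v t) a b) holomorphic_on {t. cline p v t \<in> V}" if "a \<ge> 1" "b \<ge> 1" for a b p v
    by (rule holomorphic_on_subset[OF nice_holomorphic[OF assms(1) that]]) (use assms(2) in auto)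
qed

lemma nice_cong:
  assumes "nice f U" "\<And>s a b. s \<in> U \<Longrightarrow> a \<ge> 1 \<Longrightarrow> b \<ge> 1 \<Longrightarrow> f s a b = g s a b"
  shows "nice g U"
proof (rule niceI)
  show "continuous_on (U \<times> {1..} \<times> {1..}) (\<lambda>(s, a, b). g s a b)"
    using nice_continuous[OF assms(1)] by (rule continuous_on_eq) (use assms(2) in auto)
  show "(\<lambda>t. g (cline p v t) a b) holomorphic_on {t. cline p v t \<in> U}" if "a \<ge> 1" "b \<ge> 1" for a b p v
    using nice_holomorphic[OF assms(1) that] by (rule holomorphic_transform) (use assms(2) that in auto)
qed

lemma nice_add: "nice f U \<Longrightarrow> nice g U \<Longrightarrow> nice (\<lambda>s a b. f s a b + g s a b) U"
  unfolding nice_def case_prod_beta by (auto intro!: continuous_intros holomorphic_intros)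

lemma nice_diff: "nice f U \<Longrightarrow> nice g U \<Longrightarrow> nice (\<lambda>s a b. f s a b - g s a b) U"
  unfolding nice_def case_prod_beta by (auto intro!: continuous_intros holomorphic_intros)

lemma nice_mult: "nice f U \<Longrightarrow> nice g U \<Longrightarrow> nice (\<lambda>s a b. f s a b * g s a b) U"
  unfolding nice_def case_prod_beta by (auto intro!: continuous_intros holomorphic_intros)

lemma nice_const: "nice (\<lambda>s a b. c) U"
  unfolding nice_def case_prod_beta by (auto intro!: continuous_intros holomorphic_intros)

lemma nice_s1: "nice (\<lambda>s a b. fst s) U"
  and nice_s2: "nice (\<lambda>s a b. fst (snd s)) U"
  and nice_s3: "nice (\<lambda>s a b. snd (snd s)) U"
  unfolding nice_def case_prod_beta cline_def by (auto intro!: continuous_intros holomorphic_intros)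

lemma nice_a: "nice (\<lambda>s a b. of_real a) U"
  and nice_b: "nice (\<lambda>s a b. of_real b) U"
  unfolding nice_def case_prod_beta by (auto intro!: continuous_intros holomorphic_intros)

lemma nice_rGamma:
  assumes "nice f U"
  shows "nice (\<lambda>s a b. rGamma (f s a b)) U"
proof (rule niceI)
  have "continuous_on (U \<times> {1..} \<times> {1..}) (\<lambda>x. rGamma ((\<lambda>(s, a, b). f s a b) x))"
    by (rule continuous_on_compose2[OF _ nice_continuous[OF assms]])
       (auto intro!: continuous_intros holomorphic_on_imp_continuous_on holomorphic_intros holomorphic_rGamma)
  then show "continuous_on (U \<times> {1..} \<times> {1..}) (\<lambda>(s, a, b). rGamma (f s a b))"
    by (simp add: case_prod_beta)
  show "(\<lambda>t. rGamma (f (cline p v t) a b)) holomorphic_on {t. cline p v t \<in> U}"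
    if "a \<ge> 1" "b \<ge> 1" for a b p v
    by (intro holomorphic_rGamma' nice_holomorphic[OF assms that])
qed

text \<open>A positive base is kept off the cut by the form \<open>exp (f \<cdot> ln x)\<close>.\<close>

lemma nice_powr:
  assumes f: "nice f U" and h: "continuous_on ({1..} \<times> {1..}) (\<lambda>(a, b). h a b)"
    and pos: "\<And>a b. a \<ge> 1 \<Longrightarrow> b \<ge> 1 \<Longrightarrow> h a b > (0::real)"
  shows "nice (\<lambda>s a b. of_real (h a b) powr f s a b) U"
proof -
  have h': "continuous_on (U \<times> {1..} \<times> {1..}) (\<lambda>x. h (fst (snd x)) (snd (snd x)))"
  proof -
    have "continuous_on (U \<times> {1..} \<times> {1..}) (\<lambda>x. (\<lambda>(a, b). h a b) (fst (snd x), snd (snd x)))"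
      by (rule continuous_on_compose2[OF h]) (auto intro!: continuous_intros)
    then show ?thesis by (simp only: prod.case)
  qed
  have f': "continuous_on (U \<times> {1..} \<times> {1..}) (\<lambda>x. f (fst x) (fst (snd x)) (snd (snd x)))"
    using nice_continuous[OF f] by (simp add: case_prod_beta)
  have "nice (\<lambda>s a b. exp (f s a b * of_real (ln (h a b)))) U"
  proof (rule niceI)
    show "continuous_on (U \<times> {1..} \<times> {1..}) (\<lambda>(s, a, b). exp (f s a b * of_real (ln (h a b))))"
      unfolding case_prod_beta
      by (intro continuous_intros h' f') (use pos in \<open>fastforce simp: less_le\<close>)
    show "(\<lambda>t. exp (f (cline p v t) a b * of_real (ln (h a b)))) holomorphic_on {t. cline p v t \<in> U}"
      if "a \<ge> 1" "b \<ge> 1" for a b p v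
      by (intro holomorphic_intros nice_holomorphic[OF f that])
  qed
  then show ?thesis
  proof (rule nice_cong)
    show "exp (f s a b * of_real (ln (h a b))) = of_real (h a b) powr f s a b"
      if "a \<ge> 1" "b \<ge> 1" for s a b
      using pos[OF that] by (simp add: powr_def Ln_of_real)
  qed
qed

lemma nice_shift:
  assumes "nice f V" "\<And>s. s \<in> U \<Longrightarrow> s + e \<in> V"
  shows "nice (\<lambda>s a b. f (s + e) a b) U"
proof (rule niceI)
  show "continuous_on (U \<times> {1..} \<times> {1..}) (\<lambda>(s, a, b). f (s + e) a b)"
    unfolding case_prod_beta
    by (rule nice_continuous_compose[OF assms(1)]) (use assms(2) in \<open>auto intro!: continuous_intros\<close>)
  have eq: "cline p v t + e = cline (p + e) v t" for p v t
    by (cases p; cases v; cases e) simp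
  show "(\<lambda>t. f (cline p v t + e) a b) holomorphic_on {t. cline p v t \<in> U}" if "a \<ge> 1" "b \<ge> 1" for a b p v
    using nice_holomorphic[OF assms(1) that, of "p + e" v] unfolding eq
    by (rule holomorphic_on_subset) (simp add: eq [symmetric] assms(2) Collect_mono)
qed

definition swap3 :: "'a \<times> 'a \<times> 'a \<Rightarrow> 'a \<times> 'a \<times> 'a" where
  "swap3 s = (fst (snd s), fst s, snd (snd s))"

lemma swap3_simp [simp]: "swap3 (x, y, z) = (y, x, z)"
  by (simp add: swap3_def)

lemma nice_swap:
  assumes "nice f V" "\<And>s. s \<in> U \<Longrightarrow> swap3 s \<in> V"
  shows "nice (\<lambda>s a b. f (swap3 s) b a) U"
proof (rule niceI)
  show "continuous_on (U \<times> {1..} \<times> {1..}) (\<lambda>(s, a, b). f (swap3 s) b a)"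
    unfolding case_prod_beta
    by (rule nice_continuous_compose[OF assms(1)])
       (use assms(2) in \<open>auto simp: swap3_def intro!: continuous_intros\<close>)
  have eq: "swap3 (cline p v t) = cline (swap3 p) (swap3 v) t" for p v t
    by (cases p; cases v) simp
  show "(\<lambda>t. f (swap3 (cline p v t)) b a) holomorphic_on {t. cline p v t \<in> U}"
    if "a \<ge> 1" "b \<ge> 1" for a b p v
    using nice_holomorphic[OF assms(1) that(2,1), of "swap3 p" "swap3 v"] unfolding eq
    by (rule holomorphic_on_subset) (simp add: eq [symmetric] assms(2) Collect_mono)
qed

lemma nice_integral_a:
  fixes w :: "real \<Rightarrow> complex"
  assumes f: "nice f U" and U: "open U" and w: "continuous_on {0..1} w"
  shows "nice (\<lambda>s a b. integral {0..1} (\<lambda>y. w y * f s (a + y) b)) U"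
proof (rule niceI)
  have "continuous_on (U \<times> {1..} \<times> {1..})
      (\<lambda>x. integral (cbox 0 1) (\<lambda>y. w y * f (fst x) (fst (snd x) + y) (snd (snd x))))"
  proof (rule integral_continuous_on_param)
    have "continuous_on ((U \<times> {1..} \<times> {1..}) \<times> {0..1}) (\<lambda>z. w (snd z))"
      by (rule continuous_on_compose2[OF w]) (auto intro!: continuous_intros)
    moreover have "continuous_on ((U \<times> {1..} \<times> {1..}) \<times> {0..1})
        (\<lambda>z. f (fst (fst z)) (fst (snd (fst z)) + snd z) (snd (snd (fst z))))"
      by (rule nice_continuous_compose[OF f]) (auto intro!: continuous_intros)
    ultimately show "continuous_on ((U \<times> {1..} \<times> {1..}) \<times> cbox 0 1)
        (\<lambda>(x, y). w y * f (fst x) (fst (snd x) + y) (snd (snd x)))"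
      unfolding case_prod_beta by (auto intro!: continuous_intros)
  qed
  then show "continuous_on (U \<times> {1..} \<times> {1..}) (\<lambda>(s, a, b). integral {0..1} (\<lambda>y. w y * f s (a + y) b))"
    by (simp add: case_prod_beta)
  fix a b :: real and p v :: "complex \<times> complex \<times> complex"
  assume ab: "a \<ge> 1" "b \<ge> 1"
  show "(\<lambda>t. integral {0..1} (\<lambda>y. w y * f (cline p v t) (a + y) b)) holomorphic_on {t. cline p v t \<in> U}"
  proof (rule holomorphic_on_integral_interval)
    show "open {t. cline p v t \<in> U}" using U by (rule open_cline_vimage)
    show "(\<lambda>t. w y * f (cline p v t) (a + y) b) holomorphic_on {t. cline p v t \<in> U}" if "y \<in> {0..1}" for y
      by (intro holomorphic_intros nice_holomorphic[OF f]) (use that ab in auto)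
    have "continuous_on ({t. cline p v t \<in> U} \<times> {0..1}) (\<lambda>z. w (snd z))"
      by (rule continuous_on_compose2[OF w]) (auto intro!: continuous_intros)
    moreover have "continuous_on ({t. cline p v t \<in> U} \<times> {0..1}) (\<lambda>z. f (cline p v (fst z)) (a + snd z) b)"
      by (rule nice_continuous_compose[OF f])
         (use ab in \<open>auto intro!: continuous_intros continuous_on_compose2[OF continuous_on_cline[of UNIV]]\<close>)
    ultimately show "continuous_on ({t. cline p v t \<in> U} \<times> {0..1}) (\<lambda>(t, y). w y * f (cline p v t) (a + y) b)"
      unfolding case_prod_beta by (auto intro!: continuous_intros)
  qed
qed

lemma nice_integral_b:
  fixes w :: "real \<Rightarrow> complex"
  assumes f: "nice f U" and U: "open U" and w: "continuous_on {0..1} w"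
  shows "nice (\<lambda>s a b. integral {0..1} (\<lambda>y. w y * f s a (b + y))) U"
proof -
  have U': "open (swap3 ` U)"
  proof -
    have "swap3 ` U = swap3 -` U" by (force simp: image_iff)
    moreover have "continuous_on UNIV (swap3 :: complex \<times> complex \<times> complex \<Rightarrow> _)"
      unfolding swap3_def by (intro continuous_intros)
    ultimately show ?thesis using open_vimage[OF U] by metis
  qed
  have "nice (\<lambda>s a b. f (swap3 s) b a) (swap3 ` U)"
    by (rule nice_swap[OF f]) auto
  from nice_swap[OF nice_integral_a[OF this U' w], of U] show ?thesis
    by (simp add: swap3_def)
qed

text \<open>Continuity and holomorphy are local, so the M-test with a majorant near
  \<open>s0\<close> and for \<open>a\<close>, \<open>b\<close> up to \<beta> is enough. The bound
  \<beta> is there for the single series, whose terms may grow with \<open>b\<close> when the third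
  exponent has negative real part.\<close>

lemma nice_infsum:
  assumes U: "open U" and f: "\<And>i. i \<in> I \<Longrightarrow> nice (f i) U"
    and dom: "\<And>s0 \<beta>. s0 \<in> U \<Longrightarrow> \<exists>V M. open V \<and> s0 \<in> V \<and> M summable_on I \<and>
       (\<forall>s\<in>V \<inter> U. \<forall>a\<in>{1..\<beta>}. \<forall>b\<in>{1..\<beta>}. \<forall>i\<in>I. norm (f i s a b) \<le> M i)"
  shows "nice (\<lambda>s a b. \<Sum>\<^sub>\<infinity>i\<in>I. f i s a b) U"
proof (rule niceI)
  show "continuous_on (U \<times> {1..} \<times> {1..}) (\<lambda>(s, a, b). \<Sum>\<^sub>\<infinity>i\<in>I. f i s a b)"
  proof (rule continuous_on_locally)
    fix x assume "x \<in> U \<times> {1::real..} \<times> {1::real..}"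
    then obtain s0 a0 b0 where x: "x = (s0, a0, b0)" "s0 \<in> U" "a0 \<ge> 1" "b0 \<ge> 1" by auto
    define \<beta> where "\<beta> = max a0 b0 + 1"
    obtain V M where V: "open V" "s0 \<in> V" "M summable_on I"
      and M: "\<And>s a b i. s \<in> V \<inter> U \<Longrightarrow> a \<in> {1..\<beta>} \<Longrightarrow> b \<in> {1..\<beta>} \<Longrightarrow> i \<in> I \<Longrightarrow> norm (f i s a b) \<le> M i"
      using dom[OF x(2), of \<beta>] by metis
    let ?T = "V \<times> {..<\<beta>} \<times> {..<\<beta>}"
    let ?S = "(U \<times> {1..} \<times> {1..}) \<inter> ?T"
    have "uniform_limit ?S (\<lambda>X y. \<Sum>i\<in>X. (\<lambda>(s, a, b). f i s a b) y)
        (\<lambda>y. \<Sum>\<^sub>\<infinity>i\<in>I. (\<lambda>(s, a, b). f i s a b) y) (finite_subsets_at_top I)"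
      by (rule Weierstrass_m_test_general[OF _ V(3)]) (auto intro!: M)
    then have "continuous_on ?S (\<lambda>y. \<Sum>\<^sub>\<infinity>i\<in>I. (\<lambda>(s, a, b). f i s a b) y)"
    proof (rule uniform_limit_theorem[rotated])
      show "\<forall>\<^sub>F X in finite_subsets_at_top I. continuous_on ?S (\<lambda>y. \<Sum>i\<in>X. (\<lambda>(s, a, b). f i s a b) y)"
        by (rule eventually_finite_subsets_at_top_weakI)
           (auto intro!: continuous_on_sum continuous_on_subset[OF nice_continuous[OF f]])
    qed simp
    then have "continuous_on ?S (\<lambda>(s, a, b). \<Sum>\<^sub>\<infinity>i\<in>I. f i s a b)"
      by (simp add: case_prod_beta)
    moreover have "open ?T" using V by (intro open_Times) auto
    moreover have "x \<in> ?T" using x V by (auto simp: \<beta>_def)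
    ultimately show "\<exists>T. open T \<and> x \<in> T \<and>
        continuous_on (U \<times> {1..} \<times> {1..} \<inter> T) (\<lambda>(s, a, b). \<Sum>\<^sub>\<infinity>i\<in>I. f i s a b)"
      by blast
  qed
  fix a b :: real and p v :: "complex \<times> complex \<times> complex"
  assume ab: "a \<ge> 1" "b \<ge> 1"
  show "(\<lambda>t. \<Sum>\<^sub>\<infinity>i\<in>I. f i (cline p v t) a b) holomorphic_on {t. cline p v t \<in> U}"
  proof (rule holomorphic_on_locally)
    fix z assume z: "z \<in> {t. cline p v t \<in> U}"
    obtain V M where V: "open V" "cline p v z \<in> V" "M summable_on I"
      and M: "\<And>s a' b' i. s \<in> V \<inter> U \<Longrightarrow> a' \<in> {1..max a b} \<Longrightarrow> b' \<in> {1..max a b} \<Longrightarrow> i \<in> I \<Longrightarrow>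
        norm (f i s a' b') \<le> M i"
      using dom[of "cline p v z" "max a b"] z by blast
    have "open {t. cline p v t \<in> V \<inter> U}" using U V by (intro open_cline_vimage) auto
    then obtain r where r: "r > 0" "cball z r \<subseteq> {t. cline p v t \<in> V \<inter> U}"
      using z V open_contains_cball by blast
    have ul: "uniform_limit (cball z r) (\<lambda>X t. \<Sum>i\<in>X. f i (cline p v t) a b)
        (\<lambda>t. \<Sum>\<^sub>\<infinity>i\<in>I. f i (cline p v t) a b) (finite_subsets_at_top I)"
      by (rule Weierstrass_m_test_general[OF _ V(3)]) (use ab r in \<open>auto intro!: M\<close>)
    have ev: "\<forall>\<^sub>F X in finite_subsets_at_top I.
        continuous_on (cball z r) (\<lambda>t. \<Sum>i\<in>X. f i (cline p v t) a b) \<and>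
        (\<lambda>t. \<Sum>i\<in>X. f i (cline p v t) a b) holomorphic_on ball z r"
    proof (rule eventually_finite_subsets_at_top_weakI)
      fix X assume "finite X" "X \<subseteq> I"
      then have "(\<lambda>t. \<Sum>i\<in>X. f i (cline p v t) a b) holomorphic_on cball z r"
        using r ab by (intro holomorphic_on_sum holomorphic_on_subset[OF nice_holomorphic[OF f]]) auto
      then show "continuous_on (cball z r) (\<lambda>t. \<Sum>i\<in>X. f i (cline p v t) a b) \<and>
        (\<lambda>t. \<Sum>i\<in>X. f i (cline p v t) a b) holomorphic_on ball z r"
        using holomorphic_on_imp_continuous_on holomorphic_on_subset ball_subset_cball by blast
    qed
    have "(\<lambda>t. \<Sum>\<^sub>\<infinity>i\<in>I. f i (cline p v t) a b) holomorphic_on ball z r"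
      by (rule holomorphic_uniform_limit[OF ev ul]) auto
    with r show "\<exists>r>0. (\<lambda>t. \<Sum>\<^sub>\<infinity>i\<in>I. f i (cline p v t) a b) holomorphic_on ball z r" by blast
  qed
qed

text \<open>A convex domain meets every complex line in a convex, hence connected, set. The
  one-variable identity theorem on the line from a point of \<open>W\<close> to \<open>q\<close>
  then suffices.\<close>

lemma nice_identity:
  assumes "nice f U" "nice g U" "open U" "convex U" "open W" "W \<subseteq> U" "W \<noteq> {}"
    and eq: "\<And>s. s \<in> W \<Longrightarrow> f s a b = g s a b" and ab: "a \<ge> 1" "b \<ge> 1" and q: "q \<in> U"
  shows "f q a b = g q a b"
proof -
  obtain p where p: "p \<in> W" using assms by auto
  have line0: "cline p (q - p) 0 = p" and line1: "cline p (q - p) 1 = q"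
    by (cases p; cases q; simp)+
  have "f (cline p (q - p) 1) a b = g (cline p (q - p) 1) a b"
  proof (rule analytic_continuation_open[where z = 1 and f = "\<lambda>t. f (cline p (q - p) t) a b"
        and g = "\<lambda>t. g (cline p (q - p) t) a b" and s = "{t. cline p (q - p) t \<in> W}"
        and s' = "{t. cline p (q - p) t \<in> U}"])
    show "{t. cline p (q - p) t \<in> W} \<noteq> {}" using p line0 by (metis (mono_tags, lifting) empty_iff mem_Collect_eq)
    show "connected {t. cline p (q - p) t \<in> U}"
      using assms by (intro convex_connected convex_cline_vimage)
    show "(\<lambda>t. f (cline p (q - p) t) a b) holomorphic_on {t. cline p (q - p) t \<in> U}"
      "(\<lambda>t. g (cline p (q - p) t) a b) holomorphic_on {t. cline p (q - p) t \<in> U}"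
      by (rule nice_holomorphic[OF _ ab], fact)+
    show "1 \<in> {t. cline p (q - p) t \<in> U}" using line1 q by simp
    show "{t. cline p (q - p) t \<in> W} \<subseteq> {t. cline p (q - p) t \<in> U}" using assms(6) by blast
    show "f (cline p (q - p) z) a b = g (cline p (q - p) z) a b" if "z \<in> {t. cline p (q - p) t \<in> W}" for z
      using that by (intro eq) simp
  qed (intro open_cline_vimage assms)+
  then show ?thesis using line1 by simp
qed

text \<open>If \<open>f\<close> is a fixed point of an operator that enlarges the domain of holomorphy,
  the iterates of the operator continue \<open>f\<close>.\<close>

lemma nice_extend:
  assumes U: "\<And>K::nat. open (U K)" "\<And>K. convex (U K)" "\<And>K. U K \<subseteq> U (Suc K)" "U 0 \<noteq> {}"
    and f: "nice f (U 0)"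
    and L: "\<And>K g. nice g (U K) \<Longrightarrow> nice (L g) (U (Suc K))"
    and fixpt: "\<And>g s a b. (\<And>s a b. s \<in> U 0 \<Longrightarrow> a \<ge> 1 \<Longrightarrow> b \<ge> 1 \<Longrightarrow> g s a b = f s a b) \<Longrightarrow>
       s \<in> U 0 \<Longrightarrow> a \<ge> 1 \<Longrightarrow> b \<ge> 1 \<Longrightarrow> L g s a b = f s a b"
  shows "\<exists>F. nice F (\<Union>K. U K) \<and> (\<forall>s\<in>U 0. \<forall>a\<ge>1. \<forall>b\<ge>1. F s a b = f s a b)"
proof -
  define F where "F K = (L ^^ K) f" for K
  have nF: "nice (F K) (U K)" for K
    by (induction K) (simp_all add: F_def f L)
  have F0: "F K s a b = f s a b" if "s \<in> U 0" "a \<ge> 1" "b \<ge> 1" for K s a b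
    using that
  proof (induction K arbitrary: s a b)
    case (Suc K)
    have "L (F K) s a b = f s a b" by (rule fixpt) (use Suc in auto)
    then show ?case by (simp add: F_def)
  qed (simp add: F_def)
  have mono: "U i \<subseteq> U j" if "i \<le> j" for i j
    using U(3) that by (rule lift_Suc_mono_le)
  have agree: "F j s a b = F i s a b" if "i \<le> j" "s \<in> U i" "a \<ge> 1" "b \<ge> 1" for i j s a b
  proof (rule nice_identity[where f = "F j" and g = "F i" and U = "U i" and W = "U 0"])
    show "nice (F j) (U i)" using nF mono[OF that(1)] by (rule nice_subset)
    show "U 0 \<subseteq> U i" by (rule mono) simp
    show "F j s a b = F i s a b" if "s \<in> U 0" for s
      by (simp add: F0 that \<open>a \<ge> 1\<close> \<open>b \<ge> 1\<close>)
  qed (fact that U nF)+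
  \<comment> \<open>By \<open>agree\<close> all iterates of index at least \<open>K\<close> coincide
    on \<open>U K\<close>, so taking the least admissible index glues them consistently.\<close>
  define G where "G s = F (LEAST K. s \<in> U K) s" for s
  have G: "G s a b = F K s a b" if "s \<in> U K" "a \<ge> 1" "b \<ge> 1" for s a b K
    unfolding G_def
    by (rule agree[symmetric]) (use that in \<open>auto intro: LeastI Least_le\<close>)
  have nG: "nice G (U K)" for K
    by (rule nice_cong[OF nF[of K]]) (simp add: G)
  have "nice G (\<Union>K. U K)"
  proof (rule niceI)
    show "continuous_on ((\<Union>K. U K) \<times> {1..} \<times> {1..}) (\<lambda>(s, a, b). G s a b)"
    proof (rule continuous_on_locally)
      fix x assume "x \<in> (\<Union>K. U K) \<times> {1::real..} \<times> {1::real..}"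
      then obtain K where K: "x \<in> U K \<times> UNIV" by auto
      have "continuous_on (((\<Union>K. U K) \<times> {1..} \<times> {1..}) \<inter> (U K \<times> UNIV)) (\<lambda>(s, a, b). G s a b)"
        by (rule continuous_on_subset[OF nice_continuous[OF nG[of K]]]) auto
      then show "\<exists>T. open T \<and> x \<in> T \<and>
          continuous_on ((\<Union>K. U K) \<times> {1..} \<times> {1..} \<inter> T) (\<lambda>(s, a, b). G s a b)"
        using U(1) K by (intro exI[of _ "U K \<times> UNIV"]) (auto intro: open_Times)
    qed
    show "(\<lambda>t. G (cline p v t) a b) holomorphic_on {t. cline p v t \<in> (\<Union>K. U K)}"
      if ab: "a \<ge> 1" "b \<ge> 1" for a b p v
    proof (rule holomorphic_on_locally)
      fix z assume "z \<in> {t. cline p v t \<in> (\<Union>K. U K)}"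
      then obtain K where "z \<in> {t. cline p v t \<in> U K}" by auto
      then obtain r where "r > 0" "ball z r \<subseteq> {t. cline p v t \<in> U K}"
        using open_cline_vimage[OF U(1)] open_contains_ball by meson
      then show "\<exists>r>0. (\<lambda>t. G (cline p v t) a b) holomorphic_on ball z r"
        using nice_holomorphic[OF nG ab] holomorphic_on_subset by blast
    qed
  qed
  moreover have "\<forall>s\<in>U 0. \<forall>a\<ge>1. \<forall>b\<ge>1. G s a b = f s a b"
    using G[of _ 0] F0[of _ _ _ 0] by auto
  ultimately show ?thesis by blast
qed

text \<open>Cauchy's formula on the unit circle writes the directional derivative at
  \<open>p\<close> as an integral of values of \<open>F\<close> over a compact interval, which
  depends continuously on \<open>p\<close>.\<close>

lemma continuous_line_deriv:
  fixes F :: "complex \<times> complex \<times> complex \<Rightarrow> complex"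
  assumes cont: "continuous_on UNIV F"
    and hol: "\<And>p v. (\<lambda>t. F (cline p v t)) holomorphic_on UNIV"
  shows "continuous_on UNIV (\<lambda>p. deriv (\<lambda>t. F (cline p v t)) 0)"
proof -
  have compose: "continuous_on S (\<lambda>x. F (g x))" if "continuous_on S g"
    for S and g :: "(complex \<times> complex \<times> complex) \<times> real \<Rightarrow> _"
    using continuous_on_compose2[OF cont that] by auto
  have eq: "deriv (\<lambda>t. F (cline p v t)) 0 = 1 / (2 * of_real pi * \<i>) *
      integral (cbox 0 1) (\<lambda>x. F (cline p v (exp (2 * of_real pi * \<i> * of_real x))) /
        (exp (2 * of_real pi * \<i> * of_real x))\<^sup>2 * (2 * pi * \<i> * exp (2 * of_real pi * \<i> * of_real x)))" for p
  proof -
    have "((\<lambda>t. F (cline p v t)) has_field_derivative (1 / (2 * of_real pi * \<i>) *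
        contour_integral (circlepath 0 1) (\<lambda>u. F (cline p v u) / (u - 0)^2))) (at 0)"
      by (rule Cauchy_derivative_integral_circlepath)
         (use hol[of p v] in \<open>auto intro: holomorphic_on_subset holomorphic_on_imp_continuous_on continuous_on_subset\<close>)
    from DERIV_imp_deriv[OF this] show ?thesis
      unfolding contour_integral_integral vector_derivative_circlepath
      unfolding circlepath by simp
  qed
  show ?thesis
    unfolding eq
  proof (intro continuous_intros integral_continuous_on_param)
    show "continuous_on (UNIV \<times> cbox 0 1) (\<lambda>(p, x). F (cline p v (exp (2 * of_real pi * \<i> * of_real x))) /
        (exp (2 * of_real pi * \<i> * of_real x))\<^sup>2 * (2 * pi * \<i> * exp (2 * of_real pi * \<i> * of_real x)))"
      unfolding case_prod_beta cline_def by (intro continuous_intros compose) auto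
  qed
qed

text \<open>Osgood's lemma, with separate holomorphy replaced by holomorphy on complex lines.\<close>

lemma holomorphic3_on_UNIV:
  assumes cont: "continuous_on UNIV F"
    and hol: "\<And>p v. (\<lambda>t. F (cline p v t)) holomorphic_on UNIV"
  shows "holomorphic3_on F UNIV"
proof -
  define P where "P v p = deriv (\<lambda>t. F (cline p v t)) 0" for v p
  have contP: "continuous_on UNIV (P v)" for v
    unfolding P_def by (rule continuous_line_deriv[OF cont hol])
  have contP1: "continuous_on S (\<lambda>x. P v (g x))" if "continuous_on S g"
    for S v and g :: "complex \<times> complex \<Rightarrow> _"
    using continuous_on_compose2[OF contP that] by auto
  have contP2: "continuous_on S (\<lambda>x. P v (g x))" if "continuous_on S g"
    for S v and g :: "complex \<times> complex \<times> complex \<Rightarrow> _"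
    using continuous_on_compose2[OF contP that] by auto
  have der: "((\<lambda>t. F (cline p v t)) has_derivative (\<lambda>h. P v p * h)) (at 0)" for p v
    using holomorphic_derivI[OF hol, of 0 p v] unfolding P_def has_field_derivative_def by simp
  have shift: "((\<lambda>t. G (t - z)) has_derivative D) (at z)"
    if "(G has_derivative D) (at 0)" for G :: "complex \<Rightarrow> complex" and D z
      proof -
    have "((\<lambda>t. t - z) has_derivative (\<lambda>h. h)) (at z)" by (auto intro!: derivative_eq_intros)
    from has_derivative_compose[OF this, of G D] that show ?thesis by simp
  qed
  have d1: "((\<lambda>x. F (x, y, z)) has_derivative (\<lambda>h. P (1, 0, 0) (x, y, z) * h)) (at x)" for x y z
    using shift[OF der[of "(x, y, z)" "(1, 0, 0)"], of x] by simp
  have d2: "((\<lambda>y. F (x, y, z)) has_derivative (\<lambda>h. P (0, 1, 0) (x, y, z) * h)) (at y)" for x y z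
    using shift[OF der[of "(x, y, z)" "(0, 1, 0)"], of y] by simp
  have d3: "((\<lambda>z. F (x, y, z)) has_derivative (\<lambda>h. P (0, 0, 1) (x, y, z) * h)) (at z)" for x y z
    using shift[OF der[of "(x, y, z)" "(0, 0, 1)"], of z] by simp
  \<comment> \<open>Partial derivatives are combined two at a time: the triple is read as (x, (y,
    z)), and \<open>B\<close> is the derivative in the inner pair.\<close>
  define B where "B x w = (blinfun_mult_right (P (0, 1, 0) (x, w)) o\<^sub>L fst_blinfun) +
      (blinfun_mult_right (P (0, 0, 1) (x, w)) o\<^sub>L snd_blinfun)" for x w
  have d23: "((\<lambda>w. F (x, w)) has_derivative blinfun_apply (B x w)) (at w)" for x w
  proof -
    obtain y z where w: "w = (y, z)" by (cases w)
    have "((\<lambda>(y, z). F (x, y, z)) has_derivative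
        (\<lambda>(ty, tz). P (0, 1, 0) (x, y, z) * ty + blinfun_mult_right (P (0, 0, 1) (x, y, z)) tz))
        (at (y, z) within UNIV \<times> UNIV)"
    proof (rule has_derivative_partialsI)
      show "continuous (at (y, z) within UNIV \<times> UNIV) (\<lambda>(y, z). blinfun_mult_right (P (0, 0, 1) (x, y, z)))"
        unfolding case_prod_beta
        by (rule continuous_on_eq_continuous_within[THEN iffD1, rule_format])
           (intro bounded_linear.continuous_on[OF bounded_linear_blinfun_mult_right] contP1 continuous_intros, simp)
    qed (use d2 d3 in auto)
    moreover have "blinfun_apply (B x w) =
        (\<lambda>(ty, tz). P (0, 1, 0) (x, y, z) * ty + blinfun_mult_right (P (0, 0, 1) (x, y, z)) tz)"
      by (auto simp: B_def w blinfun.bilinear_simps fun_eq_iff)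
    ultimately show ?thesis by (simp add: w case_prod_beta')
  qed
  have "(F has_derivative (\<lambda>(tx, tw). P (1, 0, 0) (x, w) * tx + B x w tw)) (at (x, w))" for x w
  proof -
    have "((\<lambda>(x, w). F (x, w)) has_derivative (\<lambda>(tx, tw). P (1, 0, 0) (x, w) * tx + B x w tw))
        (at (x, w) within UNIV \<times> UNIV)"
    proof (rule has_derivative_partialsI)
      show "((\<lambda>x. F (x, w)) has_derivative (*) (P (1, 0, 0) (x, w))) (at x)"
        using d1[of "fst w" "snd w" x] by simp
      show "continuous (at (x, w) within UNIV \<times> UNIV) (\<lambda>(x, w). B x w)"
        unfolding case_prod_beta B_def
        by (rule continuous_on_eq_continuous_within[THEN iffD1, rule_format])
           (simp, intro continuous_intros bounded_linear.continuous_on[OF bounded_linear_blinfun_mult_right] contP2, simp)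
    qed (use d23 in auto)
    then show ?thesis by simp
  qed
  then have "(F has_derivative (\<lambda>(x, y, z). P (1, 0, 0) p * x + P (0, 1, 0) p * y + P (0, 0, 1) p * z)) (at p)" for p
    by (cases p) (simp add: B_def blinfun.add_left case_prod_beta' add.assoc)
  then show ?thesis unfolding holomorphic3_on_def by blast
qed

lemma holomorphic3_on_cline:
  assumes "holomorphic3_on F U" "cline p v t \<in> U"
  shows "(\<lambda>t. F (cline p v t)) field_differentiable (at t)"
proof -
  obtain a b c where D: "(F has_derivative (\<lambda>(x, y, z). a * x + b * y + c * z)) (at (cline p v t))"
    using assms unfolding holomorphic3_on_def by blast
  have "((\<lambda>t. cline p v t) has_derivative (\<lambda>h. (h * fst v, h * fst (snd v), h * snd (snd v)))) (at t)"
    unfolding cline_def by (auto intro!: derivative_eq_intros)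
  from has_derivative_compose[OF this D]
  have "((\<lambda>t. F (cline p v t)) has_derivative
      (\<lambda>h. a * (h * fst v) + b * (h * fst (snd v)) + c * (h * snd (snd v)))) (at t)"
    by simp
  also have "(\<lambda>h. a * (h * fst v) + b * (h * fst (snd v)) + c * (h * snd (snd v))) =
      (*) (a * fst v + b * fst (snd v) + c * snd (snd v))"
    by (auto simp: algebra_simps)
  finally show ?thesis
    unfolding field_differentiable_def has_field_derivative_def by blast
qed

text \<open>The quotient representation holds only off \<open>P\<close>. Openness of the set of
  parameters off \<open>P\<close> leaves a neighbourhood on which the quotient may be differentiated
  in place of \<open>F\<close>.\<close>

lemma meromorphic3_cline:
  assumes F: "meromorphic3 F P" and "cline p v t \<notin> P" and "open {t. cline p v t \<notin> P}"
  shows "(\<lambda>t. F (cline p v t)) field_differentiable (at t)"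
proof -
  obtain U g h where U: "open U" "cline p v t \<in> U" "holomorphic3_on g U" "holomorphic3_on h U"
    and h0: "\<forall>q\<in>U. h q = 0 \<longrightarrow> q \<in> P" and eq: "\<forall>q\<in>U - P. F q = g q / h q"
    using F unfolding meromorphic3_def by metis
  have "(\<lambda>t. g (cline p v t) / h (cline p v t)) field_differentiable (at t)"
    using U h0 assms(2) by (intro field_differentiable_divide holomorphic3_on_cline) auto
  then obtain D where D: "((\<lambda>t. g (cline p v t) / h (cline p v t)) has_field_derivative D) (at t)"
    unfolding field_differentiable_def by blast
  have "((\<lambda>t. F (cline p v t)) has_field_derivative D) (at t)"
  proof (rule has_field_derivative_transform_within_open[OF D])
    show "open ({t. cline p v t \<in> U} \<inter> {t. cline p v t \<notin> P})"
      using U assms by (intro open_Int open_cline_vimage)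
  qed (use U assms eq in auto)
  then show ?thesis unfolding field_differentiable_def by blast
qed

section \<open>Singular hyperplanes and uniqueness of the Tornheim function\<close>

definition tornheim_denom :: "complex \<times> complex \<times> complex \<Rightarrow> complex" where
  "tornheim_denom = (\<lambda>(s1, s2, s3). (s1 + s2 + s3 - 2) * rGamma (s1 + s3 - 1) * rGamma (s2 + s3 - 1))"

text \<open>\<open>rGamma\<close> is entire and vanishes exactly at 0, -1, -2, ..., which turns two
  infinite families of hyperplanes into zero sets of entire functions.\<close>

lemma tornheim_denom_eq_0_iff: "tornheim_denom s = 0 \<longleftrightarrow> s \<in> tornheim_poles"
proof -
  have *: "z - 1 \<in> \<int>\<^sub>\<le>\<^sub>0 \<longleftrightarrow> (\<exists>k::nat. z = 1 - of_nat k)" for z :: complex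
  proof
    assume "z - 1 \<in> \<int>\<^sub>\<le>\<^sub>0"
    then obtain k where "z - 1 = - of_nat k" by (elim nonpos_Ints_cases')
    then have "z = 1 - of_nat k" by (simp add: diff_eq_eq)
    then show "\<exists>k::nat. z = 1 - of_nat k" ..
  next
    assume "\<exists>k::nat. z = 1 - of_nat k"
    then obtain k where "z - 1 = of_int (- int k)" by auto
    then show "z - 1 \<in> \<int>\<^sub>\<le>\<^sub>0" by (auto simp: nonpos_Ints_def intro: exI[of _ "- int k"])
  qed
  obtain s1 s2 s3 where s: "s = (s1, s2, s3)" by (cases s)
  have "tornheim_denom s = 0 \<longleftrightarrow> s1 + s2 + s3 - 2 = 0 \<or> s3 + s1 - 1 \<in> \<int>\<^sub>\<le>\<^sub>0 \<or> s2 + s3 - 1 \<in> \<int>\<^sub>\<le>\<^sub>0"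
    by (simp only: s tornheim_denom_def prod.case mult_eq_0_iff rGamma_eq_zero_iff disj_assoc add.commute[of s1 s3])
  also have "\<dots> \<longleftrightarrow> s \<in> tornheim_poles"
    by (simp only: s * tornheim_poles_def mem_Collect_eq prod.case right_minus_eq) blast
  finally show ?thesis .
qed

lemma nice_tornheim_denom: "nice (\<lambda>s a b. tornheim_denom s) U"
  unfolding tornheim_denom_def case_prod_beta
  by (intro nice_mult nice_rGamma nice_diff nice_add nice_s1 nice_s2 nice_s3 nice_const)

lemma finite_affine_solutions: "c \<noteq> e \<Longrightarrow> finite {t. c + t * d = (e::complex)}"
  by (rule finite_subset[of _ "{(e - c) / d}"]) (auto simp: field_simps)

text \<open>At (3, 3, 3) the sums that govern the poles are 6, 6 and 9, none of them singular. A
  line through this point therefore lies in no polar hyperplane and meets each of them at most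
  once.\<close>

lemma countable_cline_tornheim_poles: "countable {t. cline (3, 3, 3) v t \<in> tornheim_poles}"
proof -
  obtain v1 v2 v3 where v: "v = (v1, v2, v3)" by (cases v)
  have ne: "(6::complex) \<noteq> 1 - of_nat k" for k
  proof
    assume "(6::complex) = 1 - of_nat k"
    then have "Re (6::complex) = Re (1 - of_nat k :: complex)" by (rule arg_cong)
    then show False by simp
  qed
  have "{t. cline (3, 3, 3) v t \<in> tornheim_poles} \<subseteq>
      (\<Union>k::nat. {t. 6 + t * (v2 + v3) = 1 - of_nat k}) \<union> (\<Union>k::nat. {t. 6 + t * (v3 + v1) = 1 - of_nat k}) \<union>
      {t. 9 + t * (v1 + v2 + v3) = 2}"
    by (auto simp: v tornheim_poles_def algebra_simps)
  moreover have "countable \<dots>"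
    using finite_affine_solutions[OF ne] finite_affine_solutions[of 9 2]
    by (intro countable_Un countable_UN[OF countableI_type] countable_finite) auto
  ultimately show ?thesis by (rule countable_subset)
qed

definition tornheim_region :: "(complex \<times> complex \<times> complex) set" where
  "tornheim_region = {(s1, s2, s3). Re (s2 + s3) > 1 \<and> Re (s3 + s1) > 1 \<and> Re (s1 + s2 + s3) > 2}"

lemma open_tornheim_region: "open tornheim_region"
  unfolding tornheim_region_def case_prod_beta by (intro open_Collect_conj open_Collect_less continuous_intros)

text \<open>The quotient of \<open>g\<close> by \<open>tornheim_denom\<close> witnesses the
  specification behind the choice operator, so the chosen function satisfies it too. The two are
  compared on the line from (3, 3, 3) to the given point, where removing the polar parameters leaves
  a connected set.\<close>

lemma tornheim_T_eq:
  assumes g: "nice (\<lambda>s a b. g s) UNIV"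
    and eq: "\<And>s1 s2 s3. (s1, s2, s3) \<in> tornheim_region \<Longrightarrow>
      g (s1, s2, s3) = tornheim_denom (s1, s2, s3) * tornheim_series s1 s2 s3"
    and q: "(q1, q2, q3) \<notin> tornheim_poles"
  shows "tornheim_T q1 q2 q3 = g (q1, q2, q3) / tornheim_denom (q1, q2, q3)"
proof -
  have hol3: "holomorphic3_on f UNIV" if "nice (\<lambda>s a b. f s) UNIV" for f
  proof (rule holomorphic3_on_UNIV)
    show "continuous_on UNIV f"
      using nice_continuous_compose[OF that, where S = UNIV and ?g1.0 = "\<lambda>x. x" and ?g2.0 = "\<lambda>x. 1" and ?g3.0 = "\<lambda>x. 1"]
      by simp
    show "(\<lambda>t. f (cline p v t)) holomorphic_on UNIV" for p v
      using nice_holomorphic[OF that, of 1 1 p v] by simp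
  qed
  have region_poles: "s \<notin> tornheim_poles" if "s \<in> tornheim_region" for s
  proof -
    have "z \<noteq> 1 - of_nat k" if "Re z > 1" for z k using that by auto
    moreover have "z \<noteq> 2" if "Re z > 2" for z using that by auto
    ultimately show ?thesis
      using that unfolding tornheim_poles_def tornheim_region_def by (cases s) blast
  qed
  let ?Q = "\<lambda>F. meromorphic3 F tornheim_poles \<and>
        (\<forall>z1 z2 z3. Re (z2 + z3) > 1 \<and> Re (z3 + z1) > 1 \<and> Re (z1 + z2 + z3) > 2 \<longrightarrow>
           F (z1, z2, z3) = tornheim_series z1 z2 z3)"
  define F0 where "F0 = (\<lambda>s. g s / tornheim_denom s)"
  have m0: "meromorphic3 F0 tornheim_poles"
    unfolding meromorphic3_def
    by (intro allI exI[of _ UNIV] exI[of _ g] exI[of _ tornheim_denom])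
       (auto simp: F0_def tornheim_denom_eq_0_iff hol3 g nice_tornheim_denom)
  have Q0: "?Q F0"
    using m0 region_poles by (auto simp: F0_def eq tornheim_region_def tornheim_denom_eq_0_iff)
  define F where "F = (SOME F. ?Q F)"
  have Q: "?Q F" unfolding F_def by (rule someI[of ?Q, OF Q0])
  define v where "v = (q1, q2, q3) - (3, 3, 3)"
  have line0: "cline (3, 3, 3) v 0 = (3, 3, 3)" and line1: "cline (3, 3, 3) v 1 = (q1, q2, q3)"
    by (simp_all add: v_def)
  have op: "open {t. cline (3, 3, 3) v t \<notin> tornheim_poles}"
  proof -
    have "continuous_on UNIV (\<lambda>t. tornheim_denom (cline (3, 3, 3) v t))"
      using nice_holomorphic[OF nice_tornheim_denom[of UNIV], of 1 1 "(3, 3, 3)" v]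
      by (intro holomorphic_on_imp_continuous_on) simp
    then have "open {t. tornheim_denom (cline (3, 3, 3) v t) \<noteq> 0}"
      by (intro open_Collect_neq) auto
    then show ?thesis by (simp add: tornheim_denom_eq_0_iff)
  qed
  have "F (cline (3, 3, 3) v 1) = F0 (cline (3, 3, 3) v 1)"
  proof (rule analytic_continuation_open[where z = 1 and f = "\<lambda>t. F (cline (3, 3, 3) v t)"
        and g = "\<lambda>t. F0 (cline (3, 3, 3) v t)" and s = "{t. cline (3, 3, 3) v t \<in> tornheim_region}"
        and s' = "{t. cline (3, 3, 3) v t \<notin> tornheim_poles}"])
    have "0 \<in> {t. cline (3, 3, 3) v t \<in> tornheim_region}"
      by (simp only: line0 mem_Collect_eq) (simp add: tornheim_region_def)
    then show "{t. cline (3, 3, 3) v t \<in> tornheim_region} \<noteq> {}" by blast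
    show "connected {t. cline (3, 3, 3) v t \<notin> tornheim_poles}"
    proof -
      have "connected (UNIV - {t. cline (3, 3, 3) v t \<in> tornheim_poles})"
        by (intro connected_open_diff_countable countable_cline_tornheim_poles convex_connected) auto
      then show ?thesis by (simp add: Diff_eq Collect_neg_eq)
    qed
    show "(\<lambda>t. F (cline (3, 3, 3) v t)) holomorphic_on {t. cline (3, 3, 3) v t \<notin> tornheim_poles}"
      "(\<lambda>t. F0 (cline (3, 3, 3) v t)) holomorphic_on {t. cline (3, 3, 3) v t \<notin> tornheim_poles}"
      unfolding holomorphic_on_def using Q m0 op
      by (blast intro: field_differentiable_at_within meromorphic3_cline)+
    show "F (cline (3, 3, 3) v z) = F0 (cline (3, 3, 3) v z)"
      if "z \<in> {t. cline (3, 3, 3) v t \<in> tornheim_region}" for z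
      using that Q Q0 by (cases "cline (3, 3, 3) v z") (simp add: tornheim_region_def)
    show "1 \<in> {t. cline (3, 3, 3) v t \<notin> tornheim_poles}" using q line1 by simp
    show "{t. cline (3, 3, 3) v t \<in> tornheim_region} \<subseteq> {t. cline (3, 3, 3) v t \<notin> tornheim_poles}"
      using region_poles by blast
  qed (intro op open_cline_vimage open_tornheim_region)+
  then show ?thesis
    unfolding line1 by (simp add: tornheim_T_def F_def F0_def)
qed

section \<open>Termwise integration of series\<close>

lemma infsum_integral:
  fixes f :: "'i \<Rightarrow> real \<Rightarrow> complex"
  assumes cont: "\<And>i. i \<in> I \<Longrightarrow> continuous_on {c..d} (f i)"
    and M: "\<And>i y. i \<in> I \<Longrightarrow> y \<in> {c..d} \<Longrightarrow> norm (f i y) \<le> M i" "M summable_on I"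
  shows "continuous_on {c..d} (\<lambda>y. \<Sum>\<^sub>\<infinity>i\<in>I. f i y)"
    and "((\<lambda>i. integral {c..d} (f i)) has_sum integral {c..d} (\<lambda>y. \<Sum>\<^sub>\<infinity>i\<in>I. f i y)) I"
proof -
  \<comment> \<open>The value 0 is a filler: passing to the limit under the integral asks for
    continuity of every member of the family, while the filter only sees finite subsets of
    \<open>I\<close>.\<close>
  define F where "F X = (if finite X \<and> X \<subseteq> I then (\<lambda>y. \<Sum>i\<in>X. f i y) else (\<lambda>_. 0))" for X
  have ev: "\<forall>\<^sub>F X in finite_subsets_at_top I. finite X \<and> X \<subseteq> I"
    by (rule eventually_finite_subsets_at_top_weakI) auto
  have "uniform_limit {c..d} (\<lambda>X y. \<Sum>i\<in>X. f i y) (\<lambda>y. \<Sum>\<^sub>\<infinity>i\<in>I. f i y) (finite_subsets_at_top I)"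
    by (rule Weierstrass_m_test_general[OF M])
  then have ul: "uniform_limit {c..d} F (\<lambda>y. \<Sum>\<^sub>\<infinity>i\<in>I. f i y) (finite_subsets_at_top I)"
    by (rule uniform_limit_cong[THEN iffD1, rotated -1])
       (use ev in \<open>auto elim!: eventually_mono simp: F_def\<close>)
  have cF: "continuous_on {c..d} (F X)" for X
    using cont by (auto simp: F_def intro!: continuous_on_sum)
  show "continuous_on {c..d} (\<lambda>y. \<Sum>\<^sub>\<infinity>i\<in>I. f i y)"
    by (rule uniform_limit_theorem[OF _ ul]) (auto intro: cF)
  obtain J K where J: "\<And>X. (F X has_integral J X) {c..d}"
      "((\<lambda>y. \<Sum>\<^sub>\<infinity>i\<in>I. f i y) has_integral K) {c..d}" "(J \<longlongrightarrow> K) (finite_subsets_at_top I)"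
    using uniform_limit_integral[OF ul cF] by auto
  have "\<forall>\<^sub>F X in finite_subsets_at_top I. J X = (\<Sum>i\<in>X. integral {c..d} (f i))"
    using ev
  proof eventually_elim
    case (elim X)
    then have "(F X has_integral (\<Sum>i\<in>X. integral {c..d} (f i))) {c..d}"
      unfolding F_def using cont
      by (auto intro!: has_integral_sum integrable_integral integrable_continuous_real)
    with J(1) show ?case by (rule has_integral_unique)
  qed
  then have "((\<lambda>X. \<Sum>i\<in>X. integral {c..d} (f i)) \<longlongrightarrow> K) (finite_subsets_at_top I)"
    using J(3) tendsto_cong by force
  then show "((\<lambda>i. integral {c..d} (f i)) has_sum integral {c..d} (\<lambda>y. \<Sum>\<^sub>\<infinity>i\<in>I. f i y)) I"
    unfolding has_sum_def using J(2) by (simp add: integral_unique)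
qed

lemma has_sum_diff:
  fixes f g :: "'i \<Rightarrow> 'a::real_normed_vector"
  assumes "(f has_sum x) I" "(g has_sum y) I"
  shows "((\<lambda>i. f i - g i) has_sum (x - y)) I"
  using has_sum_add[OF assms(1), of "\<lambda>i. - g i" "- y"] assms(2) by (simp add: has_sum_uminus)

text \<open>Applied term by term, the fundamental theorem gives the first equation and integration
  by parts against \<open>x - y\<close> the second. The minus sign in \<open>der\<close> suits terms
  that are negative powers.\<close>

lemma infsum_deriv_integral:
  fixes f f' :: "'i \<Rightarrow> real \<Rightarrow> complex"
  assumes x: "x \<ge> 0"
    and der: "\<And>i y. i \<in> I \<Longrightarrow> y \<in> {0..x} \<Longrightarrow> (f i has_vector_derivative - f' i y) (at y within {0..x})"
    and cont: "\<And>i. i \<in> I \<Longrightarrow> continuous_on {0..x} (f' i)"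
    and M: "\<And>i y. i \<in> I \<Longrightarrow> y \<in> {0..x} \<Longrightarrow> norm (f i y) \<le> M i" "M summable_on I"
    and M': "\<And>i y. i \<in> I \<Longrightarrow> y \<in> {0..x} \<Longrightarrow> norm (f' i y) \<le> M' i" "M' summable_on I"
  shows "integral {0..x} (\<lambda>y. \<Sum>\<^sub>\<infinity>i\<in>I. f' i y) = (\<Sum>\<^sub>\<infinity>i\<in>I. f i 0) - (\<Sum>\<^sub>\<infinity>i\<in>I. f i x)"
    and "integral {0..x} (\<lambda>y. of_real (x - y) * (\<Sum>\<^sub>\<infinity>i\<in>I. f' i y)) =
      of_real x * (\<Sum>\<^sub>\<infinity>i\<in>I. f i 0) - integral {0..x} (\<lambda>y. \<Sum>\<^sub>\<infinity>i\<in>I. f i y)"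
proof -
  have contf: "continuous_on {0..x} (f i)" if "i \<in> I" for i
    unfolding continuous_on_eq_continuous_within
    by (intro ballI has_vector_derivative_continuous[OF der[OF that]])
  have summ: "(\<lambda>i. f i y) summable_on I" if "y \<in> {0..x}" for y
    using M(1) that by (intro abs_summable_summable[OF Infinite_Sum.abs_summable_on_comparison_test'[OF M(2)]])
  have "integral {0..x} (f' i) = f i 0 - f i x" if "i \<in> I" for i
  proof -
    have "((\<lambda>y. - f' i y) has_integral f i x - f i 0) {0..x}"
      by (rule fundamental_theorem_of_calculus[OF x der[OF that]])
    from has_integral_neg[OF this] show ?thesis by (simp add: integral_unique)
  qed
  then have "((\<lambda>i. f i 0 - f i x) has_sum integral {0..x} (\<lambda>y. \<Sum>\<^sub>\<infinity>i\<in>I. f' i y)) I"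
    using infsum_integral(2)[OF cont M'] by (simp cong: has_sum_cong)
  moreover have "((\<lambda>i. f i 0 - f i x) has_sum (\<Sum>\<^sub>\<infinity>i\<in>I. f i 0) - (\<Sum>\<^sub>\<infinity>i\<in>I. f i x)) I"
    by (intro has_sum_diff has_sum_infsum summ) (use x in auto)
  ultimately show "integral {0..x} (\<lambda>y. \<Sum>\<^sub>\<infinity>i\<in>I. f' i y) = (\<Sum>\<^sub>\<infinity>i\<in>I. f i 0) - (\<Sum>\<^sub>\<infinity>i\<in>I. f i x)"
    using has_sum_unique by blast
  have "integral {0..x} (\<lambda>y. of_real (x - y) * f' i y) = of_real x * f i 0 - integral {0..x} (f i)" if "i \<in> I" for i
  proof -
    have "((\<lambda>y. - (of_real (x - y) * f' i y) - f i y) has_integral of_real (x - x) * f i x - of_real (x - 0) * f i 0) {0..x}"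
    proof (rule fundamental_theorem_of_calculus[OF x])
      fix y assume y: "y \<in> {0..x}"
      have "((\<lambda>y. complex_of_real (x - y)) has_vector_derivative - 1) (at y within {0..x})"
        by (auto intro!: derivative_eq_intros simp: has_vector_derivative_def scaleR_conv_of_real)
      from has_vector_derivative_mult[OF this der[OF that y]]
      show "((\<lambda>y. of_real (x - y) * f i y) has_vector_derivative - (of_real (x - y) * f' i y) - f i y) (at y within {0..x})"
        by simp
    qed
    then have "((\<lambda>y. (- (of_real (x - y) * f' i y) - f i y) + f i y) has_integral
        - (of_real x * f i 0) + integral {0..x} (f i)) {0..x}"
      using contf[OF that] by (intro has_integral_add integrable_integral integrable_continuous_real) auto
    from has_integral_neg[OF this] show ?thesis by (simp add: integral_unique)
  qed
  moreover have "((\<lambda>i. integral {0..x} (\<lambda>y. of_real (x - y) * f' i y)) has_sum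
      integral {0..x} (\<lambda>y. \<Sum>\<^sub>\<infinity>i\<in>I. of_real (x - y) * f' i y)) I"
  proof (rule infsum_integral(2))
    show "(\<lambda>i. x * M' i) summable_on I" using M'(2) by (rule summable_on_cmult_right)
    show "norm (of_real (x - y) * f' i y) \<le> x * M' i" if "i \<in> I" "y \<in> {0..x}" for i y
      using M'(1)[OF that] that by (auto simp: norm_mult intro!: mult_mono simp del: of_real_diff)
  qed (auto intro!: continuous_intros cont)
  moreover have "((\<lambda>i. of_real x * f i 0 - integral {0..x} (f i)) has_sum
      of_real x * (\<Sum>\<^sub>\<infinity>i\<in>I. f i 0) - integral {0..x} (\<lambda>y. \<Sum>\<^sub>\<infinity>i\<in>I. f i y)) I"
    by (intro has_sum_diff has_sum_cmult_right has_sum_infsum summ infsum_integral(2)[OF contf M]) (use x in auto)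
  ultimately have "integral {0..x} (\<lambda>y. \<Sum>\<^sub>\<infinity>i\<in>I. of_real (x - y) * f' i y) =
      of_real x * (\<Sum>\<^sub>\<infinity>i\<in>I. f i 0) - integral {0..x} (\<lambda>y. \<Sum>\<^sub>\<infinity>i\<in>I. f i y)"
    by (metis (no_types, lifting) has_sum_cong has_sum_unique)
  then show "integral {0..x} (\<lambda>y. of_real (x - y) * (\<Sum>\<^sub>\<infinity>i\<in>I. f' i y)) =
      of_real x * (\<Sum>\<^sub>\<infinity>i\<in>I. f i 0) - integral {0..x} (\<lambda>y. \<Sum>\<^sub>\<infinity>i\<in>I. f i y)"
    by (simp only: infsum_cmult_right')
qed

section \<open>The two series\<close>

lemma norm_of_real_powr: "x > 0 \<Longrightarrow> norm (of_real x powr z :: complex) = exp (Re z * ln x)"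
  by (simp add: powr_def Ln_of_real)

text \<open>If x \<ge> y, then x + y lies between x and 2 x, so ln (x + y) may be replaced by ln x
  at the cost \<open>K * ln 2\<close>. Writing the rest in terms of ln x - ln y and ln y, both
  nonnegative, brings in exactly the sums s1 + s3 and s1 + s2 + s3. The other case is symmetric. The
  result dominates the double series by a product of two convergent single ones.\<close>

lemma tornheim_exponent_bound:
  fixes x y :: real
  assumes xy: "x \<ge> 1" "y \<ge> 1"
    and \<sigma>: "\<sigma>1 + \<sigma>3 \<ge> 1 + \<eta>" "\<sigma>2 + \<sigma>3 \<ge> 1 + \<eta>" "\<sigma>1 + \<sigma>2 + \<sigma>3 \<ge> 2 + 2 * \<eta>" "\<bar>\<sigma>3\<bar> \<le> K"
  shows "- \<sigma>1 * ln x - \<sigma>2 * ln y - \<sigma>3 * ln (x + y) \<le> K * ln 2 - (1 + \<eta>) * ln x - (1 + \<eta>) * ln y"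
proof -
  have *: "- \<sigma>1 * ln x - \<sigma>2 * ln y - \<sigma>3 * ln (x + y) \<le> K * ln 2 - (1 + \<eta>) * ln x - (1 + \<eta>) * ln y"
    if xy: "x \<ge> y" "y \<ge> 1" and \<sigma>: "\<sigma>1 + \<sigma>3 \<ge> 1 + \<eta>" "\<sigma>1 + \<sigma>2 + \<sigma>3 \<ge> 2 + 2 * \<eta>" "\<bar>\<sigma>3\<bar> \<le> K"
    for x y \<sigma>1 \<sigma>2 :: real
  proof -
    have "ln (x + y) \<le> ln (2 * x)" "ln x \<le> ln (x + y)" using xy by simp_all
    then have L: "0 \<le> ln (x + y) - ln x" "ln (x + y) - ln x \<le> ln 2"
      using xy by (simp_all add: ln_mult)
    have "- \<sigma>3 * (ln (x + y) - ln x) \<le> \<bar>\<sigma>3\<bar> * (ln (x + y) - ln x)"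
      using L by (intro mult_right_mono) auto
    also have "\<dots> \<le> K * ln 2" using L \<sigma> by (intro mult_mono) auto
    finally have 1: "- \<sigma>3 * ln (x + y) \<le> K * ln 2 - \<sigma>3 * ln x" by (simp add: algebra_simps)
    have "0 \<le> (\<sigma>1 + \<sigma>3 - 1 - \<eta>) * (ln x - ln y) + (\<sigma>1 + \<sigma>2 + \<sigma>3 - 2 - 2 * \<eta>) * ln y"
      using xy \<sigma> by (intro add_nonneg_nonneg mult_nonneg_nonneg) auto
    then show ?thesis using 1 by (simp add: algebra_simps)
  qed
  show ?thesis
  proof (cases "x \<ge> y")
    case True
    then show ?thesis using * assms by blast
  next
    case False
    then show ?thesis using *[of x y \<sigma>2 \<sigma>1] assms by (simp add: add.commute add.left_commute)
  qed
qed

lemma summable_on_nat_powr: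
  assumes "\<eta> > 0"
  shows "(\<lambda>m::nat. exp (- (1 + \<eta>) * ln (real m + 1))) summable_on UNIV"
proof (rule norm_summable_imp_summable_on)
  have "summable (\<lambda>m. real (Suc m) powr (- (1 + \<eta>)))"
    using assms summable_Suc_iff[of "\<lambda>m. real m powr (- (1 + \<eta>))"] by (simp add: summable_real_powr_iff)
  then show "summable (\<lambda>m. norm (exp (- (1 + \<eta>) * ln (real m + 1))))"
    by (simp add: powr_def add.commute)
qed

lemma summable_on_times:
  fixes f :: "'i \<Rightarrow> real" and g :: "'j \<Rightarrow> real"
  assumes f: "f summable_on UNIV" and g: "g summable_on UNIV" and "\<And>i. f i \<ge> 0" "\<And>j. g j \<ge> 0"
  shows "(\<lambda>p. f (fst p) * g (snd p)) summable_on UNIV"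
proof -
  have "(\<lambda>p. norm (f (fst p) * g (snd p))) summable_on (Sigma UNIV (\<lambda>_. UNIV))"
    unfolding Infinite_Sum.abs_summable_on_Sigma_iff
  proof (intro conjI ballI)
    show "(\<lambda>y. norm (f (fst (i, y)) * g (snd (i, y)))) summable_on UNIV" for i
      using summable_on_cmult_right[OF g, of "f i"] assms by simp
    have "(\<lambda>i. f i * (\<Sum>\<^sub>\<infinity>j. g j)) summable_on UNIV"
      by (rule summable_on_cmult_left[OF f])
    moreover have "(\<Sum>\<^sub>\<infinity>j. g j) \<ge> 0" by (rule infsum_nonneg) (rule assms)
    ultimately show "(\<lambda>i. norm (\<Sum>\<^sub>\<infinity>j. norm (f (fst (i, j)) * g (snd (i, j))))) summable_on UNIV"
      using assms by (simp add: infsum_cmult_right')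
  qed
  then show ?thesis using assms by simp
qed

lemma summable_on_nat_nat_powr:
  assumes "\<eta> > 0"
  shows "(\<lambda>(m::nat, n::nat). exp (- (1 + \<eta>) * ln (real m + 1)) * exp (- (1 + \<eta>) * ln (real n + 1)))
    summable_on UNIV"
  using summable_on_times[OF summable_on_nat_powr[OF assms] summable_on_nat_powr[OF assms]]
  by (simp add: case_prod_unfold)

text \<open>The single series is the boundary row that a unit shift of one variable splits off from
  the double series. It takes the same triple of exponents, so that one set of recursion lemmas
  serves both.\<close>

definition ssum_term :: "nat \<Rightarrow> complex \<times> complex \<times> complex \<Rightarrow> real \<Rightarrow> real \<Rightarrow> complex" where
  "ssum_term m s a b = of_real (real m + a) powr (- fst s) * of_real (real m + a + b) powr (- snd (snd s))"

definition dsum_term :: "nat \<times> nat \<Rightarrow> complex \<times> complex \<times> complex \<Rightarrow> real \<Rightarrow> real \<Rightarrow> complex" where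
  "dsum_term p s a b = of_real (real (fst p) + a) powr (- fst s) * of_real (real (snd p) + b) powr (- fst (snd s)) *
     of_real (real (fst p) + a + (real (snd p) + b)) powr (- snd (snd s))"

definition ssum :: "complex \<times> complex \<times> complex \<Rightarrow> real \<Rightarrow> real \<Rightarrow> complex" where
  "ssum s a b = (\<Sum>\<^sub>\<infinity>m. ssum_term m s a b)"

definition dsum :: "complex \<times> complex \<times> complex \<Rightarrow> real \<Rightarrow> real \<Rightarrow> complex" where
  "dsum s a b = (\<Sum>\<^sub>\<infinity>p. dsum_term p s a b)"

definition ssum_region :: "(complex \<times> complex \<times> complex) set" where
  "ssum_region = {s. Re (fst s + snd (snd s)) > 1}"

text \<open>The logarithms of m + a + b and m + a differ by at most ln (1 + \<beta>), so the terms
  behave like powers of m + a with exponent -(s1 + s3). The majorant is uniform in all a \<ge> 1,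
  because the relations below integrate over shifts of a.\<close>

lemma ssum_dom:
  assumes "s0 \<in> ssum_region"
  shows "\<exists>V M. open V \<and> s0 \<in> V \<and> M summable_on (UNIV :: nat set) \<and>
       (\<forall>s\<in>V. \<forall>a\<ge>1. \<forall>b\<in>{1..\<beta>}. \<forall>m. norm (ssum_term m s a b) \<le> M m)"
proof -
  define \<eta> where "\<eta> = (Re (fst s0 + snd (snd s0)) - 1) / 2"
  have \<eta>: "\<eta> > 0" using assms by (simp add: \<eta>_def ssum_region_def)
  define K where "K = \<bar>Re (snd (snd s0))\<bar> + 1"
  define V where "V = {s::complex \<times> complex \<times> complex. Re (fst s + snd (snd s)) > 1 + \<eta> \<and> \<bar>Re (snd (snd s))\<bar> < K}"
  define M where "M m = exp (K * ln (1 + \<beta>)) * exp (- (1 + \<eta>) * ln (real m + 1))" for m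
  have bound: "norm (ssum_term m s a b) \<le> M m" if "s \<in> V" "a \<ge> 1" "b \<in> {1..\<beta>}" for m s a b
  proof -
    define x where "x = real m + a"
    have x: "x \<ge> real m + 1" using that by (simp add: x_def)
    then have x1: "x \<ge> 1" by (smt (verit) of_nat_0_le_iff)
    define L where "L = ln (x + b) - ln x"
    have "ln x \<le> ln (x + b)" using x1 that by simp
    moreover have "x + b \<le> x * (1 + \<beta>)"
    proof -
      have "b \<le> x * \<beta>" using x1 that mult_mono[of 1 x b \<beta>] by auto
      then show ?thesis by (simp add: algebra_simps)
    qed
    then have "ln (x + b) \<le> ln (x * (1 + \<beta>))" using x1 that by (subst ln_le_cancel_iff) (auto intro!: mult_pos_pos)
    then have "ln (x + b) \<le> ln x + ln (1 + \<beta>)" using x1 that by (subst (asm) ln_mult) auto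
    ultimately have L: "0 \<le> L" "L \<le> ln (1 + \<beta>)" by (auto simp: L_def)
    have "- Re (snd (snd s)) * L \<le> \<bar>Re (snd (snd s))\<bar> * L" using L by (intro mult_right_mono) auto
    also have "\<dots> \<le> K * ln (1 + \<beta>)" using L that by (intro mult_mono) (auto simp: V_def)
    finally have 1: "- Re (snd (snd s)) * L \<le> K * ln (1 + \<beta>)" .
    have "- Re (fst s + snd (snd s)) * ln x \<le> - (1 + \<eta>) * ln x"
      using that x1 by (intro mult_right_mono) (auto simp: V_def)
    also have "\<dots> \<le> - (1 + \<eta>) * ln (real m + 1)"
      using x \<eta> by (intro mult_left_mono_neg) auto
    finally have 2: "- Re (fst s + snd (snd s)) * ln x \<le> - (1 + \<eta>) * ln (real m + 1)" .
    have "norm (ssum_term m s a b) = exp (- Re (fst s) * ln x + - Re (snd (snd s)) * ln (x + b))"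
      using x1 that by (simp add: ssum_term_def norm_mult x_def[symmetric] norm_of_real_powr flip: of_real_add exp_add)
    also have "- Re (fst s) * ln x + - Re (snd (snd s)) * ln (x + b) =
        - Re (fst s + snd (snd s)) * ln x + - Re (snd (snd s)) * L"
      by (simp add: L_def algebra_simps)
    also have "exp \<dots> \<le> M m"
      using 1 2 by (simp add: M_def flip: exp_add)
    finally show ?thesis .
  qed
  have "open V" unfolding V_def by (intro open_Collect_conj open_Collect_less continuous_intros)
  moreover have "s0 \<in> V" using \<eta> by (simp add: V_def K_def \<eta>_def field_simps)
  moreover have "M summable_on UNIV"
    unfolding M_def by (intro summable_on_cmult_right summable_on_nat_powr \<eta>)
  ultimately show ?thesis using bound by blast
qed

lemma dsum_dom:
  assumes "s0 \<in> tornheim_region"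
  shows "\<exists>V M. open V \<and> s0 \<in> V \<and> M summable_on (UNIV :: (nat \<times> nat) set) \<and>
       (\<forall>s\<in>V. \<forall>a\<ge>1. \<forall>b\<ge>1. \<forall>p. norm (dsum_term p s a b) \<le> M p)"
proof -
  obtain z1 z2 z3 where s0: "s0 = (z1, z2, z3)" by (cases s0)
  \<comment> \<open>Half of the smallest margin to the boundary, so that a neighbourhood of
    \<open>s0\<close> keeps the margin \<eta>. The last margin is halved beforehand since
    \<open>tornheim_exponent_bound\<close> asks for \<open>2 + 2 * \<eta>\<close>.\<close>
  define \<eta> where "\<eta> = min (Re (z1 + z3) - 1) (min (Re (z2 + z3) - 1) ((Re (z1 + z2 + z3) - 2) / 2)) / 2"
  have \<eta>: "\<eta> > 0" "1 + \<eta> < Re (z1 + z3)" "1 + \<eta> < Re (z2 + z3)" "2 + 2 * \<eta> < Re (z1 + z2 + z3)"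
    using assms by (auto simp: \<eta>_def s0 tornheim_region_def min_def field_simps)
  define K where "K = \<bar>Re z3\<bar> + 1"
  define V where "V = {s::complex \<times> complex \<times> complex. Re (fst s + snd (snd s)) > 1 + \<eta> \<and>
     Re (fst (snd s) + snd (snd s)) > 1 + \<eta> \<and> Re (fst s + fst (snd s) + snd (snd s)) > 2 + 2 * \<eta> \<and>
     \<bar>Re (snd (snd s))\<bar> < K}"
  define M where "M = (\<lambda>(m::nat, n::nat). exp (K * ln 2) * (exp (- (1 + \<eta>) * ln (real m + 1)) * exp (- (1 + \<eta>) * ln (real n + 1))))"
  have bound: "norm (dsum_term p s a b) \<le> M p" if s: "s \<in> V" and ab: "a \<ge> 1" "b \<ge> 1" for p s a b
  proof -
    obtain m n where p: "p = (m, n)" by (cases p)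
    define x y where "x = real m + a" and "y = real n + b"
    have x: "x \<ge> real m + 1" "y \<ge> real n + 1" using ab by (simp_all add: x_def y_def)
    then have x1: "x \<ge> 1" "y \<ge> 1" by (smt (verit) of_nat_0_le_iff)+
    have lnm: "- (1 + \<eta>) * ln x \<le> - (1 + \<eta>) * ln (real m + 1)" "- (1 + \<eta>) * ln y \<le> - (1 + \<eta>) * ln (real n + 1)"
      using x \<eta> by (auto intro!: mult_left_mono_neg)
    have "norm (dsum_term p s a b) =
        exp (- Re (fst s) * ln x - Re (fst (snd s)) * ln y - Re (snd (snd s)) * ln (x + y))"
      using x1 by (simp add: dsum_term_def p norm_mult x_def[symmetric] y_def[symmetric] norm_of_real_powr flip: of_real_add exp_add)
    also have "\<dots> \<le> exp (K * ln 2 - (1 + \<eta>) * ln x - (1 + \<eta>) * ln y)"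
      using s x1 by (subst exp_le_cancel_iff, intro tornheim_exponent_bound) (auto simp: V_def)
    also have "\<dots> \<le> M p"
      using lnm by (simp add: M_def p algebra_simps flip: exp_add)
    finally show ?thesis .
  qed
  have "open V" unfolding V_def by (intro open_Collect_conj open_Collect_less continuous_intros)
  moreover have "s0 \<in> V" using \<eta> by (simp add: V_def K_def s0)
  moreover have "M summable_on UNIV"
    using summable_on_cmult_right[OF summable_on_nat_nat_powr[OF \<eta>(1)], of "exp (K * ln 2)"]
    by (simp add: M_def case_prod_unfold)
  ultimately show ?thesis using bound by blast
qed

lemma nice_uminus: "nice f U \<Longrightarrow> nice (\<lambda>s a b. - f s a b) U"
  using nice_diff[OF nice_const[of 0]] by simp

lemma nice_ssum_term: "nice (ssum_term m) U"
  unfolding ssum_term_def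
  by (intro nice_mult nice_powr nice_uminus nice_s1 nice_s3) (auto intro!: continuous_intros simp: case_prod_beta)

lemma nice_dsum_term: "nice (dsum_term p) U"
  unfolding dsum_term_def
  by (intro nice_mult nice_powr nice_uminus nice_s1 nice_s2 nice_s3) (auto intro!: continuous_intros simp: case_prod_beta)

lemma open_ssum_region: "open ssum_region"
  unfolding ssum_region_def by (intro open_Collect_less continuous_intros)

lemma nice_ssum: "nice ssum ssum_region"
  unfolding ssum_def[abs_def]
proof (rule nice_infsum[OF open_ssum_region nice_ssum_term])
  show "\<exists>V M. open V \<and> s0 \<in> V \<and> M summable_on UNIV \<and>
      (\<forall>s\<in>V \<inter> ssum_region. \<forall>a\<in>{1..\<beta>}. \<forall>b\<in>{1..\<beta>}. \<forall>i\<in>UNIV. norm (ssum_term i s a b) \<le> M i)"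
    if s0: "s0 \<in> ssum_region" for s0 \<beta>
  proof -
    obtain V M where "open V" "s0 \<in> V" "M summable_on UNIV" "\<forall>s\<in>V. \<forall>a\<ge>1. \<forall>b\<in>{1..\<beta>}. \<forall>m. norm (ssum_term m s a b) \<le> M m"
      using ssum_dom[OF s0, of \<beta>] by blast
    then show ?thesis by (intro exI[of _ V] exI[of _ M]) simp
  qed
qed

lemma nice_dsum: "nice dsum tornheim_region"
  unfolding dsum_def[abs_def]
proof (rule nice_infsum[OF open_tornheim_region nice_dsum_term])
  show "\<exists>V M. open V \<and> s0 \<in> V \<and> M summable_on UNIV \<and>
      (\<forall>s\<in>V \<inter> tornheim_region. \<forall>a\<in>{1..\<beta>}. \<forall>b\<in>{1..\<beta>}. \<forall>i\<in>UNIV. norm (dsum_term i s a b) \<le> M i)"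
    if s0: "s0 \<in> tornheim_region" for s0 \<beta>
  proof -
    obtain V M where "open V" "s0 \<in> V" "M summable_on UNIV" "\<forall>s\<in>V. \<forall>a\<ge>1. \<forall>b\<ge>1. \<forall>p. norm (dsum_term p s a b) \<le> M p"
      using dsum_dom[OF s0] by blast
    then show ?thesis by (intro exI[of _ V] exI[of _ M]) simp
  qed
qed

lemma ssum_summable:
  assumes "s \<in> ssum_region" "a \<ge> 1" "b \<ge> 1"
  shows "(\<lambda>m. ssum_term m s a b) summable_on UNIV"
proof -
  obtain V M where M: "s \<in> V" "M summable_on UNIV" "\<forall>s\<in>V. \<forall>a\<ge>1. \<forall>b\<in>{1..b}. \<forall>m. norm (ssum_term m s a b) \<le> M m"
    using ssum_dom[OF assms(1), of b] by blast
  have "(\<lambda>m. norm (ssum_term m s a b)) summable_on UNIV"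
    by (rule Infinite_Sum.abs_summable_on_comparison_test'[OF M(2)], rule M(3)[rule_format])
       (use assms M(1) in auto)
  then show ?thesis by (rule abs_summable_summable)
qed

lemma dsum_summable:
  assumes "s \<in> tornheim_region" "a \<ge> 1" "b \<ge> 1"
  shows "(\<lambda>p. dsum_term p s a b) summable_on UNIV"
proof -
  obtain V M where M: "s \<in> V" "M summable_on UNIV" "\<forall>s\<in>V. \<forall>a\<ge>1. \<forall>b\<ge>1. \<forall>p. norm (dsum_term p s a b) \<le> M p"
    using dsum_dom[OF assms(1)] by blast
  have "(\<lambda>p. norm (dsum_term p s a b)) summable_on UNIV"
    by (rule Infinite_Sum.abs_summable_on_comparison_test'[OF M(2)], rule M(3)[rule_format])
       (use assms M(1) in auto)
  then show ?thesis by (rule abs_summable_summable)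
qed

section \<open>Averaging operators\<close>

text \<open>Continuity on the quadrant is what makes the averaging operators additive and, by
  Fubini, commuting.\<close>

definition C0 :: "(real \<Rightarrow> real \<Rightarrow> complex) \<Rightarrow> bool" where
  "C0 h \<longleftrightarrow> continuous_on ({1..} \<times> {1..}) (\<lambda>(a, b). h a b)"

definition Ia :: "(real \<Rightarrow> complex) \<Rightarrow> (real \<Rightarrow> real \<Rightarrow> complex) \<Rightarrow> real \<Rightarrow> real \<Rightarrow> complex" where
  "Ia w h a b = integral {0..1} (\<lambda>y. w y * h (a + y) b)"

definition Ib :: "(real \<Rightarrow> complex) \<Rightarrow> (real \<Rightarrow> real \<Rightarrow> complex) \<Rightarrow> real \<Rightarrow> real \<Rightarrow> complex" where
  "Ib w h a b = integral {0..1} (\<lambda>y. w y * h a (b + y))"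

text \<open>\<open>one_wt\<close> averages over a unit interval. \<open>tri_wt\<close> is the weight
  left by integrating by parts: applied to minus the derivative of a function it gives the function
  minus its average.\<close>

definition one_wt :: "real \<Rightarrow> complex" where "one_wt y = 1"
definition tri_wt :: "real \<Rightarrow> complex" where "tri_wt y = of_real (1 - y)"

abbreviation "Sa \<equiv> Ia one_wt"
abbreviation "Sb \<equiv> Ib one_wt"
abbreviation "Ja \<equiv> Ia tri_wt"
abbreviation "Jb \<equiv> Ib tri_wt"

lemma cont_wt [intro]: "continuous_on S one_wt" "continuous_on S tri_wt"
  unfolding one_wt_def[abs_def] tri_wt_def[abs_def] by (intro continuous_intros)+

lemma Ib_eq_Ia: "Ib w h a b = Ia w (\<lambda>x y. h y x) b a"
  by (simp add: Ia_def Ib_def)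

lemma nice_C0: "nice f U \<Longrightarrow> s \<in> U \<Longrightarrow> C0 (f s)"
  unfolding C0_def case_prod_beta
  by (rule nice_continuous_compose[where U = U]) (auto intro!: continuous_intros)

lemma C0_compose:
  assumes "C0 h" "continuous_on S g1" "continuous_on S g2" "\<And>x. x \<in> S \<Longrightarrow> g1 x \<ge> 1 \<and> g2 x \<ge> 1"
  shows "continuous_on S (\<lambda>x. h (g1 x) (g2 x))"
proof -
  have "continuous_on S (\<lambda>x. (\<lambda>(a, b). h a b) (g1 x, g2 x))"
    by (rule continuous_on_compose2[OF assms(1)[unfolded C0_def]])
       (use assms in \<open>auto intro!: continuous_intros\<close>)
  then show ?thesis by simp
qed

lemma C0_swap: "C0 h \<Longrightarrow> C0 (\<lambda>a b. h b a)"
  unfolding C0_def[of "\<lambda>a b. h b a"] case_prod_beta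
  by (rule C0_compose) (auto intro!: continuous_intros)

lemma C0_add: "C0 h \<Longrightarrow> C0 k \<Longrightarrow> C0 (\<lambda>a b. h a b + k a b)"
  and C0_diff: "C0 h \<Longrightarrow> C0 k \<Longrightarrow> C0 (\<lambda>a b. h a b - k a b)"
  and C0_mult: "C0 h \<Longrightarrow> C0 k \<Longrightarrow> C0 (\<lambda>a b. h a b * k a b)"
  and C0_const: "C0 (\<lambda>a b. c)"
  unfolding C0_def case_prod_beta by (auto intro!: continuous_intros)

lemma C0_powr: "C0 (\<lambda>a b. of_real a powr z)" "C0 (\<lambda>a b. of_real b powr z)" "C0 (\<lambda>a b. of_real (a + b) powr z)"
proof -
  have *: "continuous_on ({1..} \<times> {1..}) (\<lambda>(a::real, b::real). a)"
    "continuous_on ({1..} \<times> {1..}) (\<lambda>(a::real, b::real). b)"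
    "continuous_on ({1..} \<times> {1..}) (\<lambda>(a::real, b::real). a + b)"
    unfolding case_prod_beta by (intro continuous_intros)+
  show "C0 (\<lambda>a b. of_real a powr z)"
    using nice_C0[OF nice_powr[OF nice_const[of z UNIV] *(1)], of undefined] by simp
  show "C0 (\<lambda>a b. of_real b powr z)"
    using nice_C0[OF nice_powr[OF nice_const[of z UNIV] *(2)], of undefined] by simp
  show "C0 (\<lambda>a b. of_real (a + b) powr z)"
    using nice_C0[OF nice_powr[OF nice_const[of z UNIV] *(3)], of undefined] by simp
qed

lemma C0_Ia:
  assumes "C0 h" "continuous_on {0..1} w"
  shows "C0 (Ia w h)"
proof -
  have "nice (\<lambda>s. h) UNIV"
  proof (rule niceI)
    show "continuous_on (UNIV \<times> {1..} \<times> {1..}) (\<lambda>(s, a, b). h a b)"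
      unfolding case_prod_beta by (rule C0_compose[OF assms(1)]) (auto intro!: continuous_intros)
  qed auto
  from nice_C0[OF nice_integral_a[OF this _ assms(2)]] show ?thesis
    by (simp add: Ia_def[abs_def])
qed

lemma C0_Ib: "C0 h \<Longrightarrow> continuous_on {0..1} w \<Longrightarrow> C0 (Ib w h)"
  using C0_swap[OF C0_Ia[OF C0_swap]] by (simp add: Ib_eq_Ia[abs_def])

lemma nice_Ia: "nice f U \<Longrightarrow> open U \<Longrightarrow> continuous_on {0..1} w \<Longrightarrow> nice (\<lambda>s. Ia w (f s)) U"
  and nice_Ib: "nice f U \<Longrightarrow> open U \<Longrightarrow> continuous_on {0..1} w \<Longrightarrow> nice (\<lambda>s. Ib w (f s)) U"
  using nice_integral_a[of f U w] nice_integral_b[of f U w] by (simp_all add: Ia_def[abs_def] Ib_def[abs_def])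

lemma integrable_Ia:
  assumes "C0 h" "continuous_on {0..1} w" "a \<ge> 1" "b \<ge> 1"
  shows "(\<lambda>y. w y * h (a + y) b) integrable_on {0..1}"
  by (rule integrable_continuous_real, rule continuous_on_mult[OF assms(2)], rule C0_compose[OF assms(1)])
     (use assms(3,4) in \<open>auto intro!: continuous_intros\<close>)

lemma Ia_add: "C0 h \<Longrightarrow> C0 k \<Longrightarrow> continuous_on {0..1} w \<Longrightarrow> a \<ge> 1 \<Longrightarrow> b \<ge> 1 \<Longrightarrow>
    Ia w (\<lambda>a b. h a b + k a b) a b = Ia w h a b + Ia w k a b"
  unfolding Ia_def distrib_left by (rule integral_add; rule integrable_Ia)

lemma Ia_diff: "C0 h \<Longrightarrow> C0 k \<Longrightarrow> continuous_on {0..1} w \<Longrightarrow> a \<ge> 1 \<Longrightarrow> b \<ge> 1 \<Longrightarrow>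
    Ia w (\<lambda>a b. h a b - k a b) a b = Ia w h a b - Ia w k a b"
  unfolding Ia_def right_diff_distrib by (rule integral_diff; rule integrable_Ia)

lemma Ia_mult: "Ia w (\<lambda>a b. c b * h a b) a b = c b * Ia w h a b"
  unfolding Ia_def by (simp add: mult.left_commute)

lemma Ia_cong: "(\<And>a b. a \<ge> 1 \<Longrightarrow> b \<ge> 1 \<Longrightarrow> h a b = k a b) \<Longrightarrow> a \<ge> 1 \<Longrightarrow> b \<ge> 1 \<Longrightarrow> Ia w h a b = Ia w k a b"
  unfolding Ia_def by (intro integral_cong) auto

lemma Ib_add: "C0 h \<Longrightarrow> C0 k \<Longrightarrow> continuous_on {0..1} w \<Longrightarrow> a \<ge> 1 \<Longrightarrow> b \<ge> 1 \<Longrightarrow>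
    Ib w (\<lambda>a b. h a b + k a b) a b = Ib w h a b + Ib w k a b"
  unfolding Ib_eq_Ia by (rule Ia_add; (rule C0_swap)?)

lemma Ib_diff: "C0 h \<Longrightarrow> C0 k \<Longrightarrow> continuous_on {0..1} w \<Longrightarrow> a \<ge> 1 \<Longrightarrow> b \<ge> 1 \<Longrightarrow>
    Ib w (\<lambda>a b. h a b - k a b) a b = Ib w h a b - Ib w k a b"
  unfolding Ib_eq_Ia by (rule Ia_diff; (rule C0_swap)?)

lemma Ib_mult: "Ib w (\<lambda>a b. c a * h a b) a b = c a * Ib w h a b"
  unfolding Ib_eq_Ia by (rule Ia_mult)

lemma Ib_cong: "(\<And>a b. a \<ge> 1 \<Longrightarrow> b \<ge> 1 \<Longrightarrow> h a b = k a b) \<Longrightarrow> a \<ge> 1 \<Longrightarrow> b \<ge> 1 \<Longrightarrow> Ib w h a b = Ib w k a b"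
  unfolding Ib_def by (intro integral_cong) auto

lemma Ia_Ib:
  assumes "C0 h" "continuous_on {0..1} w" "continuous_on {0..1} w'" "a \<ge> 1" "b \<ge> 1"
  shows "Ia w (Ib w' h) a b = Ib w' (Ia w h) a b"
proof -
  have "Ia w (Ib w' h) a b = integral (cbox 0 1) (\<lambda>x. integral (cbox 0 1) (\<lambda>y. w x * (w' y * h (a + x) (b + y))))"
    by (simp add: Ia_def Ib_def)
  also have "\<dots> = integral (cbox 0 1) (\<lambda>y. integral (cbox 0 1) (\<lambda>x. w x * (w' y * h (a + x) (b + y))))"
  proof (rule integral_swap_continuous)
    have "continuous_on (cbox (0, 0) (1, 1)) (\<lambda>z::real\<times>real. w (fst z))"
      "continuous_on (cbox (0, 0) (1, 1)) (\<lambda>z::real\<times>real. w' (snd z))"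
      by (rule continuous_on_compose2[OF assms(2)] continuous_on_compose2[OF assms(3)];
          force intro!: continuous_intros simp: cbox_Pair_eq)+
    moreover have "continuous_on (cbox (0, 0) (1, 1)) (\<lambda>z. h (a + fst z) (b + snd z))"
      by (rule C0_compose[OF assms(1)]) (use assms in \<open>auto intro!: continuous_intros simp: cbox_Pair_eq\<close>)
    ultimately show "continuous_on (cbox (0, 0) (1, 1)) (\<lambda>(x, y). w x * (w' y * h (a + x) (b + y)))"
      unfolding case_prod_beta by (intro continuous_intros)
  qed
  also have "\<dots> = Ib w' (Ia w h) a b"
  proof -
    have "integral {0..1} (\<lambda>x. w x * (c * k x)) = c * integral {0..1} (\<lambda>x. w x * k x)" for c :: complex and k
      by (simp add: mult.left_commute[of _ c])
    then show ?thesis by (simp add: Ia_def Ib_def)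
  qed
  finally show ?thesis .
qed

section \<open>Relations between the series\<close>

abbreviation "e1 \<equiv> (1::complex, 0::complex, 0::complex)"
abbreviation "e2 \<equiv> (0::complex, 1::complex, 0::complex)"
abbreviation "e3 \<equiv> (0::complex, 0::complex, 1::complex)"

text \<open>Differentiation in the shift \<open>a\<close> raises the first or the third exponent, so
  the fundamental theorem and integration by parts relate the series at \<open>s\<close> to those at
  \<open>s + e1\<close> and \<open>s + e3\<close>. Length 1 serves the averaging operators, a
  general \<open>x\<close> the derivative of the zeta function.\<close>

lemma series_relations:
  fixes T :: "'i \<Rightarrow> complex \<times> complex \<times> complex \<Rightarrow> real \<Rightarrow> real \<Rightarrow> complex"
  assumes nice: "\<And>i. nice (T i) UNIV"
    and der: "\<And>i s a b X. a \<ge> 1 \<Longrightarrow> b \<ge> 1 \<Longrightarrow> ((\<lambda>a. T i s a b) has_vector_derivative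
       - (fst s * T i (s + e1) a b + snd (snd s) * T i (s + e3) a b)) (at a within X)"
    and dom: "\<And>s0 \<beta>. s0 \<in> R \<Longrightarrow> \<exists>V M. open V \<and> s0 \<in> V \<and> M summable_on (UNIV :: 'i set) \<and>
       (\<forall>s\<in>V. \<forall>a\<ge>1. \<forall>b\<in>{1..\<beta>}. \<forall>i. norm (T i s a b) \<le> M i)"
    and s: "s \<in> R" "s + e1 \<in> R" "s + e3 \<in> R" and ab: "a \<ge> 1" "b \<ge> 1" and x: "x \<ge> 0"
  defines "F \<equiv> \<lambda>s a b. \<Sum>\<^sub>\<infinity>i. T i s a b"
  shows "integral {0..x} (\<lambda>y. fst s * F (s + e1) (a + y) b + snd (snd s) * F (s + e3) (a + y) b) = F s a b - F s (a + x) b"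
    and "integral {0..x} (\<lambda>y. of_real (x - y) * (fst s * F (s + e1) (a + y) b + snd (snd s) * F (s + e3) (a + y) b)) =
       of_real x * F s a b - integral {0..x} (\<lambda>y. F s (a + y) b)"
proof -
  have "\<exists>M. M summable_on UNIV \<and> (\<forall>a\<ge>1. \<forall>i. norm (T i s a b) \<le> M i)" if "s \<in> R" for s
    using dom[OF that, of b] ab by (meson atLeastAtMost_iff order_refl)
  with s obtain M M1 M3 where
    M: "M summable_on UNIV" "\<And>a i. a \<ge> 1 \<Longrightarrow> norm (T i s a b) \<le> M i" and
    M1: "M1 summable_on UNIV" "\<And>a i. a \<ge> 1 \<Longrightarrow> norm (T i (s + e1) a b) \<le> M1 i" and
    M3: "M3 summable_on UNIV" "\<And>a i. a \<ge> 1 \<Longrightarrow> norm (T i (s + e3) a b) \<le> M3 i"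
    by metis
  have summ: "(\<lambda>i. T i s' a b) summable_on UNIV" if "M' summable_on UNIV" "\<And>i. norm (T i s' a b) \<le> M' i" for s' a M'
    by (rule abs_summable_summable[OF Infinite_Sum.abs_summable_on_comparison_test'[OF that(1)]]) (use that in auto)
  let ?f = "\<lambda>i y. T i s (a + y) b"
  let ?f' = "\<lambda>i y. fst s * T i (s + e1) (a + y) b + snd (snd s) * T i (s + e3) (a + y) b"
  have F': "(\<Sum>\<^sub>\<infinity>i. ?f' i y) = fst s * F (s + e1) (a + y) b + snd (snd s) * F (s + e3) (a + y) b" if "y \<in> {0..x}" for y
  proof -
    have "(\<lambda>i. T i (s + e1) (a + y) b) summable_on UNIV" "(\<lambda>i. T i (s + e3) (a + y) b) summable_on UNIV"
      by (rule summ[OF M1(1)], rule M1(2)) (use that ab in simp, rule summ[OF M3(1)], rule M3(2), use that ab in simp)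
    then show ?thesis
      unfolding F_def by (subst infsum_add) (auto intro: summable_on_cmult_right simp: infsum_cmult_right')
  qed
  have der': "(?f i has_vector_derivative - ?f' i y) (at y within {0..x})" if "y \<in> {0..x}" for i y
  proof -
    have "((\<lambda>y. a + y) has_vector_derivative 1) (at y within {0..x})"
      by (auto intro!: derivative_eq_intros)
    from vector_diff_chain_within[OF this der] show ?thesis
      using ab that by (simp add: o_def)
  qed
  have cont: "continuous_on {0..x} (?f' i)" for i
    using ab by (intro continuous_intros nice_continuous_compose[OF nice]) auto
  have M': "(\<lambda>i. norm (fst s) * M1 i + norm (snd (snd s)) * M3 i) summable_on UNIV"
    by (intro summable_on_add summable_on_cmult_right M1 M3)
  have bd: "norm (?f' i y) \<le> norm (fst s) * M1 i + norm (snd (snd s)) * M3 i" if "y \<in> {0..x}" for i y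
    using ab that
    by (intro order.trans[OF norm_triangle_ineq] add_mono) (auto simp: norm_mult intro!: mult_left_mono M1 M3)
  note rel = infsum_deriv_integral[of x UNIV ?f ?f', OF x der' cont _ M(1) bd M']
  have bd0: "norm (T i s (a + y) b) \<le> M i" if "y \<in> {0..x}" for i y
    using that ab by (intro M) simp
  have "integral {0..x} (\<lambda>y. fst s * F (s + e1) (a + y) b + snd (snd s) * F (s + e3) (a + y) b) =
      integral {0..x} (\<lambda>y. \<Sum>\<^sub>\<infinity>i. ?f' i y)"
    by (intro integral_cong) (simp only: F')
  also have "\<dots> = F s a b - F s (a + x) b"
    using rel(1)[OF _ bd0] by (simp add: F_def)
  finally show "integral {0..x} (\<lambda>y. fst s * F (s + e1) (a + y) b + snd (snd s) * F (s + e3) (a + y) b) = F s a b - F s (a + x) b" .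
  have "integral {0..x} (\<lambda>y. of_real (x - y) * (fst s * F (s + e1) (a + y) b + snd (snd s) * F (s + e3) (a + y) b)) =
      integral {0..x} (\<lambda>y. of_real (x - y) * (\<Sum>\<^sub>\<infinity>i. ?f' i y))"
    by (intro integral_cong) (simp only: F')
  also have "\<dots> = of_real x * F s a b - integral {0..x} (\<lambda>y. F s (a + y) b)"
    using rel(2)[OF _ bd0] by (simp add: F_def)
  finally show "integral {0..x} (\<lambda>y. of_real (x - y) * (fst s * F (s + e1) (a + y) b + snd (snd s) * F (s + e3) (a + y) b)) =
       of_real x * F s a b - integral {0..x} (\<lambda>y. F s (a + y) b)" .
qed

lemma of_real_powr_has_vector_derivative:
  assumes "x > 0"
  shows "((\<lambda>x. complex_of_real x powr z) has_vector_derivative z * of_real x powr (z - 1)) (at x within X)"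
proof -
  have "((\<lambda>w. w powr z) has_field_derivative z * of_real x powr (z - 1)) (at (of_real x))"
    using assms by (intro has_field_derivative_powr) auto
  then show ?thesis
    using has_vector_derivative_real_field has_vector_derivative_at_within by blast
qed

lemma of_real_powr_shift_has_vector_derivative:
  assumes "c + x > 0"
  shows "((\<lambda>x. complex_of_real (c + x) powr z) has_vector_derivative z * of_real (c + x) powr (z - 1)) (at x within X)"
proof -
  have "((\<lambda>y. c + y) has_vector_derivative 1) (at x within X)"
    by (auto intro!: derivative_eq_intros)
  from vector_diff_chain_within[OF this of_real_powr_has_vector_derivative[OF assms]]
  show ?thesis by (simp add: o_def)
qed

lemma minus1: "- z - 1 = - 1 - (z::complex)"
  by simp

lemma ssum_term_has_vector_derivative:
  assumes "a \<ge> 1" "b \<ge> 1"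
  shows "((\<lambda>a. ssum_term m s a b) has_vector_derivative
       - (fst s * ssum_term m (s + e1) a b + snd (snd s) * ssum_term m (s + e3) a b)) (at a within X)"
proof -
  obtain s1 s2 s3 where s: "s = (s1, s2, s3)" by (cases s)
  have "((\<lambda>a. of_real (real m + a) powr (- s1) * of_real ((real m + b) + a) powr (- s3)) has_vector_derivative
      of_real (real m + a) powr (- s1) * (- s3 * of_real ((real m + b) + a) powr (- s3 - 1)) +
      (- s1 * of_real (real m + a) powr (- s1 - 1)) * of_real ((real m + b) + a) powr (- s3)) (at a within X)"
    using assms by (intro has_vector_derivative_mult of_real_powr_shift_has_vector_derivative) auto
  then show ?thesis by (simp add: s ssum_term_def algebra_simps minus1)
qed

lemma dsum_term_has_vector_derivative:
  assumes "a \<ge> 1" "b \<ge> 1"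
  shows "((\<lambda>a. dsum_term p s a b) has_vector_derivative
       - (fst s * dsum_term p (s + e1) a b + snd (snd s) * dsum_term p (s + e3) a b)) (at a within X)"
proof -
  obtain s1 s2 s3 where s: "s = (s1, s2, s3)" by (cases s)
  obtain m n where p: "p = (m, n)" by (cases p)
  let ?c = "of_real (real n + b) powr (- s2) :: complex"
  have "((\<lambda>a. ?c * (of_real (real m + a) powr (- s1) * of_real ((real m + real n + b) + a) powr (- s3))) has_vector_derivative
      ?c * (of_real (real m + a) powr (- s1) * (- s3 * of_real ((real m + real n + b) + a) powr (- s3 - 1)) +
      (- s1 * of_real (real m + a) powr (- s1 - 1)) * of_real ((real m + real n + b) + a) powr (- s3))) (at a within X)"
    using assms by (intro has_vector_derivative_mult_right has_vector_derivative_mult of_real_powr_shift_has_vector_derivative) auto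
  then show ?thesis by (simp add: s p dsum_term_def algebra_simps minus1)
qed

lemma ssum_region_step: "s \<in> ssum_region \<Longrightarrow> s + e1 \<in> ssum_region \<and> s + e3 \<in> ssum_region"
  by (cases s) (auto simp: ssum_region_def)

lemma tornheim_region_step: "s \<in> tornheim_region \<Longrightarrow>
    s + e1 \<in> tornheim_region \<and> s + e2 \<in> tornheim_region \<and> s + e3 \<in> tornheim_region"
  by (cases s) (auto simp: tornheim_region_def)

text \<open>Minus the derivative in \<open>a\<close>, obtained term by term; likewise for the double
  series.\<close>

definition ssum_slope :: "complex \<times> complex \<times> complex \<Rightarrow> real \<Rightarrow> real \<Rightarrow> complex" where
  "ssum_slope s a b = fst s * ssum (s + e1) a b + snd (snd s) * ssum (s + e3) a b"

definition dsum_slope :: "complex \<times> complex \<times> complex \<Rightarrow> real \<Rightarrow> real \<Rightarrow> complex" where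
  "dsum_slope s a b = fst s * dsum (s + e1) a b + snd (snd s) * dsum (s + e3) a b"

lemma ssum_relations:
  assumes "s \<in> ssum_region" "a \<ge> 1" "b \<ge> 1" "x \<ge> 0"
  shows "integral {0..x} (\<lambda>y. ssum_slope s (a + y) b) = ssum s a b - ssum s (a + x) b"
    and "integral {0..x} (\<lambda>y. of_real (x - y) * ssum_slope s (a + y) b) = of_real x * ssum s a b - integral {0..x} (\<lambda>y. ssum s (a + y) b)"
proof -
  have "\<exists>V M. open V \<and> s0 \<in> V \<and> M summable_on (UNIV :: nat set) \<and>
       (\<forall>s\<in>V. \<forall>a\<ge>1. \<forall>b\<in>{1..\<beta>}. \<forall>i. norm (ssum_term i s a b) \<le> M i)" if "s0 \<in> ssum_region" for s0 \<beta>
    using ssum_dom[OF that] .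
  note * = series_relations[of ssum_term ssum_region s a b x, OF nice_ssum_term ssum_term_has_vector_derivative this]
  show "integral {0..x} (\<lambda>y. ssum_slope s (a + y) b) = ssum s a b - ssum s (a + x) b"
    "integral {0..x} (\<lambda>y. of_real (x - y) * ssum_slope s (a + y) b) = of_real x * ssum s a b - integral {0..x} (\<lambda>y. ssum s (a + y) b)"
    using * ssum_region_step[OF assms(1)] assms unfolding ssum_slope_def ssum_def by blast+
qed

lemma dsum_relations:
  assumes "s \<in> tornheim_region" "a \<ge> 1" "b \<ge> 1"
  shows "Sa (dsum_slope s) a b = dsum s a b - dsum s (a + 1) b"
    and "Ja (dsum_slope s) a b = dsum s a b - Sa (dsum s) a b"
proof -
  have "\<exists>V M. open V \<and> s0 \<in> V \<and> M summable_on (UNIV :: (nat \<times> nat) set) \<and>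
       (\<forall>s\<in>V. \<forall>a\<ge>1. \<forall>b\<in>{1..\<beta>}. \<forall>i. norm (dsum_term i s a b) \<le> M i)" if s0: "s0 \<in> tornheim_region" for s0 \<beta>
  proof -
    obtain V M where "open V" "s0 \<in> V" "M summable_on UNIV" "\<forall>s\<in>V. \<forall>a\<ge>1. \<forall>b\<ge>1. \<forall>p. norm (dsum_term p s a b) \<le> M p"
      using dsum_dom[OF s0] by blast
    then show ?thesis by (intro exI[of _ V] exI[of _ M]) simp
  qed
  note * = series_relations[of dsum_term tornheim_region s a b 1, OF nice_dsum_term dsum_term_has_vector_derivative this]
  have "integral {0..1} (\<lambda>y. dsum_slope s (a + y) b) = dsum s a b - dsum s (a + 1) b"
    "integral {0..1} (\<lambda>y. of_real (1 - y) * dsum_slope s (a + y) b) = of_real 1 * dsum s a b - integral {0..1} (\<lambda>y. dsum s (a + y) b)"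
    using * tornheim_region_step[OF assms(1)] assms zero_le_one unfolding dsum_slope_def dsum_def by blast+
  then show "Sa (dsum_slope s) a b = dsum s a b - dsum s (a + 1) b" "Ja (dsum_slope s) a b = dsum s a b - Sa (dsum s) a b"
    by (simp_all add: Ia_def one_wt_def tri_wt_def)
qed

lemma ssum_step:
  assumes "s \<in> ssum_region" "a \<ge> 1" "b \<ge> 1"
  shows "ssum s a b - ssum s (a + 1) b = of_real a powr (- fst s) * of_real (a + b) powr (- snd (snd s))"
proof -
  have "ssum s a b = (\<Sum>\<^sub>\<infinity>m\<in>{0} \<union> range Suc. ssum_term m s a b)"
    unfolding ssum_def by (metis UNIV_nat_eq insert_is_Un)
  also have "\<dots> = (\<Sum>\<^sub>\<infinity>m\<in>{0}. ssum_term m s a b) + (\<Sum>\<^sub>\<infinity>m\<in>range Suc. ssum_term m s a b)"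
    by (intro infsum_Un_disjoint summable_on_subset_banach[OF ssum_summable[OF assms]]) auto
  also have "(\<Sum>\<^sub>\<infinity>m\<in>range Suc. ssum_term m s a b) = ssum s (a + 1) b"
    unfolding ssum_def by (subst infsum_reindex) (auto simp: ssum_term_def o_def algebra_simps intro!: infsum_cong)
  finally show ?thesis by (simp add: ssum_term_def)
qed

text \<open>The row with first index 0 is a single series in the second index, in which the two
  shifts exchange their roles; hence \<open>swap3\<close> and the order \<open>b a\<close>.\<close>

lemma dsum_step:
  assumes "s \<in> tornheim_region" "a \<ge> 1" "b \<ge> 1"
  shows "dsum s a b - dsum s (a + 1) b = of_real a powr (- fst s) * ssum (swap3 s) b a"
proof -
  let ?f = "\<lambda>p. dsum_term p s a b"
  have un: "UNIV = range (Pair (0::nat)) \<union> range (\<lambda>(m::nat, n::nat). (Suc m, n))"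
  proof -
    have "(m, n) \<in> range (Pair 0) \<union> range (\<lambda>(m, n). (Suc m, n))" for m n :: nat
      by (cases m) (auto simp: image_iff)
    then show ?thesis by auto
  qed
  have "dsum s a b = (\<Sum>\<^sub>\<infinity>p\<in>range (Pair 0) \<union> range (\<lambda>(m, n). (Suc m, n)). ?f p)"
    unfolding dsum_def by (subst un[symmetric]) (rule refl)
  also have "\<dots> = (\<Sum>\<^sub>\<infinity>p\<in>range (Pair 0). ?f p) + (\<Sum>\<^sub>\<infinity>p\<in>range (\<lambda>(m, n). (Suc m, n)). ?f p)"
    by (intro infsum_Un_disjoint summable_on_subset_banach[OF dsum_summable[OF assms]]) auto
  also have "(\<Sum>\<^sub>\<infinity>p\<in>range (\<lambda>(m, n). (Suc m, n)). ?f p) = dsum s (a + 1) b"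
    unfolding dsum_def by (subst infsum_reindex) (auto simp: dsum_term_def o_def algebra_simps inj_on_def intro!: infsum_cong)
  also have "(\<Sum>\<^sub>\<infinity>p\<in>range (Pair 0). ?f p) = of_real a powr (- fst s) * ssum (swap3 s) b a"
    unfolding ssum_def infsum_cmult_right'[symmetric]
    by (subst infsum_reindex) (auto simp: dsum_term_def ssum_term_def swap3_def o_def algebra_simps inj_on_def intro!: infsum_cong)
  finally show ?thesis by simp
qed

lemma dsum_swap: "dsum (swap3 s) b a = dsum s a b"
  unfolding dsum_def
  by (rule infsum_reindex_bij_witness[of _ prod.swap prod.swap]) (auto simp: dsum_term_def swap3_def algebra_simps)

lemma of_real_powr_add1: "x > 0 \<Longrightarrow> complex_of_real x powr (z + 1) = of_real x * of_real x powr z"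
  by (simp add: powr_add)

text \<open>Term by term this is x = (x + b) - b for x = m + a.\<close>

lemma ssum_split:
  assumes "s \<in> ssum_region" "a \<ge> 1" "b \<ge> 1"
  shows "ssum (s + (-1, 0, 1)) a b = ssum s a b - of_real b * ssum (s + e3) a b"
proof -
  obtain s1 s2 s3 where s: "s = (s1, s2, s3)" by (cases s)
  have "ssum_term m (s + (-1, 0, 1)) a b = ssum_term m s a b - of_real b * ssum_term m (s + e3) a b" for m
  proof -
    let ?x = "real m + a"
    have "?x > 0" "?x + b > 0" using assms by auto
    then have "of_real ?x powr (- s1 + 1) = of_real ?x * of_real ?x powr (- s1)"
      "of_real (?x + b) powr ((- s3 - 1) + 1) = of_real (?x + b) * of_real (?x + b) powr (- s3 - 1)"
      by (intro of_real_powr_add1; simp)+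
    then show ?thesis by (simp add: ssum_term_def s algebra_simps minus1)
  qed
  then show ?thesis
    unfolding ssum_def infsum_cmult_right'[symmetric]
    using ssum_summable[OF assms] ssum_summable[OF conjunct2[OF ssum_region_step[OF assms(1)]] assms(2,3)]
    by (intro infsumI) (simp add: has_sum_diff summable_on_cmult_right)
qed

text \<open>The partial fraction identity of Tornheim sums: the numerator x + y cancels one factor
  of the third power.\<close>

lemma dsum_split:
  assumes "s + (-1, 0, 1) \<in> tornheim_region" "s + (0, -1, 1) \<in> tornheim_region" "a \<ge> 1" "b \<ge> 1"
  shows "dsum (s + (-1, 0, 1)) a b + dsum (s + (0, -1, 1)) a b = dsum s a b"
proof -
  obtain s1 s2 s3 where s: "s = (s1, s2, s3)" by (cases s)
  have "dsum_term p (s + (-1, 0, 1)) a b + dsum_term p (s + (0, -1, 1)) a b = dsum_term p s a b" for p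
  proof -
    let ?x = "real (fst p) + a" and ?y = "real (snd p) + b"
    have "?x > 0" "?y > 0" "?x + ?y > 0" using assms by (auto intro: add_pos_pos add_nonneg_pos)
    then have "of_real ?x powr (- s1 + 1) = of_real ?x * of_real ?x powr (- s1)"
      "of_real ?y powr (- s2 + 1) = of_real ?y * of_real ?y powr (- s2)"
      "of_real (?x + ?y) powr ((- s3 - 1) + 1) = of_real (?x + ?y) * of_real (?x + ?y) powr (- s3 - 1)"
      by (intro of_real_powr_add1; simp)+
    then show ?thesis by (simp add: dsum_term_def s algebra_simps minus1)
  qed
  then show ?thesis
    unfolding dsum_def using dsum_summable[OF assms(1,3,4)] dsum_summable[OF assms(2,3,4)]
    by (subst infsum_add[symmetric]) auto
qed

section \<open>Averages, remainders and their recursions\<close>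

lemma Ia_lin:
  assumes "C0 h" "C0 k" "continuous_on {0..1} w" "a \<ge> 1" "b \<ge> 1"
  shows "Ia w (\<lambda>a b. c * h a b + d * k a b) a b = c * Ia w h a b + d * Ia w k a b"
  using Ia_add[OF C0_mult[OF C0_const assms(1)] C0_mult[OF C0_const assms(2)] assms(3-5), of c d]
  by (simp add: Ia_mult)

lemma Ib_lin:
  assumes "C0 h" "C0 k" "continuous_on {0..1} w" "a \<ge> 1" "b \<ge> 1"
  shows "Ib w (\<lambda>a b. c * h a b + d * k a b) a b = c * Ib w h a b + d * Ib w k a b"
  using Ib_add[OF C0_mult[OF C0_const assms(1)] C0_mult[OF C0_const assms(2)] assms(3-5), of c d]
  by (simp add: Ib_mult)

lemma C0_lin: "C0 h \<Longrightarrow> C0 k \<Longrightarrow> C0 (\<lambda>a b. c * h a b + d * k a b)"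
  by (rule C0_add; rule C0_mult; (rule C0_const)?)

text \<open>Averages (\<open>avg\<close>) over unit intervals in \<open>a\<close>, in \<open>b\<close> or in both, and the deviations
  (\<open>rem\<close>) from them.  By partial summation each of them satisfies a recursion that raises the exponents.\<close>

definition ssum_avg :: "complex \<times> complex \<times> complex \<Rightarrow> real \<Rightarrow> real \<Rightarrow> complex" where
  "ssum_avg s = Sa (ssum s)"

definition ssum_rem :: "complex \<times> complex \<times> complex \<Rightarrow> real \<Rightarrow> real \<Rightarrow> complex" where
  "ssum_rem s = (\<lambda>a b. ssum s a b - ssum_avg s a b)"

definition dsum_avg :: "complex \<times> complex \<times> complex \<Rightarrow> real \<Rightarrow> real \<Rightarrow> complex" where
  "dsum_avg s = Sa (dsum s)"

definition dsum_avg2 :: "complex \<times> complex \<times> complex \<Rightarrow> real \<Rightarrow> real \<Rightarrow> complex" where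
  "dsum_avg2 s = Sb (dsum_avg s)"

definition dsum_rem :: "complex \<times> complex \<times> complex \<Rightarrow> real \<Rightarrow> real \<Rightarrow> complex" where
  "dsum_rem s = (\<lambda>a b. dsum s a b - Sb (dsum s) a b)"

definition dsum_avg_rem :: "complex \<times> complex \<times> complex \<Rightarrow> real \<Rightarrow> real \<Rightarrow> complex" where
  "dsum_avg_rem s = (\<lambda>a b. dsum_avg s a b - dsum_avg2 s a b)"

definition dsum_rem2 :: "complex \<times> complex \<times> complex \<Rightarrow> real \<Rightarrow> real \<Rightarrow> complex" where
  "dsum_rem2 s = (\<lambda>a b. dsum_rem s a b - dsum_avg_rem s a b)"

lemma C0_ssum: "s \<in> ssum_region \<Longrightarrow> C0 (ssum s)"
  using nice_C0[OF nice_ssum] .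

lemma C0_dsum: "s \<in> tornheim_region \<Longrightarrow> C0 (dsum s)"
  using nice_C0[OF nice_dsum] .

lemma C0_ssum_avg: "s \<in> ssum_region \<Longrightarrow> C0 (ssum_avg s)"
  unfolding ssum_avg_def by (intro C0_Ia C0_ssum cont_wt)

lemma C0_ssum_rem: "s \<in> ssum_region \<Longrightarrow> C0 (ssum_rem s)"
  unfolding ssum_rem_def by (rule C0_diff[OF C0_ssum C0_ssum_avg])

lemma C0_dsum_avg: "s \<in> tornheim_region \<Longrightarrow> C0 (dsum_avg s)"
  unfolding dsum_avg_def by (intro C0_Ia C0_dsum cont_wt)

lemma C0_dsum_avg2: "s \<in> tornheim_region \<Longrightarrow> C0 (dsum_avg2 s)"
  unfolding dsum_avg2_def by (intro C0_Ib C0_dsum_avg cont_wt)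

lemma C0_dsum_rem: "s \<in> tornheim_region \<Longrightarrow> C0 (dsum_rem s)"
  unfolding dsum_rem_def by (intro C0_diff C0_Ib C0_dsum cont_wt)

lemma C0_dsum_avg_rem: "s \<in> tornheim_region \<Longrightarrow> C0 (dsum_avg_rem s)"
  unfolding dsum_avg_rem_def by (rule C0_diff[OF C0_dsum_avg C0_dsum_avg2])

lemma C0_dsum_rem2: "s \<in> tornheim_region \<Longrightarrow> C0 (dsum_rem2 s)"
  unfolding dsum_rem2_def by (rule C0_diff[OF C0_dsum_rem C0_dsum_avg_rem])

text \<open>The average of minus the derivative is a unit difference, and the series telescopes to
  its first term.\<close>

lemma ssum_Sa:
  assumes "s \<in> ssum_region" "a \<ge> 1" "b \<ge> 1"
  shows "Sa (ssum_slope s) a b = of_real a powr (- fst s) * of_real (a + b) powr (- snd (snd s))"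
  using ssum_relations(1)[OF assms, of 1] ssum_step[OF assms] by (simp add: Ia_def one_wt_def)

lemma ssum_Ja:
  assumes "s \<in> ssum_region" "a \<ge> 1" "b \<ge> 1"
  shows "Ja (ssum_slope s) a b = ssum_rem s a b"
  using ssum_relations(2)[OF assms, of 1] by (simp add: Ia_def one_wt_def tri_wt_def ssum_rem_def ssum_avg_def)

text \<open>The slope at s - e1 has an explicit average. Its mixed term is removed by
  \<open>ssum_split\<close>, which leaves the average at \<open>s\<close> with the factor s1 + s3 -
  1, the source of all poles of the single series, and one average at a raised third
  exponent.\<close>

lemma ssum_avg_rec:
  assumes s: "Re (fst s + snd (snd s)) > 2" and ab: "a \<ge> 1" "b \<ge> 1"
  shows "(fst s + snd (snd s) - 1) * ssum_avg s a b =
    of_real a powr (1 - fst s) * of_real (a + b) powr (- snd (snd s)) + snd (snd s) * of_real b * ssum_avg (s + e3) a b"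
proof -
  define s' where "s' = s + (-1, 0, 0)"
  have reg: "s' \<in> ssum_region" "s \<in> ssum_region" "s + e3 \<in> ssum_region"
    using s by (auto simp: s'_def ssum_region_def)
  have s': "s' + e1 = s" "s' + e3 = s + (-1, 0, 1)" "fst s' = fst s - 1" "snd (snd s') = snd (snd s)"
    by (cases s; simp add: s'_def)+
  have C: "C0 (\<lambda>a b. of_real b * ssum (s + e3) a b)"
    using C0_mult[OF nice_C0[OF nice_b[of UNIV]] C0_ssum[OF reg(3)], of undefined] by simp
  have "Sa (ssum_slope s') a b = Sa (\<lambda>a b. (fst s + snd (snd s) - 1) * ssum s a b + (- snd (snd s)) * (of_real b * ssum (s + e3) a b)) a b"
    by (rule Ia_cong[OF _ ab]) (simp add: ssum_slope_def s' ssum_split[OF reg(2)] algebra_simps)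
  also have "\<dots> = (fst s + snd (snd s) - 1) * ssum_avg s a b + (- snd (snd s)) * (of_real b * ssum_avg (s + e3) a b)"
    by (simp only: ssum_avg_def Ia_lin[OF C0_ssum[OF reg(2)] C cont_wt(1) ab] Ia_mult)
  finally show ?thesis
    using ssum_Sa[OF reg(1) ab] by (simp add: s' algebra_simps)
qed

text \<open>\<open>Ja\<close> of the slope is the remainder, and the average of the slope is
  explicit. Splitting the slope into average and deviation leaves remainders at raised exponents
  without any division, which is why the remainder continues to an entire function.\<close>

lemma ssum_rem_rec:
  assumes s: "s \<in> ssum_region" and ab: "a \<ge> 1" "b \<ge> 1"
  shows "ssum_rem s a b = Ja (\<lambda>a b. of_real a powr (- fst s) * of_real (a + b) powr (- snd (snd s))) a b +
    Ja (\<lambda>a b. fst s * ssum_rem (s + e1) a b + snd (snd s) * ssum_rem (s + e3) a b) a b"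
proof -
  have reg: "s + e1 \<in> ssum_region" "s + e3 \<in> ssum_region" using ssum_region_step[OF s] by auto
  have "ssum_rem s a b = Ja (ssum_slope s) a b" using ssum_Ja[OF s ab] by simp
  also have "\<dots> = Ja (\<lambda>a b. of_real a powr (- fst s) * of_real (a + b) powr (- snd (snd s)) +
      (fst s * ssum_rem (s + e1) a b + snd (snd s) * ssum_rem (s + e3) a b)) a b"
  proof (rule Ia_cong[OF _ ab])
    fix a b :: real assume ab: "a \<ge> 1" "b \<ge> 1"
    have "fst s * ssum_avg (s + e1) a b + snd (snd s) * ssum_avg (s + e3) a b = Sa (ssum_slope s) a b"
      unfolding ssum_slope_def[abs_def] ssum_avg_def by (rule Ia_lin[symmetric]) (intro C0_ssum reg cont_wt ab)+
    then show "ssum_slope s a b = of_real a powr (- fst s) * of_real (a + b) powr (- snd (snd s)) +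
        (fst s * ssum_rem (s + e1) a b + snd (snd s) * ssum_rem (s + e3) a b)"
      using ssum_Sa[OF s ab] by (simp add: ssum_slope_def ssum_rem_def algebra_simps)
  qed
  also have "\<dots> = Ja (\<lambda>a b. of_real a powr (- fst s) * of_real (a + b) powr (- snd (snd s))) a b +
      Ja (\<lambda>a b. fst s * ssum_rem (s + e1) a b + snd (snd s) * ssum_rem (s + e3) a b) a b"
    by (rule Ia_add) (intro C0_mult C0_powr C0_lin C0_ssum_rem reg cont_wt ab)+
  finally show ?thesis .
qed

lemma swap3_simps: "fst (swap3 s) = fst (snd s)" "fst (snd (swap3 s)) = fst s" "snd (snd (swap3 s)) = snd (snd s)"
    "swap3 (swap3 s) = s" "swap3 (s + t) = swap3 s + swap3 t"
  by (cases s; cases t; simp)+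

lemma tornheim_region_swap: "swap3 s \<in> tornheim_region \<longleftrightarrow> s \<in> tornheim_region"
  by (cases s) (auto simp: tornheim_region_def add.commute add.left_commute)

lemma tornheim_region_ssum: "s \<in> tornheim_region \<Longrightarrow> s \<in> ssum_region \<and> swap3 s \<in> ssum_region"
  by (cases s) (auto simp: tornheim_region_def ssum_region_def)

lemma ssum_cong_fst: "fst s = fst s' \<Longrightarrow> snd (snd s) = snd (snd s') \<Longrightarrow> ssum s = ssum s'"
  by (simp add: ssum_def[abs_def] ssum_term_def)

lemma dsum_avg_swap: "Sb (dsum s) a b = dsum_avg (swap3 s) b a"
  unfolding dsum_avg_def Ib_eq_Ia dsum_swap[of s, symmetric] ..

lemma dsum_avg2_eq: "s \<in> tornheim_region \<Longrightarrow> a \<ge> 1 \<Longrightarrow> b \<ge> 1 \<Longrightarrow> dsum_avg2 s a b = Sa (Sb (dsum s)) a b"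
  unfolding dsum_avg2_def dsum_avg_def by (rule Ia_Ib[symmetric]) (auto intro: C0_dsum)

lemma dsum_avg2_swap:
  assumes "s \<in> tornheim_region" "a \<ge> 1" "b \<ge> 1"
  shows "dsum_avg2 (swap3 s) b a = dsum_avg2 s a b"
proof -
  have "dsum_avg2 s a b = Sa (Sb (dsum s)) a b" by (rule dsum_avg2_eq[OF assms])
  also have "\<dots> = Sa (\<lambda>a b. dsum_avg (swap3 s) b a) a b" by (simp only: dsum_avg_swap[abs_def])
  also have "\<dots> = dsum_avg2 (swap3 s) b a" by (simp add: dsum_avg2_def Ib_eq_Ia)
  finally show ?thesis ..
qed

lemma dsum_rem2_swap:
  assumes "s \<in> tornheim_region" "a \<ge> 1" "b \<ge> 1"
  shows "dsum_rem2 (swap3 s) b a = dsum_rem2 s a b"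
  using dsum_avg2_swap[OF assms] by (simp add: dsum_rem2_def dsum_rem_def dsum_avg_rem_def dsum_avg_swap swap3_simps dsum_swap)

lemma dsum_Sa:
  assumes "s \<in> tornheim_region" "a \<ge> 1" "b \<ge> 1"
  shows "Sa (dsum_slope s) a b = of_real a powr (- fst s) * ssum (swap3 s) b a"
  using dsum_relations(1)[OF assms] dsum_step[OF assms] by simp

text \<open>Minus the derivative in \<open>b\<close>. The statements about it follow from those in
  \<open>a\<close> by exchanging the variables.\<close>

definition dsum_slope_b :: "complex \<times> complex \<times> complex \<Rightarrow> real \<Rightarrow> real \<Rightarrow> complex" where
  "dsum_slope_b s a b = fst (snd s) * dsum (s + e2) a b + snd (snd s) * dsum (s + e3) a b"

lemma dsum_slope_swap: "dsum_slope (swap3 s) b a = dsum_slope_b s a b"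
  using dsum_swap[of "s + e2" b a] dsum_swap[of "s + e3" b a]
  by (simp add: dsum_slope_def dsum_slope_b_def swap3_simps)

lemma dsum_Sb:
  assumes "s \<in> tornheim_region" "a \<ge> 1" "b \<ge> 1"
  shows "Sb (dsum_slope_b s) a b = of_real b powr (- fst (snd s)) * ssum s a b"
  using dsum_Sa[of "swap3 s" b a] assms
  by (simp add: Ib_eq_Ia dsum_slope_swap[symmetric] tornheim_region_swap swap3_simps)

lemma dsum_Jb:
  assumes "s \<in> tornheim_region" "a \<ge> 1" "b \<ge> 1"
  shows "Jb (dsum_slope_b s) a b = dsum_rem s a b"
  using dsum_relations(2)[of "swap3 s" b a] assms
  by (simp add: Ib_eq_Ia[of tri_wt] dsum_slope_swap[symmetric] tornheim_region_swap dsum_rem_def dsum_swap dsum_avg_swap dsum_avg_def)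

text \<open>Derived from the slope at s - e1 like the recursion for the single series, with
  \<open>dsum_split\<close> for the mixed term. The new term moves one unit from the second exponent
  to the third: it gains one in s1 + s3 but nothing in s2 + s3 or in the total.\<close>

lemma dsum_avg_rec:
  assumes s: "Re (fst s + snd (snd s)) > 2" "s \<in> tornheim_region" "Re (fst s + fst (snd s) + snd (snd s)) > 3"
    and ab: "a \<ge> 1" "b \<ge> 1"
  shows "(fst s + snd (snd s) - 1) * dsum_avg s a b + (- snd (snd s)) * dsum_avg (s + (0, -1, 1)) a b =
    of_real a powr (1 - fst s) * ssum (swap3 s) b a"
proof -
  define s' where "s' = s + (-1, 0, 0)"
  have reg: "s' \<in> tornheim_region" "s + (-1, 0, 1) \<in> tornheim_region" "s + (0, -1, 1) \<in> tornheim_region"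
    using s by (cases s; auto simp: s'_def tornheim_region_def)+
  have s': "s' + e1 = s" "s' + e3 = s + (-1, 0, 1)" "fst s' = fst s - 1" "snd (snd s') = snd (snd s)"
    by (cases s; simp add: s'_def)+
  have "Sa (dsum_slope s') a b = Sa (\<lambda>a b. (fst s + snd (snd s) - 1) * dsum s a b + (- snd (snd s)) * dsum (s + (0, -1, 1)) a b) a b"
  proof (rule Ia_cong[OF _ ab])
    fix a b :: real assume "a \<ge> 1" "b \<ge> 1"
    note eq = dsum_split[OF reg(2,3) this]
    have "snd (snd s) * dsum (s + (-1, 0, 1)) a b = snd (snd s) * dsum s a b - snd (snd s) * dsum (s + (0, -1, 1)) a b"
      unfolding eq[symmetric] by (simp add: distrib_left)
    then show "dsum_slope s' a b = (fst s + snd (snd s) - 1) * dsum s a b + (- snd (snd s)) * dsum (s + (0, -1, 1)) a b"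
      by (simp add: dsum_slope_def s' algebra_simps)
  qed
  also have "\<dots> = (fst s + snd (snd s) - 1) * dsum_avg s a b + (- snd (snd s)) * dsum_avg (s + (0, -1, 1)) a b"
    unfolding dsum_avg_def by (rule Ia_lin) (intro C0_dsum s reg cont_wt ab)+
  finally have "(fst s + snd (snd s) - 1) * dsum_avg s a b + (- snd (snd s)) * dsum_avg (s + (0, -1, 1)) a b =
      of_real a powr (- fst s') * ssum (swap3 s') b a"
    using dsum_Sa[OF reg(1) ab] by simp
  moreover have "ssum (swap3 s') = ssum (swap3 s)"
    by (rule ssum_cong_fst) (cases s; simp add: s'_def)+
  ultimately show ?thesis by (simp add: s')
qed

lemma Sb_ssum_swap: "Sb (\<lambda>a b. c a * ssum (swap3 s) b a) a b = c a * ssum_avg (swap3 s) b a"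
  by (simp add: Ib_mult ssum_avg_def Ib_eq_Ia)

lemma dsum_avg2_rec:
  assumes s: "Re (fst s + snd (snd s)) > 2" "s \<in> tornheim_region" "Re (fst s + fst (snd s) + snd (snd s)) > 3"
    and ab: "a \<ge> 1" "b \<ge> 1"
  shows "(fst s + snd (snd s) - 1) * dsum_avg2 s a b + (- snd (snd s)) * dsum_avg2 (s + (0, -1, 1)) a b =
    of_real a powr (1 - fst s) * ssum_avg (swap3 s) b a"
proof -
  have reg: "s + (0, -1, 1) \<in> tornheim_region"
    using s by (cases s) (auto simp: tornheim_region_def)
  have "(fst s + snd (snd s) - 1) * dsum_avg2 s a b + (- snd (snd s)) * dsum_avg2 (s + (0, -1, 1)) a b =
      Sb (\<lambda>a b. (fst s + snd (snd s) - 1) * dsum_avg s a b + (- snd (snd s)) * dsum_avg (s + (0, -1, 1)) a b) a b"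
    unfolding dsum_avg2_def by (rule Ib_lin[symmetric]) (intro C0_dsum_avg s reg cont_wt ab)+
  also have "\<dots> = Sb (\<lambda>a b. of_real a powr (1 - fst s) * ssum (swap3 s) b a) a b"
    by (rule Ib_cong[OF _ ab]) (rule dsum_avg_rec[OF s])
  also have "\<dots> = of_real a powr (1 - fst s) * ssum_avg (swap3 s) b a"
    by (rule Sb_ssum_swap)
  finally show ?thesis .
qed

text \<open>Subtracting the recursion averaged over \<open>b\<close> replaces the single series by
  its remainder, whose continuation is entire.\<close>

lemma dsum_avg_rem_rec_a:
  assumes s: "Re (fst s + snd (snd s)) > 2" "s \<in> tornheim_region" "Re (fst s + fst (snd s) + snd (snd s)) > 3"
    and ab: "a \<ge> 1" "b \<ge> 1"
  shows "(fst s + snd (snd s) - 1) * dsum_avg_rem s a b =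
    of_real a powr (1 - fst s) * ssum_rem (swap3 s) b a + snd (snd s) * dsum_avg_rem (s + (0, -1, 1)) a b"
  using dsum_avg_rec[OF assms] dsum_avg2_rec[OF assms] by (simp add: dsum_avg_rem_def ssum_rem_def algebra_simps)

text \<open>The recursions in the two variables are added. By \<open>dsum_split\<close> their mixed
  terms add up to the double average itself, so no recursion remains and the factor is (s1 + s3 - 1)
  + (s2 + s3 - 1) - s3. This is where the pole at s1 + s2 + s3 = 2 comes from.\<close>

lemma dsum_avg2_formula:
  assumes s: "Re (fst s + snd (snd s)) > 2" "Re (fst (snd s) + snd (snd s)) > 2"
      "Re (fst s + fst (snd s) + snd (snd s)) > 3"
    and ab: "a \<ge> 1" "b \<ge> 1"
  shows "(fst s + fst (snd s) + snd (snd s) - 2) * dsum_avg2 s a b =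
    of_real a powr (1 - fst s) * ssum_avg (swap3 s) b a + of_real b powr (1 - fst (snd s)) * ssum_avg s a b"
proof -
  have reg: "s \<in> tornheim_region" "swap3 s \<in> tornheim_region"
     "s + (-1, 0, 1) \<in> tornheim_region" "s + (0, -1, 1) \<in> tornheim_region"
    using s by (cases s; auto simp: tornheim_region_def)+
  have 1: "(fst s + snd (snd s) - 1) * dsum_avg2 s a b + (- snd (snd s)) * dsum_avg2 (s + (0, -1, 1)) a b =
    of_real a powr (1 - fst s) * ssum_avg (swap3 s) b a"
    by (rule dsum_avg2_rec) (use s reg ab in auto)
  have "(fst (swap3 s) + snd (snd (swap3 s)) - 1) * dsum_avg2 (swap3 s) b a + (- snd (snd (swap3 s))) * dsum_avg2 (swap3 s + (0, -1, 1)) b a =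
    of_real b powr (1 - fst (swap3 s)) * ssum_avg (swap3 (swap3 s)) a b"
    by (rule dsum_avg2_rec) (use s reg ab in \<open>auto simp: swap3_simps add.commute add.left_commute\<close>)
  moreover have "swap3 s + (0, -1, 1) = swap3 (s + (-1, 0, 1))" by (cases s) simp
  ultimately have 2: "(fst (snd s) + snd (snd s) - 1) * dsum_avg2 s a b + (- snd (snd s)) * dsum_avg2 (s + (-1, 0, 1)) a b =
    of_real b powr (1 - fst (snd s)) * ssum_avg s a b"
    using dsum_avg2_swap[OF reg(1) ab] dsum_avg2_swap[OF reg(3) ab] by (simp only: swap3_simps(1-4))
  have "dsum_avg2 s a b = Sa (Sb (\<lambda>a b. 1 * dsum (s + (-1, 0, 1)) a b + 1 * dsum (s + (0, -1, 1)) a b)) a b"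
    unfolding dsum_avg2_eq[OF reg(1) ab]
    by (intro Ia_cong[OF _ ab] Ib_cong) (use dsum_split[OF reg(3,4)] in auto)
  also have "\<dots> = Sa (\<lambda>a b. 1 * Sb (dsum (s + (-1, 0, 1))) a b + 1 * Sb (dsum (s + (0, -1, 1))) a b) a b"
    by (intro Ia_cong[OF _ ab] Ib_lin C0_dsum reg cont_wt)
  also have "\<dots> = 1 * dsum_avg2 (s + (-1, 0, 1)) a b + 1 * dsum_avg2 (s + (0, -1, 1)) a b"
    unfolding dsum_avg2_eq[OF reg(3) ab] dsum_avg2_eq[OF reg(4) ab] by (rule Ia_lin) (intro C0_Ib C0_dsum reg cont_wt ab)+
  finally have 3: "dsum_avg2 s a b = dsum_avg2 (s + (-1, 0, 1)) a b + dsum_avg2 (s + (0, -1, 1)) a b" by simp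
  have "(fst s + fst (snd s) + snd (snd s) - 2) * dsum_avg2 s a b =
      ((fst s + snd (snd s) - 1) * dsum_avg2 s a b + (- snd (snd s)) * dsum_avg2 (s + (0, -1, 1)) a b) +
      ((fst (snd s) + snd (snd s) - 1) * dsum_avg2 s a b + (- snd (snd s)) * dsum_avg2 (s + (-1, 0, 1)) a b)"
    using arg_cong[OF 3, of "\<lambda>z. snd (snd s) * z"] by (simp add: algebra_simps)
  then show ?thesis unfolding 1 2 .
qed

text \<open>Averaging over \<open>a\<close> commutes with the operators in \<open>b\<close>, and the
  slope in \<open>b\<close> has an explicit average. Both new terms gain one in s2 + s3 and in the
  total, which \<open>dsum_avg_rem_rec_a\<close> does not provide, and nothing has to be divided
  by.\<close>

lemma dsum_avg_rem_rec_b: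
  assumes s: "s \<in> tornheim_region" and ab: "a \<ge> 1" "b \<ge> 1"
  shows "dsum_avg_rem s a b = Jb (\<lambda>a b. of_real b powr (- fst (snd s)) * ssum_avg s a b) a b +
    Jb (\<lambda>a b. fst (snd s) * dsum_avg_rem (s + e2) a b + snd (snd s) * dsum_avg_rem (s + e3) a b) a b"
proof -
  have reg: "s + e2 \<in> tornheim_region" "s + e3 \<in> tornheim_region" using tornheim_region_step[OF s] by auto
  have regG: "s \<in> ssum_region" using tornheim_region_ssum[OF s] by simp
  have Cd: "C0 (dsum_slope_b s)" unfolding dsum_slope_b_def[abs_def] by (intro C0_lin C0_dsum reg)
  have "dsum_avg_rem s a b = Sa (dsum_rem s) a b"
    unfolding dsum_avg_rem_def dsum_avg_def dsum_avg2_eq[OF s ab] dsum_rem_def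
    by (rule Ia_diff[symmetric]) (intro C0_Ib C0_dsum s cont_wt ab)+
  also have "\<dots> = Sa (Jb (dsum_slope_b s)) a b"
    by (rule Ia_cong[OF _ ab]) (rule dsum_Jb[OF s, symmetric])
  also have "\<dots> = Jb (Sa (dsum_slope_b s)) a b"
    by (rule Ia_Ib[OF Cd cont_wt(1) cont_wt(2) ab])
  also have "\<dots> = Jb (\<lambda>a b. of_real b powr (- fst (snd s)) * ssum_avg s a b +
      (fst (snd s) * dsum_avg_rem (s + e2) a b + snd (snd s) * dsum_avg_rem (s + e3) a b)) a b"
  proof (rule Ib_cong[OF _ ab])
    fix a b :: real assume ab: "a \<ge> 1" "b \<ge> 1"
    have "Sa (dsum_slope_b s) a b = fst (snd s) * dsum_avg (s + e2) a b + snd (snd s) * dsum_avg (s + e3) a b"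
      unfolding dsum_slope_b_def[abs_def] dsum_avg_def by (rule Ia_lin) (intro C0_dsum reg cont_wt ab)+
    moreover have "fst (snd s) * dsum_avg2 (s + e2) a b + snd (snd s) * dsum_avg2 (s + e3) a b = of_real b powr (- fst (snd s)) * ssum_avg s a b"
    proof -
      have "fst (snd s) * dsum_avg2 (s + e2) a b + snd (snd s) * dsum_avg2 (s + e3) a b =
          Sa (\<lambda>a b. fst (snd s) * Sb (dsum (s + e2)) a b + snd (snd s) * Sb (dsum (s + e3)) a b) a b"
        unfolding dsum_avg2_eq[OF reg(1) ab] dsum_avg2_eq[OF reg(2) ab]
        by (rule Ia_lin[symmetric]) (intro C0_Ib C0_dsum reg cont_wt ab)+
      also have "\<dots> = Sa (\<lambda>a b. of_real b powr (- fst (snd s)) * ssum s a b) a b"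
      proof (rule Ia_cong[OF _ ab])
        fix a b :: real assume ab: "a \<ge> 1" "b \<ge> 1"
        have "fst (snd s) * Sb (dsum (s + e2)) a b + snd (snd s) * Sb (dsum (s + e3)) a b = Sb (dsum_slope_b s) a b"
          unfolding dsum_slope_b_def[abs_def] by (rule Ib_lin[symmetric]) (intro C0_dsum reg cont_wt ab)+
        then show "fst (snd s) * Sb (dsum (s + e2)) a b + snd (snd s) * Sb (dsum (s + e3)) a b =
            of_real b powr (- fst (snd s)) * ssum s a b"
          using dsum_Sb[OF s ab] by simp
      qed
      also have "\<dots> = of_real b powr (- fst (snd s)) * ssum_avg s a b"
        unfolding ssum_avg_def by (rule Ia_mult)
      finally show ?thesis .
    qed
    ultimately show "Sa (dsum_slope_b s) a b = of_real b powr (- fst (snd s)) * ssum_avg s a b +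
        (fst (snd s) * dsum_avg_rem (s + e2) a b + snd (snd s) * dsum_avg_rem (s + e3) a b)"
      by (simp add: dsum_avg_rem_def algebra_simps)
  qed
  also have "\<dots> = Jb (\<lambda>a b. of_real b powr (- fst (snd s)) * ssum_avg s a b) a b +
    Jb (\<lambda>a b. fst (snd s) * dsum_avg_rem (s + e2) a b + snd (snd s) * dsum_avg_rem (s + e3) a b) a b"
    by (rule Ib_add) (intro C0_mult C0_powr C0_lin C0_dsum_avg_rem C0_ssum_avg reg regG cont_wt ab)+
  finally show ?thesis .
qed

text \<open>Deviations in both variables are needed for a recursion in which neither a division nor
  an average of the double series occurs.\<close>

lemma dsum_rem2_rec:
  assumes s: "s \<in> tornheim_region" and ab: "a \<ge> 1" "b \<ge> 1"
  shows "dsum_rem2 s a b = Ja (\<lambda>a b. of_real a powr (- fst s) * ssum_rem (swap3 s) b a) a b +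
    Ja (\<lambda>a b. fst s * dsum_rem2 (s + e1) a b + snd (snd s) * dsum_rem2 (s + e3) a b) a b"
proof -
  have reg: "s + e1 \<in> tornheim_region" "s + e3 \<in> tornheim_region" using tornheim_region_step[OF s] by auto
  have regG: "swap3 s \<in> ssum_region" using tornheim_region_ssum[OF s] by simp
  have Cd: "C0 (dsum_slope s)" unfolding dsum_slope_def[abs_def] by (intro C0_lin C0_dsum reg)
  \<comment> \<open>\<open>Q\<close> is the slope in \<open>a\<close> minus its average over
    \<open>b\<close>. \<open>Ja\<close> recovers \<open>dsum_rem2\<close> from it, and
    \<open>Sa\<close> yields the explicit boundary term.\<close>
  define Q where "Q a b = fst s * dsum_rem (s + e1) a b + snd (snd s) * dsum_rem (s + e3) a b" for a b
  have Q: "Q a b = dsum_slope s a b - Sb (dsum_slope s) a b" if ab: "a \<ge> 1" "b \<ge> 1" for a b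
  proof -
    have "Sb (dsum_slope s) a b = fst s * Sb (dsum (s + e1)) a b + snd (snd s) * Sb (dsum (s + e3)) a b"
      unfolding dsum_slope_def[abs_def] by (rule Ib_lin) (intro C0_dsum reg cont_wt ab)+
    then show ?thesis by (simp add: Q_def dsum_rem_def dsum_slope_def algebra_simps)
  qed
  have JQ: "Ja Q a b = dsum_rem2 s a b"
  proof -
    have "Ja Q a b = Ja (\<lambda>a b. dsum_slope s a b - Sb (dsum_slope s) a b) a b"
      by (rule Ia_cong[OF Q ab])
    also have "\<dots> = Ja (dsum_slope s) a b - Ja (Sb (dsum_slope s)) a b"
      by (rule Ia_diff) (intro C0_Ib Cd cont_wt ab)+
    also have "Ja (Sb (dsum_slope s)) a b = Sb (Ja (dsum_slope s)) a b"
      by (rule Ia_Ib[OF Cd cont_wt(2) cont_wt(1) ab])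
    also have "\<dots> = Sb (\<lambda>a b. dsum s a b - dsum_avg s a b) a b"
      unfolding dsum_avg_def by (rule Ib_cong[OF _ ab]) (rule dsum_relations(2)[OF s])
    also have "\<dots> = Sb (dsum s) a b - dsum_avg2 s a b"
      unfolding dsum_avg2_def by (rule Ib_diff) (intro C0_dsum C0_dsum_avg s cont_wt ab)+
    finally show ?thesis
      using dsum_relations(2)[OF s ab] by (simp add: dsum_rem2_def dsum_rem_def dsum_avg_rem_def dsum_avg_def)
  qed
  have SQ: "Sa Q a b = of_real a powr (- fst s) * ssum_rem (swap3 s) b a" if ab: "a \<ge> 1" "b \<ge> 1" for a b
  proof -
    have "Sa Q a b = Sa (\<lambda>a b. dsum_slope s a b - Sb (dsum_slope s) a b) a b"
      by (rule Ia_cong[OF Q ab])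
    also have "\<dots> = Sa (dsum_slope s) a b - Sa (Sb (dsum_slope s)) a b"
      by (rule Ia_diff) (intro C0_Ib Cd cont_wt ab)+
    also have "Sa (Sb (dsum_slope s)) a b = Sb (Sa (dsum_slope s)) a b"
      by (rule Ia_Ib[OF Cd cont_wt(1) cont_wt(1) ab])
    also have "\<dots> = Sb (\<lambda>a b. of_real a powr (- fst s) * ssum (swap3 s) b a) a b"
      by (rule Ib_cong[OF _ ab]) (rule dsum_Sa[OF s])
    also have "\<dots> = of_real a powr (- fst s) * ssum_avg (swap3 s) b a" by (rule Sb_ssum_swap)
    finally show ?thesis using dsum_Sa[OF s ab] by (simp add: ssum_rem_def algebra_simps)
  qed
  have dsum_avg_rem_Sa: "dsum_avg_rem s a b = Sa (dsum_rem s) a b" if s: "s \<in> tornheim_region" and ab: "a \<ge> 1" "b \<ge> 1" for s a b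
    unfolding dsum_avg_rem_def dsum_avg_def dsum_avg2_eq[OF s ab] dsum_rem_def
    by (rule Ia_diff[symmetric]) (intro C0_Ib C0_dsum s cont_wt ab)+
  have "dsum_rem2 s a b = Ja Q a b" using JQ by simp
  also have "\<dots> = Ja (\<lambda>a b. of_real a powr (- fst s) * ssum_rem (swap3 s) b a +
      (fst s * dsum_rem2 (s + e1) a b + snd (snd s) * dsum_rem2 (s + e3) a b)) a b"
  proof (rule Ia_cong[OF _ ab])
    fix a b :: real assume ab: "a \<ge> 1" "b \<ge> 1"
    have "fst s * dsum_avg_rem (s + e1) a b + snd (snd s) * dsum_avg_rem (s + e3) a b = Sa Q a b"
      unfolding dsum_avg_rem_Sa[OF reg(1) ab] dsum_avg_rem_Sa[OF reg(2) ab] Q_def[abs_def]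
      by (rule Ia_lin[symmetric]) (intro C0_dsum_rem reg cont_wt ab)+
    then show "Q a b = of_real a powr (- fst s) * ssum_rem (swap3 s) b a +
        (fst s * dsum_rem2 (s + e1) a b + snd (snd s) * dsum_rem2 (s + e3) a b)"
      using SQ[OF ab] by (simp add: Q_def dsum_rem2_def algebra_simps)
  qed
  also have "\<dots> = Ja (\<lambda>a b. of_real a powr (- fst s) * ssum_rem (swap3 s) b a) a b +
    Ja (\<lambda>a b. fst s * dsum_rem2 (s + e1) a b + snd (snd s) * dsum_rem2 (s + e3) a b) a b"
    by (rule Ia_add) (intro C0_mult C0_powr C0_lin C0_dsum_rem2 C0_swap[OF C0_ssum_rem] reg regG cont_wt ab)+
  finally show ?thesis .
qed

section \<open>Continuation of the double series\<close>

lemma nice_powr_a: "nice f U \<Longrightarrow> nice (\<lambda>s a b. of_real a powr f s a b) U"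
  and nice_powr_b: "nice f U \<Longrightarrow> nice (\<lambda>s a b. of_real b powr f s a b) U"
  and nice_powr_ab: "nice f U \<Longrightarrow> nice (\<lambda>s a b. of_real (a + b) powr f s a b) U"
proof -
  have *: "continuous_on ({1..} \<times> {1..}) (\<lambda>(a::real, b::real). a)"
    "continuous_on ({1..} \<times> {1..}) (\<lambda>(a::real, b::real). b)"
    "continuous_on ({1..} \<times> {1..}) (\<lambda>(a::real, b::real). a + b)"
    unfolding case_prod_beta by (intro continuous_intros)+
  assume f: "nice f U"
  show "nice (\<lambda>s a b. of_real a powr f s a b) U" by (rule nice_powr[OF f *(1)]) auto
  show "nice (\<lambda>s a b. of_real b powr f s a b) U" by (rule nice_powr[OF f *(2)]) auto
  show "nice (\<lambda>s a b. of_real (a + b) powr f s a b) U" by (rule nice_powr[OF f *(3)]) auto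
qed

lemmas nice_intros = nice_add nice_diff nice_mult nice_uminus nice_const nice_s1 nice_s2 nice_s3
  nice_a nice_b nice_rGamma nice_powr_a nice_powr_b nice_powr_ab

text \<open>The index counts applications of the recursions. The bounds 2, 2 and 3 for K = 0 lie one
  above those of convergence, because the recursions for averages start from a lowered exponent.
  Convexity serves \<open>nice_identity\<close>.\<close>

definition UA :: "nat \<Rightarrow> (complex \<times> complex \<times> complex) set" where
  "UA K = {s. Re (fst s + snd (snd s)) > 2 - real K}"

definition UR :: "nat \<Rightarrow> (complex \<times> complex \<times> complex) set" where
  "UR K = {s. Re (fst s + snd (snd s)) > 2 - real K \<and> Re (fst (snd s) + snd (snd s)) > 2 - real K \<and>
     Re (fst s + fst (snd s) + snd (snd s)) > 3 - real K}"

lemma open_UA: "open (UA K)" and open_UR: "open (UR K)"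
  unfolding UA_def UR_def by (intro open_Collect_conj open_Collect_less continuous_intros)+

lemma convex_halfspace_linear:
  fixes l :: "'a::real_vector \<Rightarrow> real"
  assumes "linear l"
  shows "convex {s. l s > c}"
proof -
  have "convex (l -` {c<..})" by (rule convex_linear_vimage[OF assms]) simp
  then show ?thesis by (simp add: vimage_def greaterThan_def)
qed

lemma linear_exponents:
  "linear (\<lambda>s. Re (fst s + snd (snd s)))" "linear (\<lambda>s. Re (fst (snd s) + snd (snd s)))"
  "linear (\<lambda>s. Re (fst s + fst (snd s) + snd (snd s)))"
  by (auto intro!: linearI simp: algebra_simps)

lemma convex_UA: "convex (UA K)"
  unfolding UA_def by (intro convex_halfspace_linear linear_exponents)

lemma convex_UR: "convex (UR K)"
  unfolding UR_def Collect_conj_eq by (intro convex_Int convex_halfspace_linear linear_exponents)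

lemma convex_tornheim_region: "convex tornheim_region"
proof -
  have "tornheim_region = {s. Re (fst s + snd (snd s)) > 1} \<inter> {s. Re (fst (snd s) + snd (snd s)) > 1} \<inter>
      {s. Re (fst s + fst (snd s) + snd (snd s)) > 2}"
    by (auto simp: tornheim_region_def)
  moreover have "convex \<dots>" by (intro convex_Int convex_halfspace_linear linear_exponents)
  ultimately show ?thesis by metis
qed

lemma UA_mono: "UA K \<subseteq> UA (Suc K)" and UR_mono: "UR K \<subseteq> UR (Suc K)"
  by (auto simp: UA_def UR_def)

lemma UA_0: "UA 0 \<noteq> {}" and UR_0: "UR 0 \<noteq> {}"
proof -
  have "(3, 3, 3) \<in> UA 0" "(3, 3, 3) \<in> UR 0" by (auto simp: UA_def UR_def)
  then show "UA 0 \<noteq> {}" "UR 0 \<noteq> {}" by blast+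
qed

lemma Union_UA: "(\<Union>K. UA K) = UNIV"
proof -
  have "\<exists>K. s \<in> UA K" for s
    using reals_Archimedean2[of "2 - Re (fst s + snd (snd s))"] by (auto simp: UA_def algebra_simps)
  then show ?thesis by blast
qed

lemma Union_UR: "(\<Union>K. UR K) = UNIV"
proof -
  have "\<exists>K. s \<in> UR K" for s
  proof -
    obtain K where "real K > max (max (2 - Re (fst s + snd (snd s))) (2 - Re (fst (snd s) + snd (snd s))))
        (3 - Re (fst s + fst (snd s) + snd (snd s)))"
      using reals_Archimedean2 by blast
    then show ?thesis by (auto simp: UR_def intro!: exI[of _ K])
  qed
  then show ?thesis by blast
qed

lemma UA_0_ssum: "s \<in> UA 0 \<Longrightarrow> s \<in> ssum_region" and UR_0_tornheim: "s \<in> UR 0 \<Longrightarrow> s \<in> tornheim_region"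
    and UR_0_UA: "s \<in> UR 0 \<Longrightarrow> s \<in> UA 0 \<and> swap3 s \<in> UA 0"
  by (cases s; auto simp: UA_def UR_def ssum_region_def tornheim_region_def)+

lemma UA_extend:
  assumes f: "nice f (UA 0)"
    and L: "\<And>K g. nice g (UA K) \<Longrightarrow> nice (L g) (UA (Suc K))"
    and fixpt: "\<And>g s a b. (\<And>s a b. s \<in> UA 0 \<Longrightarrow> a \<ge> 1 \<Longrightarrow> b \<ge> 1 \<Longrightarrow> g s a b = f s a b) \<Longrightarrow>
       s \<in> UA 0 \<Longrightarrow> a \<ge> 1 \<Longrightarrow> b \<ge> 1 \<Longrightarrow> L g s a b = f s a b"
  shows "\<exists>H. nice H UNIV \<and> (\<forall>s\<in>UA 0. \<forall>a\<ge>1. \<forall>b\<ge>1. H s a b = f s a b)"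
  using nice_extend[of UA f L, OF open_UA convex_UA UA_mono UA_0 assms] unfolding Union_UA by blast

lemma UR_extend:
  assumes f: "nice f (UR 0)"
    and L: "\<And>K g. nice g (UR K) \<Longrightarrow> nice (L g) (UR (Suc K))"
    and fixpt: "\<And>g s a b. (\<And>s a b. s \<in> UR 0 \<Longrightarrow> a \<ge> 1 \<Longrightarrow> b \<ge> 1 \<Longrightarrow> g s a b = f s a b) \<Longrightarrow>
       s \<in> UR 0 \<Longrightarrow> a \<ge> 1 \<Longrightarrow> b \<ge> 1 \<Longrightarrow> L g s a b = f s a b"
  shows "\<exists>H. nice H UNIV \<and> (\<forall>s\<in>UR 0. \<forall>a\<ge>1. \<forall>b\<ge>1. H s a b = f s a b)"
  using nice_extend[of UR f L, OF open_UR convex_UR UR_mono UR_0 assms] unfolding Union_UR by blast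

lemma nice_ssum_avg: "nice ssum_avg ssum_region"
  unfolding ssum_avg_def[abs_def] by (intro nice_Ia nice_ssum open_ssum_region cont_wt)

lemma nice_ssum_rem: "nice ssum_rem ssum_region"
  unfolding ssum_rem_def[abs_def] by (intro nice_diff nice_ssum nice_ssum_avg)

lemma nice_dsum_avg: "nice dsum_avg tornheim_region"
  unfolding dsum_avg_def[abs_def] by (intro nice_Ia nice_dsum open_tornheim_region cont_wt)

lemma nice_dsum_avg_rem: "nice dsum_avg_rem tornheim_region"
  unfolding dsum_avg_rem_def[abs_def] dsum_avg2_def[abs_def] by (intro nice_diff nice_dsum_avg nice_Ib open_tornheim_region cont_wt)

lemma nice_dsum_rem2: "nice dsum_rem2 tornheim_region"
  unfolding dsum_rem2_def[abs_def] dsum_rem_def[abs_def] by (intro nice_diff nice_dsum nice_dsum_avg_rem nice_Ib open_tornheim_region cont_wt)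

lemma rGamma_shift: "rGamma (z - 1) = (z - 1) * rGamma (z::complex)"
  using rGamma_plus1[of "z - 1"] by simp

text \<open>Multiplied by \<open>rGamma (fst s + snd (snd s))\<close>, the factor s1 + s3 - 1 on the
  left of \<open>ssum_avg_rec\<close> becomes \<open>rGamma\<close> at the argument lowered by one.
  The recursion for the normalised average thus has no denominator.\<close>

lemma ssum_avg_continuation:
  "\<exists>P. nice P UNIV \<and> (\<forall>s\<in>UA 0. \<forall>a\<ge>1. \<forall>b\<ge>1. P s a b = rGamma (fst s + snd (snd s) - 1) * ssum_avg s a b)"
proof (rule UA_extend[where L = "\<lambda>g s a b. rGamma (fst s + snd (snd s)) *
     (of_real a powr (1 - fst s) * of_real (a + b) powr (- snd (snd s))) + snd (snd s) * of_real b * g (s + e3) a b"])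
  show "nice (\<lambda>s a b. rGamma (fst s + snd (snd s) - 1) * ssum_avg s a b) (UA 0)"
    by (intro nice_intros nice_subset[OF nice_ssum_avg]) (auto dest: UA_0_ssum)
  fix K g assume g: "nice g (UA K)"
  show "nice (\<lambda>s a b. rGamma (fst s + snd (snd s)) *
     (of_real a powr (1 - fst s) * of_real (a + b) powr (- snd (snd s))) + snd (snd s) * of_real b * g (s + e3) a b) (UA (Suc K))"
    by (intro nice_intros nice_shift[OF g]) (auto simp: UA_def)
next
  fix g :: "complex \<times> complex \<times> complex \<Rightarrow> real \<Rightarrow> real \<Rightarrow> complex" and s and a b :: real
  assume g: "\<And>s a b. s \<in> UA 0 \<Longrightarrow> a \<ge> 1 \<Longrightarrow> b \<ge> 1 \<Longrightarrow> g s a b = rGamma (fst s + snd (snd s) - 1) * ssum_avg s a b"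
    and s: "s \<in> UA 0" and ab: "a \<ge> 1" "b \<ge> (1::real)"
  have "s + e3 \<in> UA 0" using s by (auto simp: UA_def)
  moreover have rec: "(fst s + snd (snd s) - 1) * ssum_avg s a b =
    of_real a powr (1 - fst s) * of_real (a + b) powr (- snd (snd s)) + snd (snd s) * of_real b * ssum_avg (s + e3) a b"
    by (rule ssum_avg_rec) (use s ab in \<open>auto simp: UA_def\<close>)
  moreover have "fst (s + e3) + snd (snd (s + e3)) - 1 = fst s + snd (snd s)" by (cases s) simp
  ultimately have ge: "g (s + e3) a b = rGamma (fst s + snd (snd s)) * ssum_avg (s + e3) a b"
    using g[of "s + e3" a b] ab by (simp only:)
  show "rGamma (fst s + snd (snd s)) *
     (of_real a powr (1 - fst s) * of_real (a + b) powr (- snd (snd s))) + snd (snd s) * of_real b * g (s + e3) a b =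
     rGamma (fst s + snd (snd s) - 1) * ssum_avg s a b"
    using arg_cong[OF rec, of "(*) (rGamma (fst s + snd (snd s)))"]
    unfolding ge rGamma_shift by (simp only: distrib_left mult_ac)
qed

lemma ssum_rem_continuation:
  "\<exists>W. nice W UNIV \<and> (\<forall>s\<in>UA 0. \<forall>a\<ge>1. \<forall>b\<ge>1. W s a b = ssum_rem s a b)"
proof (rule UA_extend[where L = "\<lambda>g s a b. Ja (\<lambda>a b. of_real a powr (- fst s) * of_real (a + b) powr (- snd (snd s))) a b +
    Ja (\<lambda>a b. fst s * g (s + e1) a b + snd (snd s) * g (s + e3) a b) a b"])
  show "nice ssum_rem (UA 0)"
    by (intro nice_subset[OF nice_ssum_rem]) (auto dest: UA_0_ssum)
  fix K g assume g: "nice g (UA K)"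
  show "nice (\<lambda>s a b. Ja (\<lambda>a b. of_real a powr (- fst s) * of_real (a + b) powr (- snd (snd s))) a b +
    Ja (\<lambda>a b. fst s * g (s + e1) a b + snd (snd s) * g (s + e3) a b) a b) (UA (Suc K))"
    by (intro nice_add nice_Ia cont_wt open_UA nice_intros nice_shift[OF g]) (auto simp: UA_def)
next
  fix g :: "complex \<times> complex \<times> complex \<Rightarrow> real \<Rightarrow> real \<Rightarrow> complex" and s and a b :: real
  assume g: "\<And>s a b. s \<in> UA 0 \<Longrightarrow> a \<ge> 1 \<Longrightarrow> b \<ge> 1 \<Longrightarrow> g s a b = ssum_rem s a b"
    and s: "s \<in> UA 0" and ab: "a \<ge> 1" "b \<ge> (1::real)"
  have *: "s + e1 \<in> UA 0" "s + e3 \<in> UA 0" using s by (auto simp: UA_def)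
  have "Ja (\<lambda>a b. fst s * g (s + e1) a b + snd (snd s) * g (s + e3) a b) a b =
      Ja (\<lambda>a b. fst s * ssum_rem (s + e1) a b + snd (snd s) * ssum_rem (s + e3) a b) a b"
    by (rule Ia_cong[OF _ ab]) (simp add: g *)
  then show "Ja (\<lambda>a b. of_real a powr (- fst s) * of_real (a + b) powr (- snd (snd s))) a b +
    Ja (\<lambda>a b. fst s * g (s + e1) a b + snd (snd s) * g (s + e3) a b) a b = ssum_rem s a b"
    using ssum_rem_rec[OF UA_0_ssum[OF s] ab] by simp
qed

definition ssum_avg_ext :: "complex \<times> complex \<times> complex \<Rightarrow> real \<Rightarrow> real \<Rightarrow> complex" where
  "ssum_avg_ext = (SOME P. nice P UNIV \<and> (\<forall>s\<in>UA 0. \<forall>a\<ge>1. \<forall>b\<ge>1. P s a b = rGamma (fst s + snd (snd s) - 1) * ssum_avg s a b))"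

definition ssum_rem_ext :: "complex \<times> complex \<times> complex \<Rightarrow> real \<Rightarrow> real \<Rightarrow> complex" where
  "ssum_rem_ext = (SOME W. nice W UNIV \<and> (\<forall>s\<in>UA 0. \<forall>a\<ge>1. \<forall>b\<ge>1. W s a b = ssum_rem s a b))"

lemma nice_ssum_avg_ext: "nice ssum_avg_ext UNIV"
  and ssum_avg_ext_eq: "\<And>s a b. s \<in> UA 0 \<Longrightarrow> a \<ge> 1 \<Longrightarrow> b \<ge> 1 \<Longrightarrow> ssum_avg_ext s a b = rGamma (fst s + snd (snd s) - 1) * ssum_avg s a b"
  using someI_ex[OF ssum_avg_continuation] unfolding ssum_avg_ext_def[symmetric] by blast+

lemma nice_ssum_rem_ext: "nice ssum_rem_ext UNIV"
  and ssum_rem_ext_eq: "\<And>s a b. s \<in> UA 0 \<Longrightarrow> a \<ge> 1 \<Longrightarrow> b \<ge> 1 \<Longrightarrow> ssum_rem_ext s a b = ssum_rem s a b"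
  using someI_ex[OF ssum_rem_continuation] unfolding ssum_rem_ext_def[symmetric] by blast+

lemma nice_ssum_avg_ext_swap: "nice (\<lambda>s a b. ssum_avg_ext (swap3 s) b a) U" and nice_ssum_rem_ext_swap: "nice (\<lambda>s a b. ssum_rem_ext (swap3 s) b a) U"
  by (rule nice_swap[OF nice_ssum_avg_ext] nice_swap[OF nice_ssum_rem_ext]; simp)+

text \<open>The recursion in \<open>a\<close> gains only in s1 + s3. The recursion in
  \<open>b\<close>, which is the operator \<open>H\<close>, is therefore applied to its last term,
  and together they gain one in all three conditions of \<open>UR\<close>. The factor s1 + s3 - 1 is
  absorbed by the normalisation as for the single series.\<close>

lemma dsum_avg_rem_continuation:
  "\<exists>P. nice P UNIV \<and> (\<forall>s\<in>UR 0. \<forall>a\<ge>1. \<forall>b\<ge>1. P s a b = rGamma (fst s + snd (snd s) - 1) * dsum_avg_rem s a b)"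
proof -
  \<comment> \<open>The factor s1 + s3 - 1 before \<open>g (s + e3)\<close> compensates for the
    normalisation there, whose \<open>rGamma\<close> has an argument larger by one.\<close>
  define H :: "(complex \<times> complex \<times> complex \<Rightarrow> real \<Rightarrow> real \<Rightarrow> complex) \<Rightarrow> complex \<times> complex \<times> complex \<Rightarrow> real \<Rightarrow> real \<Rightarrow> complex"
    where "H g s = (\<lambda>a b. Jb (\<lambda>a b. of_real b powr (- fst (snd s)) * ssum_avg_ext s a b) a b +
      Jb (\<lambda>a b. fst (snd s) * g (s + e2) a b + snd (snd s) * (fst s + snd (snd s) - 1) * g (s + e3) a b) a b)" for g s
  define L :: "(complex \<times> complex \<times> complex \<Rightarrow> real \<Rightarrow> real \<Rightarrow> complex) \<Rightarrow> complex \<times> complex \<times> complex \<Rightarrow> real \<Rightarrow> real \<Rightarrow> complex"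
    where "L g s = (\<lambda>a b. rGamma (fst s + snd (snd s)) * (of_real a powr (1 - fst s) * ssum_rem_ext (swap3 s) b a) +
      snd (snd s) * H g (s + (0, -1, 1)) a b)" for g s
  show ?thesis
  proof (rule UR_extend[of _ L])
    show "nice (\<lambda>s a b. rGamma (fst s + snd (snd s) - 1) * dsum_avg_rem s a b) (UR 0)"
      by (intro nice_intros nice_subset[OF nice_dsum_avg_rem]) (auto dest: UR_0_tornheim)
    fix K g assume g: "nice g (UR K)"
    define W where "W = {s. s + e2 \<in> UR K \<and> s + e3 \<in> UR K}"
    have W: "open W"
      unfolding W_def UR_def mem_Collect_eq by (intro open_Collect_conj open_Collect_less continuous_intros)
    have "nice (H g) W"
      unfolding H_def
      by (intro nice_add nice_Ib cont_wt W nice_intros nice_subset[OF nice_ssum_avg_ext] nice_shift[OF g]) (auto simp: W_def)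
    then show "nice (L g) (UR (Suc K))"
      unfolding L_def
      by (intro nice_intros nice_ssum_rem_ext_swap nice_shift[of "H g" W]) (auto simp: W_def UR_def)
  next
    fix g :: "complex \<times> complex \<times> complex \<Rightarrow> real \<Rightarrow> real \<Rightarrow> complex" and s and a b :: real
    assume g: "\<And>s a b. s \<in> UR 0 \<Longrightarrow> a \<ge> 1 \<Longrightarrow> b \<ge> 1 \<Longrightarrow> g s a b = rGamma (fst s + snd (snd s) - 1) * dsum_avg_rem s a b"
      and s: "s \<in> UR 0" and ab: "a \<ge> 1" "b \<ge> (1::real)"
    have H: "H g s a b = rGamma (fst s + snd (snd s) - 1) * dsum_avg_rem s a b" if s: "s \<in> UR 0" for s
    proof -
      have *: "s + e2 \<in> UR 0" "s + e3 \<in> UR 0" using s by (auto simp: UR_def)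
      define r where "r = rGamma (fst s + snd (snd s) - 1)"
      have r: "r = (fst s + snd (snd s) - 1) * rGamma (fst s + snd (snd s))"
        unfolding r_def by (rule rGamma_shift)
      have "H g s a b = Jb (\<lambda>a b. r * (of_real b powr (- fst (snd s)) * ssum_avg s a b)) a b +
          Jb (\<lambda>a b. r * (fst (snd s) * dsum_avg_rem (s + e2) a b + snd (snd s) * dsum_avg_rem (s + e3) a b)) a b"
        unfolding H_def
      proof (intro arg_cong2[of _ _ _ _ "(+)"] Ib_cong[OF _ ab])
        fix a b :: real assume ab: "a \<ge> 1" "b \<ge> 1"
        show "of_real b powr (- fst (snd s)) * ssum_avg_ext s a b = r * (of_real b powr (- fst (snd s)) * ssum_avg s a b)"
          using UR_0_UA[OF s] ab by (simp add: ssum_avg_ext_eq r_def)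
        have "fst (s + e2) + snd (snd (s + e2)) - 1 = fst s + snd (snd s) - 1"
          "fst (s + e3) + snd (snd (s + e3)) - 1 = fst s + snd (snd s)"
          by (cases s; simp)+
        then have "g (s + e2) a b = r * dsum_avg_rem (s + e2) a b"
            "g (s + e3) a b = rGamma (fst s + snd (snd s)) * dsum_avg_rem (s + e3) a b"
          using g[OF *(1) ab] g[OF *(2) ab] by (simp_all only: r_def)
        then show "fst (snd s) * g (s + e2) a b + snd (snd s) * (fst s + snd (snd s) - 1) * g (s + e3) a b =
            r * (fst (snd s) * dsum_avg_rem (s + e2) a b + snd (snd s) * dsum_avg_rem (s + e3) a b)"
          by (simp add: distrib_left) (simp add: r mult_ac)
      qed
      also have "\<dots> = r * dsum_avg_rem s a b"
        unfolding Ib_mult[where c = "\<lambda>_. r"] dsum_avg_rem_rec_b[OF UR_0_tornheim[OF s] ab] by (simp add: distrib_left)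
      finally show ?thesis by (simp add: r_def)
    qed
    have s': "s + (0, -1, 1) \<in> UR 0" using s by (auto simp: UR_def)
    have "fst (s + (0, -1, 1)) + snd (snd (s + (0, -1, 1))) - 1 = fst s + snd (snd s)" by (cases s) simp
    then have "L g s a b = rGamma (fst s + snd (snd s)) * (of_real a powr (1 - fst s) * ssum_rem (swap3 s) b a +
        snd (snd s) * dsum_avg_rem (s + (0, -1, 1)) a b)"
      using UR_0_UA[OF s] ab by (simp add: L_def H[OF s'] ssum_rem_ext_eq algebra_simps)
    also have "of_real a powr (1 - fst s) * ssum_rem (swap3 s) b a + snd (snd s) * dsum_avg_rem (s + (0, -1, 1)) a b =
        (fst s + snd (snd s) - 1) * dsum_avg_rem s a b"
      by (rule dsum_avg_rem_rec_a[symmetric]) (use s ab UR_0_tornheim in \<open>auto simp: UR_def\<close>)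
    finally show "L g s a b = rGamma (fst s + snd (snd s) - 1) * dsum_avg_rem s a b"
      by (simp only: rGamma_shift mult_ac)
  qed
qed

lemma dsum_rem2_rec_b:
  assumes s: "s \<in> tornheim_region" and ab: "a \<ge> 1" "b \<ge> 1"
  shows "dsum_rem2 s a b = Jb (\<lambda>a b. of_real b powr (- fst (snd s)) * ssum_rem s a b) a b +
    Jb (\<lambda>a b. fst (snd s) * dsum_rem2 (s + e2) a b + snd (snd s) * dsum_rem2 (s + e3) a b) a b"
proof -
  have *: "s + e2 \<in> tornheim_region" "s + e3 \<in> tornheim_region" using tornheim_region_step[OF s] by auto
  have "dsum_rem2 s a b = dsum_rem2 (swap3 s) b a" using dsum_rem2_swap[OF s ab] by simp
  also have "\<dots> = Ja (\<lambda>a b. of_real a powr (- fst (swap3 s)) * ssum_rem (swap3 (swap3 s)) b a) b a +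
    Ja (\<lambda>a b. fst (swap3 s) * dsum_rem2 (swap3 s + e1) a b + snd (snd (swap3 s)) * dsum_rem2 (swap3 s + e3) a b) b a"
    by (rule dsum_rem2_rec) (use s ab in \<open>auto simp: tornheim_region_swap\<close>)
  also have "Ja (\<lambda>a b. fst (swap3 s) * dsum_rem2 (swap3 s + e1) a b + snd (snd (swap3 s)) * dsum_rem2 (swap3 s + e3) a b) b a =
      Ja (\<lambda>a b. fst (snd s) * dsum_rem2 (s + e2) b a + snd (snd s) * dsum_rem2 (s + e3) b a) b a"
  proof (rule Ia_cong[OF _ ab(2,1)])
    fix a b :: real assume ab: "a \<ge> 1" "b \<ge> 1"
    show "fst (swap3 s) * dsum_rem2 (swap3 s + e1) a b + snd (snd (swap3 s)) * dsum_rem2 (swap3 s + e3) a b =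
        fst (snd s) * dsum_rem2 (s + e2) b a + snd (snd s) * dsum_rem2 (s + e3) b a"
      using dsum_rem2_swap[OF *(1) ab(2,1)] dsum_rem2_swap[OF *(2) ab(2,1)] by (simp add: swap3_simps)
  qed
  finally show ?thesis by (simp add: Ib_eq_Ia swap3_simps)
qed

text \<open>In the recursion in \<open>a\<close> the term at \<open>s + e1\<close> gains nothing in
  s2 + s3, so the recursion in \<open>b\<close>, again called \<open>H\<close>, is inserted there.
  The term at \<open>s + e3\<close> gains in all three sums by itself.\<close>

lemma dsum_rem2_continuation:
  "\<exists>P. nice P UNIV \<and> (\<forall>s\<in>UR 0. \<forall>a\<ge>1. \<forall>b\<ge>1. P s a b = dsum_rem2 s a b)"
proof -
  define H :: "(complex \<times> complex \<times> complex \<Rightarrow> real \<Rightarrow> real \<Rightarrow> complex) \<Rightarrow> complex \<times> complex \<times> complex \<Rightarrow> real \<Rightarrow> real \<Rightarrow> complex"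
    where "H g s = (\<lambda>a b. Jb (\<lambda>a b. of_real b powr (- fst (snd s)) * ssum_rem_ext s a b) a b +
      Jb (\<lambda>a b. fst (snd s) * g (s + e2) a b + snd (snd s) * g (s + e3) a b) a b)" for g s
  define L :: "(complex \<times> complex \<times> complex \<Rightarrow> real \<Rightarrow> real \<Rightarrow> complex) \<Rightarrow> complex \<times> complex \<times> complex \<Rightarrow> real \<Rightarrow> real \<Rightarrow> complex"
    where "L g s = (\<lambda>a b. Ja (\<lambda>a b. of_real a powr (- fst s) * ssum_rem_ext (swap3 s) b a) a b +
      Ja (\<lambda>a b. fst s * H g (s + e1) a b + snd (snd s) * g (s + e3) a b) a b)" for g s
  show ?thesis
  proof (rule UR_extend[of _ L])
    show "nice dsum_rem2 (UR 0)"
      by (intro nice_subset[OF nice_dsum_rem2]) (auto dest: UR_0_tornheim)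
    fix K g assume g: "nice g (UR K)"
    define W where "W = {s. s + e2 \<in> UR K \<and> s + e3 \<in> UR K}"
    have W: "open W"
      unfolding W_def UR_def mem_Collect_eq by (intro open_Collect_conj open_Collect_less continuous_intros)
    have "nice (H g) W"
      unfolding H_def
      by (intro nice_add nice_Ib cont_wt W nice_intros nice_subset[OF nice_ssum_rem_ext] nice_shift[OF g]) (auto simp: W_def)
    then show "nice (L g) (UR (Suc K))"
      unfolding L_def
      by (intro nice_add nice_Ia cont_wt open_UR nice_intros nice_ssum_rem_ext_swap nice_shift[of "H g" W] nice_shift[OF g])
         (auto simp: W_def UR_def)
  next
    fix g :: "complex \<times> complex \<times> complex \<Rightarrow> real \<Rightarrow> real \<Rightarrow> complex" and s and a b :: real
    assume g: "\<And>s a b. s \<in> UR 0 \<Longrightarrow> a \<ge> 1 \<Longrightarrow> b \<ge> 1 \<Longrightarrow> g s a b = dsum_rem2 s a b"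
      and s: "s \<in> UR 0" and ab: "a \<ge> 1" "b \<ge> (1::real)"
    have H: "H g s a b = dsum_rem2 s a b" if s: "s \<in> UR 0" and ab: "a \<ge> 1" "b \<ge> 1" for s a b
    proof -
      have *: "s + e2 \<in> UR 0" "s + e3 \<in> UR 0" using s by (auto simp: UR_def)
      show ?thesis
        unfolding H_def dsum_rem2_rec_b[OF UR_0_tornheim[OF s] ab]
        by (intro arg_cong2[of _ _ _ _ "(+)"] Ib_cong[OF _ ab]) (use UR_0_UA[OF s] in \<open>simp_all add: ssum_rem_ext_eq g *\<close>)
    qed
    have *: "s + e1 \<in> UR 0" "s + e3 \<in> UR 0" using s by (auto simp: UR_def)
    show "L g s a b = dsum_rem2 s a b"
      unfolding L_def dsum_rem2_rec[OF UR_0_tornheim[OF s] ab]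
      by (intro arg_cong2[of _ _ _ _ "(+)"] Ia_cong[OF _ ab]) (use UR_0_UA[OF s] in \<open>simp_all add: ssum_rem_ext_eq g H *\<close>)
  qed
qed

lemma dsum_eq_tornheim_series: "dsum (s1, s2, s3) 1 1 = tornheim_series s1 s2 s3"
  unfolding dsum_def tornheim_series_def
proof (rule infsum_reindex_bij_witness[of _ "\<lambda>(m, n). (m - 1, n - 1)" "\<lambda>(m, n). (Suc m, Suc n)"])
  fix p :: "nat \<times> nat"
  show "(case case p of (m, n) \<Rightarrow> (Suc m, Suc n) of (m, n) \<Rightarrow>
      of_nat m powr - s1 * of_nat n powr - s2 * of_nat (m + n) powr - s3) = dsum_term p (s1, s2, s3) 1 1"
    by (cases p) (simp add: dsum_term_def algebra_simps)
qed auto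

text \<open>Average and deviation in each variable split the double series into four pieces. The
  double average is explicit up to single averages, each mixed piece has the poles of one Gamma
  factor only, and the double deviation is entire.\<close>

lemma tornheim_continuation:
  "\<exists>g. nice (\<lambda>s a b. g s) UNIV \<and> (\<forall>s1 s2 s3. (s1, s2, s3) \<in> tornheim_region \<longrightarrow>
      g (s1, s2, s3) = tornheim_denom (s1, s2, s3) * tornheim_series s1 s2 s3)"
proof -
  obtain P where P: "nice P UNIV"
      "\<And>s a b. s \<in> UR 0 \<Longrightarrow> a \<ge> 1 \<Longrightarrow> b \<ge> 1 \<Longrightarrow> P s a b = rGamma (fst s + snd (snd s) - 1) * dsum_avg_rem s a b"
    using dsum_avg_rem_continuation by blast
  obtain Q where Q: "nice Q UNIV" "\<And>s a b. s \<in> UR 0 \<Longrightarrow> a \<ge> 1 \<Longrightarrow> b \<ge> 1 \<Longrightarrow> Q s a b = dsum_rem2 s a b"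
    using dsum_rem2_continuation by blast
  define \<Gamma>1 \<Gamma>2 where "\<Gamma>1 s = rGamma (fst s + snd (snd s) - 1)" and "\<Gamma>2 s = rGamma (fst (snd s) + snd (snd s) - 1)"
    for s :: "complex \<times> complex \<times> complex"
  \<comment> \<open>Each summand is multiplied only by the \<open>rGamma\<close> factors that its
    continuation does not already contain: \<open>ssum_avg_ext\<close> and \<open>P\<close> bring
    one each, \<open>Q\<close> none.\<close>
  define H where "H = (\<lambda>s a b. \<Gamma>1 s * (of_real a powr (1 - fst s) * ssum_avg_ext (swap3 s) b a) +
      \<Gamma>2 s * (of_real b powr (1 - fst (snd s)) * ssum_avg_ext s a b) +
      (fst s + fst (snd s) + snd (snd s) - 2) * (\<Gamma>2 s * P s a b + \<Gamma>1 s * P (swap3 s) b a + \<Gamma>1 s * \<Gamma>2 s * Q s a b))"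
  have nH: "nice H U" for U
    unfolding H_def \<Gamma>1_def \<Gamma>2_def
    by (intro nice_intros nice_ssum_avg_ext_swap nice_swap[OF P(1)] nice_subset[OF nice_ssum_avg_ext] nice_subset[OF P(1)] nice_subset[OF Q(1)]) auto
  have H0: "H s a b = tornheim_denom s * dsum s a b" if s: "s \<in> UR 0" and ab: "a \<ge> 1" "b \<ge> 1" for s a b
  proof -
    have sw: "swap3 s \<in> UR 0" using s by (cases s) (auto simp: UR_def add.commute add.left_commute)
    have reg: "s \<in> tornheim_region" using UR_0_tornheim[OF s] .
    have "dsum s a b = dsum_rem2 s a b + dsum_avg_rem s a b + dsum_avg_rem (swap3 s) b a + dsum_avg2 s a b"
      using dsum_avg2_swap[OF reg ab] by (simp add: dsum_rem2_def dsum_rem_def dsum_avg_rem_def dsum_avg_swap)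
    moreover have "(fst s + fst (snd s) + snd (snd s) - 2) * dsum_avg2 s a b =
        of_real a powr (1 - fst s) * ssum_avg (swap3 s) b a + of_real b powr (1 - fst (snd s)) * ssum_avg s a b"
      by (rule dsum_avg2_formula) (use s ab in \<open>auto simp: UR_def\<close>)
    moreover have "tornheim_denom s = (fst s + fst (snd s) + snd (snd s) - 2) * \<Gamma>1 s * \<Gamma>2 s"
      by (simp add: tornheim_denom_def case_prod_beta \<Gamma>1_def \<Gamma>2_def)
    ultimately have "tornheim_denom s * dsum s a b = \<Gamma>1 s * \<Gamma>2 s *
        (of_real a powr (1 - fst s) * ssum_avg (swap3 s) b a + of_real b powr (1 - fst (snd s)) * ssum_avg s a b) +
        (fst s + fst (snd s) + snd (snd s) - 2) * \<Gamma>1 s * \<Gamma>2 s * (dsum_rem2 s a b + dsum_avg_rem s a b + dsum_avg_rem (swap3 s) b a)"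
      by (simp only: distrib_left mult_ac) (simp add: algebra_simps)
    moreover have "ssum_avg_ext s a b = \<Gamma>1 s * ssum_avg s a b" "ssum_avg_ext (swap3 s) b a = \<Gamma>2 s * ssum_avg (swap3 s) b a"
        "P s a b = \<Gamma>1 s * dsum_avg_rem s a b" "P (swap3 s) b a = \<Gamma>2 s * dsum_avg_rem (swap3 s) b a" "Q s a b = dsum_rem2 s a b"
      using UR_0_UA[OF s] ab P(2)[OF s ab] P(2)[OF sw ab(2,1)] Q(2)[OF s ab]
      by (simp_all add: ssum_avg_ext_eq \<Gamma>1_def \<Gamma>2_def swap3_simps)
    ultimately show ?thesis
      unfolding H_def by (simp add: algebra_simps)
  qed
  have "H s 1 1 = tornheim_denom s * dsum s 1 1" if "s \<in> tornheim_region" for s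
  \<comment> \<open>The recursions gave the identity on \<open>UR 0\<close> only; convexity of the
    region of convergence carries it over.\<close>
  proof (rule nice_identity[where f = H and g = "\<lambda>s a b. tornheim_denom s * dsum s a b" and U = tornheim_region and W = "UR 0"])
    show "nice (\<lambda>s a b. tornheim_denom s * dsum s a b) tornheim_region"
      by (intro nice_mult nice_tornheim_denom nice_dsum)
  qed (use that nH H0 UR_0 in \<open>auto intro: open_tornheim_region convex_tornheim_region open_UR UR_0_tornheim\<close>)
  moreover have "nice (\<lambda>s a b. H s 1 1) UNIV"
  proof (rule niceI)
    show "continuous_on (UNIV \<times> {1..} \<times> {1..}) (\<lambda>(s, a, b). H s 1 1)"
      unfolding case_prod_beta
      by (rule nice_continuous_compose[OF nH[of UNIV], where ?g2.0 = "\<lambda>_. 1" and ?g3.0 = "\<lambda>_. 1"])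
         (auto intro!: continuous_intros)
    show "(\<lambda>t. H (cline p v t) 1 1) holomorphic_on {t. cline p v t \<in> UNIV}" for p v
      by (rule nice_holomorphic[OF nH]) auto
  qed
  ultimately show ?thesis
    by (intro exI[of _ "\<lambda>s. H s 1 1"]) (auto simp: dsum_eq_tornheim_series)
qed

section \<open>The Hurwitz zeta function\<close>

text \<open>Both functions extend \<open>(w - 1) \<zeta>(w, a)\<close>; the first one is only meant for \<open>a \<ge> 1\<close>.\<close>

definition zeta_reg1 :: "complex \<Rightarrow> real \<Rightarrow> complex" where
  "zeta_reg1 w a = of_real a powr (1 - w) + (w - 1) * ssum_rem_ext (w, 0, 0) a 1"

definition zeta_reg :: "complex \<Rightarrow> real \<Rightarrow> complex" where
  "zeta_reg w a = (w - 1) * of_real a powr (- w) + zeta_reg1 w (1 + a)"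

lemma cline_axis: "cline (0, 0, 0) e1 w = (w, 0, 0)"
  by simp

lemma holomorphic_of_real_powr: "x > 0 \<Longrightarrow> f holomorphic_on S \<Longrightarrow> (\<lambda>w. complex_of_real x powr f w) holomorphic_on S"
  by (auto intro!: holomorphic_intros simp: powr_def)

lemma holomorphic_zeta_reg1: "a \<ge> 1 \<Longrightarrow> (\<lambda>w. zeta_reg1 w a) holomorphic_on S"
  unfolding zeta_reg1_def using nice_holomorphic[OF nice_ssum_rem_ext, of a 1 "(0, 0, 0)" e1]
  by (intro holomorphic_intros holomorphic_of_real_powr) (auto simp: cline_axis intro: holomorphic_on_subset)

lemma continuous_zeta_reg1: "continuous_on (UNIV \<times> {1..}) (\<lambda>(w, a). zeta_reg1 w a)"
proof -
  have 1: "continuous_on (UNIV \<times> {1..}) (\<lambda>x::complex \<times> real. ssum_rem_ext (fst x, 0, 0) (snd x) 1)"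
    by (rule nice_continuous_compose[OF nice_ssum_rem_ext]) (auto intro!: continuous_intros)
  have "continuous_on (UNIV \<times> {1..}) (\<lambda>x::complex \<times> real. exp ((1 - fst x) * of_real (ln (snd x))))"
    by (intro continuous_intros) auto
  then have 2: "continuous_on (UNIV \<times> {1..}) (\<lambda>x::complex \<times> real. complex_of_real (snd x) powr (1 - fst x))"
    by (rule continuous_on_eq) (auto simp: powr_def Ln_of_real)
  show ?thesis
    unfolding zeta_reg1_def case_prod_beta by (intro continuous_on_add continuous_on_mult 1 2 continuous_intros)
qed

lemma of_real_plus_1_neq_0: "a > 0 \<Longrightarrow> complex_of_real a + 1 \<noteq> 0"
  by (auto simp: complex_eq_iff)

lemma continuous_zeta_reg1_compose:
  assumes "continuous_on S f" "continuous_on S g" "\<And>x. x \<in> S \<Longrightarrow> g x \<ge> 1"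
  shows "continuous_on S (\<lambda>x. zeta_reg1 (f x) (g x))"
proof -
  have "continuous_on S (\<lambda>x. (\<lambda>(w, a). zeta_reg1 w a) (f x, g x))"
    by (rule continuous_on_compose2[OF continuous_zeta_reg1]) (use assms in \<open>auto intro!: continuous_intros\<close>)
  then show ?thesis by simp
qed

text \<open>With third exponent 0 the recursion for the average closes up: \<open>ssum_avg\<close>
  times w - 1 is a^(1 - w). So \<open>zeta_reg1\<close> is this explicit average plus the entire
  remainder, first for Re w > 2 and then by continuation.\<close>

lemma zeta_reg1_eq_ssum:
  assumes w: "Re w > 1" and a: "a \<ge> 1"
  shows "zeta_reg1 w a = (w - 1) * ssum (w, 0, 0) a 1"
proof (rule analytic_continuation_open[where z = w and s = "{w. Re w > 2}" and s' = "{w. Re w > 1}"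
      and f = "\<lambda>w. zeta_reg1 w a" and g = "\<lambda>w. (w - 1) * ssum (w, 0, 0) a 1"])
  show "open {w. Re w > 2}" "open {w. Re w > 1}" by (auto intro: open_halfspace_Re_gt)
  have "Re 3 > 2" by simp
  then show "{w. Re w > 2} \<noteq> {}" by blast
  show "connected {w. Re w > 1}" by (intro convex_connected convex_halfspace_Re_gt)
  show "(\<lambda>w. zeta_reg1 w a) holomorphic_on {w. Re w > 1}" by (rule holomorphic_zeta_reg1[OF a])
  show "(\<lambda>w. (w - 1) * ssum (w, 0, 0) a 1) holomorphic_on {w. Re w > 1}"
    using nice_holomorphic[OF nice_ssum a, of 1 "(0, 0, 0)" e1]
    by (intro holomorphic_intros) (simp add: cline_axis ssum_region_def)
  fix z :: complex assume "z \<in> {w. Re w > 2}"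
  then have z: "Re z > 2" by simp
  have "(z - 1) * ssum_avg (z, 0, 0) a 1 = of_real a powr (1 - z)"
    using ssum_avg_rec[of "(z, 0, 0)" a 1] z a of_real_plus_1_neq_0[of a] by auto
  moreover have "ssum_rem_ext (z, 0, 0) a 1 = ssum (z, 0, 0) a 1 - ssum_avg (z, 0, 0) a 1"
    unfolding ssum_rem_def[symmetric] by (subst ssum_rem_ext_eq) (use z a in \<open>auto simp: UA_def ssum_rem_def\<close>)
  ultimately show "zeta_reg1 z a = (z - 1) * ssum (z, 0, 0) a 1"
    by (simp only: zeta_reg1_def right_diff_distrib) simp
qed (use w in auto)

lemma halfplane_identity:
  assumes "f holomorphic_on UNIV" "g holomorphic_on UNIV" "\<And>w. Re w > c \<Longrightarrow> f w = g w"
  shows "f w = g w"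
proof (rule analytic_continuation_open[where s = "{w. Re w > c}" and s' = UNIV and f = f and g = g])
  have "Re (of_real (c + 1)) > c" by simp
  then show "{w. Re w > c} \<noteq> {}" by blast
qed (use assms in \<open>auto intro: open_halfspace_Re_gt\<close>)

text \<open>For Re w > 1 the slope of the series is w times the series at w + 1, which is exactly
  \<open>zeta_reg1 (w + 1)\<close>. Both sides are entire in w.\<close>

lemma zeta_reg1_diff:
  assumes a: "a \<ge> 1" and x: "x \<ge> 0"
  shows "zeta_reg1 w a - zeta_reg1 w (a + x) = (w - 1) * integral {0..x} (\<lambda>y. zeta_reg1 (w + 1) (a + y))"
proof (rule halfplane_identity[where c = 1 and f = "\<lambda>w. zeta_reg1 w a - zeta_reg1 w (a + x)"])
  show "(\<lambda>w. zeta_reg1 w a - zeta_reg1 w (a + x)) holomorphic_on UNIV"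
    using a x by (intro holomorphic_intros holomorphic_zeta_reg1) auto
  have "(\<lambda>w. zeta_reg1 (w + 1) (a + y)) holomorphic_on UNIV" if "y \<in> {0..x}" for y
    by (rule holomorphic_on_compose_gen[where g = "\<lambda>w. zeta_reg1 w (a + y)" and t = UNIV and f = "\<lambda>w. w + 1", unfolded o_def])
       (use a that in \<open>auto intro!: holomorphic_intros holomorphic_zeta_reg1\<close>)
  then show "(\<lambda>w. (w - 1) * integral {0..x} (\<lambda>y. zeta_reg1 (w + 1) (a + y))) holomorphic_on UNIV"
    using a by (intro holomorphic_intros holomorphic_on_integral_interval)
      (auto simp: case_prod_beta intro!: continuous_zeta_reg1_compose continuous_intros)
  fix w :: complex assume w: "Re w > 1"
  have "integral {0..x} (\<lambda>y. ssum_slope (w, 0, 0) (a + y) 1) = ssum (w, 0, 0) a 1 - ssum (w, 0, 0) (a + x) 1"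
    by (rule ssum_relations(1)) (use w a x in \<open>auto simp: ssum_region_def\<close>)
  moreover have "integral {0..x} (\<lambda>y. ssum_slope (w, 0, 0) (a + y) 1) = integral {0..x} (\<lambda>y. zeta_reg1 (w + 1) (a + y))"
    using w a by (intro integral_cong) (auto simp: ssum_slope_def zeta_reg1_eq_ssum)
  ultimately show "zeta_reg1 w a - zeta_reg1 w (a + x) = (w - 1) * integral {0..x} (\<lambda>y. zeta_reg1 (w + 1) (a + y))"
    using w a x by (simp add: zeta_reg1_eq_ssum flip: right_diff_distrib)
qed

lemma zeta_reg_eq_zeta_reg1:
  assumes a: "a \<ge> 1"
  shows "zeta_reg w a = zeta_reg1 w a"
proof (rule halfplane_identity[where c = 1 and f = "\<lambda>w. zeta_reg w a"])
  show "(\<lambda>w. zeta_reg w a) holomorphic_on UNIV" unfolding zeta_reg_def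
    using a by (intro holomorphic_intros holomorphic_zeta_reg1 holomorphic_of_real_powr) auto
  show "(\<lambda>w. zeta_reg1 w a) holomorphic_on UNIV" by (rule holomorphic_zeta_reg1[OF a])
  fix w :: complex assume w: "Re w > 1"
  have "ssum (w, 0, 0) a 1 - ssum (w, 0, 0) (a + 1) 1 = of_real a powr (- w)"
    using ssum_step[of "(w, 0, 0)" a 1] w a of_real_plus_1_neq_0[of a] by (auto simp: ssum_region_def)
  then show "zeta_reg w a = zeta_reg1 w a"
    using w a by (simp add: zeta_reg_def zeta_reg1_eq_ssum add.commute[of 1 a] flip: distrib_left) (simp add: algebra_simps)
qed

lemma holomorphic_zeta_reg: "a > 0 \<Longrightarrow> (\<lambda>w. zeta_reg w a) holomorphic_on S"
  unfolding zeta_reg_def by (intro holomorphic_intros holomorphic_zeta_reg1 holomorphic_of_real_powr) auto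

lemma continuous_zeta_reg_compose:
  assumes "continuous_on S f" "continuous_on S g" "\<And>x. x \<in> S \<Longrightarrow> g x > 0"
  shows "continuous_on S (\<lambda>x. zeta_reg (f x) (g x))"
proof -
  have g0: "g x \<noteq> 0" if "x \<in> S" for x using assms(3)[OF that] by simp
  have "continuous_on S (\<lambda>x. exp ((- f x) * of_real (ln (g x))))"
    using g0 by (intro continuous_intros assms) auto
  then have 1: "continuous_on S (\<lambda>x. complex_of_real (g x) powr (- f x))"
    by (rule continuous_on_eq) (simp add: powr_def Ln_of_real g0 assms(3))
  have 2: "continuous_on S (\<lambda>x. zeta_reg1 (f x) (1 + g x))"
    by (intro continuous_zeta_reg1_compose continuous_intros assms) (use assms(3) in \<open>auto intro: less_imp_le\<close>)
  show ?thesis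
    unfolding zeta_reg_def by (intro continuous_on_add continuous_on_mult continuous_on_diff continuous_on_const assms(1) 1 2)
qed

text \<open>The normalised form of the rule that the derivative of zeta(w, x) is -w zeta(w + 1, x).
  The part at 1 + x is differentiated through the integral in \<open>zeta_reg1_diff\<close>.\<close>

lemma zeta_reg_has_vector_derivative:
  assumes x: "x > 0"
  shows "((\<lambda>x. zeta_reg w x) has_vector_derivative (1 - w) * zeta_reg (w + 1) x) (at x within X)"
proof -
  have "((\<lambda>u. integral {0..u} (\<lambda>y. zeta_reg1 (w + 1) (1 + y))) has_vector_derivative zeta_reg1 (w + 1) (1 + x)) (at x within {0..x + 1})"
    by (rule integral_has_vector_derivative) (use x in \<open>auto intro!: continuous_zeta_reg1_compose continuous_intros\<close>)
  then have "((\<lambda>u. integral {0..u} (\<lambda>y. zeta_reg1 (w + 1) (1 + y))) has_vector_derivative zeta_reg1 (w + 1) (1 + x)) (at x)"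
    using x by (simp add: at_within_Icc_at)
  then have "((\<lambda>u. zeta_reg1 w 1 - (w - 1) * integral {0..u} (\<lambda>y. zeta_reg1 (w + 1) (1 + y))) has_vector_derivative
      - ((w - 1) * zeta_reg1 (w + 1) (1 + x))) (at x)"
    by (auto intro!: derivative_eq_intros)
  then have "((\<lambda>u. zeta_reg1 w (1 + u)) has_vector_derivative - ((w - 1) * zeta_reg1 (w + 1) (1 + x))) (at x)"
  proof (rule has_vector_derivative_transform_within_open[where S = "{0<..}"])
    show "zeta_reg1 w 1 - (w - 1) * integral {0..u} (\<lambda>y. zeta_reg1 (w + 1) (1 + y)) = zeta_reg1 w (1 + u)" if "u \<in> {0<..}" for u
      using zeta_reg1_diff[of 1 u w] that by (simp add: algebra_simps)
  qed (use x in auto)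
  moreover have "((\<lambda>x. (w - 1) * of_real x powr (- w)) has_vector_derivative
      (w - 1) * (- w * of_real x powr (- w - 1))) (at x)"
    using x by (intro has_vector_derivative_mult_right of_real_powr_has_vector_derivative)
  ultimately have "((\<lambda>x. zeta_reg w x) has_vector_derivative
      (w - 1) * (- w * of_real x powr (- w - 1)) + - ((w - 1) * zeta_reg1 (w + 1) (1 + x))) (at x)"
    unfolding zeta_reg_def by (intro has_vector_derivative_add)
  also have "(w - 1) * (- w * of_real x powr (- w - 1)) + - ((w - 1) * zeta_reg1 (w + 1) (1 + x)) = (1 - w) * zeta_reg (w + 1) x"
    by (simp add: zeta_reg_def algebra_simps minus1)
  finally show ?thesis by (rule has_vector_derivative_at_within)
qed

lemma zeta_reg_sums:
  assumes w: "Re w > 1" and a: "a > 0"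
  shows "(\<lambda>n. (of_nat n + complex_of_real a) powr (- w)) sums (zeta_reg w a / (w - 1))"
proof -
  have w1: "w \<noteq> 1" using w by auto
  have "((\<lambda>m. ssum_term m (w, 0, 0) (1 + a) 1) has_sum ssum (w, 0, 0) (1 + a) 1) UNIV"
    unfolding ssum_def by (intro has_sum_infsum ssum_summable) (use w a in \<open>auto simp: ssum_region_def\<close>)
  then have "(\<lambda>m. ssum_term m (w, 0, 0) (1 + a) 1) sums ssum (w, 0, 0) (1 + a) 1"
    by (rule has_sum_imp_sums)
  moreover have "ssum_term m (w, 0, 0) (1 + a) 1 = (of_nat (Suc m) + complex_of_real a) powr (- w)" for m
  proof -
    have "complex_of_real (real m + (1 + a) + 1) \<noteq> 0" using a
      by (subst of_real_eq_0_iff) (simp add: add_nonneg_eq_0_iff)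
    then have "complex_of_real (real m + (1 + a) + 1) powr 0 = 1" by simp
    then show ?thesis by (simp add: ssum_term_def algebra_simps)
  qed
  ultimately have "(\<lambda>m. (of_nat (Suc m) + complex_of_real a) powr (- w)) sums ssum (w, 0, 0) (1 + a) 1"
    by simp
  then have "(\<lambda>n. (of_nat n + complex_of_real a) powr (- w)) sums (ssum (w, 0, 0) (1 + a) 1 + (of_nat 0 + of_real a) powr (- w))"
    by (subst (asm) sums_Suc_iff) simp
  moreover have "zeta_reg w a / (w - 1) = ssum (w, 0, 0) (1 + a) 1 + (of_nat 0 + of_real a) powr (- w)"
    using w w1 a by (simp add: zeta_reg_def zeta_reg1_eq_ssum field_simps)
  ultimately show ?thesis by simp
qed

text \<open>Its values on Re w > 1 and holomorphy on the connected punctured plane determine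
  whatever function the choice operator returns.\<close>

lemma hurwitz_zeta_eq:
  assumes a: "a > 0" and w: "w \<noteq> 1"
  shows "hurwitz_zeta w (of_real a) = zeta_reg w a / (w - 1)"
proof -
  let ?P = "\<lambda>f. f holomorphic_on (- {1}) \<and>
     (\<forall>z. Re z > 1 \<longrightarrow> f z = (\<Sum>n. (of_nat n + complex_of_real a) powr (- z)))"
  let ?f = "\<lambda>w. zeta_reg w a / (w - 1)"
  have P: "?P ?f"
    using zeta_reg_sums[OF _ a] by (auto intro!: holomorphic_intros holomorphic_zeta_reg[OF a] simp: sums_iff)
  define f where "f = (SOME f. ?P f)"
  have Pf: "?P f" unfolding f_def by (rule someI[of ?P, OF P])
  have "f w = ?f w"
  proof (rule analytic_continuation_open[where s = "{w. Re w > 1}" and s' = "- {1}" and f = f and g = ?f])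
    have "Re 2 > 1" by simp
    then show "{w. Re w > 1} \<noteq> {}" by blast
    show "connected (- {1::complex})" by (rule connected_punctured_universe) simp
  qed (use P Pf w in \<open>auto intro: open_halfspace_Re_gt\<close>)
  then show ?thesis by (simp add: hurwitz_zeta_def f_def)
qed

section \<open>Finite parts\<close>

text \<open>The difference of the values at \<open>\<tau> + h\<close> and, multiplied by one of the factors \<open>exp (- (l j * h))\<close>, at \<open>\<tau>\<close>
  has one exponential less.\<close>

lemma exp_sum_limit_eq_0:
  assumes "finite J" "\<And>j. j \<in> J \<Longrightarrow> l j \<noteq> 0"
    and "((\<lambda>\<tau>::real. \<Sum>j\<in>J. d j * exp (- (l j * of_real \<tau>))) \<longlongrightarrow> (L::complex)) at_top"
  shows "L = 0"
  using assms
proof (induction J arbitrary: d L rule: finite_induct)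
  case empty
  then have "((\<lambda>\<tau>::real. 0) \<longlongrightarrow> L) at_top" by simp
  then show ?case by (simp add: tendsto_const_iff)
next
  case (insert n J)
  \<comment> \<open>If \<open>l n\<close> has a real part, any shift changes the modulus; if it is
    imaginary, half a period gives -1. Either way 1 - q is invertible in the end.\<close>
  obtain h :: real where h: "exp (- (l n * of_real h)) \<noteq> 1"
  proof (cases "Re (l n) = 0")
    case False
    have "norm (exp (- (l n * of_real 1))) \<noteq> 1" using False by simp
    then have "exp (- (l n * of_real 1)) \<noteq> 1" by (metis norm_one)
    then show ?thesis by (rule that)
  next
    case True
    then have "Im (l n) \<noteq> 0" using insert.prems(1)[of n] by (auto simp: complex_eq_iff)
    then have "l n * of_real (pi / Im (l n)) = \<i> * of_real pi"
      using True by (auto simp: complex_eq_iff)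
    then have "exp (- (l n * of_real (pi / Im (l n)))) = - 1"
      by (simp add: exp_minus mult.commute)
    then show ?thesis by (intro that[of "pi / Im (l n)"]) simp
  qed
  define q where "q = exp (- (l n * of_real h))"
  let ?g = "\<lambda>\<tau>::real. \<Sum>j\<in>insert n J. d j * exp (- (l j * of_real \<tau>))"
  have "filterlim (\<lambda>\<tau>::real. \<tau> + h) at_top at_top"
    by (rule filterlim_tendsto_add_at_top[OF tendsto_const filterlim_ident, of h, simplified add.commute])
  then have "((\<lambda>\<tau>. ?g (\<tau> + h)) \<longlongrightarrow> L) at_top"
    using filterlim_compose[OF insert.prems(2)] by blast
  then have "((\<lambda>\<tau>. ?g (\<tau> + h) - q * ?g \<tau>) \<longlongrightarrow> L - q * L) at_top"
    by (intro tendsto_intros insert.prems(2))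
  moreover have "?g (\<tau> + h) - q * ?g \<tau> = (\<Sum>j\<in>J. (d j * (exp (- (l j * of_real h)) - q)) * exp (- (l j * of_real \<tau>)))" for \<tau>
  proof -
    have e: "exp (- (l j * of_real (\<tau> + h))) = exp (- (l j * of_real h)) * exp (- (l j * of_real \<tau>))" for j
      by (simp add: exp_add[symmetric] algebra_simps)
    have "?g (\<tau> + h) - q * ?g \<tau> =
        (\<Sum>j\<in>insert n J. (d j * (exp (- (l j * of_real h)) - q)) * exp (- (l j * of_real \<tau>)))"
      unfolding e sum_distrib_left sum_subtractf[symmetric]
      by (intro sum.cong refl) (simp only: left_diff_distrib right_diff_distrib mult_ac)
    then show ?thesis
      using insert.hyps by (simp add: q_def)
  qed
  ultimately have "((\<lambda>\<tau>::real. \<Sum>j\<in>J. (d j * (exp (- (l j * of_real h)) - q)) * exp (- (l j * of_real \<tau>)))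
      \<longlongrightarrow> L - q * L) at_top"
    by simp
  then have "L - q * L = 0"
    by (rule insert.IH[rotated]) (use insert.prems in auto)
  then have "(1 - q) * L = 0" by (simp add: algebra_simps)
  then show ?case using h by (simp add: q_def)
qed

text \<open>The two local models: \<open>\<zeta>(1 - s, \<alpha>)\<close> for \<open>\<kappa> = (1, 1)\<close> and \<open>\<zeta>(1 - s, 1 - \<alpha>)\<close> for \<open>\<kappa> = (0, -1)\<close>.\<close>

definition zeta_model :: "complex \<times> real \<Rightarrow> complex \<Rightarrow> real \<Rightarrow> complex" where
  "zeta_model \<kappa> s \<alpha> = fst \<kappa> * of_real \<alpha> powr (s - 1) - zeta_reg (1 - s) (1 + snd \<kappa> * \<alpha>) / s"

text \<open>The falling factorial s (s - 1) ... (s - i + 1), the factor produced by differentiating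
  \<open>zeta_reg (1 - s) x\<close> i times in x.\<close>

fun falling_prod :: "nat \<Rightarrow> complex \<Rightarrow> complex" where
  "falling_prod 0 s = 1"
| "falling_prod (Suc i) s = falling_prod i s * (s - of_nat i)"

text \<open>Taylor coefficient at \<alpha> = 0 of
  \<open>- zeta_reg (1 - s) (1 + \<eta> * \<alpha>) / s\<close>, the regular part of the local
  model.\<close>

definition taylor_coef :: "real \<Rightarrow> nat \<Rightarrow> complex \<Rightarrow> complex" where
  "taylor_coef \<eta> i s = - (of_real (\<eta> ^ i) * falling_prod i s * zeta_reg (1 - s + of_nat i) 1) / (fact i * s)"

definition main_term :: "nat \<Rightarrow> complex \<times> real \<Rightarrow> complex \<Rightarrow> real \<Rightarrow> complex" where
  "main_term K \<kappa> s \<alpha> = fst \<kappa> * of_real \<alpha> powr (s - 1) + (\<Sum>i<K. taylor_coef (snd \<kappa>) i s * of_real \<alpha> ^ i)"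

lemma holomorphic_falling_prod: "falling_prod i holomorphic_on S"
proof -
  have "(\<lambda>s. falling_prod i s) holomorphic_on S" by (induction i) (auto intro!: holomorphic_intros)
  then show ?thesis by simp
qed

lemma holomorphic_zeta_reg_compose: "a > 0 \<Longrightarrow> f holomorphic_on S \<Longrightarrow> (\<lambda>w. zeta_reg (f w) a) holomorphic_on S"
  using holomorphic_on_compose_gen[of f S "\<lambda>w. zeta_reg w a" UNIV] holomorphic_zeta_reg[of a UNIV] by (simp add: o_def)

lemma holomorphic_taylor_coef: "0 \<notin> S \<Longrightarrow> taylor_coef \<eta> i holomorphic_on S"
proof -
  assume "0 \<notin> S"
  then have "(\<lambda>s. taylor_coef \<eta> i s) holomorphic_on S"
    unfolding taylor_coef_def using holomorphic_falling_prod
    by (intro holomorphic_intros holomorphic_zeta_reg_compose) auto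
  then show ?thesis by simp
qed

text \<open>Taylor's formula with integral remainder. For arguments up to 1/2 the number 1 + \<eta>
  x stays at least 1/2, away from the singularity of the zeta function in its second
  argument.\<close>

lemma zeta_model_taylor_remainder:
  assumes \<kappa>: "\<bar>snd \<kappa>\<bar> \<le> 1" and K: "K > 0" and \<alpha>: "\<alpha> \<in> {0..1/2}" and s: "s \<noteq> 0"
    and B: "\<And>x. x \<in> {0..1/2} \<Longrightarrow> norm (falling_prod K s * zeta_reg (1 - s + of_nat K) (1 + snd \<kappa> * x) / s) \<le> B"
  shows "norm (zeta_model \<kappa> s \<alpha> - main_term K \<kappa> s \<alpha>) \<le> B * \<alpha> ^ K"
proof -
  define \<eta> where "\<eta> = snd \<kappa>"
  define Df where "Df i x = - (of_real (\<eta> ^ i) * falling_prod i s * zeta_reg (1 - s + of_nat i) (1 + \<eta> * x) / s)" for i x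
  have pos: "1 + \<eta> * x > 0" if "x \<in> {0..1/2}" for x
  proof -
    have "\<bar>\<eta> * x\<bar> \<le> 1 * (1/2)" unfolding abs_mult using \<kappa> that by (intro mult_mono) (auto simp: \<eta>_def)
    then show ?thesis by auto
  qed
  have der: "(Df i has_vector_derivative Df (Suc i) x) (at x within {0..\<alpha>})" if "x \<in> {0..\<alpha>}" for i x
  proof -
    have x: "x \<in> {0..1/2}" using that \<alpha> by auto
    have "((\<lambda>x. 1 + \<eta> * x) has_vector_derivative \<eta>) (at x within {0..\<alpha>})"
      by (auto intro!: derivative_eq_intros simp: has_real_derivative_iff_has_vector_derivative[symmetric])
    note chain = vector_diff_chain_within[OF this zeta_reg_has_vector_derivative[OF pos[OF x]], unfolded o_def]
    have "((\<lambda>x. zeta_reg (1 - s + of_nat i) (1 + \<eta> * x)) has_vector_derivative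
        \<eta> *\<^sub>R ((1 - (1 - s + of_nat i)) * zeta_reg (1 - s + of_nat i + 1) (1 + \<eta> * x))) (at x within {0..\<alpha>})"
      by (rule chain)
    note d = has_vector_derivative_mult_right[OF this, of "- (of_real (\<eta> ^ i) * falling_prod i s / s)"]
    have arg: "1 - s + of_nat (Suc i) = 1 - s + of_nat i + 1" by simp
    have "Df i = (\<lambda>x. - (of_real (\<eta> ^ i) * falling_prod i s / s) * zeta_reg (1 - s + of_nat i) (1 + \<eta> * x))"
      by (simp add: Df_def fun_eq_iff)
    moreover have "Df (Suc i) x = - (of_real (\<eta> ^ i) * falling_prod i s / s) *
        (\<eta> *\<^sub>R ((1 - (1 - s + of_nat i)) * zeta_reg (1 - s + of_nat i + 1) (1 + \<eta> * x)))"
      unfolding Df_def arg by (simp add: scaleR_conv_of_real)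
    ultimately show ?thesis using d by simp
  qed
  have "((\<lambda>x. ((\<alpha> - x) ^ (K - 1) / fact (K - 1)) *\<^sub>R Df K x) has_integral
      Df 0 \<alpha> - (\<Sum>i<K. ((\<alpha> - 0) ^ i / fact i) *\<^sub>R Df i 0)) {0..\<alpha>}"
    by (rule Taylor_has_integral[OF K refl]) (use der \<alpha> in auto)
  moreover have "Df 0 \<alpha> - (\<Sum>i<K. ((\<alpha> - 0) ^ i / fact i) *\<^sub>R Df i 0) = zeta_model \<kappa> s \<alpha> - main_term K \<kappa> s \<alpha>"
    unfolding zeta_model_def main_term_def
    by (simp add: Df_def \<eta>_def taylor_coef_def scaleR_conv_of_real field_simps sum_negf[symmetric])
  ultimately have int: "((\<lambda>x. ((\<alpha> - x) ^ (K - 1) / fact (K - 1)) *\<^sub>R Df K x) has_integral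
      zeta_model \<kappa> s \<alpha> - main_term K \<kappa> s \<alpha>) {0..\<alpha>}" by simp
  have B0: "B \<ge> 0" using order.trans[OF norm_ge_zero B[of 0]] by simp
  have "norm (zeta_model \<kappa> s \<alpha> - main_term K \<kappa> s \<alpha>) \<le> (B * \<alpha> ^ (K - 1)) * measure lborel (cbox 0 \<alpha>)"
  proof (rule has_integral_bound)
    show "((\<lambda>x. ((\<alpha> - x) ^ (K - 1) / fact (K - 1)) *\<^sub>R Df K x) has_integral
      zeta_model \<kappa> s \<alpha> - main_term K \<kappa> s \<alpha>) (cbox 0 \<alpha>)" using int by simp
    fix x assume "x \<in> cbox 0 \<alpha>"
    then have x: "x \<in> {0..\<alpha>}" "x \<in> {0..1/2}" using \<alpha> by auto
    have "norm (Df K x) = \<bar>\<eta>\<bar> ^ K * norm (falling_prod K s * zeta_reg (1 - s + of_nat K) (1 + snd \<kappa> * x) / s)"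
      by (simp add: Df_def \<eta>_def norm_mult norm_divide norm_power)
    also have "\<dots> \<le> 1 * B"
      using \<kappa> B[OF x(2)] B0 by (intro mult_mono power_le_one) (auto simp: \<eta>_def)
    finally have D: "norm (Df K x) \<le> B" by simp
    have "(\<alpha> - x) ^ (K - 1) / fact (K - 1) \<le> \<alpha> ^ (K - 1) / 1"
      using x by (intro frac_le power_mono) auto
    then have "norm (((\<alpha> - x) ^ (K - 1) / fact (K - 1)) *\<^sub>R Df K x) \<le> \<alpha> ^ (K - 1) * B"
      unfolding norm_scaleR using x D by (intro mult_mono) auto
    then show "norm (((\<alpha> - x) ^ (K - 1) / fact (K - 1)) *\<^sub>R Df K x) \<le> B * \<alpha> ^ (K - 1)"
      by (simp add: mult.commute)
  qed (use B0 \<alpha> in auto)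
  also have "\<dots> = B * \<alpha> ^ K"
    using \<alpha> power_minus_mult[OF K, of \<alpha>] by (simp add: mult.assoc)
  finally show ?thesis .
qed

text \<open>For Re s \<ge> 1 - M the singular power is at most \<alpha>^(-M), which also dominates
  bounded quantities because \<alpha> < 1. Uniformity near \<open>s0\<close> is what makes the later
  integrals holomorphic.\<close>

lemma zeta_model_bounds:
  assumes \<kappa>: "norm (fst \<kappa>) \<le> 1" "\<bar>snd \<kappa>\<bar> \<le> 1" and K: "K > 0" and s0: "s0 \<noteq> 0"
  shows "\<exists>d>0. \<exists>C\<ge>0. \<forall>s\<in>ball s0 d. \<forall>\<alpha>\<in>{0<..1/2}. Re s \<ge> 1 - real M \<longrightarrow>
    norm (zeta_model \<kappa> s \<alpha>) \<le> C * (1 / \<alpha>) ^ M \<and> norm (main_term K \<kappa> s \<alpha>) \<le> C * (1 / \<alpha>) ^ M \<and>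
    norm (zeta_model \<kappa> s \<alpha> - main_term K \<kappa> s \<alpha>) \<le> C * \<alpha> ^ K"
proof -
  \<comment> \<open>Half the distance to 0 keeps the division by s harmless.\<close>
  define d where "d = norm s0 / 2"
  have d: "d > 0" using s0 by (simp add: d_def)
  have s_ne: "s \<noteq> 0" if "s \<in> cball s0 d" for s
    using that s0 by (auto simp: d_def dist_norm)
  let ?S = "cball s0 d \<times> {0..1/2::real}"
  have pos: "1 + snd \<kappa> * x > 0" if "x \<in> {0..1/2}" for x
  proof -
    have "\<bar>snd \<kappa> * x\<bar> \<le> 1 * (1/2)" unfolding abs_mult using \<kappa> that by (intro mult_mono) auto
    then show ?thesis by auto
  qed
  have contcW: "continuous_on ?S (\<lambda>x. falling_prod K (fst x))"
    using holomorphic_on_imp_continuous_on[OF holomorphic_falling_prod[of K UNIV]]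
    by (rule continuous_on_compose2) (auto intro!: continuous_intros)
  have bounded: "\<exists>B\<ge>0. \<forall>x\<in>?S. norm (f x) \<le> B" if "continuous_on ?S f" for f :: "complex \<times> real \<Rightarrow> complex"
  proof -
    have "compact (f ` ?S)" by (intro compact_continuous_image that compact_Times) auto
    then obtain B where "\<forall>x\<in>?S. norm (f x) \<le> B" using compact_imp_bounded bounded_iff by (metis imageI)
    then show ?thesis by (intro exI[of _ "max B 0"]) (auto intro: max.coboundedI1)
  qed
  have "continuous_on ?S (\<lambda>x. falling_prod K (fst x) * zeta_reg (1 - fst x + of_nat K) (1 + snd \<kappa> * snd x) / fst x)"
    using s_ne pos by (intro continuous_intros contcW continuous_zeta_reg_compose) auto
  then obtain B where B: "B \<ge> 0" "\<And>s x. s \<in> cball s0 d \<Longrightarrow> x \<in> {0..1/2} \<Longrightarrow>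
      norm (falling_prod K s * zeta_reg (1 - s + of_nat K) (1 + snd \<kappa> * x) / s) \<le> B"
    using bounded by fastforce
  have "continuous_on ?S (\<lambda>x. zeta_reg (1 - fst x) (1 + snd \<kappa> * snd x) / fst x)"
    using s_ne pos by (intro continuous_intros continuous_zeta_reg_compose) auto
  then obtain B' where B': "B' \<ge> 0" "\<And>s x. s \<in> cball s0 d \<Longrightarrow> x \<in> {0..1/2} \<Longrightarrow>
      norm (zeta_reg (1 - s) (1 + snd \<kappa> * x) / s) \<le> B'"
    using bounded by fastforce
  define C where "C = 1 + B' + B"
  have main: "norm (zeta_model \<kappa> s \<alpha>) \<le> C * (1 / \<alpha>) ^ M \<and> norm (main_term K \<kappa> s \<alpha>) \<le> C * (1 / \<alpha>) ^ M \<and>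
    norm (zeta_model \<kappa> s \<alpha> - main_term K \<kappa> s \<alpha>) \<le> C * \<alpha> ^ K"
    if s: "s \<in> ball s0 d" and \<alpha>: "\<alpha> \<in> {0<..1/2}" and M: "Re s \<ge> 1 - real M" for s \<alpha>
  proof -
    have one: "1 \<le> (1 / \<alpha>) ^ M" using \<alpha> by (intro one_le_power) auto
    have "norm (complex_of_real \<alpha> powr (s - 1)) = exp ((Re s - 1) * ln \<alpha>)"
      using \<alpha> by (subst norm_of_real_powr) auto
    also have "\<dots> \<le> exp (- real M * ln \<alpha>)"
      using \<alpha> M by (subst exp_le_cancel_iff, intro mult_right_mono_neg) auto
    also have "\<dots> = (1 / \<alpha>) ^ M"
    proof -
      have "exp (- real M * ln \<alpha>) = exp (real M * (- ln \<alpha>))" by simp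
      also have "\<dots> = exp (- ln \<alpha>) ^ M" by (rule exp_of_nat_mult)
      also have "exp (- ln \<alpha>) = 1 / \<alpha>" using \<alpha> by (simp add: exp_minus inverse_eq_divide)
      finally show ?thesis .
    qed
    finally have p: "norm (complex_of_real \<alpha> powr (s - 1)) \<le> (1 / \<alpha>) ^ M" .
    have r: "norm (zeta_model \<kappa> s \<alpha> - main_term K \<kappa> s \<alpha>) \<le> B * \<alpha> ^ K"
      using s \<alpha> s_ne by (intro zeta_model_taylor_remainder \<kappa> K B(2)) auto
    have "norm (fst \<kappa> * of_real \<alpha> powr (s - 1)) \<le> 1 * (1 / \<alpha>) ^ M"
      unfolding norm_mult using \<kappa> p by (intro mult_mono) auto
    moreover have "norm (zeta_reg (1 - s) (1 + snd \<kappa> * \<alpha>) / s) \<le> B'"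
      using s \<alpha> by (intro B') auto
    ultimately have "norm (zeta_model \<kappa> s \<alpha>) \<le> (1 / \<alpha>) ^ M + B'"
      unfolding zeta_model_def by (smt (verit) norm_triangle_ineq4)
    moreover have "B' * 1 \<le> B' * (1 / \<alpha>) ^ M" using B' one by (intro mult_left_mono) auto
    ultimately have x: "norm (zeta_model \<kappa> s \<alpha>) \<le> (1 + B') * (1 / \<alpha>) ^ M" by (simp add: distrib_right)
    have "\<alpha> ^ K \<le> 1" using \<alpha> by (intro power_le_one) auto
    then have "B * \<alpha> ^ K \<le> B * (1 / \<alpha>) ^ M" using B one by (intro mult_left_mono) auto
    moreover have "norm (main_term K \<kappa> s \<alpha>) \<le> norm (zeta_model \<kappa> s \<alpha>) + norm (zeta_model \<kappa> s \<alpha> - main_term K \<kappa> s \<alpha>)"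
      by (metis norm_minus_commute norm_triangle_sub)
    ultimately have m: "norm (main_term K \<kappa> s \<alpha>) \<le> C * (1 / \<alpha>) ^ M"
      using x r by (simp add: C_def distrib_right)
    have "(1 + B') * (1 / \<alpha>) ^ M \<le> C * (1 / \<alpha>) ^ M" "B * \<alpha> ^ K \<le> C * \<alpha> ^ K"
      using B B' \<alpha> by (auto simp: C_def intro!: mult_right_mono)
    then show ?thesis using x r m by linarith
  qed
  have "C \<ge> 0" using B B' by (simp add: C_def)
  with d main show ?thesis by blast
qed

text \<open>The index \<open>K\<close> stands for the singular term \<open>\<alpha> powr (s - 1)\<close>, an index \<open>j < K\<close> for \<open>\<alpha> ^ j\<close>.\<close>

definition expansion_coef :: "nat \<Rightarrow> complex \<times> real \<Rightarrow> nat \<Rightarrow> complex \<Rightarrow> complex" where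
  "expansion_coef K \<kappa> j s = (if j = K then fst \<kappa> else taylor_coef (snd \<kappa>) j s)"

definition expansion_exponent :: "nat \<Rightarrow> nat \<Rightarrow> complex \<Rightarrow> complex" where
  "expansion_exponent K j s = (if j = K then s - 1 else of_nat j)"

definition exponent3 :: "nat \<Rightarrow> nat \<times> nat \<times> nat \<Rightarrow> complex \<Rightarrow> complex \<Rightarrow> complex \<Rightarrow> complex" where
  "exponent3 K = (\<lambda>(i, j, k) s1 s2 s3. expansion_exponent K i s1 + expansion_exponent K j s2 + expansion_exponent K k s3)"

definition coef3 :: "nat \<Rightarrow> complex \<times> real \<Rightarrow> complex \<times> real \<Rightarrow> complex \<times> real \<Rightarrow> nat \<times> nat \<times> nat
    \<Rightarrow> complex \<Rightarrow> complex \<Rightarrow> complex \<Rightarrow> complex" where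
  "coef3 K \<kappa>1 \<kappa>2 \<kappa>3 = (\<lambda>(i, j, k) s1 s2 s3. expansion_coef K \<kappa>1 i s1 * expansion_coef K \<kappa>2 j s2 * expansion_coef K \<kappa>3 k s3)"

abbreviation "idx3 K \<equiv> {..K} \<times> {..K} \<times> {..K::nat}"

lemma main_term_eq_sum:
  assumes "\<alpha> > 0"
  shows "main_term K \<kappa> s \<alpha> = (\<Sum>j\<le>K. expansion_coef K \<kappa> j s * of_real \<alpha> powr expansion_exponent K j s)"
proof -
  have "complex_of_real \<alpha> powr of_nat j = of_real \<alpha> ^ j" for j
    using assms by (subst powr_nat') auto
  then have "(\<Sum>j\<le>K. expansion_coef K \<kappa> j s * of_real \<alpha> powr expansion_exponent K j s) =
      (\<Sum>j<K. taylor_coef (snd \<kappa>) j s * of_real \<alpha> ^ j) + fst \<kappa> * of_real \<alpha> powr (s - 1)"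
    by (simp add: lessThan_Suc_atMost[symmetric] expansion_coef_def expansion_exponent_def)
  then show ?thesis by (simp add: main_term_def)
qed

lemma main_term_product:
  assumes "\<alpha> > 0"
  shows "main_term K \<kappa>1 s1 \<alpha> * main_term K \<kappa>2 s2 \<alpha> * main_term K \<kappa>3 s3 \<alpha> =
    (\<Sum>p\<in>idx3 K. coef3 K \<kappa>1 \<kappa>2 \<kappa>3 p s1 s2 s3 * of_real \<alpha> powr exponent3 K p s1 s2 s3)"
proof -
  have "main_term K \<kappa>1 s1 \<alpha> * main_term K \<kappa>2 s2 \<alpha> * main_term K \<kappa>3 s3 \<alpha> =
     (\<Sum>i\<le>K. \<Sum>j\<le>K. \<Sum>k\<le>K. (expansion_coef K \<kappa>1 i s1 * of_real \<alpha> powr expansion_exponent K i s1) *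
       ((expansion_coef K \<kappa>2 j s2 * of_real \<alpha> powr expansion_exponent K j s2) * (expansion_coef K \<kappa>3 k s3 * of_real \<alpha> powr expansion_exponent K k s3)))"
  proof -
    have "(\<Sum>i\<le>K. a i) * (\<Sum>j\<le>K. b j) * (\<Sum>k\<le>K. c k) = (\<Sum>i\<le>K. \<Sum>j\<le>K. \<Sum>k\<le>K. a i * (b j * c k))"
      for a b c :: "nat \<Rightarrow> complex"
    proof -
      have "(\<Sum>i\<le>K. a i) * (\<Sum>j\<le>K. b j) * (\<Sum>k\<le>K. c k) = (\<Sum>i\<le>K. a i) * (\<Sum>j\<le>K. \<Sum>k\<le>K. b j * c k)"
        by (simp only: mult.assoc sum_product[of b _ c])
      also have "\<dots> = (\<Sum>i\<le>K. a i * (\<Sum>j\<le>K. \<Sum>k\<le>K. b j * c k))"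
        by (rule sum_distrib_right)
      finally show ?thesis by (simp only: sum_distrib_left)
    qed
    then show ?thesis unfolding main_term_eq_sum[OF assms] .
  qed
  also have "\<dots> = (\<Sum>i\<le>K. \<Sum>j\<le>K. \<Sum>k\<le>K. (expansion_coef K \<kappa>1 i s1 * expansion_coef K \<kappa>2 j s2 * expansion_coef K \<kappa>3 k s3) *
       of_real \<alpha> powr (expansion_exponent K i s1 + expansion_exponent K j s2 + expansion_exponent K k s3))"
    using assms by (intro sum.cong refl) (simp add: powr_add mult_ac)
  also have "\<dots> = (\<Sum>p\<in>idx3 K. coef3 K \<kappa>1 \<kappa>2 \<kappa>3 p s1 s2 s3 * of_real \<alpha> powr exponent3 K p s1 s2 s3)"
    by (simp add: sum.cartesian_product coef3_def exponent3_def case_prod_unfold)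
  finally show ?thesis .
qed

definition product_remainder :: "nat \<Rightarrow> complex \<times> real \<Rightarrow> complex \<times> real \<Rightarrow> complex \<times> real \<Rightarrow>
    complex \<Rightarrow> complex \<Rightarrow> complex \<Rightarrow> real \<Rightarrow> complex" where
  "product_remainder K \<kappa>1 \<kappa>2 \<kappa>3 s1 s2 s3 \<alpha> = zeta_model \<kappa>1 s1 \<alpha> * zeta_model \<kappa>2 s2 \<alpha> * zeta_model \<kappa>3 s3 \<alpha> -
     main_term K \<kappa>1 s1 \<alpha> * main_term K \<kappa>2 s2 \<alpha> * main_term K \<kappa>3 s3 \<alpha>"

text \<open>A power \<open>\<alpha> powr e\<close> contributes its primitive at \<open>1/2\<close>, whether or not it is integrable at \<open>0\<close>.\<close>

definition finite_part :: "nat \<Rightarrow> complex \<times> real \<Rightarrow> complex \<times> real \<Rightarrow> complex \<times> real \<Rightarrow>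
    complex \<Rightarrow> complex \<Rightarrow> complex \<Rightarrow> complex" where
  "finite_part K \<kappa>1 \<kappa>2 \<kappa>3 s1 s2 s3 =
     (\<Sum>p\<in>idx3 K. coef3 K \<kappa>1 \<kappa>2 \<kappa>3 p s1 s2 s3 * (of_real (1/2) powr (exponent3 K p s1 s2 s3 + 1) /
        (exponent3 K p s1 s2 s3 + 1))) +
     (\<integral>\<alpha>. product_remainder K \<kappa>1 \<kappa>2 \<kappa>3 s1 s2 s3 \<alpha> \<partial>(lebesgue_on {0<..1/2}))"

definition kappa_ok :: "complex \<times> real \<Rightarrow> bool" where
  "kappa_ok \<kappa> \<longleftrightarrow> norm (fst \<kappa>) \<le> 1 \<and> \<bar>snd \<kappa>\<bar> \<le> 1"

lemma kappa_pos: "kappa_ok \<kappa> \<Longrightarrow> x \<in> {0..1/2} \<Longrightarrow> 1 + snd \<kappa> * x > 0"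
proof -
  assume "kappa_ok \<kappa>" "x \<in> {0..1/2}"
  then have "\<bar>snd \<kappa> * x\<bar> \<le> 1 * (1/2)" unfolding abs_mult by (intro mult_mono) (auto simp: kappa_ok_def)
  then show ?thesis by auto
qed

text \<open>Replacing one factor at a time writes the difference of the products as three terms,
  each with two factors of size \<alpha>^(-M) and one Taylor remainder of size \<alpha>^K. With K =
  2 M these powers cancel exactly.\<close>

lemma product_remainder_bound:
  assumes ok: "kappa_ok \<kappa>1" "kappa_ok \<kappa>2" "kappa_ok \<kappa>3" and K: "K = 2 * M" "K > 0"
    and z: "z1 \<noteq> 0" "z2 \<noteq> 0" "z3 \<noteq> 0"
  shows "\<exists>d>0. \<exists>C. \<forall>s1\<in>ball z1 d. \<forall>s2\<in>ball z2 d. \<forall>s3\<in>ball z3 d. \<forall>\<alpha>\<in>{0<..1/2}.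
    Re s1 \<ge> 1 - real M \<longrightarrow> Re s2 \<ge> 1 - real M \<longrightarrow> Re s3 \<ge> 1 - real M \<longrightarrow>
    norm (product_remainder K \<kappa>1 \<kappa>2 \<kappa>3 s1 s2 s3 \<alpha>) \<le> C"
proof -
  have bounds: "\<exists>d>0. \<exists>C\<ge>0. \<forall>s\<in>ball z d. \<forall>\<alpha>\<in>{0<..1/2}. Re s \<ge> 1 - real M \<longrightarrow>
    norm (zeta_model \<kappa> s \<alpha>) \<le> C * (1 / \<alpha>) ^ M \<and> norm (main_term K \<kappa> s \<alpha>) \<le> C * (1 / \<alpha>) ^ M \<and>
    norm (zeta_model \<kappa> s \<alpha> - main_term K \<kappa> s \<alpha>) \<le> C * \<alpha> ^ K" if "kappa_ok \<kappa>" "z \<noteq> 0" for \<kappa> z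
    using that K unfolding kappa_ok_def by (intro zeta_model_bounds) auto
  obtain d1 C1 where 1: "d1 > 0" "C1 \<ge> 0" "\<forall>s\<in>ball z1 d1. \<forall>\<alpha>\<in>{0<..1/2}. Re s \<ge> 1 - real M \<longrightarrow>
    norm (zeta_model \<kappa>1 s \<alpha>) \<le> C1 * (1 / \<alpha>) ^ M \<and> norm (main_term K \<kappa>1 s \<alpha>) \<le> C1 * (1 / \<alpha>) ^ M \<and>
    norm (zeta_model \<kappa>1 s \<alpha> - main_term K \<kappa>1 s \<alpha>) \<le> C1 * \<alpha> ^ K" using bounds[OF ok(1) z(1)] by blast
  obtain d2 C2 where 2: "d2 > 0" "C2 \<ge> 0" "\<forall>s\<in>ball z2 d2. \<forall>\<alpha>\<in>{0<..1/2}. Re s \<ge> 1 - real M \<longrightarrow>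
    norm (zeta_model \<kappa>2 s \<alpha>) \<le> C2 * (1 / \<alpha>) ^ M \<and> norm (main_term K \<kappa>2 s \<alpha>) \<le> C2 * (1 / \<alpha>) ^ M \<and>
    norm (zeta_model \<kappa>2 s \<alpha> - main_term K \<kappa>2 s \<alpha>) \<le> C2 * \<alpha> ^ K" using bounds[OF ok(2) z(2)] by blast
  obtain d3 C3 where 3: "d3 > 0" "C3 \<ge> 0" "\<forall>s\<in>ball z3 d3. \<forall>\<alpha>\<in>{0<..1/2}. Re s \<ge> 1 - real M \<longrightarrow>
    norm (zeta_model \<kappa>3 s \<alpha>) \<le> C3 * (1 / \<alpha>) ^ M \<and> norm (main_term K \<kappa>3 s \<alpha>) \<le> C3 * (1 / \<alpha>) ^ M \<and>
    norm (zeta_model \<kappa>3 s \<alpha> - main_term K \<kappa>3 s \<alpha>) \<le> C3 * \<alpha> ^ K" using bounds[OF ok(3) z(3)] by blast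
  have prod3: "norm (x * y * w) \<le> C1 * C2 * C3"
    if "norm x \<le> C1 * p" "norm y \<le> C2 * q" "norm w \<le> C3 * r" "p * q * r = 1" "p \<ge> 0" "q \<ge> 0" "r \<ge> 0"
    for x y w :: complex and p q r :: real
  proof -
    have "norm (x * y * w) \<le> (C1 * p) * (C2 * q) * (C3 * r)"
      unfolding norm_mult using that 1(2) 2(2) 3(2) by (intro mult_mono mult_nonneg_nonneg) auto
    also have "\<dots> = C1 * C2 * C3 * (p * q * r)" by (simp only: mult_ac)
    finally show ?thesis using that by simp
  qed
  have "norm (product_remainder K \<kappa>1 \<kappa>2 \<kappa>3 s1 s2 s3 \<alpha>) \<le> 3 * (C1 * C2 * C3)"
    if s: "s1 \<in> ball z1 (min d1 (min d2 d3))" "s2 \<in> ball z2 (min d1 (min d2 d3))" "s3 \<in> ball z3 (min d1 (min d2 d3))"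
      and \<alpha>: "\<alpha> \<in> {0<..1/2}" and M: "Re s1 \<ge> 1 - real M" "Re s2 \<ge> 1 - real M" "Re s3 \<ge> 1 - real M" for s1 s2 s3 \<alpha>
  proof -
    define u v where "u = (1 / \<alpha>) ^ M" and "v = \<alpha> ^ K"
    have uv: "u \<ge> 0" "v \<ge> 0" using \<alpha> by (auto simp: u_def v_def)
    have "v * u * u = 1"
      using \<alpha> by (simp add: u_def v_def K(1) power_mult power2_eq_square power_mult_distrib[symmetric] mult.commute[of 2] power_one_over)
    then have w: "v * u * u = 1" "u * v * u = 1" "u * u * v = 1" by (simp_all add: mult_ac)
    have x: "norm (zeta_model \<kappa>1 s1 \<alpha>) \<le> C1 * u" "norm (main_term K \<kappa>1 s1 \<alpha>) \<le> C1 * u" "norm (zeta_model \<kappa>1 s1 \<alpha> - main_term K \<kappa>1 s1 \<alpha>) \<le> C1 * v"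
      "norm (zeta_model \<kappa>2 s2 \<alpha>) \<le> C2 * u" "norm (main_term K \<kappa>2 s2 \<alpha>) \<le> C2 * u" "norm (zeta_model \<kappa>2 s2 \<alpha> - main_term K \<kappa>2 s2 \<alpha>) \<le> C2 * v"
      "norm (zeta_model \<kappa>3 s3 \<alpha>) \<le> C3 * u" "norm (main_term K \<kappa>3 s3 \<alpha>) \<le> C3 * u" "norm (zeta_model \<kappa>3 s3 \<alpha> - main_term K \<kappa>3 s3 \<alpha>) \<le> C3 * v"
      unfolding u_def v_def using 1(3) 2(3) 3(3) s \<alpha> M by auto
    have "product_remainder K \<kappa>1 \<kappa>2 \<kappa>3 s1 s2 s3 \<alpha> =
        ((zeta_model \<kappa>1 s1 \<alpha> - main_term K \<kappa>1 s1 \<alpha>) * zeta_model \<kappa>2 s2 \<alpha> * zeta_model \<kappa>3 s3 \<alpha> +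
        main_term K \<kappa>1 s1 \<alpha> * (zeta_model \<kappa>2 s2 \<alpha> - main_term K \<kappa>2 s2 \<alpha>) * zeta_model \<kappa>3 s3 \<alpha>) +
        main_term K \<kappa>1 s1 \<alpha> * main_term K \<kappa>2 s2 \<alpha> * (zeta_model \<kappa>3 s3 \<alpha> - main_term K \<kappa>3 s3 \<alpha>)"
      by (simp add: product_remainder_def algebra_simps)
    also have "norm \<dots> \<le> (C1 * C2 * C3 + C1 * C2 * C3) + C1 * C2 * C3"
      by (intro norm_triangle_mono prod3[OF _ _ _ w(1)] prod3[OF _ _ _ w(2)] prod3[OF _ _ _ w(3)] x uv)
    finally show ?thesis by simp
  qed
  then show ?thesis
    using 1(1) 2(1) 3(1) by (intro exI[of _ "min d1 (min d2 d3)"] conjI exI[of _ "3 * (C1 * C2 * C3)"]) auto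
qed

lemma continuous_on_zeta_model:
  assumes "kappa_ok \<kappa>"
  shows "continuous_on {0<..1/2} (zeta_model \<kappa> s)"
proof -
  have "continuous_on {0<..1/2} (\<lambda>\<alpha>. exp ((s - 1) * of_real (ln \<alpha>)))"
    by (intro continuous_intros) auto
  then have 1: "continuous_on {0<..1/2} (\<lambda>\<alpha>. complex_of_real \<alpha> powr (s - 1))"
    by (rule continuous_on_eq) (auto simp: powr_def Ln_of_real)
  have 2: "continuous_on {0<..1/2} (\<lambda>\<alpha>. zeta_reg (1 - s) (1 + snd \<kappa> * \<alpha>))"
    by (intro continuous_zeta_reg_compose continuous_intros) (use kappa_pos[OF assms] in auto)
  have "continuous_on {0<..1/2} (\<lambda>\<alpha>. fst \<kappa> * of_real \<alpha> powr (s - 1) - zeta_reg (1 - s) (1 + snd \<kappa> * \<alpha>) / s)"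
  proof (intro continuous_on_diff continuous_on_mult continuous_on_const 1)
    show "continuous_on {0<..1/2} (\<lambda>\<alpha>. zeta_reg (1 - s) (1 + snd \<kappa> * \<alpha>) / s)"
      unfolding divide_inverse[of _ s] by (rule continuous_on_mult[OF 2 continuous_on_const])
  qed
  then show ?thesis by (simp add: zeta_model_def[abs_def])
qed

lemma continuous_on_main_term: "continuous_on {0<..1/2} (main_term K \<kappa> s)"
proof -
  have "continuous_on {0<..1/2} (\<lambda>\<alpha>. exp ((s - 1) * of_real (ln \<alpha>)))"
    by (intro continuous_intros) auto
  then have 1: "continuous_on {0<..1/2} (\<lambda>\<alpha>. complex_of_real \<alpha> powr (s - 1))"
    by (rule continuous_on_eq) (auto simp: powr_def Ln_of_real)
  have "continuous_on {0<..1/2} (\<lambda>\<alpha>. fst \<kappa> * of_real \<alpha> powr (s - 1) + (\<Sum>i<K. taylor_coef (snd \<kappa>) i s * of_real \<alpha> ^ i))"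
    by (intro continuous_on_add continuous_on_mult continuous_on_const 1 continuous_on_sum continuous_on_power continuous_intros)
  then show ?thesis by (simp add: main_term_def[abs_def])
qed

lemma continuous_on_product_remainder:
  assumes ok: "kappa_ok \<kappa>1" "kappa_ok \<kappa>2" "kappa_ok \<kappa>3"
  shows "continuous_on {0<..1/2} (product_remainder K \<kappa>1 \<kappa>2 \<kappa>3 s1 s2 s3)"
  unfolding product_remainder_def[abs_def]
  by (intro continuous_on_diff continuous_on_mult continuous_on_zeta_model continuous_on_main_term ok)

lemma finite_measure_half: "finite_measure (lebesgue_on {0<..1/2::real})"
  by (intro finite_measure_lebesgue_on bounded_set_imp_lmeasurable) (auto intro: bounded_subset[of "{0..1/2}"])

lemma holomorphic_zeta_model: "kappa_ok \<kappa> \<Longrightarrow> \<alpha> \<in> {0<..1/2} \<Longrightarrow> 0 \<notin> S \<Longrightarrow> (\<lambda>s. zeta_model \<kappa> s \<alpha>) holomorphic_on S"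
  unfolding zeta_model_def using kappa_pos[of \<kappa> \<alpha>]
  by (intro holomorphic_intros holomorphic_of_real_powr holomorphic_zeta_reg_compose) auto

lemma holomorphic_main_term: "\<alpha> \<in> {0<..1/2} \<Longrightarrow> 0 \<notin> S \<Longrightarrow> (\<lambda>s. main_term K \<kappa> s \<alpha>) holomorphic_on S"
  unfolding main_term_def
  by (intro holomorphic_intros holomorphic_of_real_powr holomorphic_taylor_coef) auto

lemma holomorphic_compose: "f holomorphic_on T \<Longrightarrow> S holomorphic_on W \<Longrightarrow> S ` W \<subseteq> T \<Longrightarrow> (\<lambda>t. f (S t)) holomorphic_on W"
  using holomorphic_on_compose_gen[of S W f T] by (simp add: o_def)

text \<open>With no exponent equal to -1 the primitives at 1/2 are holomorphic. The remainder is
  locally bounded by a constant, hence dominated on a set of finite measure.\<close>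

lemma finite_part_holomorphic:
  fixes S1 S2 S3 :: "complex \<Rightarrow> complex"
  assumes ok: "kappa_ok \<kappa>1" "kappa_ok \<kappa>2" "kappa_ok \<kappa>3" and K: "K = 2 * M" "K > 0"
    and W: "open W" and S: "S1 holomorphic_on W" "S2 holomorphic_on W" "S3 holomorphic_on W"
    and ne: "\<And>t. t \<in> W \<Longrightarrow> S1 t \<noteq> 0 \<and> S2 t \<noteq> 0 \<and> S3 t \<noteq> 0"
    and M: "\<And>t. t \<in> W \<Longrightarrow> Re (S1 t) \<ge> 1 - real M \<and> Re (S2 t) \<ge> 1 - real M \<and> Re (S3 t) \<ge> 1 - real M"
    and ex: "\<And>t p. t \<in> W \<Longrightarrow> p \<in> idx3 K \<Longrightarrow> exponent3 K p (S1 t) (S2 t) (S3 t) \<noteq> - 1"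
  shows "(\<lambda>t. finite_part K \<kappa>1 \<kappa>2 \<kappa>3 (S1 t) (S2 t) (S3 t)) holomorphic_on W"
  unfolding finite_part_def
proof (intro holomorphic_on_add holomorphic_on_sum holomorphic_on_mult)
  have hol: "(\<lambda>t. expansion_coef K \<kappa> j (S t)) holomorphic_on W" if "S holomorphic_on W" "\<And>t. t \<in> W \<Longrightarrow> S t \<noteq> 0" for S \<kappa> j
  proof (cases "j = K")
    case False
    have "(\<lambda>t. taylor_coef (snd \<kappa>) j (S t)) holomorphic_on W"
      by (rule holomorphic_compose[OF holomorphic_taylor_coef[of "- {0}"] that(1)]) (use that(2) in auto)
    then show ?thesis using False by (simp add: expansion_coef_def)
  qed (simp add: expansion_coef_def)
  have hol': "(\<lambda>t. expansion_exponent K j (S t)) holomorphic_on W" if "S holomorphic_on W" for S j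
    by (cases "j = K") (use that in \<open>auto simp: expansion_exponent_def intro!: holomorphic_intros\<close>)
  fix p assume p: "p \<in> idx3 K"
  show "(\<lambda>t. coef3 K \<kappa>1 \<kappa>2 \<kappa>3 p (S1 t) (S2 t) (S3 t)) holomorphic_on W"
    unfolding coef3_def case_prod_beta by (intro holomorphic_on_mult hol S) (use ne in blast)+
  have E: "(\<lambda>t. exponent3 K p (S1 t) (S2 t) (S3 t)) holomorphic_on W"
    unfolding exponent3_def case_prod_beta by (intro holomorphic_on_add hol' S)
  show "(\<lambda>t. of_real (1/2) powr (exponent3 K p (S1 t) (S2 t) (S3 t) + 1) / (exponent3 K p (S1 t) (S2 t) (S3 t) + 1)) holomorphic_on W"
    by (intro holomorphic_on_divide holomorphic_of_real_powr holomorphic_on_add E holomorphic_on_const)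
       (use ex[OF _ p] in \<open>auto simp: add_eq_0_iff2\<close>)
next
  show "(\<lambda>t. \<integral>\<alpha>. product_remainder K \<kappa>1 \<kappa>2 \<kappa>3 (S1 t) (S2 t) (S3 t) \<alpha> \<partial>(lebesgue_on {0<..1/2})) holomorphic_on W"
  proof (rule holomorphic_on_lebesgue_integral[OF W])
    fix \<alpha> :: real assume "\<alpha> \<in> space (lebesgue_on {0<..1/2})"
    then have \<alpha>: "\<alpha> \<in> {0<..1/2}" by simp
    have hX: "(\<lambda>t. zeta_model \<kappa> (S t) \<alpha>) holomorphic_on W" and hm: "(\<lambda>t. main_term K \<kappa> (S t) \<alpha>) holomorphic_on W"
      if "kappa_ok \<kappa>" "S holomorphic_on W" "\<And>t. t \<in> W \<Longrightarrow> S t \<noteq> 0" for \<kappa> S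
    proof -
      have sub: "S ` W \<subseteq> - {0}" by (rule image_subsetI) (simp add: that(3))
      have zero: "(0::complex) \<notin> - {0}" by simp
      show "(\<lambda>t. zeta_model \<kappa> (S t) \<alpha>) holomorphic_on W"
        by (rule holomorphic_compose[OF holomorphic_zeta_model[OF that(1) \<alpha> zero] that(2) sub])
      show "(\<lambda>t. main_term K \<kappa> (S t) \<alpha>) holomorphic_on W"
        by (rule holomorphic_compose[OF holomorphic_main_term[OF \<alpha> zero] that(2) sub])
    qed
    show "(\<lambda>t. product_remainder K \<kappa>1 \<kappa>2 \<kappa>3 (S1 t) (S2 t) (S3 t) \<alpha>) holomorphic_on W"
      unfolding product_remainder_def
      using ne by (intro holomorphic_on_diff holomorphic_on_mult hX[OF ok(1) S(1)] hX[OF ok(2) S(2)]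
          hX[OF ok(3) S(3)] hm[OF ok(1) S(1)] hm[OF ok(2) S(2)] hm[OF ok(3) S(3)]) auto
  next
    show "product_remainder K \<kappa>1 \<kappa>2 \<kappa>3 (S1 t) (S2 t) (S3 t) \<in> borel_measurable (lebesgue_on {0<..1/2})" for t
      by (intro continuous_imp_measurable_on_sets_lebesgue continuous_on_product_remainder ok) auto
    fix t0 assume t0: "t0 \<in> W"
    obtain d C where d: "d > 0" and C: "\<forall>s1\<in>ball (S1 t0) d. \<forall>s2\<in>ball (S2 t0) d. \<forall>s3\<in>ball (S3 t0) d. \<forall>\<alpha>\<in>{0<..1/2}.
        Re s1 \<ge> 1 - real M \<longrightarrow> Re s2 \<ge> 1 - real M \<longrightarrow> Re s3 \<ge> 1 - real M \<longrightarrow> norm (product_remainder K \<kappa>1 \<kappa>2 \<kappa>3 s1 s2 s3 \<alpha>) \<le> C"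
      using product_remainder_bound[OF ok K, of "S1 t0" "S2 t0" "S3 t0"] ne[OF t0] by blast
    have near: "\<exists>e>0. \<forall>t\<in>ball t0 e \<inter> W. S t \<in> ball (S t0) d" if "S holomorphic_on W" for S
    proof -
      have "continuous_on W S" using that by (rule holomorphic_on_imp_continuous_on)
      then obtain e where e: "e > 0" "\<forall>x\<in>W. dist x t0 < e \<longrightarrow> dist (S x) (S t0) < d"
        using t0 d unfolding continuous_on_iff by blast
      then show ?thesis by (intro exI[of _ e]) (simp add: dist_commute)
    qed
    obtain r1 r2 r3 where "r1 > 0" "r2 > 0" "r3 > 0" "\<forall>t\<in>ball t0 r1 \<inter> W. S1 t \<in> ball (S1 t0) d"
        "\<forall>t\<in>ball t0 r2 \<inter> W. S2 t \<in> ball (S2 t0) d" "\<forall>t\<in>ball t0 r3 \<inter> W. S3 t \<in> ball (S3 t0) d"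
      using near[OF S(1)] near[OF S(2)] near[OF S(3)] by metis
    then have "\<forall>t\<in>ball t0 (min r1 (min r2 r3)) \<inter> W. \<forall>\<alpha>\<in>{0<..1/2}. norm (product_remainder K \<kappa>1 \<kappa>2 \<kappa>3 (S1 t) (S2 t) (S3 t) \<alpha>) \<le> C"
      using C M by simp
    moreover have "integrable (lebesgue_on {0<..1/2::real}) (\<lambda>_. C)"
      by (rule finite_measure.integrable_const[OF finite_measure_half])
    ultimately show "\<exists>e>0. \<exists>g. integrable (lebesgue_on {0<..1/2}) g \<and> (\<forall>t\<in>ball t0 e \<inter> W.
        \<forall>\<alpha>\<in>space (lebesgue_on {0<..1/2}). norm (product_remainder K \<kappa>1 \<kappa>2 \<kappa>3 (S1 t) (S2 t) (S3 t) \<alpha>) \<le> g \<alpha>)"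
      using \<open>r1 > 0\<close> \<open>r2 > 0\<close> \<open>r3 > 0\<close>
      by (intro exI[of _ "min r1 (min r2 r3)"] conjI exI[of _ "\<lambda>_. C"]) auto
  qed
qed

text \<open>Only the product is assumed integrable, in the Henstock-Kurzweil sense; single powers of
  its expansion may fail to be. So the powers are integrated over [x, 1/2] all together, and only
  their joint boundary value at 0 is examined.\<close>

lemma finite_part_eq_integral:
  assumes ok: "kappa_ok \<kappa>1" "kappa_ok \<kappa>2" "kappa_ok \<kappa>3" and K: "K = 2 * M" "K > 0"
    and ne: "s1 \<noteq> 0" "s2 \<noteq> 0" "s3 \<noteq> 0"
    and M: "Re s1 \<ge> 1 - real M" "Re s2 \<ge> 1 - real M" "Re s3 \<ge> 1 - real M"
    and ex: "\<And>p. p \<in> idx3 K \<Longrightarrow> exponent3 K p s1 s2 s3 \<noteq> - 1"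
    and int: "(\<lambda>\<alpha>. zeta_model \<kappa>1 s1 \<alpha> * zeta_model \<kappa>2 s2 \<alpha> * zeta_model \<kappa>3 s3 \<alpha>) integrable_on {0<..1/2}"
  shows "integral {0<..1/2} (\<lambda>\<alpha>. zeta_model \<kappa>1 s1 \<alpha> * zeta_model \<kappa>2 s2 \<alpha> * zeta_model \<kappa>3 s3 \<alpha>) = finite_part K \<kappa>1 \<kappa>2 \<kappa>3 s1 s2 s3"
proof -
  let ?R = "product_remainder K \<kappa>1 \<kappa>2 \<kappa>3 s1 s2 s3"
  let ?P = "\<lambda>\<alpha>. zeta_model \<kappa>1 s1 \<alpha> * zeta_model \<kappa>2 s2 \<alpha> * zeta_model \<kappa>3 s3 \<alpha>"
  define c E where "c p = coef3 K \<kappa>1 \<kappa>2 \<kappa>3 p s1 s2 s3" and "E p = exponent3 K p s1 s2 s3" for p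
  let ?m = "\<lambda>\<alpha>::real. \<Sum>p\<in>idx3 K. c p * of_real \<alpha> powr E p"
  have E: "E p + 1 \<noteq> 0" if "p \<in> idx3 K" for p
    using ex[OF that] by (auto simp: E_def add_eq_0_iff2)
  obtain d C where d: "d > 0" and C: "\<forall>z1\<in>ball s1 d. \<forall>z2\<in>ball s2 d. \<forall>z3\<in>ball s3 d. \<forall>\<alpha>\<in>{0<..1/2}.
      Re z1 \<ge> 1 - real M \<longrightarrow> Re z2 \<ge> 1 - real M \<longrightarrow> Re z3 \<ge> 1 - real M \<longrightarrow> norm (product_remainder K \<kappa>1 \<kappa>2 \<kappa>3 z1 z2 z3 \<alpha>) \<le> C"
    using product_remainder_bound[OF ok K ne] by blast
  have bd: "norm (?R \<alpha>) \<le> C" if "\<alpha> \<in> {0<..1/2}" for \<alpha>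
    using C d M that by simp
  have intR: "integrable (lebesgue_on {0<..1/2}) ?R"
  proof (rule Bochner_Integration.integrable_bound)
    show "integrable (lebesgue_on {0<..1/2::real}) (\<lambda>_. C)"
      by (rule finite_measure.integrable_const[OF finite_measure_half])
    show "?R \<in> borel_measurable (lebesgue_on {0<..1/2})"
      by (intro continuous_imp_measurable_on_sets_lebesgue continuous_on_product_remainder ok) auto
  qed (use bd in \<open>auto intro!: AE_I2 order.trans[OF bd]\<close>)
  have R: "?R integrable_on {0<..1/2}" "integral {0<..1/2} ?R = (\<integral>\<alpha>. ?R \<alpha> \<partial>(lebesgue_on {0<..1/2}))"
    using intR by (auto intro: integrable_on_lebesgue_on lebesgue_integral_eq_integral[symmetric])
  have eq: "?P \<alpha> = ?m \<alpha> + ?R \<alpha>" if "\<alpha> \<in> {0<..1/2}" for \<alpha>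
    using main_term_product[of \<alpha> K \<kappa>1 s1 \<kappa>2 s2 \<kappa>3 s3] that by (simp add: product_remainder_def c_def E_def)
  \<comment> \<open>The remainder is bounded, so integrability of the product passes to the power
    sum as a whole.\<close>
  have m_int: "?m integrable_on {0<..1/2}"
    by (rule integrable_eq[OF integrable_diff[OF int R(1)]]) (use eq in auto)
  have "(?m has_integral i) {0..1/2} \<longleftrightarrow> (?m has_integral i) {0<..1/2}" for i
    by (rule has_integral_spike_set_eq) (auto intro: negligible_subset[of "{0}"])
  then have m_int': "?m integrable_on {0..1/2}" and m_eq: "integral {0..1/2} ?m = integral {0<..1/2} ?m"
    using m_int by (auto simp: integrable_on_def integral_def)
  define L0 where "L0 = (\<Sum>p\<in>idx3 K. c p * (of_real (1/2) powr (E p + 1) / (E p + 1)))"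
  have FTC: "integral {x..1/2} ?m = L0 - (\<Sum>p\<in>idx3 K. c p / (E p + 1) * of_real x powr (E p + 1))"
    if x: "0 < x" "x \<le> 1/2" for x
  proof (rule integral_unique)
    let ?A = "\<lambda>x::real. \<Sum>p\<in>idx3 K. c p / (E p + 1) * of_real x powr (E p + 1)"
    have "(?m has_integral ?A (1/2) - ?A x) {x..1/2}"
    proof (rule fundamental_theorem_of_calculus[OF x(2)])
      fix y assume y: "y \<in> {x..1/2}"
      have "(?A has_vector_derivative (\<Sum>p\<in>idx3 K. c p / (E p + 1) * ((E p + 1) * of_real y powr (E p + 1 - 1)))) (at y within {x..1/2})"
        using x y by (intro has_vector_derivative_sum has_vector_derivative_mult_right of_real_powr_has_vector_derivative) auto
      moreover have "(\<Sum>p\<in>idx3 K. c p / (E p + 1) * ((E p + 1) * of_real y powr (E p + 1 - 1))) = ?m y"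
        by (intro sum.cong refl) (use E in auto)
      ultimately show "(?A has_vector_derivative ?m y) (at y within {x..1/2})" by metis
    qed
    then show "(?m has_integral L0 - (\<Sum>p\<in>idx3 K. c p / (E p + 1) * of_real x powr (E p + 1))) {x..1/2}"
      by (simp add: L0_def)
  qed
  have "continuous_on {0..1/2} (\<lambda>x. integral {x..1/2} ?m)"
    by (rule indefinite_integral_continuous_1'[OF m_int'])
  then have "((\<lambda>x. integral {x..1/2} ?m) \<longlongrightarrow> integral {0..1/2} ?m) (at 0 within {0..1/2})"
    unfolding continuous_on_def by (rule bspec) simp
  \<comment> \<open>The substitution x = exp (- \<tau>) turns powers into the exponentials of
    \<open>exp_sum_limit_eq_0\<close>, with the nonzero rates \<open>E p + 1\<close>.\<close>
  moreover have "filterlim (\<lambda>\<tau>::real. exp (- \<tau>)) (at 0 within {0..1/2}) at_top"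
    unfolding filterlim_at
  proof
    show "\<forall>\<^sub>F \<tau> in at_top. exp (- \<tau>) \<in> {0..1/2::real} \<and> exp (- \<tau>) \<noteq> 0"
      using eventually_ge_at_top[of "ln 2 :: real"]
    proof eventually_elim
      case (elim \<tau>)
      then have "exp (- \<tau>) \<le> exp (- ln 2)" by simp
      also have "exp (- ln 2) = (1/2::real)" by (simp add: exp_minus)
      finally show ?case by simp
    qed
    show "((\<lambda>\<tau>::real. exp (- \<tau>)) \<longlongrightarrow> 0) at_top" by real_asymp
  qed
  ultimately have "((\<lambda>\<tau>. integral {exp (- \<tau>)..1/2} ?m) \<longlongrightarrow> integral {0..1/2} ?m) at_top"
    by (rule filterlim_compose)
  moreover have "\<forall>\<^sub>F \<tau> in at_top. integral {exp (- \<tau>)..1/2} ?m =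
      L0 - (\<Sum>p\<in>idx3 K. c p / (E p + 1) * exp (- ((E p + 1) * of_real \<tau>)))"
    using eventually_ge_at_top[of "ln 2 :: real"]
  proof eventually_elim
    case (elim \<tau>)
    then have "exp (- \<tau>) \<le> exp (- ln 2)" by simp
    also have "exp (- ln 2) = (1/2::real)" by (simp add: exp_minus)
    finally have "integral {exp (- \<tau>)..1/2} ?m = L0 - (\<Sum>p\<in>idx3 K. c p / (E p + 1) * of_real (exp (- \<tau>)) powr (E p + 1))"
      by (intro FTC) auto
    moreover have "complex_of_real (exp (- \<tau>)) powr z = exp (- (z * of_real \<tau>))" for z
      by (simp add: powr_def Ln_of_real del: of_real_exp)
    ultimately show ?case by simp
  qed
  ultimately have "((\<lambda>\<tau>. L0 - (\<Sum>p\<in>idx3 K. c p / (E p + 1) * exp (- ((E p + 1) * of_real \<tau>)))) \<longlongrightarrow> integral {0..1/2} ?m) at_top"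
    using tendsto_cong by fast
  from tendsto_diff[OF tendsto_const[of L0] this]
  have "((\<lambda>\<tau>::real. \<Sum>p\<in>idx3 K. c p / (E p + 1) * exp (- ((E p + 1) * of_real \<tau>))) \<longlongrightarrow> L0 - integral {0..1/2} ?m) at_top"
    by simp
  then have "L0 - integral {0..1/2} ?m = 0"
    by (rule exp_sum_limit_eq_0[rotated 2]) (use E in auto)
  then have "integral {0<..1/2} ?m = L0" using m_eq by simp
  moreover have "integral {0<..1/2} ?P = integral {0<..1/2} ?m + integral {0<..1/2} ?R"
  proof -
    have "integral {0<..1/2} ?P = integral {0<..1/2} (\<lambda>\<alpha>. ?m \<alpha> + ?R \<alpha>)"
      by (rule integral_cong) (rule eq)
    then show ?thesis using integral_add[OF m_int R(1)] by simp
  qed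
  ultimately show ?thesis
    using R(2) by (simp add: finite_part_def L0_def c_def E_def)
qed

section \<open>Fourier series\<close>

definition ee :: "int \<Rightarrow> real \<Rightarrow> complex" where
  "ee n \<alpha> = exp (2 * of_real pi * \<i> * of_int n * of_real \<alpha>)"

lemma ee_add: "ee (m + n) \<alpha> = ee m \<alpha> * ee n \<alpha>"
  by (simp add: ee_def exp_add[symmetric] algebra_simps)

lemma ee_0 [simp]: "ee 0 \<alpha> = 1"
  by (simp add: ee_def)

lemma norm_ee [simp]: "norm (ee n \<alpha>) = 1"
  by (simp add: ee_def)

lemma ee_shift: "ee n (of_nat m + \<alpha>) = ee n \<alpha>"
proof -
  have "ee n (of_nat m + \<alpha>) = ee n \<alpha> * exp (2 * of_real pi * \<i> * of_int (n * int m))"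
    by (simp add: ee_def exp_add[symmetric] algebra_simps)
  also have "exp (2 * of_real pi * \<i> * of_int (n * int m)) = 1"
    by (auto simp: exp_eq_1 intro!: exI[of _ "n * int m"])
  finally show ?thesis by simp
qed

lemma continuous_on_ee [continuous_intros]: "continuous_on S (ee n)"
  unfolding ee_def by (intro continuous_intros)

text \<open>Test against powers of a trigonometric polynomial that exceeds \<open>1\<close> only near \<open>a\<close>.\<close>

lemma fourier_uniqueness:
  fixes f :: "real \<Rightarrow> complex"
  assumes cont: "continuous_on {0..1} f"
    and coeff: "\<And>n. integral {0..1} (\<lambda>\<alpha>. f \<alpha> * ee n \<alpha>) = 0"
    and a: "a \<in> {0<..<1}"
  shows "f a = 0"
proof (rule ccontr)
  assume fa: "f a \<noteq> 0"
  define c where "c = (norm (f a))\<^sup>2 / 2"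
  have c: "c > 0" using fa by (simp add: c_def)
  \<comment> \<open>Pairing with the value at \<open>a\<close> gives a real function that is
    positive there, so that signs can be controlled.\<close>
  define g where "g \<alpha> = Re (f \<alpha> * cnj (f a))" for \<alpha>
  have contg: "continuous_on {0..1} g"
    unfolding g_def by (intro continuous_intros cont)
  have "f a * cnj (f a) = of_real ((norm (f a))\<^sup>2)" by (rule complex_norm_square[symmetric])
  then have ga: "g a = 2 * c" by (simp add: g_def c_def)
  obtain d0 where d0: "d0 > 0" "\<And>x. x \<in> {0..1} \<Longrightarrow> \<bar>x - a\<bar> < d0 \<Longrightarrow> \<bar>g x - g a\<bar> < c"
  proof -
    have "\<exists>d>0. \<forall>x\<in>{0..1}. dist x a < d \<longrightarrow> dist (g x) (g a) < c"
      using contg a c unfolding continuous_on_iff by auto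
    then show ?thesis using that by (auto simp: dist_real_def)
  qed
  \<comment> \<open>Within distance \<open>d\<close> the function \<open>g\<close> stays above
    \<open>c\<close>, the interval around \<open>a\<close> fits into [0, 1], and 2 pi d stays where
    the cosine decreases.\<close>
  define d where "d = Min {d0 / 2, a, 1 - a, 1/4}"
  have d: "d > 0" "d < d0" "d \<le> a" "d \<le> 1 - a" "d \<le> 1/4" using d0(1) a by (auto simp: d_def min_def)
  \<comment> \<open>On [0, 1] its modulus is at most 1 beyond distance \<open>d\<close> from
    \<open>a\<close>; it is at least 1 within \<open>d\<close> and exceeds 1 by a fixed \<rho>
    within \<open>d/2\<close>.\<close>
  define T where "T \<alpha> = 1 - cos (2 * pi * d) + cos (2 * pi * (\<alpha> - a))" for \<alpha>
  have contT: "continuous_on S T" for S unfolding T_def by (intro continuous_intros)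
  have T_ee: "of_real (T \<alpha>) = of_real (1 - cos (2 * pi * d)) + ee 1 \<alpha> * (ee 1 (- a) / 2) + ee (- 1) \<alpha> * (ee 1 a / 2)" for \<alpha>
  proof -
    have "ee 1 \<alpha> * ee 1 (- a) + ee (- 1) \<alpha> * ee 1 a = 2 * cos (of_real (2 * pi * (\<alpha> - a)))"
      by (simp add: ee_def cos_exp_eq exp_add[symmetric] algebra_simps)
    then show ?thesis by (simp add: T_def cos_of_real[symmetric] add_divide_distrib[symmetric])
  qed
  have int_n: "(\<lambda>\<alpha>. f \<alpha> * of_real (T \<alpha>) ^ n * ee k \<alpha>) integrable_on {0..1}" for n k
    by (intro integrable_continuous_real continuous_intros cont contT)
  have zero: "integral {0..1} (\<lambda>\<alpha>. f \<alpha> * of_real (T \<alpha>) ^ n * ee k \<alpha>) = 0" for n k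
  proof (induction n arbitrary: k)
    case 0
    then show ?case using coeff by simp
  next
    case (Suc n)
    let ?h = "\<lambda>k \<alpha>. f \<alpha> * of_real (T \<alpha>) ^ n * ee k \<alpha>"
    have "f \<alpha> * of_real (T \<alpha>) ^ Suc n * ee k \<alpha> = of_real (1 - cos (2 * pi * d)) * ?h k \<alpha> +
        ((ee 1 (- a) / 2) * ?h (k + 1) \<alpha> + (ee 1 a / 2) * ?h (k + (- 1)) \<alpha>)" for \<alpha>
      unfolding power_Suc T_ee[of \<alpha>] ee_add by (simp only: distrib_left distrib_right mult_ac add_ac)
    then have "integral {0..1} (\<lambda>\<alpha>. f \<alpha> * of_real (T \<alpha>) ^ Suc n * ee k \<alpha>) =
        of_real (1 - cos (2 * pi * d)) * integral {0..1} (?h k) +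
        ((ee 1 (- a) / 2) * integral {0..1} (?h (k + 1)) + (ee 1 a / 2) * integral {0..1} (?h (k + (- 1))))"
      by (simp only:) (subst integral_add, (intro integrable_add integrable_on_mult_right int_n)+,
          subst integral_add, (intro integrable_add integrable_on_mult_right int_n)+, simp only: integral_mult_right)
    then show ?case using Suc by simp
  qed
  have intg: "(\<lambda>\<alpha>. g \<alpha> * T \<alpha> ^ n) integrable_on {u..v}" if "0 \<le> u" "v \<le> 1" for n u v
    by (intro integrable_continuous_real continuous_intros contT continuous_on_subset[OF contg]) (use that in auto)
  have g_zero: "integral {0..1} (\<lambda>\<alpha>. g \<alpha> * T \<alpha> ^ n) = 0" for n
  proof -
    have "((\<lambda>\<alpha>. f \<alpha> * of_real (T \<alpha>) ^ n * ee 0 \<alpha>) has_integral 0) {0..1}"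
      using integrable_integral[OF int_n[of n 0]] zero[of n 0] by simp
    from has_integral_linear[OF has_integral_mult_left[OF this, of "cnj (f a)"] bounded_linear_Re]
    have "((\<lambda>\<alpha>. Re (f \<alpha> * of_real (T \<alpha>) ^ n * ee 0 \<alpha> * cnj (f a))) has_integral 0) {0..1}"
      by (simp add: o_def)
    also have "(\<lambda>\<alpha>. Re (f \<alpha> * of_real (T \<alpha>) ^ n * ee 0 \<alpha> * cnj (f a))) = (\<lambda>\<alpha>. g \<alpha> * T \<alpha> ^ n)"
    proof
      fix \<alpha>
      have eq: "f \<alpha> * of_real (T \<alpha>) ^ n * ee 0 \<alpha> * cnj (f a) = of_real (T \<alpha> ^ n) * (f \<alpha> * cnj (f a))" by simp
      have Re_mult: "Re (of_real r * z) = Re z * r" for r z by simp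
      show "Re (f \<alpha> * of_real (T \<alpha>) ^ n * ee 0 \<alpha> * cnj (f a)) = g \<alpha> * T \<alpha> ^ n"
        unfolding g_def eq Re_mult ..
    qed
    finally show ?thesis by (rule integral_unique)
  qed
  obtain B where B: "B \<ge> 0" "\<And>x. x \<in> {0..1} \<Longrightarrow> \<bar>g x\<bar> \<le> B"
  proof -
    have "compact (g ` {0..1})" by (intro compact_continuous_image contg) auto
    then obtain B where "\<forall>y\<in>g ` {0..1}. norm y \<le> B" using compact_imp_bounded bounded_iff by metis
    then show ?thesis using that[of "max B 0"] by force
  qed
  have T_out: "\<bar>T x\<bar> \<le> 1" if "x \<in> {0..1}" "\<bar>x - a\<bar> \<ge> d" for x
  proof -
    have y: "\<bar>x - a\<bar> \<le> 1 - d" using that a d by auto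
    have "cos (2 * pi * (x - a)) = cos (2 * pi * \<bar>x - a\<bar>)" by (simp add: abs_if)
         (metis cos_minus minus_diff_eq mult_minus_right)
    also have "\<dots> \<le> cos (2 * pi * d)"
    proof (cases "\<bar>x - a\<bar> \<le> 1/2")
      case True
      then show ?thesis using that d by (intro cos_monotone_0_pi_le) auto
    next
      case False
      have "cos (2 * pi * \<bar>x - a\<bar>) = cos (2 * pi * (1 - \<bar>x - a\<bar>))"
        using cos_2pi_minus[of "2 * pi * \<bar>x - a\<bar>"] by (simp add: algebra_simps)
      also have "\<dots> \<le> cos (2 * pi * d)" using False y d by (intro cos_monotone_0_pi_le) auto
      finally show ?thesis .
    qed
    finally have "T x \<le> 1" by (simp add: T_def)
    moreover have "T x \<ge> - 1"
    proof -
      have "cos (2 * pi * d) \<le> 1" "cos (2 * pi * (x - a)) \<ge> - 1" by auto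
      then show ?thesis unfolding T_def by linarith
    qed
    ultimately show ?thesis by simp
  qed
  have T_in: "T x \<ge> 1" if "\<bar>x - a\<bar> \<le> d" for x
  proof -
    have "cos (2 * pi * (x - a)) = cos (2 * pi * \<bar>x - a\<bar>)" by (simp add: abs_if)
         (metis cos_minus minus_diff_eq mult_minus_right)
    moreover have "cos (2 * pi * \<bar>x - a\<bar>) \<ge> cos (2 * pi * d)"
      using that d by (intro cos_monotone_0_pi_le) auto
    ultimately show ?thesis by (simp add: T_def)
  qed
  define \<rho> where "\<rho> = cos (2 * pi * (d/2)) - cos (2 * pi * d)"
  have \<rho>: "\<rho> > 0" unfolding \<rho>_def using d by (auto intro!: cos_monotone_0_pi)
  have T_mid: "T x \<ge> 1 + \<rho>" if "\<bar>x - a\<bar> \<le> d/2" for x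
  proof -
    have "cos (2 * pi * (x - a)) = cos (2 * pi * \<bar>x - a\<bar>)" by (simp add: abs_if)
         (metis cos_minus minus_diff_eq mult_minus_right)
    moreover have "cos (2 * pi * \<bar>x - a\<bar>) \<ge> cos (2 * pi * (d/2))"
      using that d by (intro cos_monotone_0_pi_le) auto
    ultimately show ?thesis by (simp add: T_def \<rho>_def)
  qed
  have g_in: "g x \<ge> c" if "\<bar>x - a\<bar> \<le> d" "x \<in> {0..1}" for x
    using d0(2)[OF that(2)] that d ga by auto
  \<comment> \<open>The two outer intervals lose at most \<open>B\<close> each and the intermediate
    ones contribute nonnegatively. Bernoulli's inequality makes the middle grow linearly in n,
    although the total is 0.\<close>
  have bound: "0 \<ge> - 2 * B + c * d * (1 + real n * \<rho>)" for n
  proof -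
    let ?I = "\<lambda>u v. integral {u..v} (\<lambda>\<alpha>. g \<alpha> * T \<alpha> ^ n)"
    have comb: "?I u v + ?I v w = ?I u w" if "0 \<le> u" "u \<le> v" "v \<le> w" "w \<le> 1" for u v w
      by (rule Henstock_Kurzweil_Integration.integral_combine[OF that(2,3) intg[OF that(1,4)]])
    have split: "?I 0 1 = ?I 0 (a - d) + (?I (a - d) (a - d/2) + ?I (a - d/2) (a + d/2) + ?I (a + d/2) (a + d)) + ?I (a + d) 1"
      using d comb[of 0 "a - d" "a - d/2"] comb[of 0 "a - d/2" "a + d/2"] comb[of 0 "a + d/2" "a + d"] comb[of 0 "a + d" 1] by auto
    have out: "?I u v \<ge> - B" if uv: "0 \<le> u" "u \<le> v" "v \<le> 1" and far: "\<And>x. x \<in> {u..v} \<Longrightarrow> \<bar>x - a\<bar> \<ge> d" for u v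
    proof -
      have "integral {u..v} (\<lambda>_. - B) \<le> ?I u v"
      proof (rule integral_le)
        fix x assume x: "x \<in> {u..v}"
        then have "\<bar>g x * T x ^ n\<bar> \<le> B * 1"
          unfolding abs_mult power_abs using uv far B T_out[of x] by (intro mult_mono power_le_one) auto
        then show "- B \<le> g x * T x ^ n" by auto
      qed (use uv intg in auto)
      moreover have "(v - u) * B \<le> 1 * B" using uv B by (intro mult_right_mono) auto
      ultimately show ?thesis using uv by simp
    qed
    have ann: "?I u v \<ge> 0" if uv: "0 \<le> u" "u \<le> v" "v \<le> 1" and near: "\<And>x. x \<in> {u..v} \<Longrightarrow> \<bar>x - a\<bar> \<le> d" for u v
    proof (rule integral_nonneg)
      fix x assume x: "x \<in> {u..v}"
      have "g x \<ge> 0" "T x \<ge> 0" using g_in[OF near[OF x]] T_in[OF near[OF x]] x uv c by auto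
      then show "0 \<le> g x * T x ^ n" by simp
    qed (use uv intg in auto)
    have mid: "?I (a - d/2) (a + d/2) \<ge> c * d * (1 + real n * \<rho>)"
    proof -
      have "integral {a - d/2..a + d/2} (\<lambda>_. c * (1 + real n * \<rho>)) \<le> ?I (a - d/2) (a + d/2)"
      proof (rule integral_le)
        fix x assume x: "x \<in> {a - d/2..a + d/2}"
        then have near: "\<bar>x - a\<bar> \<le> d/2" unfolding abs_le_iff by auto
        have "1 + real n * \<rho> \<le> (1 + \<rho>) ^ n" using \<rho> Bernoulli_inequality[of \<rho> n] by (simp add: mult.commute)
        also have "\<dots> \<le> T x ^ n" using T_mid[OF near] \<rho> by (intro power_mono) auto
        finally have "1 + real n * \<rho> \<le> T x ^ n" .
        moreover have "c \<le> g x" using near d x a by (intro g_in) auto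
        ultimately show "c * (1 + real n * \<rho>) \<le> g x * T x ^ n"
          using c \<rho> by (intro mult_mono) auto
      qed (use d in \<open>auto intro!: intg\<close>)
      then show ?thesis using d by (simp add: mult.commute mult.left_commute)
    qed
    have "?I 0 (a - d) \<ge> - B" "?I (a + d) 1 \<ge> - B" using d by (auto intro!: out)
    moreover have "?I (a - d) (a - d/2) \<ge> 0" "?I (a + d/2) (a + d) \<ge> 0"
      using d by (auto intro!: ann simp: abs_le_iff)
    ultimately show ?thesis using split mid g_zero[of n] by linarith
  qed
  obtain n where "real n > 2 * B / (c * d * \<rho>)" using reals_Archimedean2 by blast
  then have "2 * B < real n * (c * d * \<rho>)" using c d \<rho> by (simp add: divide_less_eq)
  moreover have "c * d > 0" using c d by simp
  ultimately show False using bound[of n] by (simp add: algebra_simps)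
qed

section \<open>Gamma integrals on the imaginary axis\<close>

lemma absolutely_integrable_bounded_continuous:
  fixes f :: "real \<Rightarrow> complex"
  assumes "continuous_on S f" "S \<in> sets lebesgue" "g integrable_on S" "\<And>x. x \<in> S \<Longrightarrow> norm (f x) \<le> g x"
  shows "f absolutely_integrable_on S"
  by (rule measurable_bounded_by_integrable_imp_absolutely_integrable[OF _ assms(2,3)])
     (use assms in \<open>auto intro: continuous_imp_measurable_on_sets_lebesgue\<close>)

lemma holomorphic_on_integral_dominated:
  fixes f :: "complex \<Rightarrow> real \<Rightarrow> complex"
  assumes U: "open U" and S: "S \<in> sets lebesgue"
    and hol: "\<And>x. x \<in> S \<Longrightarrow> (\<lambda>t. f t x) holomorphic_on U"
    and cont: "\<And>t. t \<in> U \<Longrightarrow> continuous_on S (f t)"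
    and dom: "\<And>t0. t0 \<in> U \<Longrightarrow> \<exists>d>0. \<exists>g. g integrable_on S \<and> (\<forall>t\<in>ball t0 d \<inter> U. \<forall>x\<in>S. norm (f t x) \<le> g x)"
  shows "(\<lambda>t. integral S (f t)) holomorphic_on U"
proof -
  have dom': "\<exists>d>0. \<exists>g. integrable (lebesgue_on S) g \<and>
      (\<forall>t\<in>ball t0 d \<inter> U. \<forall>x\<in>space (lebesgue_on S). norm (f t x) \<le> g x)" if t0: "t0 \<in> U" for t0
  proof -
    obtain d g where d: "d > 0" "g integrable_on S" "\<forall>t\<in>ball t0 d \<inter> U. \<forall>x\<in>S. norm (f t x) \<le> g x"
      using dom[OF t0] by blast
    have "g absolutely_integrable_on S"
    proof (rule nonnegative_absolutely_integrable_1[OF d(2)])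
      fix x assume "x \<in> S"
      then have "norm (f t0 x) \<le> g x" using d t0 by simp
      then show "0 \<le> g x" using norm_ge_zero order.trans by blast
    qed
    then have "integrable (lebesgue_on S) g"
      using S by (simp add: absolutely_integrable_on_def integrable_restrict_space set_integrable_def)
    then show ?thesis using d S by (intro exI[of _ d] conjI exI[of _ g]) auto
  qed
  have eq: "(\<integral>x. f t x \<partial>(lebesgue_on S)) = integral S (f t)" if t: "t \<in> U" for t
  proof -
    obtain d g where d: "d > 0" "g integrable_on S" "\<forall>t\<in>ball t d \<inter> U. \<forall>x\<in>S. norm (f t x) \<le> g x"
      using dom[OF t] by blast
    have "f t absolutely_integrable_on S"
      by (rule absolutely_integrable_bounded_continuous[OF cont[OF t] S d(2)]) (use d t in auto)
    then have "integrable (lebesgue_on S) (f t)"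
      using S by (simp add: integrable_restrict_space set_integrable_def)
    then show ?thesis by (rule lebesgue_integral_eq_integral[OF _ S])
  qed
  have "(\<lambda>t. \<integral>x. f t x \<partial>(lebesgue_on S)) holomorphic_on U"
    by (rule holomorphic_on_lebesgue_integral[OF U _ _ dom'])
       (use S hol cont in \<open>auto intro: continuous_imp_measurable_on_sets_lebesgue\<close>)
  then show ?thesis by (rule holomorphic_transform) (rule eq)
qed

section \<open>The Gamma integral in the right half-plane\<close>

definition gamma_kernel :: "complex \<Rightarrow> complex \<Rightarrow> real \<Rightarrow> complex" where
  "gamma_kernel s z x = of_real x powr (s - 1) * exp (- (z * of_real x))"

lemma continuous_on_of_real_powr:
  assumes "S \<subseteq> {0<..}"
  shows "continuous_on S (\<lambda>x. complex_of_real x powr w)"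
proof -
  have "continuous_on S (\<lambda>x. exp (w * of_real (ln x)))"
    using assms by (intro continuous_intros) auto
  then show ?thesis
    by (rule continuous_on_eq) (use assms in \<open>auto simp: powr_def Ln_of_real subset_iff\<close>)
qed

lemma continuous_on_gamma_kernel: "S \<subseteq> {0<..} \<Longrightarrow> continuous_on S (gamma_kernel s z)"
  unfolding gamma_kernel_def by (intro continuous_on_mult continuous_on_of_real_powr continuous_intros)

lemma norm_gamma_kernel: "x > 0 \<Longrightarrow> norm (gamma_kernel s z x) = x powr (Re s - 1) * exp (- (Re z * x))"
  by (simp add: gamma_kernel_def norm_mult norm_of_real_powr powr_def)

lemma gamma_weight_integrable:
  fixes \<sigma> c :: real
  assumes "\<sigma> > 0" "c > 0"
  shows "(\<lambda>x. x powr (\<sigma> - 1) * exp (- (c * x))) integrable_on {0<..}"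
proof -
  have "(\<lambda>t. complex_of_real t powr (of_real \<sigma> - 1) / of_real (exp (c * t))) absolutely_integrable_on {0<..}"
    by (rule absolutely_integrable_Gamma_integral) (use assms in auto)
  then have "(\<lambda>t. norm (complex_of_real t powr (of_real \<sigma> - 1) / of_real (exp (c * t)))) integrable_on {0<..}"
    by (simp add: absolutely_integrable_on_def)
  then show ?thesis
  proof (rule integrable_eq)
    fix x :: real assume x: "x \<in> {0<..}"
    have "norm (complex_of_real x powr (of_real \<sigma> - 1) / of_real (exp (c * x))) = exp ((\<sigma> - 1) * ln x) / exp (c * x)"
      using x by (simp only: norm_divide norm_of_real norm_of_real_powr greaterThan_iff) simp
    then show "norm (complex_of_real x powr (of_real \<sigma> - 1) / of_real (exp (c * x))) = x powr (\<sigma> - 1) * exp (- (c * x))"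
      using x by (simp only: powr_def greaterThan_iff exp_minus divide_inverse) simp
  qed
qed

lemma gamma_kernel_abs_integrable:
  assumes "Re s > 0" "Re z > 0"
  shows "gamma_kernel s z absolutely_integrable_on {0<..}"
  by (rule absolutely_integrable_bounded_continuous[OF continuous_on_gamma_kernel _ gamma_weight_integrable[OF assms]])
     (auto simp: norm_gamma_kernel)

text \<open>The substitution of c x for x, carried out for the Lebesgue integral of the kernel
  extended by zero to the whole line.\<close>

lemma Gamma_integral_scaled:
  assumes s: "Re s > 0" and c: "c > 0"
  shows "integral {0<..} (gamma_kernel s (of_real c)) = Gamma s * of_real c powr (- s)"
proof -
  have L: "(\<integral>x. indicator {0<..} x *\<^sub>R gamma_kernel s (of_real c) x \<partial>lborel) = integral {0<..} (gamma_kernel s (of_real c))"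
    if "c > 0" for c
  proof -
    have "set_integrable lebesgue {0<..} (gamma_kernel s (of_real c))"
      by (rule gamma_kernel_abs_integrable) (use s that in auto)
    then have "set_integrable lborel {0<..} (gamma_kernel s (of_real c))"
      unfolding set_integrable_def
      by (subst (asm) integrable_completion)
         (auto intro!: borel_measurable_continuous_on_indicator continuous_on_gamma_kernel)
    from set_borel_integral_eq_integral(2)[OF this] show ?thesis
      by (simp add: set_lebesgue_integral_def)
  qed
  have "((\<lambda>t. of_real t powr (s - 1) / of_real (exp t)) has_integral Gamma s) {0<..}"
    by (rule Gamma_integral_complex'[OF s])
  then have "(gamma_kernel s (of_real 1) has_integral Gamma s) {0<..}"
    by (rule has_integral_eq[rotated]) (auto simp: gamma_kernel_def exp_minus divide_inverse exp_of_real)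
  then have "Gamma s = (\<integral>x. indicator {0<..} x *\<^sub>R gamma_kernel s (of_real 1) x \<partial>lborel)"
    using L[of 1] by (simp add: integral_unique)
  also have "\<dots> = \<bar>c\<bar> *\<^sub>R (\<integral>x. indicator {0<..} (0 + c * x) *\<^sub>R gamma_kernel s (of_real 1) (0 + c * x) \<partial>lborel)"
    by (rule lborel_integral_real_affine) (use c in auto)
  also have "(\<lambda>x. indicator {0<..} (0 + c * x) *\<^sub>R gamma_kernel s (of_real 1) (0 + c * x)) =
      (\<lambda>x. of_real c powr (s - 1) * (indicator {0<..} x *\<^sub>R gamma_kernel s (of_real c) x))"
  proof
    fix x :: real
    show "indicator {0<..} (0 + c * x) *\<^sub>R gamma_kernel s (of_real 1) (0 + c * x) =
      of_real c powr (s - 1) * (indicator {0<..} x *\<^sub>R gamma_kernel s (of_real c) x)"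
    proof (cases "x > 0")
      case True
      have "complex_of_real (c * x) powr (s - 1) = of_real c powr (s - 1) * of_real x powr (s - 1)"
        using c True by (simp add: powr_times_real)
      then show ?thesis using c True by (simp add: gamma_kernel_def)
    next
      case False
      then have "\<not> 0 < c * x" using c by (simp add: zero_less_mult_iff)
      then show ?thesis using False by simp
    qed
  qed
  also have "(\<integral>x. of_real c powr (s - 1) * (indicator {0<..} x *\<^sub>R gamma_kernel s (of_real c) x) \<partial>lborel) =
      of_real c powr (s - 1) * integral {0<..} (gamma_kernel s (of_real c))"
    unfolding L[OF c, symmetric] by (rule integral_mult_right_zero)
  finally have "Gamma s = of_real c * of_real c powr (s - 1) * integral {0<..} (gamma_kernel s (of_real c))"
    using c by (simp add: scaleR_conv_of_real)
  also have "of_real c * of_real c powr (s - 1) = complex_of_real c powr s"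
    using c of_real_powr_add1[of c "s - 1"] by simp
  finally show ?thesis using c by (simp add: powr_minus field_simps)
qed

lemma analytic_continuation_real:
  assumes "f holomorphic_on {z. Re z > 0}" "g holomorphic_on {z. Re z > 0}"
    and eq: "\<And>c. c > 0 \<Longrightarrow> f (of_real c) = g (of_real c)" and z: "Re z > 0"
  shows "f z = g z"
proof -
  have "f z - g z = 0"
  proof (rule analytic_continuation[where f = "\<lambda>z. f z - g z" and S = "{z. Re z > 0}" and U = "of_real ` {0<..}" and \<xi> = 1])
    show "(\<lambda>z. f z - g z) holomorphic_on {z. Re z > 0}" by (intro holomorphic_intros assms)
    show "connected {z. Re z > 0}" by (intro convex_connected convex_halfspace_Re_gt)
    show "1 islimpt complex_of_real ` {0<..}"
      unfolding islimpt_approachable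
    proof (intro allI impI)
      fix e :: real assume e: "e > 0"
      show "\<exists>x'\<in>complex_of_real ` {0<..}. x' \<noteq> 1 \<and> dist x' 1 < e"
      proof (rule bexI[of _ "complex_of_real (1 + e/2)"])
        have "complex_of_real (1 + e/2) \<noteq> of_real 1" using e by (subst of_real_eq_iff) simp
        moreover have "dist (complex_of_real (1 + e/2)) (of_real 1) < e"
          unfolding dist_of_real using e by (simp add: dist_real_def)
        ultimately show "complex_of_real (1 + e/2) \<noteq> 1 \<and> dist (complex_of_real (1 + e/2)) 1 < e" by simp
        show "complex_of_real (1 + e/2) \<in> complex_of_real ` {0<..}" using e by (intro imageI) simp
      qed
    qed
  qed (use eq z in \<open>auto intro: open_halfspace_Re_gt\<close>)
  then show ?thesis by simp
qed

text \<open>Both sides are holomorphic in z, and scaling gives their equality for positive real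
  z.\<close>

lemma Gamma_integral_halfplane:
  assumes s: "Re s > 0" and z: "Re z > 0"
  shows "integral {0<..} (gamma_kernel s z) = Gamma s * z powr (- s)"
proof (rule analytic_continuation_real[where f = "\<lambda>z. integral {0<..} (gamma_kernel s z)"])
  show "(\<lambda>z. integral {0<..} (gamma_kernel s z)) holomorphic_on {z. Re z > 0}"
  proof (rule holomorphic_on_integral_dominated)
    show "open {z. Re z > 0}" by (rule open_halfspace_Re_gt)
    show "(\<lambda>t. gamma_kernel s t x) holomorphic_on {z. Re z > 0}" for x
      unfolding gamma_kernel_def by (intro holomorphic_intros)
    fix t0 assume "t0 \<in> {z. Re z > 0}"
    then have t0: "Re t0 > 0" by simp
    show "\<exists>d>0. \<exists>g. g integrable_on {0<..} \<and> (\<forall>t\<in>ball t0 d \<inter> {z. Re z > 0}. \<forall>x\<in>{0<..}. norm (gamma_kernel s t x) \<le> g x)"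
    proof (intro exI conjI ballI)
      show "Re t0 / 2 > 0" using t0 by simp
      show "(\<lambda>x. x powr (Re s - 1) * exp (- (Re t0 / 2 * x))) integrable_on {0<..}"
        using s t0 by (intro gamma_weight_integrable) auto
      fix t x assume t: "t \<in> ball t0 (Re t0 / 2) \<inter> {z. Re z > 0}" and x: "x \<in> {0::real<..}"
      have "Re t0 - Re t \<le> norm (t0 - t)" using complex_Re_le_cmod[of "t0 - t"] by simp
      moreover have "norm (t0 - t) < Re t0 / 2" using t by (simp add: dist_norm)
      ultimately have "Re t \<ge> Re t0 / 2" by linarith
      then have "Re t0 / 2 * x \<le> Re t * x" using x by (intro mult_right_mono) auto
      then show "norm (gamma_kernel s t x) \<le> x powr (Re s - 1) * exp (- (Re t0 / 2 * x))"
        using x by (simp add: norm_gamma_kernel)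
    qed
  qed (auto intro: continuous_on_gamma_kernel)
  show "(\<lambda>z. Gamma s * z powr (- s)) holomorphic_on {z. Re z > 0}"
    by (intro holomorphic_intros) (auto simp: complex_nonpos_Reals_iff)
qed (use Gamma_integral_scaled[OF s] z in auto)

section \<open>Continuation of the Gamma integral to Re s > -1 and to imaginary z\<close>

lemma norm_exp_minus_1_le: "norm (exp w - 1) \<le> norm w * exp (norm (w::complex))"
proof -
  have "norm (exp w - exp 0) \<le> exp (norm w) * norm (w - 0)"
  proof (rule field_differentiable_bound[where S = "cball 0 (norm w)" and f' = exp])
    show "norm (exp x) \<le> exp (norm w)" if "x \<in> cball 0 (norm w)" for x :: complex
      using that complex_Re_le_cmod[of x] by simp
  qed (auto intro!: derivative_eq_intros)
  then show ?thesis by (simp add: mult.commute)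
qed

text \<open>Subtracting the value 1 of the exponential at 0 gains a factor x, so the integral over
  (0, 1] exists for Re s > -1. In the strip -1 < Re s < 0 thus reached, the integral over [1,
  \<infinity>) converges absolutely even for imaginary z.\<close>

definition gamma_kernel_diff :: "complex \<Rightarrow> complex \<Rightarrow> real \<Rightarrow> complex" where
  "gamma_kernel_diff s z x = of_real x powr (s - 1) * (exp (- (z * of_real x)) - 1)"

lemma continuous_on_gamma_kernel_diff: "S \<subseteq> {0<..} \<Longrightarrow> continuous_on S (gamma_kernel_diff s z)"
  unfolding gamma_kernel_diff_def by (intro continuous_on_mult continuous_on_of_real_powr continuous_intros)

lemma norm_gamma_kernel_diff:
  assumes x: "x \<in> {0<..1}" and s: "Re s \<ge> \<sigma>" and z: "norm z \<le> R"
  shows "norm (gamma_kernel_diff s z x) \<le> R * exp R * x powr \<sigma>"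
proof -
  have R: "R \<ge> 0" using z norm_ge_zero order.trans by blast
  have zx: "norm (z * of_real x) \<le> R * x" using x z by (auto simp: norm_mult intro!: mult_right_mono)
  have "norm (exp (- (z * of_real x)) - 1) \<le> norm (z * of_real x) * exp (norm (z * of_real x))"
    using norm_exp_minus_1_le[of "- (z * of_real x)"] by simp
  also have "\<dots> \<le> (R * x) * exp (R * 1)"
    using zx x R by (intro mult_mono) (auto intro!: order.trans[OF zx] mult_left_le)
  finally have 1: "norm (exp (- (z * of_real x)) - 1) \<le> R * exp R * x" by (simp add: mult_ac)
  have "norm (complex_of_real x powr (s - 1)) = x powr (Re s - 1)"
    using x by (simp add: norm_of_real_powr powr_def)
  also have "\<dots> \<le> x powr (\<sigma> - 1)" using x s by (intro powr_mono') auto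
  finally have "norm (gamma_kernel_diff s z x) \<le> x powr (\<sigma> - 1) * (R * exp R * x)"
    unfolding gamma_kernel_diff_def norm_mult using 1 by (intro mult_mono) auto
  also have "x powr (\<sigma> - 1) * (R * exp R * x) = R * exp R * x powr \<sigma>"
    using x by (simp add: powr_diff)
  finally show ?thesis .
qed

lemma powr_integrable_01: "\<sigma> > -1 \<Longrightarrow> (\<lambda>x. c * x powr \<sigma>) integrable_on {0<..1::real}"
  using integrable_on_powr_from_0'[of \<sigma> 1] by (intro integrable_on_mult_right) auto

lemma integral_powr_01:
  assumes "Re s > 0"
  shows "((\<lambda>x. complex_of_real x powr (s - 1)) has_integral 1 / s) {0<..1}"
proof -
  have s0: "s \<noteq> 0" using assms by auto
  have "((\<lambda>x. complex_of_real x powr (s - 1)) has_integral of_real 1 powr s / s - of_real 0 powr s / s) {0..1}"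
  proof (rule fundamental_theorem_of_calculus_interior)
    have "continuous_on {0..1} (\<lambda>x. complex_of_real x powr s)"
      by (rule continuous_on_powr_complex) (use assms in \<open>auto intro!: continuous_intros\<close>)
    then show "continuous_on {0..1} (\<lambda>x. complex_of_real x powr s / s)"
      by (rule continuous_on_divide[OF _ continuous_on_const]) (use s0 in simp)
    fix x :: real assume "x \<in> {0<..<1}"
    then have "((\<lambda>x. complex_of_real x powr s) has_vector_derivative s * of_real x powr (s - 1)) (at x)"
      by (intro of_real_powr_has_vector_derivative) auto
    from has_vector_derivative_divide[OF this, of s]
    show "((\<lambda>x. complex_of_real x powr s / s) has_vector_derivative of_real x powr (s - 1)) (at x)"
      using s0 by simp
  qed auto
  then have "((\<lambda>x. complex_of_real x powr (s - 1)) has_integral 1 / s) {0..1}"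
    using s0 by simp
  moreover have "((\<lambda>x. complex_of_real x powr (s - 1)) has_integral 1 / s) {0..1} \<longleftrightarrow>
      ((\<lambda>x. complex_of_real x powr (s - 1)) has_integral 1 / s) {0<..1}"
    by (rule has_integral_spike_set_eq) (auto intro: negligible_subset[of "{0}"])
  ultimately show ?thesis by simp
qed

lemma gamma_kernel_diff_integrable: "Re s > -1 \<Longrightarrow> gamma_kernel_diff s z absolutely_integrable_on {0<..1}"
  by (rule absolutely_integrable_bounded_continuous[OF continuous_on_gamma_kernel_diff _ powr_integrable_01])
     (auto intro!: norm_gamma_kernel_diff)

lemma gamma_weight_integrable_1: "c > 0 \<Longrightarrow> (\<lambda>x. x powr \<sigma> * exp (- (c * x))) integrable_on {1::real..}"
proof -
  assume c: "c > 0"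
  define \<tau> where "\<tau> = max (\<sigma> + 1) 1"
  have "(\<lambda>x. x powr (\<tau> - 1) * exp (- (c * x))) absolutely_integrable_on {0<..}"
    by (rule nonnegative_absolutely_integrable_1[OF gamma_weight_integrable]) (use c in \<open>auto simp: \<tau>_def\<close>)
  then have "(\<lambda>x. x powr (\<tau> - 1) * exp (- (c * x))) absolutely_integrable_on {1..}"
    by (rule set_integrable_subset) auto
  then have int: "(\<lambda>x. x powr (\<tau> - 1) * exp (- (c * x))) integrable_on {1..}"
    by (rule set_lebesgue_integral_eq_integral(1))
  have "(\<lambda>x. x powr \<sigma> * exp (- (c * x))) absolutely_integrable_on {1..}"
  proof (rule measurable_bounded_by_integrable_imp_absolutely_integrable[OF _ _ int])
    show "(\<lambda>x. x powr \<sigma> * exp (- (c * x))) \<in> borel_measurable (lebesgue_on {1..})"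
      by (intro continuous_imp_measurable_on_sets_lebesgue continuous_intros) auto
    show "norm (x powr \<sigma> * exp (- (c * x))) \<le> x powr (\<tau> - 1) * exp (- (c * x))" if "x \<in> {1..}" for x
      using that by (auto simp: \<tau>_def abs_mult intro!: mult_right_mono powr_mono)
  qed auto
  then show ?thesis by (rule set_lebesgue_integral_eq_integral(1))
qed

lemma gamma_kernel_abs_integrable_1: "Re z > 0 \<Longrightarrow> gamma_kernel s z absolutely_integrable_on {1..}"
  by (rule absolutely_integrable_bounded_continuous[OF continuous_on_gamma_kernel _ gamma_weight_integrable_1])
     (auto simp: norm_gamma_kernel)

lemma gamma_kernel_eq: "gamma_kernel s z x = of_real x powr (s - 1) + gamma_kernel_diff s z x"
  by (simp add: gamma_kernel_def gamma_kernel_diff_def algebra_simps)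

lemma holomorphic_gamma_kernel_diff_integral: "(\<lambda>s. integral {0<..1} (gamma_kernel_diff s z)) holomorphic_on {s. Re s > -1}"
proof (rule holomorphic_on_integral_dominated)
  show "open {s. Re s > -1}" by (rule open_halfspace_Re_gt)
  show "(\<lambda>s. gamma_kernel_diff s z x) holomorphic_on {s. Re s > -1}" if "x \<in> {0<..1}" for x
    unfolding gamma_kernel_diff_def by (intro holomorphic_on_mult holomorphic_of_real_powr holomorphic_intros) (use that in auto)
  fix s0 assume "s0 \<in> {s. Re s > -1}"
  then have s0: "Re s0 > -1" by simp
  define d where "d = (Re s0 + 1) / 2"
  show "\<exists>d>0. \<exists>g. g integrable_on {0<..1} \<and> (\<forall>s\<in>ball s0 d \<inter> {s. Re s > -1}. \<forall>x\<in>{0<..1}. norm (gamma_kernel_diff s z x) \<le> g x)"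
  proof (intro exI conjI ballI)
    show "d > 0" using s0 by (simp add: d_def)
    show "(\<lambda>x. norm z * exp (norm z) * x powr (Re s0 - d)) integrable_on {0<..1}"
      using s0 by (intro powr_integrable_01) (simp add: d_def field_simps)
    fix s x assume s: "s \<in> ball s0 d \<inter> {s. Re s > -1}" and x: "x \<in> {0<..1::real}"
    have "Re s0 - Re s \<le> norm (s0 - s)" using complex_Re_le_cmod[of "s0 - s"] by simp
    moreover have "norm (s0 - s) < d" using s by (simp add: dist_norm)
    ultimately have "Re s \<ge> Re s0 - d" by linarith
    then show "norm (gamma_kernel_diff s z x) \<le> norm z * exp (norm z) * x powr (Re s0 - d)"
      using x by (intro norm_gamma_kernel_diff) auto
  qed
qed (auto intro: continuous_on_gamma_kernel_diff)

lemma holomorphic_gamma_kernel_integral_1: "Re z > 0 \<Longrightarrow> (\<lambda>s. integral {1..} (gamma_kernel s z)) holomorphic_on UNIV"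
proof (rule holomorphic_on_integral_dominated)
  assume z: "Re z > 0"
  show "(\<lambda>s. gamma_kernel s z x) holomorphic_on UNIV" if "x \<in> {1..}" for x
    unfolding gamma_kernel_def by (intro holomorphic_on_mult holomorphic_of_real_powr holomorphic_intros) (use that in auto)
  fix s0 :: complex
  show "\<exists>d>0. \<exists>g. g integrable_on {1..} \<and> (\<forall>s\<in>ball s0 d \<inter> UNIV. \<forall>x\<in>{1..}. norm (gamma_kernel s z x) \<le> g x)"
  proof (intro exI conjI ballI)
    show "(1::real) > 0" by simp
    show "(\<lambda>x. x powr Re s0 * exp (- (Re z * x))) integrable_on {1..}"
      using z by (rule gamma_weight_integrable_1)
    fix s x assume s: "s \<in> ball s0 1 \<inter> UNIV" and x: "x \<in> {1::real..}"
    have "Re s - Re s0 \<le> norm (s - s0)" using complex_Re_le_cmod[of "s - s0"] by simp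
    moreover have "norm (s - s0) < 1" using s by (simp add: dist_norm norm_minus_commute)
    ultimately have "Re s - 1 \<le> Re s0" by linarith
    then show "norm (gamma_kernel s z x) \<le> x powr Re s0 * exp (- (Re z * x))"
      using x by (auto simp: norm_gamma_kernel intro!: mult_right_mono powr_mono)
  qed
qed (auto intro: continuous_on_gamma_kernel)

lemma strip_not_nonpos_Int: "Re s > -1 \<Longrightarrow> s \<noteq> 0 \<Longrightarrow> s \<notin> \<int>\<^sub>\<le>\<^sub>0"
  by (auto elim!: nonpos_Ints_cases')

text \<open>For Re s > 0 the subtracted power integrates to 1 / s over (0, 1]. In this form the
  right-hand side extends across Re s = 0.\<close>

lemma gamma_split:
  assumes z: "Re z > 0" and s: "Re s > -1" "s \<noteq> 0"
  shows "Gamma s * z powr (- s) = 1 / s + integral {0<..1} (gamma_kernel_diff s z) + integral {1..} (gamma_kernel s z)"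
proof (rule analytic_continuation_open[where z = s and s = "{s. Re s > 0}" and s' = "{s. Re s > -1} - {0}"
     and f = "\<lambda>s. Gamma s * z powr (- s)" and g = "\<lambda>s. 1 / s + integral {0<..1} (gamma_kernel_diff s z) + integral {1..} (gamma_kernel s z)"])
  have "1 \<in> {s. Re s > 0}" by simp
  then show "{s. Re s > 0} \<noteq> {}" by blast
  show "connected ({s. Re s > -1} - {0})"
    by (intro connected_open_diff_countable convex_connected convex_halfspace_Re_gt open_halfspace_Re_gt) auto
  have "z \<noteq> 0" using z by auto
  then show "(\<lambda>s. Gamma s * z powr (- s)) holomorphic_on {s. Re s > -1} - {0}"
    using strip_not_nonpos_Int by (intro holomorphic_intros) auto
  show "(\<lambda>s. 1 / s + integral {0<..1} (gamma_kernel_diff s z) + integral {1..} (gamma_kernel s z)) holomorphic_on {s. Re s > -1} - {0}"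
    by (intro holomorphic_intros holomorphic_on_subset[OF holomorphic_gamma_kernel_diff_integral]
        holomorphic_on_subset[OF holomorphic_gamma_kernel_integral_1[OF z]]) auto
  fix s assume "s \<in> {s. Re s > 0}"
  then have s: "Re s > 0" by simp
  have p: "((\<lambda>x. complex_of_real x powr (s - 1)) has_integral 1 / s) {0<..1}" by (rule integral_powr_01[OF s])
  have i0: "gamma_kernel_diff s z integrable_on {0<..1}"
    using set_lebesgue_integral_eq_integral(1)[OF gamma_kernel_diff_integrable] s by auto
  have i1: "gamma_kernel s z integrable_on {1..}"
    using set_lebesgue_integral_eq_integral(1)[OF gamma_kernel_abs_integrable_1[OF z]] .
  have a: "(gamma_kernel s z has_integral 1 / s + integral {0<..1} (gamma_kernel_diff s z)) {0<..1}"
    using has_integral_add[OF p integrable_integral[OF i0]] by (simp add: gamma_kernel_eq[abs_def])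
  have "integral ({0<..1} \<union> {1..}) (gamma_kernel s z) = integral {0<..1} (gamma_kernel s z) + integral {1..} (gamma_kernel s z)"
  proof (rule integral_Un)
    have "{0<..1} \<inter> {1..} = {1::real}" by auto
    then show "negligible ({0<..1} \<inter> {1::real..})" by simp
  qed (use a i1 in auto)
  moreover have "{0<..1} \<union> {1..} = {0::real<..}" by auto
  ultimately show "Gamma s * z powr (- s) = 1 / s + integral {0<..1} (gamma_kernel_diff s z) + integral {1..} (gamma_kernel s z)"
    using Gamma_integral_halfplane[OF s z] integral_unique[OF a] by simp
qed (use s in \<open>auto intro: open_halfspace_Re_gt\<close>)

lemma powr_integrable_1: "e < -1 \<Longrightarrow> (\<lambda>x. x powr e) integrable_on {1::real..}"
  using has_integral_powr_to_inf[of e 1] by auto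

lemma gamma_kernel_imag_integrable:
  assumes "Re s < 0" "Re z \<ge> 0"
  shows "gamma_kernel s z absolutely_integrable_on {1..}"
  by (rule absolutely_integrable_bounded_continuous[OF continuous_on_gamma_kernel _ powr_integrable_1[of "Re s - 1"]])
     (use assms in \<open>auto simp: norm_gamma_kernel intro!: mult_left_le\<close>)

text \<open>For Re s < 0 the tail is dominated by x^(Re s - 1) uniformly up to the imaginary axis,
  so dominated convergence yields the boundary value.\<close>

lemma gamma_split_imaginary:
  assumes s: "-1 < Re s" "Re s < 0" and w: "Re w = 0" "w \<noteq> 0"
  shows "Gamma s * w powr (- s) = 1 / s + integral {0<..1} (gamma_kernel_diff s w) + integral {1..} (gamma_kernel s w)"
proof -
  \<comment> \<open>An approach from the open half-plane; the real parts are at most 1, whence the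
    uniform bound \<open>1 + norm w\<close>.\<close>
  define z where "z k = of_real (1 / (real k + 1)) + w" for k
  have "(\<lambda>k. 1 / (real k + 1)) \<longlonglongrightarrow> 0" by real_asymp
  then have "z \<longlonglongrightarrow> of_real 0 + w" unfolding z_def by (intro tendsto_intros)
  then have z: "z \<longlonglongrightarrow> w" by simp
  have Re_z: "Re (z k) > 0" for k using w by (simp add: z_def)
  have norm_z: "norm (z k) \<le> 1 + norm w" for k
  proof -
    have "norm (complex_of_real (1 / (real k + 1))) \<le> 1" by (simp only: norm_of_real) simp
    then show ?thesis unfolding z_def by (intro order.trans[OF norm_triangle_ineq]) simp
  qed
  have "w \<notin> \<real>\<^sub>\<le>\<^sub>0" using w by (auto simp: complex_nonpos_Reals_iff complex_eq_iff)
  then have lhs: "(\<lambda>k. Gamma s * z k powr (- s)) \<longlonglongrightarrow> Gamma s * w powr (- s)"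
    by (intro tendsto_intros z) auto
  have "(\<lambda>k. integral {0<..1} (gamma_kernel_diff s (z k))) \<longlonglongrightarrow> integral {0<..1} (gamma_kernel_diff s w)"
  proof (rule dominated_convergence(2)[where h = "\<lambda>x. (1 + norm w) * exp (1 + norm w) * x powr Re s"])
    show "gamma_kernel_diff s (z k) integrable_on {0<..1}" for k
      using set_lebesgue_integral_eq_integral(1)[OF gamma_kernel_diff_integrable] s by auto
    show "(\<lambda>x. (1 + norm w) * exp (1 + norm w) * x powr Re s) integrable_on {0<..1}"
      using s by (intro powr_integrable_01) auto
    show "norm (gamma_kernel_diff s (z k) x) \<le> (1 + norm w) * exp (1 + norm w) * x powr Re s" if "x \<in> {0<..1}" for k x
      by (rule norm_gamma_kernel_diff[OF that _ norm_z]) simp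
    show "(\<lambda>k. gamma_kernel_diff s (z k) x) \<longlonglongrightarrow> gamma_kernel_diff s w x" if "x \<in> {0<..1}" for x
      unfolding gamma_kernel_diff_def by (intro tendsto_intros z)
  qed
  moreover have "(\<lambda>k. integral {1..} (gamma_kernel s (z k))) \<longlonglongrightarrow> integral {1..} (gamma_kernel s w)"
  proof (rule dominated_convergence(2)[where h = "\<lambda>x. x powr (Re s - 1)"])
    show "gamma_kernel s (z k) integrable_on {1..}" for k
      using set_lebesgue_integral_eq_integral(1)[OF gamma_kernel_abs_integrable_1[OF Re_z]] .
    show "(\<lambda>x. x powr (Re s - 1)) integrable_on {1..}" using s by (intro powr_integrable_1) auto
    show "norm (gamma_kernel s (z k) x) \<le> x powr (Re s - 1)" if "x \<in> {1..}" for k x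
      using that Re_z[of k] by (auto simp: norm_gamma_kernel intro!: mult_left_le)
    show "(\<lambda>k. gamma_kernel s (z k) x) \<longlonglongrightarrow> gamma_kernel s w x" if "x \<in> {1..}" for x
      unfolding gamma_kernel_def by (intro tendsto_intros z)
  qed
  ultimately have lim: "(\<lambda>k. 1 / s + integral {0<..1} (gamma_kernel_diff s (z k)) + integral {1..} (gamma_kernel s (z k)))
      \<longlonglongrightarrow> 1 / s + integral {0<..1} (gamma_kernel_diff s w) + integral {1..} (gamma_kernel s w)"
    by (intro tendsto_add tendsto_const)
  have "Gamma s * z k powr (- s) = 1 / s + integral {0<..1} (gamma_kernel_diff s (z k)) + integral {1..} (gamma_kernel s (z k))" for k
    by (rule gamma_split[OF Re_z]) (use s in auto)
  with lim have "(\<lambda>k. Gamma s * z k powr (- s)) \<longlonglongrightarrow> 1 / s + integral {0<..1} (gamma_kernel_diff s w) + integral {1..} (gamma_kernel s w)"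
    by simp
  with lhs show ?thesis by (rule LIMSEQ_unique)
qed

section \<open>Hurwitz's formula\<close>

lemma gamma_kernel_imaginary: "gamma_kernel s (2 * of_real pi * \<i> * of_int n) x = of_real x powr (s - 1) * ee (- n) x"
  by (simp add: gamma_kernel_def ee_def)

lemma integral_tendsto_atLeast:
  fixes f :: "real \<Rightarrow> complex"
  assumes "f absolutely_integrable_on {1..}"
  shows "(\<lambda>k. integral {1..real k + 1} f) \<longlonglongrightarrow> integral {1..} f"
proof -
  have nint: "(\<lambda>x. norm (f x)) integrable_on {1..}"
    using assms by (auto simp: absolutely_integrable_on_def)
  have sub: "f integrable_on {1..real k + 1}" for k
    using set_integrable_subset[OF assms, of "{1..real k + 1}"]
    by (auto intro: set_lebesgue_integral_eq_integral(1))
  have "(\<lambda>k. integral {1..} (\<lambda>x. if x \<in> {1..real k + 1} then f x else 0)) \<longlonglongrightarrow> integral {1..} f"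
  proof (rule dominated_convergence(2)[where h = "\<lambda>x. norm (f x)"])
    show "(\<lambda>x. if x \<in> {1..real k + 1} then f x else 0) integrable_on {1..}" for k
    proof -
      have "{1..real k + 1} \<inter> {1..} = {1..real k + 1}" by auto
      then show ?thesis
        using sub[of k] integrable_restrict_Int[of "{1..real k + 1}" f "{1..}"] by simp
    qed
    show "(\<lambda>k. if x \<in> {1..real k + 1} then f x else 0) \<longlonglongrightarrow> f x" if "x \<in> {1..}" for x
    proof (rule tendsto_eventually)
      obtain k0 :: nat where "x \<le> real k0" using real_arch_simple by blast
      then show "\<forall>\<^sub>F k in sequentially. (if x \<in> {1..real k + 1} then f x else 0) = f x"
        using that by (intro eventually_sequentiallyI[of k0]) auto
    qed
  qed (use nint in auto)
  moreover have "integral {1..} (\<lambda>x. if x \<in> {1..real k + 1} then f x else 0) = integral {1..real k + 1} f" for k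
  proof -
    have "{1..real k + 1} \<inter> {1..} = {1..real k + 1}" by auto
    then show ?thesis
      using Henstock_Kurzweil_Integration.integral_restrict_Int[of "{1::real..}" "{1..real k + 1}" f] by simp
  qed
  ultimately show ?thesis by simp
qed

text \<open>Here zeta(1 - s, 1 + \<alpha>) is the absolutely convergent series of the powers (m + 1
  + \<alpha>)^(s - 1). Since \<open>ee\<close> has period 1, the intervals [m + 1, m + 2] line up to
  the half-line from 1.\<close>

lemma zeta_unfolding:
  assumes s: "Re s < 0"
  shows "integral {0..1} (\<lambda>\<alpha>. - zeta_reg (1 - s) (1 + \<alpha>) / s * ee (- n) \<alpha>) =
    integral {1..} (gamma_kernel s (2 * of_real pi * \<i> * of_int n))"
proof -
  let ?g = "gamma_kernel s (2 * of_real pi * \<i> * of_int n)"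
  define f where "f m \<alpha> = complex_of_real (real m + 1 + \<alpha>) powr (s - 1) * ee (- n) \<alpha>" for m \<alpha>
  have contf: "continuous_on {0..1} (f m)" for m
  proof -
    have "continuous_on {0..1} (\<lambda>\<alpha>. complex_of_real (real m + 1 + \<alpha>) powr (s - 1))"
      by (rule continuous_on_compose2[OF continuous_on_of_real_powr[of "{0<..}"]])
         (auto intro!: continuous_intros)
    then show ?thesis unfolding f_def[abs_def] by (rule continuous_on_mult[OF _ continuous_on_ee])
  qed
  have bound: "norm (f m \<alpha>) \<le> exp (- (1 + (- Re s)) * ln (real m + 1))" if "\<alpha> \<in> {0..1}" for m \<alpha>
  proof -
    have "norm (f m \<alpha>) = exp ((Re s - 1) * ln (real m + 1 + \<alpha>))"
      unfolding f_def norm_mult norm_ee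
      by (subst norm_of_real_powr) (use that in auto)
    also have "\<dots> \<le> exp ((Re s - 1) * ln (real m + 1))"
      using that s by (auto intro!: mult_left_mono_neg)
    also have "(Re s - 1) * ln (real m + 1) = - (1 + (- Re s)) * ln (real m + 1)" by simp
    finally show ?thesis .
  qed
  have summ: "(\<lambda>m. exp (- (1 + (- Re s)) * ln (real m + 1))) summable_on UNIV"
    by (rule summable_on_nat_powr) (use s in auto)
  have pw: "(\<Sum>\<^sub>\<infinity>m. f m \<alpha>) = - zeta_reg (1 - s) (1 + \<alpha>) / s * ee (- n) \<alpha>" if "\<alpha> \<in> {0..1}" for \<alpha>
  proof -
    have "(\<lambda>m. f m \<alpha>) summable_on UNIV"
      by (rule abs_summable_summable[OF Infinite_Sum.abs_summable_on_comparison_test'[OF summ]])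
         (use bound[OF that] in auto)
    then have "(\<lambda>m. f m \<alpha>) sums (\<Sum>\<^sub>\<infinity>m. f m \<alpha>)"
      by (intro has_sum_imp_sums has_sum_infsum)
    moreover have "(\<lambda>m. f m \<alpha>) sums (zeta_reg (1 - s) (1 + \<alpha>) / ((1 - s) - 1) * ee (- n) \<alpha>)"
      using sums_mult2[OF zeta_reg_sums[of "1 - s" "1 + \<alpha>"], of "ee (- n) \<alpha>"] s that
      by (simp add: f_def add_ac)
    ultimately show ?thesis using sums_unique2 by fastforce
  qed
  have "((\<lambda>m. integral {0..1} (f m)) has_sum integral {0..1} (\<lambda>\<alpha>. \<Sum>\<^sub>\<infinity>m. f m \<alpha>)) UNIV"
    by (rule infsum_integral(2)[OF contf _ summ]) (rule bound)
  then have "(\<lambda>m. integral {0..1} (f m)) sums integral {0..1} (\<lambda>\<alpha>. \<Sum>\<^sub>\<infinity>m. f m \<alpha>)"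
    by (rule has_sum_imp_sums)
  also have "integral {0..1} (\<lambda>\<alpha>. \<Sum>\<^sub>\<infinity>m. f m \<alpha>) = integral {0..1} (\<lambda>\<alpha>. - zeta_reg (1 - s) (1 + \<alpha>) / s * ee (- n) \<alpha>)"
    by (rule Henstock_Kurzweil_Integration.integral_cong) (rule pw)
  finally have 1: "(\<lambda>k. \<Sum>m<k. integral {0..1} (f m)) \<longlonglongrightarrow>
      integral {0..1} (\<lambda>\<alpha>. - zeta_reg (1 - s) (1 + \<alpha>) / s * ee (- n) \<alpha>)"
    by (simp add: sums_def)
  have shift: "integral {0..1} (f m) = integral {real m + 1..real m + 2} ?g" for m
  proof -
    have "integral {real m + 1 - (real m + 1)..real m + 2 - (real m + 1)} (\<lambda>\<alpha>. ?g (\<alpha> + (real m + 1))) =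
        integral {real m + 1..real m + 2} ?g"
      by (rule integral_shift_real_ivl)
    moreover have "?g (\<alpha> + (real m + 1)) = f m \<alpha>" for \<alpha>
    proof -
      have "ee (- n) (\<alpha> + (real m + 1)) = ee (- n) \<alpha>"
        using ee_shift[of "- n" "Suc m" \<alpha>] by (simp add: add_ac)
      then show ?thesis by (simp add: gamma_kernel_imaginary f_def add_ac)
    qed
    ultimately show ?thesis by simp
  qed
  have "(\<Sum>m<k. integral {0..1} (f m)) = integral {1..real k + 1} ?g" for k
  proof (induction k)
    case (Suc k)
    have "integral {1..real k + 1} ?g + integral {real k + 1..real k + 2} ?g = integral {1..real k + 2} ?g"
      by (rule Henstock_Kurzweil_Integration.integral_combine)
         (auto intro!: integrable_continuous_real continuous_on_gamma_kernel)
    then show ?case using Suc shift[of k] by (simp add: add_ac)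
  qed simp
  moreover have "(\<lambda>k. integral {1..real k + 1} ?g) \<longlonglongrightarrow> integral {1..} ?g"
    by (rule integral_tendsto_atLeast[OF gamma_kernel_imag_integrable[OF s]]) simp
  ultimately have "(\<lambda>k. \<Sum>m<k. integral {0..1} (f m)) \<longlonglongrightarrow> integral {1..} ?g" by simp
  with 1 show ?thesis by (rule LIMSEQ_unique)
qed

lemma continuous_on_zeta_reg_1_plus: "continuous_on {0..1} (\<lambda>\<alpha>. zeta_reg w (1 + \<alpha>))"
  by (intro continuous_zeta_reg_compose continuous_intros) auto

text \<open>In the strip -1 < Re s < 0 both \<open>zeta_unfolding\<close> and
  \<open>gamma_split_imaginary\<close> are available and give the equation. Both sides continue to
  Re s > -1 without 0, which includes the half-plane where the Fourier series is wanted.\<close>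

lemma zeta_coefficient_continued:
  assumes s: "Re s > -1" "s \<noteq> 0" and n: "n \<noteq> 0"
  shows "integral {0..1} (\<lambda>\<alpha>. - zeta_reg (1 - s) (1 + \<alpha>) / s * ee (- n) \<alpha>) =
    Gamma s * (2 * of_real pi * \<i> * of_int n) powr (- s) - 1 / s - integral {0<..1} (gamma_kernel_diff s (2 * of_real pi * \<i> * of_int n))"
proof -
  let ?w = "2 * of_real pi * \<i> * of_int n"
  have w: "Re ?w = 0" "?w \<noteq> 0" using n by auto
  show ?thesis
  proof (rule analytic_continuation_open[where z = s and s = "{s. Re s > -1} \<inter> {s. Re s < 0}" and s' = "{s. Re s > -1} - {0}"
     and f = "\<lambda>s. integral {0..1} (\<lambda>\<alpha>. - zeta_reg (1 - s) (1 + \<alpha>) / s * ee (- n) \<alpha>)"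
     and g = "\<lambda>s. Gamma s * ?w powr (- s) - 1 / s - integral {0<..1} (gamma_kernel_diff s ?w)"])
    have "- of_real (1/2) \<in> {s. Re s > -1} \<inter> {s. Re s < 0}" by simp
    then show "{s. Re s > -1} \<inter> {s. Re s < 0} \<noteq> {}" by blast
    show "open ({s. Re s > -1} \<inter> {s. Re s < 0})"
      by (intro open_Int open_halfspace_Re_gt open_halfspace_Re_lt)
    show "connected ({s. Re s > -1} - {0})"
      by (intro connected_open_diff_countable convex_connected convex_halfspace_Re_gt open_halfspace_Re_gt) auto
    show op: "open ({s. Re s > -1} - {0})" by (intro open_Diff open_halfspace_Re_gt) auto
    show "(\<lambda>s. integral {0..1} (\<lambda>\<alpha>. - zeta_reg (1 - s) (1 + \<alpha>) / s * ee (- n) \<alpha>)) holomorphic_on {s. Re s > -1} - {0}"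
    proof (rule holomorphic_on_integral_interval[OF op])
      show "(\<lambda>s. - zeta_reg (1 - s) (1 + y) / s * ee (- n) y) holomorphic_on {s. Re s > -1} - {0}" if "y \<in> {0..1}" for y
        by (intro holomorphic_intros holomorphic_zeta_reg_compose) (use that in auto)
      have "continuous_on (({s. Re s > -1} - {0}) \<times> {0..1}) (\<lambda>x. zeta_reg (1 - fst x) (1 + snd x))"
        by (rule continuous_zeta_reg_compose) (auto intro!: continuous_intros)
      moreover have "continuous_on (({s. Re s > -1} - {0}) \<times> {0..1}) (\<lambda>x. ee (- n) (snd x))"
        by (rule continuous_on_compose2[OF continuous_on_ee]) (auto intro!: continuous_intros)
      ultimately show "continuous_on (({s. Re s > -1} - {0}) \<times> {0..1}) (\<lambda>(s, y). - zeta_reg (1 - s) (1 + y) / s * ee (- n) y)"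
        unfolding case_prod_beta by (intro continuous_on_mult continuous_on_divide continuous_on_minus continuous_intros) auto
    qed
    show "(\<lambda>s. Gamma s * ?w powr (- s) - 1 / s - integral {0<..1} (gamma_kernel_diff s ?w)) holomorphic_on {s. Re s > -1} - {0}"
      using strip_not_nonpos_Int w(2)
      by (intro holomorphic_intros holomorphic_on_subset[OF holomorphic_gamma_kernel_diff_integral]) auto
    fix s assume "s \<in> {s. Re s > -1} \<inter> {s. Re s < 0}"
    then have s: "-1 < Re s" "Re s < 0" by auto
    show "integral {0..1} (\<lambda>\<alpha>. - zeta_reg (1 - s) (1 + \<alpha>) / s * ee (- n) \<alpha>) =
        Gamma s * ?w powr (- s) - 1 / s - integral {0<..1} (gamma_kernel_diff s ?w)"
      unfolding zeta_unfolding[OF s(2)] gamma_split_imaginary[OF s w] by simp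
  qed (use s in auto)
qed

lemma integral_has_integral_01:
  fixes f :: "real \<Rightarrow> complex"
  shows "(f has_integral y) {0<..1} \<longleftrightarrow> (f has_integral y) {0..1}"
  by (rule has_integral_spike_set_eq) (auto intro: negligible_subset[of "{0}"])

text \<open>Putting back the power \<alpha>^(s - 1), whose coefficient is 1 / s plus the integral of
  \<open>gamma_kernel_diff\<close>, cancels both correction terms of the continued formula.\<close>

lemma zeta_fourier_coefficient:
  assumes s: "Re s > 0" and n: "n \<noteq> 0"
  shows "((\<lambda>\<alpha>. zeta_model (1, 1) s \<alpha> * ee (- n) \<alpha>) has_integral Gamma s * (2 * of_real pi * \<i> * of_int n) powr (- s)) {0..1}"
proof -
  let ?w = "2 * of_real pi * \<i> * of_int n"
  have s0: "s \<noteq> 0" using s by auto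
  have "gamma_kernel_diff s ?w integrable_on {0<..1}"
    using set_lebesgue_integral_eq_integral(1)[OF gamma_kernel_diff_integrable] s by auto
  from has_integral_add[OF integral_powr_01[OF s] integrable_integral[OF this]]
  have "(gamma_kernel s ?w has_integral 1 / s + integral {0<..1} (gamma_kernel_diff s ?w)) {0..1}"
    by (simp add: gamma_kernel_eq[abs_def] integral_has_integral_01)
  moreover have "continuous_on {0..1} (\<lambda>\<alpha>. - zeta_reg (1 - s) (1 + \<alpha>) / s * ee (- n) \<alpha>)"
    by (intro continuous_intros continuous_on_zeta_reg_1_plus) (use s0 in auto)
  then have "((\<lambda>\<alpha>. - zeta_reg (1 - s) (1 + \<alpha>) / s * ee (- n) \<alpha>) has_integral
      integral {0..1} (\<lambda>\<alpha>. - zeta_reg (1 - s) (1 + \<alpha>) / s * ee (- n) \<alpha>)) {0..1}"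
    by (intro integrable_integral integrable_continuous_real)
  ultimately have "((\<lambda>\<alpha>. gamma_kernel s ?w \<alpha> + - zeta_reg (1 - s) (1 + \<alpha>) / s * ee (- n) \<alpha>) has_integral
      1 / s + integral {0<..1} (gamma_kernel_diff s ?w) + integral {0..1} (\<lambda>\<alpha>. - zeta_reg (1 - s) (1 + \<alpha>) / s * ee (- n) \<alpha>)) {0..1}"
    by (rule has_integral_add)
  moreover have "1 / s + integral {0<..1} (gamma_kernel_diff s ?w) + integral {0..1} (\<lambda>\<alpha>. - zeta_reg (1 - s) (1 + \<alpha>) / s * ee (- n) \<alpha>) =
      Gamma s * ?w powr (- s)"
    by (subst zeta_coefficient_continued) (use s s0 n in auto)
  moreover have "gamma_kernel s ?w \<alpha> + - zeta_reg (1 - s) (1 + \<alpha>) / s * ee (- n) \<alpha> = zeta_model (1, 1) s \<alpha> * ee (- n) \<alpha>" for \<alpha>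
    unfolding gamma_kernel_imaginary zeta_model_def by (simp add: algebra_simps)
  ultimately show ?thesis by simp
qed

text \<open>By \<open>zeta_reg1_diff\<close> at -s the integral of zeta(1 - s, 1 + \<alpha>) comes
  from a unit difference, which is a single elementary term. It equals -1 / s and cancels the
  integral of \<alpha>^(s - 1).\<close>

lemma zeta_fourier_coefficient_0:
  assumes s: "Re s > 0"
  shows "(zeta_model (1, 1) s has_integral 0) {0..1}"
proof -
  have s0: "s \<noteq> 0" "- s - 1 \<noteq> 0" using s by (auto simp: complex_eq_iff)
  have "zeta_reg1 (- s) 1 - zeta_reg1 (- s) (1 + 1) = (- s - 1) * integral {0..1} (\<lambda>y. zeta_reg1 (- s + 1) (1 + y))"
    by (rule zeta_reg1_diff) auto
  moreover have "zeta_reg1 (- s) 1 = (- s - 1) + zeta_reg1 (- s) (1 + 1)"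
    using zeta_reg_eq_zeta_reg1[of 1 "- s"] by (simp add: zeta_reg_def)
  ultimately have "(- s - 1) * integral {0..1} (\<lambda>y. zeta_reg1 (- s + 1) (1 + y)) = - s - 1" by simp
  then have "integral {0..1} (\<lambda>y. zeta_reg1 (- s + 1) (1 + y)) = 1" using s0(2) by simp
  moreover have "integral {0..1} (\<lambda>y. zeta_reg1 (- s + 1) (1 + y)) = integral {0..1} (\<lambda>y. zeta_reg (1 - s) (1 + y))"
    by (rule Henstock_Kurzweil_Integration.integral_cong) (simp add: zeta_reg_eq_zeta_reg1)
  moreover have "(\<lambda>y. zeta_reg (1 - s) (1 + y)) integrable_on {0..1}"
    by (intro integrable_continuous_real continuous_on_zeta_reg_1_plus)
  ultimately have "((\<lambda>y. zeta_reg (1 - s) (1 + y)) has_integral 1) {0..1}"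
    using integrable_integral by fastforce
  from has_integral_mult_right[OF this, of "- 1 / s"]
  have "((\<lambda>y. - zeta_reg (1 - s) (1 + y) / s) has_integral - 1 / s) {0..1}" by simp
  moreover have "((\<lambda>x. complex_of_real x powr (s - 1)) has_integral 1 / s) {0..1}"
    using integral_powr_01[OF s] by (simp add: integral_has_integral_01)
  ultimately have "((\<lambda>x. complex_of_real x powr (s - 1) + - zeta_reg (1 - s) (1 + x) / s) has_integral 1 / s + - 1 / s) {0..1}"
    by (intro has_integral_add)
  then show ?thesis by (simp add: zeta_model_def[abs_def])
qed

lemma continuous_on_zeta_model_closed:
  assumes "Re s > 1"
  shows "continuous_on {0..1} (zeta_model (1, 1) s)"
proof -
  have "s \<noteq> 0" using assms by auto
  then show ?thesis
    using assms unfolding zeta_model_def[abs_def]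
    by (intro continuous_intros continuous_on_powr_complex) (auto intro!: continuous_on_zeta_reg_1_plus)
qed

section \<open>The Fourier series for Re s > 1\<close>

definition fourier_coef :: "complex \<Rightarrow> int \<Rightarrow> complex" where
  "fourier_coef s n = (if n = 0 then 0 else (2 * of_real pi * \<i> * of_int n) powr (- s))"

text \<open>The principal power of \<sigma> i with exponent -s, for \<sigma> = 1 or -1; products of
  such phases will combine to the cosines.\<close>

definition phase :: "int \<Rightarrow> complex \<Rightarrow> complex" where
  "phase \<sigma> s = exp (- (\<i> * of_real pi / 2 * of_int \<sigma> * s))"

lemma fourier_coef_0 [simp]: "fourier_coef s 0 = 0"
  by (simp add: fourier_coef_def)

lemma fourier_coef_signed:
  assumes m: "m > 0" and \<sigma>: "\<sigma> \<in> {1, -1}"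
  shows "fourier_coef s (\<sigma> * int m) = (2 * of_real pi) powr (- s) * of_nat m powr (- s) * phase \<sigma> s"
proof -
  let ?w = "2 * of_real pi * \<i> * of_int (\<sigma> * int m)"
  have w: "?w = complex_of_real (2 * pi * real m) * (of_int \<sigma> * \<i>)" by simp
  have ln\<sigma>: "Ln (of_int \<sigma> * \<i>) = \<i> * of_real pi / 2 * of_int \<sigma>" using \<sigma> by auto
  have nz: "of_int \<sigma> * \<i> \<noteq> 0" "?w \<noteq> 0" "\<sigma> * int m \<noteq> 0" using m \<sigma> by auto
  have pos: "2 * pi * real m > 0" using m by simp
  have ln_prod: "ln (2 * pi * real m) = ln (2 * pi) + ln (real m)" using m by (subst ln_mult) auto
  have L: "Ln ?w = of_real (ln (2 * pi)) + of_real (ln (real m)) + \<i> * of_real pi / 2 * of_int \<sigma>"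
    unfolding w Ln_times_of_real[OF pos nz(1)] Ln_of_real[OF pos] ln\<sigma> ln_prod of_real_add ..
  have Lp: "Ln (2 * of_real pi) = of_real (ln (2 * pi))" using Ln_of_real[of "2 * pi"] by simp
  have Lm: "Ln (of_nat m) = of_real (ln (real m))" using Ln_of_real[of "real m"] m by simp
  have "fourier_coef s (\<sigma> * int m) = exp (- s * Ln ?w)"
    using nz by (simp only: fourier_coef_def powr_def if_False)
  also have "\<dots> = exp (- s * of_real (ln (2 * pi))) * exp (- s * of_real (ln (real m))) * phase \<sigma> s"
    unfolding L phase_def exp_add[symmetric] by (rule arg_cong[of _ _ exp]) (simp add: algebra_simps)
  finally show ?thesis using m by (simp add: powr_def Lp Lm)
qed

lemma summable_on_int:
  fixes f :: "int \<Rightarrow> real"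
  assumes "(\<lambda>m::nat. f (int m + 1)) summable_on UNIV" "(\<lambda>m::nat. f (- (int m + 1))) summable_on UNIV"
  shows "f summable_on UNIV"
proof -
  have 1: "f summable_on range (\<lambda>m::nat. int m + 1)"
    using assms(1) by (subst summable_on_reindex) (auto simp: inj_on_def o_def)
  have 2: "f summable_on range (\<lambda>m::nat. - (int m + 1))"
    using assms(2) by (subst summable_on_reindex) (auto simp: inj_on_def o_def)
  have "f summable_on (range (\<lambda>m::nat. int m + 1) \<union> range (\<lambda>m::nat. - (int m + 1)) \<union> {0})"
    by (intro summable_on_union 1 2) auto
  moreover have "range (\<lambda>m::nat. int m + 1) \<union> range (\<lambda>m::nat. - (int m + 1)) \<union> {0} = UNIV"
  proof (intro set_eqI iffI UNIV_I)
    fix n :: int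
    consider "n = 0" | "n = int (nat (n - 1)) + 1" | "n = - (int (nat (- n - 1)) + 1)"
      by linarith
    then show "n \<in> range (\<lambda>m::nat. int m + 1) \<union> range (\<lambda>m::nat. - (int m + 1)) \<union> {0}"
      by cases (simp, blast, blast)
  qed
  ultimately show ?thesis by simp
qed

lemma fourier_coef_summable:
  assumes "Re s > 1"
  shows "(\<lambda>n. norm (fourier_coef s n)) summable_on UNIV"
proof (rule summable_on_int)
  have eq: "norm (fourier_coef s (\<sigma> * (int m + 1))) =
      (norm ((2 * complex_of_real pi) powr (- s)) * norm (phase \<sigma> s)) * exp (- (1 + (Re s - 1)) * ln (real m + 1))"
    if "\<sigma> \<in> {1, -1}" for \<sigma> m
  proof -
    have "norm (complex_of_real (real m + 1) powr (- s)) = exp (Re (- s) * ln (real m + 1))"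
      by (rule norm_of_real_powr) simp
    then show ?thesis
      using fourier_coef_signed[of "Suc m" \<sigma> s] that by (simp add: norm_mult add_ac)
  qed
  have s: "(\<lambda>m::nat. norm (fourier_coef s (\<sigma> * (int m + 1)))) summable_on UNIV" if "\<sigma> \<in> {1, -1}" for \<sigma>
    unfolding eq[OF that] by (intro summable_on_cmult_right summable_on_nat_powr) (use assms in simp)
  show "(\<lambda>m::nat. norm (fourier_coef s (int m + 1))) summable_on UNIV" using s[of 1] by simp
  show "(\<lambda>m::nat. norm (fourier_coef s (- (int m + 1)))) summable_on UNIV" using s[of "-1"] by simp
qed

lemma integral_ee: "(ee n has_integral (if n = 0 then 1 else 0)) {0..1}"
proof (cases "n = 0")
  case True
  then show ?thesis using has_integral_const_real[of "1::complex" 0 1] by (simp add: ee_def[abs_def])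
next
  case False
  let ?c = "2 * of_real pi * \<i> * of_int n"
  have c: "?c \<noteq> 0" using False by simp
  have "(ee n has_integral ee n 1 / ?c - ee n 0 / ?c) {0..1}"
  proof (rule fundamental_theorem_of_calculus)
    fix x :: real
    have "((\<lambda>z. exp (?c * z) / ?c) has_field_derivative exp (?c * of_real x)) (at (of_real x))"
      using c by (auto intro!: derivative_eq_intros)
    then have "((\<lambda>x. exp (?c * of_real x) / ?c) has_vector_derivative exp (?c * of_real x)) (at x within {0..1})"
      by (rule has_vector_derivative_real_field)
    then show "((\<lambda>x. ee n x / ?c) has_vector_derivative ee n x) (at x within {0..1})"
      unfolding ee_def .
  qed simp
  moreover have "ee n 1 = ee n 0" using ee_shift[of n 1 0] by simp
  ultimately show ?thesis using False by simp
qed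

text \<open>Pairing with \<open>ee n\<close> reads off the frequency -n. For n = 0 it is the
  vanishing mean, which \<open>fourier_coef\<close> encodes by its value 0.\<close>

lemma zeta_coefficient:
  assumes s: "Re s > 1"
  shows "((\<lambda>\<alpha>. zeta_model (1, 1) s \<alpha> * ee n \<alpha>) has_integral Gamma s * fourier_coef s (- n)) {0..1}"
  using zeta_fourier_coefficient[of s "- n"] zeta_fourier_coefficient_0[of s] s by (cases "n = 0") (auto simp: fourier_coef_def)

lemma fourier_sum:
  assumes a: "(\<lambda>n. norm (a n)) summable_on UNIV"
  shows "((\<lambda>n. a n * ee n \<alpha>) has_sum (\<Sum>\<^sub>\<infinity>n. a n * ee n \<alpha>)) UNIV"
    and "continuous_on {0..1} (\<lambda>\<alpha>. \<Sum>\<^sub>\<infinity>n. a n * ee n \<alpha>)"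
    and "integral {0..1} (\<lambda>\<alpha>. (\<Sum>\<^sub>\<infinity>n. a n * ee n \<alpha>) * ee k \<alpha>) = a (- k)"
proof -
  have "(\<lambda>n. norm (a n * ee n \<alpha>)) summable_on UNIV" for \<alpha> using a by (simp add: norm_mult)
  then have s: "(\<lambda>n. a n * ee n \<alpha>) summable_on UNIV" for \<alpha> by (rule abs_summable_summable)
  then show "((\<lambda>n. a n * ee n \<alpha>) has_sum (\<Sum>\<^sub>\<infinity>n. a n * ee n \<alpha>)) UNIV" by (rule has_sum_infsum)
  show "continuous_on {0..1} (\<lambda>\<alpha>. \<Sum>\<^sub>\<infinity>n. a n * ee n \<alpha>)"
    by (rule infsum_integral(1)[OF _ _ a]) (auto intro!: continuous_intros simp: norm_mult)
  have "((\<lambda>n. integral {0..1} (\<lambda>\<alpha>. a n * ee n \<alpha> * ee k \<alpha>)) has_sum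
      integral {0..1} (\<lambda>\<alpha>. \<Sum>\<^sub>\<infinity>n. a n * ee n \<alpha> * ee k \<alpha>)) UNIV"
    by (rule infsum_integral(2)[OF _ _ a]) (auto intro!: continuous_intros simp: norm_mult)
  moreover have "integral {0..1} (\<lambda>\<alpha>. a n * ee n \<alpha> * ee k \<alpha>) = (if n = - k then a (- k) else 0)" for n
  proof -
    have "((\<lambda>\<alpha>. a n * ee (n + k) \<alpha>) has_integral a n * (if n + k = 0 then 1 else 0)) {0..1}"
      by (intro has_integral_mult_right integral_ee)
    then have "integral {0..1} (\<lambda>\<alpha>. a n * ee n \<alpha> * ee k \<alpha>) = a n * (if n + k = 0 then 1 else 0)"
      by (intro integral_unique) (simp add: ee_add mult.assoc)
    then show ?thesis by (auto simp: add_eq_0_iff2)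
  qed
  moreover have "(\<Sum>\<^sub>\<infinity>n. a n * ee n \<alpha> * ee k \<alpha>) = (\<Sum>\<^sub>\<infinity>n. a n * ee n \<alpha>) * ee k \<alpha>" for \<alpha>
    by (rule infsum_cmult_left) (rule s)
  ultimately have "((\<lambda>n. if n = - k then a (- k) else 0) has_sum
      integral {0..1} (\<lambda>\<alpha>. (\<Sum>\<^sub>\<infinity>n. a n * ee n \<alpha>) * ee k \<alpha>)) UNIV"
    by simp
  moreover have "((\<lambda>n. if n = - k then a (- k) else 0) has_sum a (- k)) UNIV"
    by (rule has_sum_finite_neutralI[of "{- k}"]) auto
  ultimately show "integral {0..1} (\<lambda>\<alpha>. (\<Sum>\<^sub>\<infinity>n. a n * ee n \<alpha>) * ee k \<alpha>) = a (- k)"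
    using has_sum_unique by blast
qed

text \<open>For Re s > 1 the singular power is continuous at 0 and the series converges absolutely.
  The difference of the two sides is continuous with vanishing Fourier coefficients.\<close>

lemma hurwitz_formula:
  assumes s: "Re s > 1" and \<alpha>: "\<alpha> \<in> {0<..<1}"
  shows "zeta_model (1, 1) s \<alpha> = Gamma s * (\<Sum>\<^sub>\<infinity>n. fourier_coef s n * ee n \<alpha>)"
proof -
  let ?F = "\<lambda>\<alpha>. \<Sum>\<^sub>\<infinity>n. fourier_coef s n * ee n \<alpha>"
  have "zeta_model (1, 1) s \<alpha> - Gamma s * ?F \<alpha> = 0"
  proof (rule fourier_uniqueness[OF _ _ \<alpha>])
    show "continuous_on {0..1} (\<lambda>\<alpha>. zeta_model (1, 1) s \<alpha> - Gamma s * ?F \<alpha>)"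
      by (intro continuous_intros continuous_on_zeta_model_closed s fourier_sum(2) fourier_coef_summable)
    fix n
    have "continuous_on {0..1} (\<lambda>\<alpha>. ?F \<alpha> * ee n \<alpha>)"
      by (intro continuous_intros fourier_sum(2) fourier_coef_summable s)
    then have "(\<lambda>\<alpha>. ?F \<alpha> * ee n \<alpha>) integrable_on {0..1}" by (rule integrable_continuous_real)
    from integrable_integral[OF this] have "((\<lambda>\<alpha>. ?F \<alpha> * ee n \<alpha>) has_integral fourier_coef s (- n)) {0..1}"
      by (simp only: fourier_sum(3)[OF fourier_coef_summable[OF s]])
    then have "((\<lambda>\<alpha>. Gamma s * (?F \<alpha> * ee n \<alpha>)) has_integral Gamma s * fourier_coef s (- n)) {0..1}"
      by (rule has_integral_mult_right)
    from has_integral_diff[OF zeta_coefficient[OF s, of n] this]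
    have "((\<lambda>\<alpha>. zeta_model (1, 1) s \<alpha> * ee n \<alpha> - Gamma s * (?F \<alpha> * ee n \<alpha>)) has_integral 0) {0..1}" by simp
    then show "integral {0..1} (\<lambda>\<alpha>. (zeta_model (1, 1) s \<alpha> - Gamma s * ?F \<alpha>) * ee n \<alpha>) = 0"
      by (intro integral_unique) (simp add: algebra_simps)
  qed
  then show ?thesis by simp
qed

section \<open>The identity for large real parts\<close>

lemma infsum_times:
  fixes f :: "'i \<Rightarrow> complex" and g :: "'j \<Rightarrow> complex"
  assumes "(\<lambda>i. norm (f i)) summable_on UNIV" "(\<lambda>j. norm (g j)) summable_on UNIV"
  shows "(\<Sum>\<^sub>\<infinity>p. f (fst p) * g (snd p)) = (\<Sum>\<^sub>\<infinity>i. f i) * (\<Sum>\<^sub>\<infinity>j. g j)"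
proof -
  have "(\<lambda>p. norm (f (fst p) * g (snd p))) summable_on UNIV"
    using summable_on_times[OF assms] by (simp add: norm_mult)
  then have "(\<lambda>p. f (fst p) * g (snd p)) summable_on UNIV" by (rule abs_summable_summable)
  then have "(\<lambda>(i, j). f i * g j) summable_on Sigma UNIV (\<lambda>_. UNIV)"
    by (simp add: case_prod_unfold)
  from infsum_Sigma'_banach[OF this]
  have "(\<Sum>\<^sub>\<infinity>p. f (fst p) * g (snd p)) = (\<Sum>\<^sub>\<infinity>i. \<Sum>\<^sub>\<infinity>j. f i * g j)"
    by (simp add: case_prod_unfold)
  then show ?thesis by (simp add: infsum_cmult_right' infsum_cmult_left')
qed

text \<open>Only two factors are expanded, the third enters through its Fourier coefficients. A
  product of two absolutely convergent series then dominates everything.\<close>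

lemma fourier_product_integral:
  assumes f: "continuous_on {0..1} f" and c: "\<And>n. ((\<lambda>\<alpha>. f \<alpha> * ee n \<alpha>) has_integral c n) {0..1}"
    and a: "(\<lambda>n. norm (a n)) summable_on UNIV" and b: "(\<lambda>n. norm (b n)) summable_on UNIV"
  shows "((\<lambda>p. a (fst p) * b (snd p) * c (fst p + snd p)) has_sum
    integral {0..1} (\<lambda>\<alpha>. f \<alpha> * (\<Sum>\<^sub>\<infinity>n. a n * ee n \<alpha>) * (\<Sum>\<^sub>\<infinity>n. b n * ee n \<alpha>))) UNIV"
proof -
  have "bounded (f ` {0..1})" by (intro compact_imp_bounded compact_continuous_image f) simp
  then obtain C where "\<forall>x\<in>f ` {0..1}. norm x \<le> C" unfolding bounded_iff ..
  then have C: "norm (f \<alpha>) \<le> C" if "\<alpha> \<in> {0..1}" for \<alpha> using that by blast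
  have "((\<lambda>p. integral {0..1} (\<lambda>\<alpha>. f \<alpha> * ((a (fst p) * ee (fst p) \<alpha>) * (b (snd p) * ee (snd p) \<alpha>)))) has_sum
      integral {0..1} (\<lambda>\<alpha>. \<Sum>\<^sub>\<infinity>p. f \<alpha> * ((a (fst p) * ee (fst p) \<alpha>) * (b (snd p) * ee (snd p) \<alpha>)))) UNIV"
  proof (rule infsum_integral(2))
    show "(\<lambda>p. C * (norm (a (fst p)) * norm (b (snd p)))) summable_on UNIV"
      by (intro summable_on_cmult_right summable_on_times a b) auto
    show "norm (f \<alpha> * ((a (fst p) * ee (fst p) \<alpha>) * (b (snd p) * ee (snd p) \<alpha>))) \<le> C * (norm (a (fst p)) * norm (b (snd p)))"
      if "\<alpha> \<in> {0..1}" for p \<alpha>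
      using C[OF that] by (auto simp: norm_mult intro!: mult_right_mono)
  qed (intro continuous_intros f)
  moreover have "integral {0..1} (\<lambda>\<alpha>. f \<alpha> * ((a n * ee n \<alpha>) * (b k * ee k \<alpha>))) = a n * b k * c (n + k)" for n k
    using has_integral_mult_right[OF c[of "n + k"], of "a n * b k"]
    by (intro integral_unique) (simp add: ee_add mult_ac)
  moreover have "(\<Sum>\<^sub>\<infinity>p. f \<alpha> * ((a (fst p) * ee (fst p) \<alpha>) * (b (snd p) * ee (snd p) \<alpha>))) =
      f \<alpha> * (\<Sum>\<^sub>\<infinity>n. a n * ee n \<alpha>) * (\<Sum>\<^sub>\<infinity>n. b n * ee n \<alpha>)" for \<alpha>
    using infsum_times[of "\<lambda>n. a n * ee n \<alpha>" "\<lambda>n. b n * ee n \<alpha>"] a b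
    by (simp add: infsum_cmult_right' norm_mult mult.assoc)
  ultimately show ?thesis by simp
qed

lemma tornheim_series_has_sum:
  assumes "(s1, s2, s3) \<in> tornheim_region"
  shows "((\<lambda>(m, n). of_nat m powr (- s1) * of_nat n powr (- s2) * of_nat (m + n) powr (- s3)) has_sum
    tornheim_series s1 s2 s3) ({1::nat..} \<times> {1::nat..})"
proof -
  have "(\<lambda>p. dsum_term p (s1, s2, s3) 1 1) summable_on UNIV" by (rule dsum_summable[OF assms]) auto
  then have "((\<lambda>p. dsum_term p (s1, s2, s3) 1 1) has_sum dsum (s1, s2, s3) 1 1) UNIV"
    unfolding dsum_def by (rule has_sum_infsum)
  then show ?thesis
    unfolding dsum_eq_tornheim_series
  proof (subst (asm) has_sum_reindex_bij_witness[of _ "\<lambda>(m, n). (m - 1, n - 1)" "\<lambda>(m, n). (Suc m, Suc n)" "{1..} \<times> {1..}"])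
    fix p :: "nat \<times> nat"
    show "(case case p of (m, n) \<Rightarrow> (Suc m, Suc n) of (m, n) \<Rightarrow>
        of_nat m powr - s1 * of_nat n powr - s2 * of_nat (m + n) powr - s3) = dsum_term p (s1, s2, s3) 1 1"
      by (cases p) (simp add: dsum_term_def algebra_simps)
  qed auto
qed

lemma phase_mult: "phase \<sigma> s * phase \<tau> t * phase \<rho> u = phase 1 (of_int \<sigma> * s + of_int \<tau> * t + of_int \<rho> * u)"
  unfolding phase_def exp_add[symmetric] by (rule arg_cong[of _ _ exp]) (simp add: algebra_simps add_divide_distrib)

lemma phase_add: "phase 1 z + phase 1 (- z) = 2 * cos (of_real pi / 2 * z)"
  by (simp add: phase_def cos_exp_eq mult_ac)

text \<open>On a sector the three frequencies have constant signs and one absolute value is the sum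
  of the other two, so a common phase factors out and the Tornheim term remains. \<open>j\<close>
  parametrises the sector by the two smaller absolute values and \<open>i\<close> is its
  inverse.\<close>

lemma sector_sum:
  assumes region: "(a, b, c) \<in> tornheim_region"
    and \<sigma>: "\<sigma> \<in> {1, -1}" "\<tau> \<in> {1, -1}" "\<rho> \<in> {1, -1}"
    and j: "\<And>m l. m \<in> {1..} \<Longrightarrow> l \<in> {1..} \<Longrightarrow> j (m, l) \<in> T \<and> i (j (m, l)) = (m, l) \<and>
      h (j (m, l)) = fourier_coef a (\<sigma> * int m) * fourier_coef b (\<tau> * int l) * fourier_coef c (\<rho> * int (m + l))"
    and i: "\<And>p. p \<in> T \<Longrightarrow> i p \<in> {1::nat..} \<times> {1::nat..} \<and> j (i p) = p"
  shows "(h has_sum (2 * of_real pi) powr (- (a + b + c)) *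
    phase 1 (of_int \<sigma> * a + of_int \<tau> * b + of_int \<rho> * c) * tornheim_series a b c) T"
proof -
  let ?K = "(2 * complex_of_real pi) powr (- (a + b + c)) * phase 1 (of_int \<sigma> * a + of_int \<tau> * b + of_int \<rho> * c)"
  let ?t = "\<lambda>(m, n). of_nat m powr (- a) * of_nat n powr (- b) * of_nat (m + n) powr (- c)"
  have K: "?K = ((2 * complex_of_real pi) powr (- a) * (2 * complex_of_real pi) powr (- b) * (2 * complex_of_real pi) powr (- c)) *
      (phase \<sigma> a * phase \<tau> b * phase \<rho> c)"
    unfolding phase_mult by (simp add: powr_add[symmetric])
  have h: "h (j (m, l)) = ?K * ?t (m, l)" if "m \<in> {1..}" "l \<in> {1..}" for m l
  proof -
    have "h (j (m, l)) = fourier_coef a (\<sigma> * int m) * fourier_coef b (\<tau> * int l) * fourier_coef c (\<rho> * int (m + l))" using j[OF that] by blast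
    then show ?thesis
      unfolding K using that \<sigma> by (simp only: fourier_coef_signed atLeast_iff) (simp add: fourier_coef_signed mult_ac)
  qed
  have "((\<lambda>p. ?K * ?t p) has_sum ?K * tornheim_series a b c) ({1..} \<times> {1..})"
    by (intro has_sum_cmult_right tornheim_series_has_sum region)
  moreover have "((\<lambda>p. ?K * ?t p) has_sum ?K * tornheim_series a b c) ({1..} \<times> {1..}) \<longleftrightarrow>
      (h has_sum ?K * tornheim_series a b c) T"
  proof (rule has_sum_reindex_bij_witness[of _ i j])
    fix p :: "nat \<times> nat" assume p: "p \<in> {1..} \<times> {1..}"
    then obtain m l where ml: "p = (m, l)" "m \<in> {1..}" "l \<in> {1..}" by blast
    show "i (j p) = p" "j p \<in> T" unfolding ml(1) using j[OF ml(2,3)] by blast+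
    show "h (j p) = ?K * ?t p" unfolding ml(1) by (rule h[OF ml(2,3)])
  qed (use i in blast)+
  ultimately show ?thesis by blast
qed

text \<open>With \<open>n2 = fst p\<close>, \<open>n3 = \<delta> * snd p\<close> and \<open>n1 = - (fst p + snd p)\<close>, the sectors collect the sign patterns
  for which \<open>\<bar>n3\<bar>\<close> (\<open>A\<close>), \<open>\<bar>n1\<bar>\<close> (\<open>B\<close>) or \<open>\<bar>n2\<bar>\<close> (\<open>C\<close>) is the largest; the other
  pairs have a vanishing term.\<close>

lemma six_sectors:
  fixes q :: "int \<times> int \<Rightarrow> complex"
  assumes \<delta>: "\<delta> \<in> {1, -1}" and s: "Re s1 > 1" "Re s2 > 1" "Re s3 > 1"
  defines "q \<equiv> \<lambda>p. fourier_coef s2 (fst p) * fourier_coef s3 (\<delta> * snd p) * fourier_coef s1 (- (fst p + snd p))"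
  defines "P \<equiv> 2 * (2 * complex_of_real pi) powr (- (s1 + s2 + s3))"
  shows "(q has_sum P *
     (cos (of_real pi / 2 * (s1 + s2 - of_int \<delta> * s3)) * tornheim_series s1 s2 s3 +
      cos (of_real pi / 2 * (s2 + of_int \<delta> * s3 - s1)) * tornheim_series s2 s3 s1 +
      cos (of_real pi / 2 * (s1 + of_int \<delta> * s3 - s2)) * tornheim_series s3 s1 s2)) UNIV"
proof -
  define A where "A \<sigma> = {p. \<sigma> * fst p > 0 \<and> \<sigma> * (fst p + snd p) < 0}" for \<sigma> :: int
  define B where "B \<sigma> = {p. \<sigma> * fst p > 0 \<and> \<sigma> * snd p > 0}" for \<sigma> :: int
  define C where "C \<sigma> = {p. \<sigma> * snd p < 0 \<and> \<sigma> * (fst p + snd p) > 0}" for \<sigma> :: int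
  let ?Q = "(2 * complex_of_real pi) powr (- (s1 + s2 + s3))"
  have \<delta>\<sigma>: "\<delta> * \<sigma> \<in> {1, -1}" "- (\<delta> * \<sigma>) \<in> {1, -1}" "- \<sigma> \<in> {1, -1}" if "\<sigma> \<in> {1, -1}" for \<sigma> :: int
    using \<delta> that by auto
  have r: "(s1, s2, s3) \<in> tornheim_region" "(s2, s3, s1) \<in> tornheim_region" "(s3, s1, s2) \<in> tornheim_region"
    using s by (auto simp: tornheim_region_def)
  \<comment> \<open>In this sector n2 = \<sigma> l and n1 = \<sigma> m, so that \<open>snd p\<close>
    is -\<sigma> (m + l). The other two sectors are parametrised in the same way with the roles
    rotated.\<close>
  have a: "(q has_sum ?Q * phase 1 z * tornheim_series s1 s2 s3) (A \<sigma>)"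
    if "\<sigma> \<in> {1, -1}" "z = of_int \<sigma> * s1 + of_int \<sigma> * s2 + of_int (- (\<delta> * \<sigma>)) * s3" for \<sigma> z
    unfolding that(2)
    by (rule sector_sum[OF r(1) that(1) that(1) \<delta>\<sigma>(2)[OF that(1)],
        where j = "\<lambda>(m, l). (\<sigma> * int l, - \<sigma> * int (m + l))" and i = "\<lambda>p. (nat (- \<sigma> * (fst p + snd p)), nat (\<sigma> * fst p))"])
       (use that(1) in \<open>auto simp: A_def q_def algebra_simps\<close>)
  have rot: "s1 + s2 + s3 = s2 + s3 + s1" "s1 + s2 + s3 = s3 + s1 + s2" by simp_all
  have b: "(q has_sum ?Q * phase 1 z * tornheim_series s2 s3 s1) (B \<sigma>)"
    if "\<sigma> \<in> {1, -1}" "z = of_int \<sigma> * s2 + of_int (\<delta> * \<sigma>) * s3 + of_int (- \<sigma>) * s1" for \<sigma> z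
    unfolding that(2) rot(1)
    by (rule sector_sum[OF r(2) that(1) \<delta>\<sigma>(1)[OF that(1)] \<delta>\<sigma>(3)[OF that(1)],
        where j = "\<lambda>(m, l). (\<sigma> * int m, \<sigma> * int l)" and i = "\<lambda>p. (nat (\<sigma> * fst p), nat (\<sigma> * snd p))"])
       (use that(1) in \<open>auto simp: B_def q_def algebra_simps\<close>)
  have c: "(q has_sum ?Q * phase 1 z * tornheim_series s3 s1 s2) (C \<sigma>)"
    if "\<sigma> \<in> {1, -1}" "z = of_int (- (\<delta> * \<sigma>)) * s3 + of_int (- \<sigma>) * s1 + of_int \<sigma> * s2" for \<sigma> z
    unfolding that(2) rot(2)
    by (rule sector_sum[OF r(3) \<delta>\<sigma>(2)[OF that(1)] \<delta>\<sigma>(3)[OF that(1)] that(1),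
        where j = "\<lambda>(m, l). (\<sigma> * int (m + l), - \<sigma> * int m)" and i = "\<lambda>p. (nat (- \<sigma> * snd p), nat (\<sigma> * (fst p + snd p)))"])
       (use that(1) in \<open>auto simp: C_def q_def algebra_simps\<close>)
  \<comment> \<open>Reversing all signs pairs the sectors of \<sigma> = 1 and \<sigma> = -1 with
    opposite phases; their sum is the cosine with the factor 2 of \<open>P\<close>.\<close>
  have pair: "P * (cos (of_real pi / 2 * z) * t) = ?Q * phase 1 z * t + ?Q * phase 1 (- z) * t" for z t
    unfolding P_def using phase_add[of z] by (simp add: distrib_left[symmetric] distrib_right[symmetric])
  have A: "(q has_sum P * (cos (of_real pi / 2 * (s1 + s2 - of_int \<delta> * s3)) * tornheim_series s1 s2 s3)) (A 1 \<union> A (-1))"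
    unfolding pair by (intro has_sum_Un_disjoint a) (auto simp: A_def)
  have B: "(q has_sum P * (cos (of_real pi / 2 * (s2 + of_int \<delta> * s3 - s1)) * tornheim_series s2 s3 s1)) (B 1 \<union> B (-1))"
    unfolding pair by (intro has_sum_Un_disjoint b) (auto simp: B_def)
  \<comment> \<open>The sector of -1 stands first, since its phase carries the argument of the
    cosine with the positive sign.\<close>
  have C: "(q has_sum P * (cos (of_real pi / 2 * (s1 + of_int \<delta> * s3 - s2)) * tornheim_series s3 s1 s2)) (C (-1) \<union> C 1)"
    unfolding pair by (intro has_sum_Un_disjoint c) (auto simp: C_def)
  have "(q has_sum P * (cos (of_real pi / 2 * (s1 + s2 - of_int \<delta> * s3)) * tornheim_series s1 s2 s3) +
      P * (cos (of_real pi / 2 * (s2 + of_int \<delta> * s3 - s1)) * tornheim_series s2 s3 s1) +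
      P * (cos (of_real pi / 2 * (s1 + of_int \<delta> * s3 - s2)) * tornheim_series s3 s1 s2))
      (A 1 \<union> A (-1) \<union> (B 1 \<union> B (-1)) \<union> (C (-1) \<union> C 1))"
    by (intro has_sum_Un_disjoint A B C) (auto simp: A_def B_def C_def)
  moreover have "q p = 0" if "p \<notin> A 1 \<union> A (-1) \<union> (B 1 \<union> B (-1)) \<union> (C (-1) \<union> C 1)" for p
  proof -
    have "fst p = 0 \<or> snd p = 0 \<or> - (fst p + snd p) = 0" using that by (auto simp: A_def B_def C_def)
    then show ?thesis
      unfolding q_def by (elim disjE) (simp_all only: fourier_coef_0 mult_zero_left mult_zero_right)
  qed
  moreover have "(q has_sum x) UNIV \<longleftrightarrow> (q has_sum x) (A 1 \<union> A (-1) \<union> (B 1 \<union> B (-1)) \<union> (C (-1) \<union> C 1))" for x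
    by (rule has_sum_cong_neutral) (use calculation(2) in auto)
  ultimately show ?thesis by (simp add: distrib_left)
qed

text \<open>The relation zeta(w, x) = x^(-w) + zeta(w, x + 1) at x = 1 - \<alpha>. Near \<alpha> = 0
  the power is absorbed in a smooth function, so no singular term is left.\<close>

lemma zeta_model_reflect:
  assumes "\<alpha> \<in> {0<..<1}" "s \<noteq> 0"
  shows "zeta_model (1, 1) s (1 - \<alpha>) = zeta_model (0, -1) s \<alpha>"
proof -
  have "zeta_reg (1 - s) (1 - \<alpha>) = - s * of_real (1 - \<alpha>) powr (s - 1) + zeta_reg (1 - s) (1 + (1 - \<alpha>))"
    using assms by (simp add: zeta_reg_def[of _ "1 - \<alpha>"] zeta_reg_eq_zeta_reg1)
  then have "- zeta_reg (1 - s) (1 - \<alpha>) / s = of_real (1 - \<alpha>) powr (s - 1) - zeta_reg (1 - s) (1 + (1 - \<alpha>)) / s"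
    using assms(2) by (simp only: minus_add_distrib add_divide_distrib) simp
  then show ?thesis by (simp add: zeta_model_def)
qed

lemma hurwitz_zeta_eq_zeta_model:
  assumes "\<alpha> > 0" "s \<noteq> 0"
  shows "hurwitz_zeta (1 - s) (of_real \<alpha>) = zeta_model (1, 1) s \<alpha>"
proof -
  have "zeta_reg (1 - s) \<alpha> = - s * of_real \<alpha> powr (s - 1) + zeta_reg (1 - s) (1 + \<alpha>)"
    using assms by (simp add: zeta_reg_def[of _ \<alpha>] zeta_reg_eq_zeta_reg1)
  then show ?thesis using assms hurwitz_zeta_eq[of \<alpha> "1 - s"] by (simp add: zeta_model_def field_simps)
qed

text \<open>\<open>\<delta> = 1\<close> belongs to part (I), \<open>\<delta> = -1\<close> to part (II).\<close>

definition zeta_product :: "int \<Rightarrow> complex \<Rightarrow> complex \<Rightarrow> complex \<Rightarrow> real \<Rightarrow> complex" where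
  "zeta_product \<delta> s1 s2 s3 \<alpha> = zeta_model (1, 1) s1 \<alpha> * zeta_model (1, 1) s2 \<alpha> * zeta_model (1, 1) s3 (if \<delta> = 1 then \<alpha> else 1 - \<alpha>)"

definition tornheim_sum :: "int \<Rightarrow> (complex \<Rightarrow> complex \<Rightarrow> complex \<Rightarrow> complex) \<Rightarrow> complex \<Rightarrow> complex \<Rightarrow> complex \<Rightarrow> complex" where
  "tornheim_sum \<delta> T s1 s2 s3 = 2 * (2 * of_real pi) powr (- (s1 + s2 + s3)) * Gamma s1 * Gamma s2 * Gamma s3 *
     (cos (of_real pi / 2 * (s1 + s2 - of_int \<delta> * s3)) * T s1 s2 s3 +
      cos (of_real pi / 2 * (s2 + of_int \<delta> * s3 - s1)) * T s2 s3 s1 +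
      cos (of_real pi / 2 * (s1 + of_int \<delta> * s3 - s2)) * T s3 s1 s2)"

lemma integral_Ioo_01:
  fixes f :: "real \<Rightarrow> complex"
  shows "(f has_integral y) {0<..<1} \<longleftrightarrow> (f has_integral y) {0..1}"
  by (rule has_integral_spike_set_eq) (auto intro: negligible_subset[of "{0, 1}"])

lemma integral_zeta_product:
  assumes \<delta>: "\<delta> \<in> {1, -1}" and s: "Re s1 > 1" "Re s2 > 1" "Re s3 > 1"
  shows "(zeta_product \<delta> s1 s2 s3 has_integral tornheim_sum \<delta> tornheim_series s1 s2 s3) {0<..<1}"
proof -
  \<comment> \<open>Reflecting \<alpha> reverses the frequencies, so the two parts differ only by
    the sign \<delta> inside the coefficient.\<close>
  let ?F2 = "\<lambda>\<alpha>. \<Sum>\<^sub>\<infinity>n. fourier_coef s2 n * ee n \<alpha>" and ?F3 = "\<lambda>\<alpha>. \<Sum>\<^sub>\<infinity>n. fourier_coef s3 (\<delta> * n) * ee n \<alpha>"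
  have fc3: "(\<lambda>n. norm (fourier_coef s3 (\<delta> * n))) summable_on UNIV"
  proof (cases "\<delta> = 1")
    case False
    have "(\<lambda>n. norm (fourier_coef s3 n)) summable_on (uminus ` UNIV)" using fourier_coef_summable[OF s(3)] by (simp add: surj_def)
    then have "(\<lambda>n. norm (fourier_coef s3 (- n))) summable_on UNIV" by (subst (asm) summable_on_reindex) (auto simp: o_def)
    then show ?thesis using False \<delta> by simp
  qed (simp add: fourier_coef_summable s)
  have cont: "continuous_on {0..1} (\<lambda>\<alpha>. zeta_model (1, 1) s1 \<alpha> * ?F2 \<alpha> * ?F3 \<alpha>)"
    by (intro continuous_intros continuous_on_zeta_model_closed fourier_sum(2) fourier_coef_summable fc3 s)
  have "((\<lambda>p. fourier_coef s2 (fst p) * fourier_coef s3 (\<delta> * snd p) * (Gamma s1 * fourier_coef s1 (- (fst p + snd p)))) has_sum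
      integral {0..1} (\<lambda>\<alpha>. zeta_model (1, 1) s1 \<alpha> * ?F2 \<alpha> * ?F3 \<alpha>)) UNIV"
    by (rule fourier_product_integral[OF continuous_on_zeta_model_closed zeta_coefficient fourier_coef_summable fc3]) (rule s)+
  moreover have "((\<lambda>p. Gamma s1 * (fourier_coef s2 (fst p) * fourier_coef s3 (\<delta> * snd p) * fourier_coef s1 (- (fst p + snd p)))) has_sum
      Gamma s1 * (2 * (2 * of_real pi) powr (- (s1 + s2 + s3)) *
       (cos (of_real pi / 2 * (s1 + s2 - of_int \<delta> * s3)) * tornheim_series s1 s2 s3 +
        cos (of_real pi / 2 * (s2 + of_int \<delta> * s3 - s1)) * tornheim_series s2 s3 s1 +
        cos (of_real pi / 2 * (s1 + of_int \<delta> * s3 - s2)) * tornheim_series s3 s1 s2))) UNIV"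
    by (intro has_sum_cmult_right six_sectors \<delta> s)
  ultimately have "integral {0..1} (\<lambda>\<alpha>. zeta_model (1, 1) s1 \<alpha> * ?F2 \<alpha> * ?F3 \<alpha>) =
      Gamma s1 * (2 * (2 * of_real pi) powr (- (s1 + s2 + s3)) *
       (cos (of_real pi / 2 * (s1 + s2 - of_int \<delta> * s3)) * tornheim_series s1 s2 s3 +
        cos (of_real pi / 2 * (s2 + of_int \<delta> * s3 - s1)) * tornheim_series s2 s3 s1 +
        cos (of_real pi / 2 * (s1 + of_int \<delta> * s3 - s2)) * tornheim_series s3 s1 s2))"
    by (intro has_sum_unique[of "\<lambda>p. fourier_coef s2 (fst p) * fourier_coef s3 (\<delta> * snd p) * (Gamma s1 * fourier_coef s1 (- (fst p + snd p)))"])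
       (simp_all add: mult_ac)
  with integrable_integral[OF integrable_continuous_real[OF cont]]
  have "((\<lambda>\<alpha>. (Gamma s2 * Gamma s3) * (zeta_model (1, 1) s1 \<alpha> * ?F2 \<alpha> * ?F3 \<alpha>)) has_integral
      (Gamma s2 * Gamma s3) * (Gamma s1 * (2 * (2 * of_real pi) powr (- (s1 + s2 + s3)) *
       (cos (of_real pi / 2 * (s1 + s2 - of_int \<delta> * s3)) * tornheim_series s1 s2 s3 +
        cos (of_real pi / 2 * (s2 + of_int \<delta> * s3 - s1)) * tornheim_series s2 s3 s1 +
        cos (of_real pi / 2 * (s1 + of_int \<delta> * s3 - s2)) * tornheim_series s3 s1 s2)))) {0<..<1}"
    unfolding integral_Ioo_01 by (intro has_integral_mult_right) simp
  then have "((\<lambda>\<alpha>. (Gamma s2 * Gamma s3) * (zeta_model (1, 1) s1 \<alpha> * ?F2 \<alpha> * ?F3 \<alpha>)) has_integral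
      tornheim_sum \<delta> tornheim_series s1 s2 s3) {0<..<1}"
    unfolding tornheim_sum_def by (simp only: mult_ac)
  then show ?thesis
  proof (rule has_integral_eq[rotated])
    fix \<alpha> :: real assume \<alpha>: "\<alpha> \<in> {0<..<1}"
    have F3: "zeta_model (1, 1) s3 (if \<delta> = 1 then \<alpha> else 1 - \<alpha>) = Gamma s3 * ?F3 \<alpha>"
    proof (cases "\<delta> = 1")
      case False
      have "ee (- n) (1 - \<alpha>) = ee n \<alpha>" for n
        using ee_shift[of "- n" 1 "- \<alpha>"] by (simp add: ee_def)
      then have "(\<Sum>\<^sub>\<infinity>n. fourier_coef s3 n * ee n (1 - \<alpha>)) = (\<Sum>\<^sub>\<infinity>n. fourier_coef s3 (- n) * ee n \<alpha>)"
        by (intro infsum_reindex_bij_witness[of _ uminus uminus]) (auto, metis minus_minus)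
      then show ?thesis using hurwitz_formula[OF s(3), of "1 - \<alpha>"] False \<delta> \<alpha> by simp
    qed (simp add: hurwitz_formula[OF s(3) \<alpha>])
    show "(Gamma s2 * Gamma s3) * (zeta_model (1, 1) s1 \<alpha> * ?F2 \<alpha> * ?F3 \<alpha>) = zeta_product \<delta> s1 s2 s3 \<alpha>"
      unfolding zeta_product_def F3 hurwitz_formula[OF s(2) \<alpha>] by simp
  qed
qed

section \<open>Continuation of the identity\<close>

text \<open>Folding at 1/2 moves the end point 1 to 0, so that one local analysis serves both end
  points.\<close>

lemma split_reflect:
  fixes g :: "real \<Rightarrow> complex"
  assumes "g integrable_on {0<..<1}"
  shows "g integrable_on {0<..1/2}" "(\<lambda>\<alpha>. g (1 - \<alpha>)) integrable_on {0<..1/2}"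
    "integral {0<..<1} g = integral {0<..1/2} g + integral {0<..1/2} (\<lambda>\<alpha>. g (1 - \<alpha>))"
proof -
  have half: "(f has_integral y) {0<..1/2} \<longleftrightarrow> (f has_integral y) {0..1/2::real}" for f :: "real \<Rightarrow> complex" and y
    by (rule has_integral_spike_set_eq) (auto intro: negligible_subset[of "{0}"])
  have g: "g integrable_on {0..1}" using assms by (simp add: integrable_on_def integral_Ioo_01)
  then have "g integrable_on {0..1/2}" "g integrable_on {1/2..1}"
    by (auto intro: integrable_subinterval_real)
  then obtain y z where y: "(g has_integral y) {0..1/2}" and z: "(g has_integral z) {1/2..1}"
    by (auto simp: integrable_on_def)
  have "((\<lambda>x. g (x + 1)) has_integral z) {1/2 - 1..1 - 1}"
    using has_integral_shift_cbox[of g z "1/2" 1 1] z by simp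
  then have "((\<lambda>x. g (- x + 1)) has_integral z) {- 0..- (- (1/2))}"
    by (subst has_integral_reflect_real) simp
  then have z': "((\<lambda>x. g (1 - x)) has_integral z) {0..1/2}" by (simp add: add.commute)
  have "(g has_integral y + z) {0..1}" by (rule has_integral_combine[OF _ _ y z]) auto
  then have "integral {0<..<1} g = y + z" by (simp add: integral_Ioo_01 integral_unique)
  moreover have "(g has_integral y) {0<..1/2}" "((\<lambda>x. g (1 - x)) has_integral z) {0<..1/2}"
    using y z' by (simp_all add: half)
  ultimately show "g integrable_on {0<..1/2}" "(\<lambda>\<alpha>. g (1 - \<alpha>)) integrable_on {0<..1/2}"
    "integral {0<..<1} g = integral {0<..1/2} g + integral {0<..1/2} (\<lambda>\<alpha>. g (1 - \<alpha>))"
    by (auto simp: integral_unique)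
qed

text \<open>In this form, as nonvanishing of a product of entire functions, the condition is open
  along lines by continuity; \<open>regular_point_iff\<close> recovers the excluded sets.\<close>

definition regular_point :: "complex \<Rightarrow> complex \<Rightarrow> complex \<Rightarrow> bool" where
  "regular_point s1 s2 s3 \<longleftrightarrow> rGamma s1 * rGamma s2 * rGamma s3 * tornheim_denom (s1, s2, s3) *
     tornheim_denom (s2, s3, s1) * tornheim_denom (s3, s1, s2) \<noteq> 0"

lemma regular_point_iff: "regular_point s1 s2 s3 \<longleftrightarrow> s1 \<notin> \<int>\<^sub>\<le>\<^sub>0 \<and> s2 \<notin> \<int>\<^sub>\<le>\<^sub>0 \<and> s3 \<notin> \<int>\<^sub>\<le>\<^sub>0 \<and>
    (s1, s2, s3) \<notin> tornheim_poles \<and> (s2, s3, s1) \<notin> tornheim_poles \<and> (s3, s1, s2) \<notin> tornheim_poles"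
  by (auto simp: regular_point_def rGamma_eq_zero_iff tornheim_denom_eq_0_iff)

lemma regular_point_nonzero: "regular_point s1 s2 s3 \<Longrightarrow> s1 \<noteq> 0 \<and> s2 \<noteq> 0 \<and> s3 \<noteq> 0"
  by (auto simp: regular_point_iff)

text \<open>Three singular powers have exponent s1 + s2 + s3 - 3, two have a pair sum minus 2 plus a
  natural number, one has s - 1 plus a natural number, and none a natural number. The value -1 would
  thus be a pole of T, of T, of Gamma, or impossible; the cyclic orders of T exclude every
  pair.\<close>

lemma exponent3_neq:
  assumes r: "regular_point a b c" and p: "p \<in> idx3 K"
  shows "exponent3 K p a b c \<noteq> - 1"
proof
  assume e: "exponent3 K p a b c = - 1"
  obtain i j k where ijk: "p = (i, j, k)" by (cases p)
  have g: "x \<noteq> - of_nat n" if "x \<in> {a, b, c}" for x n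
    using r that by (auto simp: regular_point_iff)
  have d: "b + c \<noteq> 1 - of_nat n" "c + a \<noteq> 1 - of_nat n" "a + b \<noteq> 1 - of_nat n" for n
    using r unfolding regular_point_iff tornheim_poles_def by auto
  have t: "a + b + c \<noteq> 2" using r by (auto simp: regular_point_iff tornheim_poles_def)
  have n: "of_nat n \<noteq> (- 1 :: complex)" for n
  proof
    assume "of_nat n = (- 1 :: complex)"
    then have "Re (of_nat n) = Re (- 1)" by (rule arg_cong)
    then show False by simp
  qed
  have e': "expansion_exponent K i a + expansion_exponent K j b + expansion_exponent K k c = - 1" using e by (simp add: ijk exponent3_def)
  show False
  proof (cases "i = K"; cases "j = K"; cases "k = K")
    assume "i = K" "j = K" "k = K"
    then have "a + b + c = 2" using e' by (simp add: expansion_exponent_def algebra_simps add_eq_0_iff)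
    then show False using t by simp
  next
    assume "i = K" "j = K" "k \<noteq> K"
    then have "a + b = 1 - of_nat k" using e' by (simp add: expansion_exponent_def algebra_simps)
    then show False using d by simp
  next
    assume "i = K" "j \<noteq> K" "k = K"
    then have "c + a = 1 - of_nat j" using e' by (simp add: expansion_exponent_def algebra_simps)
    then show False using d by simp
  next
    assume "i = K" "j \<noteq> K" "k \<noteq> K"
    then have "a = - of_nat (j + k)"
      using e' by (simp add: expansion_exponent_def eq_neg_iff_add_eq_0 algebra_simps)
    then show False using g by blast
  next
    assume "i \<noteq> K" "j = K" "k = K"
    then have "b + c = 1 - of_nat i" using e' by (simp add: expansion_exponent_def algebra_simps)
    then show False using d by simp
  next
    assume "i \<noteq> K" "j = K" "k \<noteq> K"
    then have "b = - of_nat (i + k)"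
      using e' by (simp add: expansion_exponent_def eq_neg_iff_add_eq_0 algebra_simps)
    then show False using g by blast
  next
    assume "i \<noteq> K" "j \<noteq> K" "k = K"
    then have "c = - of_nat (i + j)"
      using e' by (simp add: expansion_exponent_def eq_neg_iff_add_eq_0 algebra_simps)
    then show False using g by blast
  next
    assume "i \<noteq> K" "j \<noteq> K" "k \<noteq> K"
    then have "of_nat (i + j + k) = (- 1 :: complex)" using e' by (simp add: expansion_exponent_def)
    then show False using n by blast
  qed
qed

text \<open>One summand for each end point. At the reflected end the local models of all three
  factors are exchanged.\<close>

definition finite_part_product :: "nat \<Rightarrow> int \<Rightarrow> complex \<Rightarrow> complex \<Rightarrow> complex \<Rightarrow> complex" where
  "finite_part_product K \<delta> s1 s2 s3 = finite_part K (1, 1) (1, 1) (if \<delta> = 1 then (1, 1) else (0, -1)) s1 s2 s3 +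
     finite_part K (0, -1) (0, -1) (if \<delta> = 1 then (0, -1) else (1, 1)) s1 s2 s3"

lemma kappa_ok_simps [simp]: "kappa_ok (1, 1)" "kappa_ok (0, -1)"
  by (auto simp: kappa_ok_def)

lemma integral_eq_finite_part_product:
  assumes r: "regular_point s1 s2 s3" and K: "K = 2 * M" "K > 0"
    and M: "Re s1 \<ge> 1 - real M" "Re s2 \<ge> 1 - real M" "Re s3 \<ge> 1 - real M"
    and int: "zeta_product \<delta> s1 s2 s3 integrable_on {0<..<1}"
  shows "integral {0<..<1} (zeta_product \<delta> s1 s2 s3) = finite_part_product K \<delta> s1 s2 s3"
proof -
  let ?g = "zeta_product \<delta> s1 s2 s3"
  have nz: "s1 \<noteq> 0" "s2 \<noteq> 0" "s3 \<noteq> 0" using regular_point_nonzero[OF r] by auto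
  let ?\<kappa> = "if \<delta> = 1 then (1, 1) else (0, -1) :: complex \<times> real"
  let ?\<kappa>' = "if \<delta> = 1 then (0, -1) else (1, 1) :: complex \<times> real"
  have ok: "kappa_ok ?\<kappa>" "kappa_ok ?\<kappa>'" by auto
  have 1: "?g \<alpha> = zeta_model (1, 1) s1 \<alpha> * zeta_model (1, 1) s2 \<alpha> * zeta_model ?\<kappa> s3 \<alpha>" if "\<alpha> \<in> {0<..1/2}" for \<alpha>
    using that zeta_model_reflect[of \<alpha> s3] nz by (auto simp: zeta_product_def)
  have 2: "?g (1 - \<alpha>) = zeta_model (0, -1) s1 \<alpha> * zeta_model (0, -1) s2 \<alpha> * zeta_model ?\<kappa>' s3 \<alpha>" if "\<alpha> \<in> {0<..1/2}" for \<alpha>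
    using that zeta_model_reflect[of \<alpha>] nz by (auto simp: zeta_product_def)
  have i1: "(\<lambda>\<alpha>. zeta_model (1, 1) s1 \<alpha> * zeta_model (1, 1) s2 \<alpha> * zeta_model ?\<kappa> s3 \<alpha>) integrable_on {0<..1/2}"
    by (rule integrable_eq[OF split_reflect(1)[OF int]]) (rule 1)
  have i2: "(\<lambda>\<alpha>. zeta_model (0, -1) s1 \<alpha> * zeta_model (0, -1) s2 \<alpha> * zeta_model ?\<kappa>' s3 \<alpha>) integrable_on {0<..1/2}"
    by (rule integrable_eq[OF split_reflect(2)[OF int]]) (rule 2)
  have "integral {0<..1/2} ?g = finite_part K (1, 1) (1, 1) ?\<kappa> s1 s2 s3"
    using finite_part_eq_integral[OF kappa_ok_simps(1,1) ok(1) K nz M exponent3_neq[OF r] i1]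
      Henstock_Kurzweil_Integration.integral_cong[of "{0<..1/2}" ?g, OF 1] by simp
  moreover have "integral {0<..1/2} (\<lambda>\<alpha>. ?g (1 - \<alpha>)) = finite_part K (0, -1) (0, -1) ?\<kappa>' s1 s2 s3"
    using finite_part_eq_integral[OF kappa_ok_simps(2,2) ok(2) K nz M exponent3_neq[OF r] i2]
      Henstock_Kurzweil_Integration.integral_cong[of "{0<..1/2}" "\<lambda>\<alpha>. ?g (1 - \<alpha>)", OF 2] by simp
  ultimately show ?thesis unfolding split_reflect(3)[OF int] finite_part_product_def by simp
qed

lemma regular_point_region:
  assumes "Re s1 > 1" "Re s2 > 1" "Re s3 > 1"
  shows "regular_point s1 s2 s3"
proof -
  have 1: "s \<notin> \<int>\<^sub>\<le>\<^sub>0" if "Re s > 1" for s :: complex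
    using that by (auto elim!: nonpos_Ints_cases')
  have 2: "(a, b, c) \<notin> tornheim_poles" if "Re a > 1" "Re b > 1" "Re c > 1" for a b c
  proof
    assume "(a, b, c) \<in> tornheim_poles"
    then consider k :: nat where "b + c = 1 - of_nat k" | k :: nat where "c + a = 1 - of_nat k" | "a + b + c = 2"
      by (auto simp: tornheim_poles_def)
    then have "Re (b + c) \<le> 1 \<or> Re (c + a) \<le> 1 \<or> Re (a + b + c) = 2"
      by cases auto
    then show False using that by auto
  qed
  show ?thesis unfolding regular_point_iff using 1 2 assms by blast
qed

lemma holomorphic_nice_line:
  assumes "nice (\<lambda>s a b. f s) UNIV"
  shows "(\<lambda>t. f (3 + t * v1, 3 + t * v2, 3 + t * v3)) holomorphic_on S"
  using nice_holomorphic[OF assms, of 1 1 "(3, 3, 3)" "(v1, v2, v3)"]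
  by (auto intro: holomorphic_on_subset)

text \<open>The value 3 is no pole of Gamma and (3, 3, 3) none of T, so each of the countably many
  exceptional hyperplanes is met at most once.\<close>

lemma regular_line:
  fixes v1 v2 v3 :: complex
  defines "R \<equiv> {t. regular_point (3 + t * v1) (3 + t * v2) (3 + t * v3)}"
  shows "open R" "countable (- R)"
proof -
  have hol: "(\<lambda>t. rGamma (3 + t * v1) * rGamma (3 + t * v2) * rGamma (3 + t * v3) *
      tornheim_denom (3 + t * v1, 3 + t * v2, 3 + t * v3) * tornheim_denom (3 + t * v2, 3 + t * v3, 3 + t * v1) *
      tornheim_denom (3 + t * v3, 3 + t * v1, 3 + t * v2)) holomorphic_on UNIV"
    by (intro holomorphic_intros holomorphic_nice_line nice_tornheim_denom)
  show "open R"
    unfolding R_def regular_point_def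
    using open_Collect_neq[OF holomorphic_on_imp_continuous_on[OF hol] continuous_on_const] .
  have 1: "countable {t. 3 + t * v \<in> \<int>\<^sub>\<le>\<^sub>0}" for v :: complex
  proof -
    have "(3::complex) \<noteq> - of_nat k" for k
    proof
      assume "(3::complex) = - of_nat k"
      then have "Re 3 = Re (- of_nat k)" by (rule arg_cong)
      then show False by simp
    qed
    then have "countable (\<Union>k. {t. 3 + t * v = - of_nat k})"
      by (intro countable_UN countableI_type countable_finite finite_affine_solutions)
    then show ?thesis by (rule countable_subset[rotated]) (auto elim!: nonpos_Ints_cases')
  qed
  have 2: "countable {t. (3 + t * v1, 3 + t * v2, 3 + t * v3) \<in> tornheim_poles}" for v1 v2 v3
    using countable_cline_tornheim_poles[of "(v1, v2, v3)"] by simp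
  have "- R = {t. 3 + t * v1 \<in> \<int>\<^sub>\<le>\<^sub>0} \<union> {t. 3 + t * v2 \<in> \<int>\<^sub>\<le>\<^sub>0} \<union> {t. 3 + t * v3 \<in> \<int>\<^sub>\<le>\<^sub>0} \<union>
      {t. (3 + t * v1, 3 + t * v2, 3 + t * v3) \<in> tornheim_poles} \<union>
      {t. (3 + t * v2, 3 + t * v3, 3 + t * v1) \<in> tornheim_poles} \<union>
      {t. (3 + t * v3, 3 + t * v1, 3 + t * v2) \<in> tornheim_poles}"
    unfolding R_def regular_point_iff by blast
  then show "countable (- R)" by (simp only: countable_Un_iff 1 2 simp_thms)
qed

lemma zeta_product_identity:
  assumes \<delta>: "\<delta> \<in> {1, -1}" and r: "regular_point s1 s2 s3" and int: "zeta_product \<delta> s1 s2 s3 integrable_on {0<..<1}"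
  shows "integral {0<..<1} (zeta_product \<delta> s1 s2 s3) = tornheim_sum \<delta> tornheim_T s1 s2 s3"
proof -
  obtain g where g: "nice (\<lambda>s a b. g s) UNIV" and eq: "\<And>s1 s2 s3. (s1, s2, s3) \<in> tornheim_region \<Longrightarrow>
      g (s1, s2, s3) = tornheim_denom (s1, s2, s3) * tornheim_series s1 s2 s3"
    using tornheim_continuation by blast
  define T where "T a b c = g (a, b, c) / tornheim_denom (a, b, c)" for a b c
  have T: "tornheim_T a b c = T a b c" if "(a, b, c) \<notin> tornheim_poles" for a b c
    unfolding T_def by (rule tornheim_T_eq[OF g eq that])
  define v1 v2 v3 where "v1 = s1 - 3" and "v2 = s2 - 3" and "v3 = s3 - 3"
  define S1 S2 S3 where "S1 t = 3 + t * v1" and "S2 t = 3 + t * v2" and "S3 t = 3 + t * v3" for t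
  note S_defs = S1_def S2_def S3_def
  define c where "c = norm v1 + norm v2 + norm v3"
  \<comment> \<open>One order K must serve the whole domain \<open>W\<close>, which is therefore cut
    to a disc. Radius 2 contains the parameters 0 and 1, and there the real parts are at least 3 - 2
    c \<ge> 1 - M.\<close>
  obtain m :: nat where m: "2 * c \<le> real m" using real_arch_simple by blast
  define M where "M = Suc m"
  define K where "K = 2 * M"
  \<comment> \<open>In this radius the real parts differ from 3 by at most 1, so the range of the
    absolutely convergent identity is not left.\<close>
  define e where "e = 1 / (1 + c)"
  define W where "W = ball 0 2 \<inter> {t. regular_point (S1 t) (S2 t) (S3 t)}"
  have K: "K = 2 * M" "K > 0" by (auto simp: K_def M_def)
  have c0: "c \<ge> 0" by (simp add: c_def)
  have S: "S1 holomorphic_on A" "S2 holomorphic_on A" "S3 holomorphic_on A" for A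
    unfolding S_defs by (intro holomorphic_intros)+
  have Re_ge: "Re (3 + t * v) \<ge> 3 - norm t * c" if "norm v \<le> c" for t v
  proof -
    have "norm (t * v) \<le> norm t * c" using that by (auto simp: norm_mult intro: mult_left_mono)
    moreover have "\<bar>Re (t * v)\<bar> \<le> norm (t * v)" by (rule abs_Re_le_cmod)
    ultimately show ?thesis by simp
  qed
  have v: "norm v1 \<le> c" "norm v2 \<le> c" "norm v3 \<le> c" by (auto simp: c_def)
  have M: "Re (S1 t) \<ge> 1 - real M \<and> Re (S2 t) \<ge> 1 - real M \<and> Re (S3 t) \<ge> 1 - real M" if "t \<in> W" for t
  proof -
    have "norm t * c \<le> 2 * c" using that c0 by (intro mult_right_mono) (auto simp: W_def)
    then have "3 - norm t * c \<ge> 1 - real M" using m by (simp add: M_def)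
    then show ?thesis unfolding S_defs using Re_ge[OF v(1), of t] Re_ge[OF v(2), of t] Re_ge[OF v(3), of t] by linarith
  qed
  have small: "Re (S1 t) > 1 \<and> Re (S2 t) > 1 \<and> Re (S3 t) > 1" if "t \<in> ball 0 e" for t
  proof -
    have "norm t * c \<le> e * c" using that c0 by (intro mult_right_mono) auto
    also have "\<dots> \<le> 1" using c0 by (simp add: e_def divide_simps)
    finally show ?thesis unfolding S_defs using Re_ge[OF v(1), of t] Re_ge[OF v(2), of t] Re_ge[OF v(3), of t] by linarith
  qed
  have reg: "regular_point (S1 t) (S2 t) (S3 t)" if "t \<in> W" for t using that by (simp add: W_def)
  have openW: "open W" unfolding W_def S_defs by (intro open_Int open_ball regular_line(1))
  have S_1: "S1 1 = s1" "S2 1 = s2" "S3 1 = s3" by (simp_all add: S_defs v1_def v2_def v3_def)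
  have W1: "1 \<in> W" using r by (simp add: W_def S_1)
  have "finite_part_product K \<delta> (S1 1) (S2 1) (S3 1) = tornheim_sum \<delta> T (S1 1) (S2 1) (S3 1)"
  proof (rule analytic_continuation_open[where z = 1 and s = "ball 0 e" and s' = W
      and f = "\<lambda>t. finite_part_product K \<delta> (S1 t) (S2 t) (S3 t)" and g = "\<lambda>t. tornheim_sum \<delta> T (S1 t) (S2 t) (S3 t)"])
    show "ball (0::complex) e \<noteq> {}" using c0 by (simp add: e_def)
    have "connected (ball 0 2 - - {t. regular_point (S1 t) (S2 t) (S3 t)})"
      unfolding S_defs by (intro connected_open_diff_countable regular_line(2) convex_connected convex_ball open_ball) auto
    then show "connected W" by (simp add: W_def Diff_eq)
    have "e \<le> 1" using c0 by (simp add: e_def)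
    then show sub: "ball 0 e \<subseteq> W"
      using small regular_point_region by (auto simp: W_def)
    show "(\<lambda>t. finite_part_product K \<delta> (S1 t) (S2 t) (S3 t)) holomorphic_on W"
      unfolding finite_part_product_def
      by (intro holomorphic_on_add finite_part_holomorphic[OF _ _ _ K openW S _ M])
         (use regular_point_nonzero[OF reg] exponent3_neq[OF reg] in auto)
    have holT: "(\<lambda>t. T (3 + t * v1) (3 + t * v2) (3 + t * v3)) holomorphic_on W"
      if "\<And>t. t \<in> W \<Longrightarrow> (3 + t * v1, 3 + t * v2, 3 + t * v3) \<notin> tornheim_poles" for v1 v2 v3
      unfolding T_def
      by (intro holomorphic_on_divide holomorphic_nice_line nice_tornheim_denom g)
         (use that in \<open>simp add: tornheim_denom_eq_0_iff\<close>)
    have "(\<lambda>t. T (S1 t) (S2 t) (S3 t)) holomorphic_on W" "(\<lambda>t. T (S2 t) (S3 t) (S1 t)) holomorphic_on W"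
      "(\<lambda>t. T (S3 t) (S1 t) (S2 t)) holomorphic_on W"
      unfolding S_defs by (rule holT, use reg in \<open>simp add: regular_point_iff S_defs\<close>)+
    then show "(\<lambda>t. tornheim_sum \<delta> T (S1 t) (S2 t) (S3 t)) holomorphic_on W"
      unfolding tornheim_sum_def using reg
      by (intro holomorphic_intros S) (auto simp: regular_point_iff)
    fix t :: complex assume t: "t \<in> ball 0 e"
    then have R: "Re (S1 t) > 1" "Re (S2 t) > 1" "Re (S3 t) > 1" and tW: "t \<in> W"
      using small[OF t] sub t by auto
    have TS: "T a b c = tornheim_series a b c" if "Re a > 1" "Re b > 1" "Re c > 1" for a b c
    proof -
      have "(a, b, c) \<in> tornheim_region" using that by (simp add: tornheim_region_def)
      moreover have "tornheim_denom (a, b, c) \<noteq> 0"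
        using regular_point_region[OF that] by (simp add: regular_point_iff tornheim_denom_eq_0_iff)
      ultimately show ?thesis by (simp add: T_def eq)
    qed
    have hi: "(zeta_product \<delta> (S1 t) (S2 t) (S3 t) has_integral tornheim_sum \<delta> tornheim_series (S1 t) (S2 t) (S3 t)) {0<..<1}"
      by (rule integral_zeta_product[OF \<delta> R])
    have "finite_part_product K \<delta> (S1 t) (S2 t) (S3 t) = integral {0<..<1} (zeta_product \<delta> (S1 t) (S2 t) (S3 t))"
      by (rule integral_eq_finite_part_product[OF reg[OF tW] K, symmetric]) (use M[OF tW] hi in auto)
    also have "\<dots> = tornheim_sum \<delta> tornheim_series (S1 t) (S2 t) (S3 t)" using hi by (rule integral_unique)
    also have "\<dots> = tornheim_sum \<delta> T (S1 t) (S2 t) (S3 t)" unfolding tornheim_sum_def by (simp only: TS R)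
    finally show "finite_part_product K \<delta> (S1 t) (S2 t) (S3 t) = tornheim_sum \<delta> T (S1 t) (S2 t) (S3 t)" .
  qed (use openW W1 in auto)
  moreover have "integral {0<..<1} (zeta_product \<delta> s1 s2 s3) = finite_part_product K \<delta> s1 s2 s3"
    by (rule integral_eq_finite_part_product[OF r K _ _ _ int]) (use M[OF W1] S_1 in auto)
  moreover have "tornheim_sum \<delta> T s1 s2 s3 = tornheim_sum \<delta> tornheim_T s1 s2 s3"
    unfolding tornheim_sum_def using r by (simp add: T regular_point_iff)
  ultimately show ?thesis by (simp add: S_1)
qed

text \<open>The exponents are restricted to points where the right-hand sides are finite, and each
  integral enters under its own premise of existence, as a possibly conditionally convergent
  Henstock-Kurzweil integral. The interval is open because a zeta factor with parameter 0 would
  occur at \<alpha> = 0 and, in the second part, at \<alpha> = 1.\<close>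

theorem mainTheorem1:
  fixes s1 s2 s3 N :: complex
  assumes N: "N = s1 + s2 + s3"
    and Gamma_regular: "s1 \<notin> \<int>\<^sub>\<le>\<^sub>0" "s2 \<notin> \<int>\<^sub>\<le>\<^sub>0" "s3 \<notin> \<int>\<^sub>\<le>\<^sub>0"
    and T_regular: "(s1, s2, s3) \<notin> tornheim_poles" "(s2, s3, s1) \<notin> tornheim_poles"
      "(s3, s1, s2) \<notin> tornheim_poles"
  shows
    "((\<lambda>\<alpha>::real. hurwitz_zeta (1 - s1) (of_real \<alpha>) * hurwitz_zeta (1 - s2) (of_real \<alpha>)
          * hurwitz_zeta (1 - s3) (of_real \<alpha>)) integrable_on {0<..<1} \<longrightarrow>
      integral {0<..<1} (\<lambda>\<alpha>::real. hurwitz_zeta (1 - s1) (of_real \<alpha>)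
          * hurwitz_zeta (1 - s2) (of_real \<alpha>) * hurwitz_zeta (1 - s3) (of_real \<alpha>)) =
        2 * (2 * of_real pi) powr (- (s1 + s2 + s3)) * Gamma s1 * Gamma s2 * Gamma s3 *
          (cos (of_real pi / 2 * (N - 2 * s3)) * tornheim_T s1 s2 s3 +
           cos (of_real pi / 2 * (N - 2 * s1)) * tornheim_T s2 s3 s1 +
           cos (of_real pi / 2 * (N - 2 * s2)) * tornheim_T s3 s1 s2))
     \<and>
     ((\<lambda>\<alpha>::real. hurwitz_zeta (1 - s1) (of_real \<alpha>) * hurwitz_zeta (1 - s2) (of_real \<alpha>)
          * hurwitz_zeta (1 - s3) (1 - of_real \<alpha>)) integrable_on {0<..<1} \<longrightarrow>
      integral {0<..<1} (\<lambda>\<alpha>::real. hurwitz_zeta (1 - s1) (of_real \<alpha>)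
          * hurwitz_zeta (1 - s2) (of_real \<alpha>) * hurwitz_zeta (1 - s3) (1 - of_real \<alpha>)) =
        2 * (2 * of_real pi) powr (- (s1 + s2 + s3)) * Gamma s1 * Gamma s2 * Gamma s3 *
          (cos (of_real pi / 2 * N) * tornheim_T s1 s2 s3 +
           cos (of_real pi / 2 * (N - 2 * s2)) * tornheim_T s2 s3 s1 +
           cos (of_real pi / 2 * (N - 2 * s1)) * tornheim_T s3 s1 s2))"
proof -
  have r: "regular_point s1 s2 s3"
    using Gamma_regular T_regular by (simp add: regular_point_iff)
  have nz: "s1 \<noteq> 0" "s2 \<noteq> 0" "s3 \<noteq> 0" using regular_point_nonzero[OF r] by auto
  have identity: "f integrable_on {0<..<1} \<longrightarrow> integral {0<..<1} f = tornheim_sum \<delta> tornheim_T s1 s2 s3"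
    if \<delta>: "\<delta> \<in> {1, -1}" and f: "\<And>\<alpha>. \<alpha> \<in> {0<..<1} \<Longrightarrow> f \<alpha> = zeta_product \<delta> s1 s2 s3 \<alpha>" for \<delta> f
  proof
    assume int: "f integrable_on {0<..<1}"
    have "integral {0<..<1} f = integral {0<..<1} (zeta_product \<delta> s1 s2 s3)"
      by (rule Henstock_Kurzweil_Integration.integral_cong) (rule f)
    also have "\<dots> = tornheim_sum \<delta> tornheim_T s1 s2 s3"
      by (rule zeta_product_identity[OF \<delta> r integrable_eq[OF int f]])
    finally show "integral {0<..<1} f = tornheim_sum \<delta> tornheim_T s1 s2 s3" .
  qed
  have zeta: "hurwitz_zeta (1 - s) (of_real \<alpha>) = zeta_model (1, 1) s \<alpha>"
    "hurwitz_zeta (1 - s) (1 - of_real \<alpha>) = zeta_model (1, 1) s (1 - \<alpha>)"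
    if "\<alpha> \<in> {0<..<1}" "s \<noteq> 0" for s and \<alpha> :: real
    using hurwitz_zeta_eq_zeta_model[of \<alpha> s] hurwitz_zeta_eq_zeta_model[of "1 - \<alpha>" s] that by simp_all
  have "tornheim_sum 1 tornheim_T s1 s2 s3 = 2 * (2 * of_real pi) powr (- (s1 + s2 + s3)) * Gamma s1 * Gamma s2 * Gamma s3 *
          (cos (of_real pi / 2 * (N - 2 * s3)) * tornheim_T s1 s2 s3 +
           cos (of_real pi / 2 * (N - 2 * s1)) * tornheim_T s2 s3 s1 +
           cos (of_real pi / 2 * (N - 2 * s2)) * tornheim_T s3 s1 s2)"
  proof -
    have "s1 + s2 - of_int 1 * s3 = N - 2 * s3" "s2 + of_int 1 * s3 - s1 = N - 2 * s1" "s1 + of_int 1 * s3 - s2 = N - 2 * s2"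
      by (simp_all add: N)
    then show ?thesis unfolding tornheim_sum_def by (simp only:)
  qed
  moreover have "tornheim_sum (-1) tornheim_T s1 s2 s3 = 2 * (2 * of_real pi) powr (- (s1 + s2 + s3)) * Gamma s1 * Gamma s2 * Gamma s3 *
          (cos (of_real pi / 2 * N) * tornheim_T s1 s2 s3 +
           cos (of_real pi / 2 * (N - 2 * s2)) * tornheim_T s2 s3 s1 +
           cos (of_real pi / 2 * (N - 2 * s1)) * tornheim_T s3 s1 s2)"
  proof -
    \<comment> \<open>The last two arguments come out negated, which the even cosine does not
      notice.\<close>
    have "s1 + s2 - of_int (-1) * s3 = N" "s2 + of_int (-1) * s3 - s1 = - (N - 2 * s2)" "s1 + of_int (-1) * s3 - s2 = - (N - 2 * s1)"
      by (simp_all add: N)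
    then show ?thesis unfolding tornheim_sum_def by (simp only: mult_minus_right cos_minus)
  qed
  ultimately show ?thesis
    using identity[of 1] identity[of "-1"] zeta nz by (simp add: zeta_product_def)
qed

end
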